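(* Let $k$ be an algebraically closed field and let $f \in k[x^{\pm1},y^{\pm1}]$ be an irreducible Laurent polynomial whose Newton polygon $\Delta(f)$ is two-dimensional. Let $U_f \subset \mathbb{T}^2 = k^* \times k^*$ be the curve defined by $f$. Then \[ s_2(U_f) \le \mathrm{ls}_\Sigma(\Delta(f)^{(1)}) + 3 \qquad\text{and}\qquad s_{1,1}(U_f) \le s_{1,1}(\Delta(f)^{(1)}) + (2,2). \] The second inequality is with respect to the lexicographic order on $\mathbb{Z}^2$. If $\Delta(f) \simeq d\Upsilon$ for some integer $d \ge 2$, then the first bound sharpens to $s_2(U_f) \le 3d-1$. If moreover $d = 2$, then the second bound sharpens to $s_{1,1}(U_f) \le (3,4)$.
   Context: **Curves and the invariants $s_2$, $s_{1,1}$.** Curves are irreducible but not necessarily non-singular or projective. Birational equivalence of curves is written $\simeq$. For a curve $C/k$: - $s_2(C)$ is the minimum of the set of $d \in \mathbb{N}$ such that $C$ is birationally equivalent to a curve of degree $d$ in $\mathbb{P}^2$. - $s_{1,1}(C)$ is the lexicographic minimum of the set of $(a,b) \in \mathbb{N}^2$ with $a \le b$ such that $C$ is birationally equivalent to a curve of bidegree $(a,b)$ in $\mathbb{P}^1\times\mathbb{P}^1$. **Polygons.** A lattice polygon is the convex hull of finitely many points of $\mathbb{Z}^2$; it may be empty, a point or a segment. The Newton polygon $\Delta(f)$ is the convex hull of the exponent vectors $(i,j)$ of the monomials $x^iy^j$ occurring in $f$ with non-zero coefficient. A unimodular transformation is an affine map $v \mapsto Av+w$ with $A \in \mathrm{GL}_2(\mathbb{Z})$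 and $w \in \mathbb{Z}^2$. For polygons, $\Delta \simeq \Delta'$ means $\Delta' = \varphi(\Delta)$ for some unimodular transformation $\varphi$. Fix the polygons - $\Sigma = \mathrm{conv}\{(0,0),(1,0),(0,1)\}$, - $\square = [0,1]^2$, - $\Upsilon = \mathrm{conv}\{(-1,-1),(1,0),(0,1)\}$. For $X \in \{[0,1]\times\mathbb{R},\ \Sigma,\ \square\}$ and a non-empty lattice polygon $\Delta$, $\mathrm{ls}_X(\Delta)$ is the smallest integer $d \ge 0$ such that $\varphi(\Delta) \subset dX$ for some unimodular $\varphi$. For the empty polygon, $\mathrm{ls}_X(\emptyset) = -1, -2, -1$ respectively. The lattice width is $\mathrm{lw}(\Delta) = \mathrm{ls}_{[0,1]\times\mathbb{R}}(\Delta)$. Set $s_{1,1}(\Delta) = (\mathrm{lw}(\Delta), \mathrm{ls}_\square(\Delta))$. For a lattice polygon $\Delta$, $\Delta^{(1)}$ denotes the convex hull of the lattice points lying in the interior of $\Delta$. *)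

theory Defs
  imports
    "HOL-Analysis.Analysis"
    "HOL-Library.Poly_Mapping"
    "HOL-Computational_Algebra.Computational_Algebra"
begin

section \<open>Lattice polygons\<close>

definition unimodular :: "(real \<times> real \<Rightarrow> real \<times> real) \<Rightarrow> bool" where
  "unimodular \<phi> \<longleftrightarrow> (\<exists>a b c d e h :: int. \<bar>a * d - b * c\<bar> = 1 \<and>
     \<phi> = (\<lambda>(x, y). (of_int a * x + of_int b * y + of_int e,
                    of_int c * x + of_int d * y + of_int h)))"

definition polygon_equiv :: "(real \<times> real) set \<Rightarrow> (real \<times> real) set \<Rightarrow> bool" where
  "polygon_equiv \<Delta> \<Delta>' \<longleftrightarrow> (\<exists>\<phi>. unimodular \<phi> \<and> \<Delta>' = \<phi> ` \<Delta>)"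

definition std_triangle :: "(real \<times> real) set" where
  "std_triangle = convex hull {(0, 0), (1, 0), (0, 1)}"

definition unit_square :: "(real \<times> real) set" where
  "unit_square = {0..1} \<times> {0..1}"

definition upsilon :: "(real \<times> real) set" where
  "upsilon = convex hull {(-1, -1), (1, 0), (0, 1)}"

definition dilate :: "nat \<Rightarrow> (real \<times> real) set \<Rightarrow> (real \<times> real) set" where
  "dilate d X = (\<lambda>p. real d *\<^sub>R p) ` X"

definition interior_polygon :: "(real \<times> real) set \<Rightarrow> (real \<times> real) set" where
  "interior_polygon \<Delta> = convex hull (interior \<Delta> \<inter> (\<int> \<times> \<int>))"

text \<open>The \<open>d\<close>-th dilate of the strip \<open>[0,1] \<times> \<real>\<close> is \<open>[0,d] \<times> \<real>\<close>, also for \<open>d = 0\<close>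
  (where scaling pointwise by \<open>0\<close> would leave only the origin), so that a segment has
  lattice width \<open>0\<close>.\<close>

definition lw :: "(real \<times> real) set \<Rightarrow> int" where
  "lw \<Delta> = (if \<Delta> = {} then -1
     else int (LEAST d. \<exists>\<phi>. unimodular \<phi> \<and> \<phi> ` \<Delta> \<subseteq> {0..real d} \<times> UNIV))"

definition ls_triangle :: "(real \<times> real) set \<Rightarrow> int" where
  "ls_triangle \<Delta> = (if \<Delta> = {} then -2
     else int (LEAST d. \<exists>\<phi>. unimodular \<phi> \<and> \<phi> ` \<Delta> \<subseteq> dilate d std_triangle))"

definition ls_square :: "(real \<times> real) set \<Rightarrow> int" where
  "ls_square \<Delta> = (if \<Delta> = {} then -1
     else int (LEAST d. \<exists>\<phi>. unimodular \<phi> \<and> \<phi> ` \<Delta> \<subseteq> dilate d unit_square))"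

definition s11_polygon :: "(real \<times> real) set \<Rightarrow> int \<times> int" where
  "s11_polygon \<Delta> = (lw \<Delta>, ls_square \<Delta>)"

text \<open>The order instance for products that comes with the analysis library is componentwise,
  hence an explicit lexicographic order.\<close>

definition lex_le :: "'a::linorder \<times> 'a \<Rightarrow> 'a \<times> 'a \<Rightarrow> bool" where
  "lex_le p q \<longleftrightarrow> fst p < fst q \<or> (fst p = fst q \<and> snd p \<le> snd q)"


section \<open>Polynomials\<close>

type_synonym 'a laurent2 = "(int \<times> int) \<Rightarrow>\<^sub>0 'a"
type_synonym 'a poly3 = "(nat \<times> nat \<times> nat) \<Rightarrow>\<^sub>0 'a"
type_synonym 'a poly22 = "((nat \<times> nat) \<times> (nat \<times> nat)) \<Rightarrow>\<^sub>0 'a"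

definition newton_polygon :: "'a::zero laurent2 \<Rightarrow> (real \<times> real) set" where
  "newton_polygon f = convex hull ((\<lambda>(i, j). (real_of_int i, real_of_int j)) ` Poly_Mapping.keys f)"

definition eval_laurent2 :: "'a::field laurent2 \<Rightarrow> 'a \<times> 'a \<Rightarrow> 'a" where
  "eval_laurent2 f = (\<lambda>(x, y). \<Sum>(i, j)\<in>Poly_Mapping.keys f.
     Poly_Mapping.lookup f (i, j) * x powi i * y powi j)"

definition eval_poly3 :: "'a::comm_semiring_1 poly3 \<Rightarrow> 'a \<times> 'a \<times> 'a \<Rightarrow> 'a" where
  "eval_poly3 F = (\<lambda>(x, y, z). \<Sum>(i, j, l)\<in>Poly_Mapping.keys F.
     Poly_Mapping.lookup F (i, j, l) * x ^ i * y ^ j * z ^ l)"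

definition eval_poly22 :: "'a::comm_semiring_1 poly22 \<Rightarrow> ('a \<times> 'a) \<times> ('a \<times> 'a) \<Rightarrow> 'a" where
  "eval_poly22 F = (\<lambda>((x, y), (z, w)). \<Sum>((i, j), (l, m))\<in>Poly_Mapping.keys F.
     Poly_Mapping.lookup F ((i, j), (l, m)) * x ^ i * y ^ j * z ^ l * w ^ m)"

definition homogeneous :: "nat \<Rightarrow> 'a::zero poly3 \<Rightarrow> bool" where
  "homogeneous d F \<longleftrightarrow> (\<forall>(i, j, l)\<in>Poly_Mapping.keys F. i + j + l = d)"

definition bihomogeneous :: "nat \<Rightarrow> nat \<Rightarrow> 'a::zero poly22 \<Rightarrow> bool" where
  "bihomogeneous a b F \<longleftrightarrow> (\<forall>((i, j), (l, m))\<in>Poly_Mapping.keys F. i + j = a \<and> l + m = b)"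


section \<open>Varieties and birational equivalence\<close>

text \<open>
  A point is the set of all its (multi-)homogeneous coordinate vectors; points of the torus have
  exactly one coordinate vector. A variety comes with the family of the homogeneous pieces of its
  (multi-)graded coordinate ring, each piece a set of functions of the coordinate vectors.
  Vanishing of an element of a piece, and the quotient of two elements of the same piece, do not
  depend on the coordinate vector chosen. A closed subvariety has fewer points and the same pieces.
\<close>

record ('v, 'a) variety =
  points :: "'v set set"
  pieces :: "('v \<Rightarrow> 'a) set set"

definition zero_locus :: "('v, 'a::zero) variety \<Rightarrow> ('v \<Rightarrow> 'a) set \<Rightarrow> 'v set set" where
  "zero_locus X \<F> = {p \<in> points X. \<forall>F\<in>\<F>. \<forall>v\<in>p. F v = 0}"

definition zariski_open :: "('v, 'a::zero) variety \<Rightarrow> 'v set set \<Rightarrow> bool" where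
  "zariski_open X U \<longleftrightarrow> (\<exists>\<F>. \<F> \<subseteq> \<Union>(pieces X) \<and> U = points X - zero_locus X \<F>)"

definition regular_on :: "('v, 'a::field) variety \<Rightarrow> 'v set set \<Rightarrow> ('v set \<Rightarrow> 'a) \<Rightarrow> bool" where
  "regular_on X U g \<longleftrightarrow> zariski_open X U \<and>
     (\<forall>p\<in>U. \<exists>V. zariski_open X V \<and> p \<in> V \<and> V \<subseteq> U \<and>
        (\<exists>D\<in>pieces X. \<exists>G\<in>D. \<exists>H\<in>D. \<forall>q\<in>V. \<forall>v\<in>q. H v \<noteq> 0 \<and> g q = G v / H v))"

definition morphism_on ::
    "('v, 'a::field) variety \<Rightarrow> 'v set set \<Rightarrow> ('w, 'a) variety \<Rightarrow> ('v set \<Rightarrow> 'w set) \<Rightarrow> bool" where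
  "morphism_on X U Y \<phi> \<longleftrightarrow> zariski_open X U \<and> \<phi> ` U \<subseteq> points Y \<and>
     (\<forall>W. zariski_open Y W \<longrightarrow> zariski_open X {p \<in> U. \<phi> p \<in> W}) \<and>
     (\<forall>W g. regular_on Y W g \<longrightarrow> regular_on X {p \<in> U. \<phi> p \<in> W} (g \<circ> \<phi>))"

text \<open>
  \<open>\<phi>\<close> on \<open>U\<close> and \<open>\<psi>\<close> on \<open>V\<close> represent rational maps between \<open>X\<close> and \<open>Y\<close>, both of whose
  composites are defined (on a non-empty open set) and equal to the identity.
\<close>

definition birational :: "('v, 'a::field) variety \<Rightarrow> ('w, 'a) variety \<Rightarrow> bool" where
  "birational X Y \<longleftrightarrow> (\<exists>U V \<phi> \<psi>. morphism_on X U Y \<phi> \<and> morphism_on Y V X \<psi> \<and>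
     {p \<in> U. \<phi> p \<in> V} \<noteq> {} \<and> (\<forall>p\<in>U. \<phi> p \<in> V \<longrightarrow> \<psi> (\<phi> p) = p) \<and>
     {q \<in> V. \<psi> q \<in> U} \<noteq> {} \<and> (\<forall>q\<in>V. \<psi> q \<in> U \<longrightarrow> \<phi> (\<psi> q) = q))"

definition torus2 :: "('a::field \<times> 'a, 'a) variety" where
  "torus2 = \<lparr>points = {{(x, y)} | x y. x \<noteq> 0 \<and> y \<noteq> 0},
             pieces = {range eval_laurent2}\<rparr>"

definition proj_plane :: "('a::field \<times> 'a \<times> 'a, 'a) variety" where
  "proj_plane = \<lparr>points = {{(c * x, c * y, c * z) | c. c \<noteq> 0} | x y z. (x, y, z) \<noteq> (0, 0, 0)},
                 pieces = {eval_poly3 ` {F. homogeneous d F} | d. True}\<rparr>"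

definition proj_line_sq :: "(('a::field \<times> 'a) \<times> ('a \<times> 'a), 'a) variety" where
  "proj_line_sq =
     \<lparr>points = {{((c * x, c * y), (e * z, e * w)) | c e. c \<noteq> 0 \<and> e \<noteq> 0} | x y z w.
                  (x, y) \<noteq> (0, 0) \<and> (z, w) \<noteq> (0, 0)},
      pieces = {eval_poly22 ` {F. bihomogeneous a b F} | a b. True}\<rparr>"

definition subvariety :: "('v, 'a::zero) variety \<Rightarrow> ('v \<Rightarrow> 'a) \<Rightarrow> ('v, 'a) variety" where
  "subvariety X F = X\<lparr>points := zero_locus X {F}\<rparr>"

definition torus_curve :: "'a::field laurent2 \<Rightarrow> ('a \<times> 'a, 'a) variety" where
  "torus_curve f = subvariety torus2 (eval_laurent2 f)"

definition plane_curve_of_degree :: "nat \<Rightarrow> ('a::field \<times> 'a \<times> 'a, 'a) variety \<Rightarrow> bool" where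
  "plane_curve_of_degree d C \<longleftrightarrow>
     (\<exists>F. irreducible F \<and> homogeneous d F \<and> C = subvariety proj_plane (eval_poly3 F))"

definition curve_of_bidegree ::
    "nat \<Rightarrow> nat \<Rightarrow> (('a::field \<times> 'a) \<times> ('a \<times> 'a), 'a) variety \<Rightarrow> bool" where
  "curve_of_bidegree a b C \<longleftrightarrow>
     (\<exists>F. irreducible F \<and> bihomogeneous a b F \<and> C = subvariety proj_line_sq (eval_poly22 F))"

definition s2_curve :: "('v, 'a::field) variety \<Rightarrow> nat" where
  "s2_curve C = (LEAST d. \<exists>C'. plane_curve_of_degree d C' \<and> birational C C')"

definition s11_curve :: "('v, 'a::field) variety \<Rightarrow> nat \<times> nat" where
  "s11_curve C =
     (let S = {(a, b). a \<le> b \<and> (\<exists>C'. curve_of_bidegree a b C' \<and> birational C C')}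
      in THE m. m \<in> S \<and> (\<forall>m'\<in>S. lex_le m m'))"

end

theory Submission
  imports Defs
begin

text \<open>
  The function field of the curve is generated by any two functions \<open>u, v\<close> that separate almost all points of
  \<open>U\<^sub>f\<close>; a nonzero polynomial relation between them, supported in \<open>{i + j \<le> d}\<close> or in \<open>{i \<le> a, j \<le> b}\<close>,
  has an irreducible factor supported there and hence gives a birational plane model of degree at most \<open>d\<close> or a model of
  bidegree at most \<open>(a, b)\<close>. Starting from \<open>f\<close> in unimodular coordinates in which the interior lattice points fill a
  minimal triangle, strip or square, convexity forces the whole polygon into a trapezoid, a triangle or a rectangle of
  controlled size, and coordinate changes centred at points of the curve itself lower the degree to the asserted value.

  For \<open>d\<Upsilon>\<close> the curve lies on the cubic surface \<open>XYZ = 1\<close> and is cut out by a polynomial of degree \<open>d\<close>.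
  Projecting from a point \<open>P\<close> of the curve gives a plane curve of degree \<open>3d - 1\<close>. If this is not birational, the third
  intersection point of the surface with the line through \<open>P\<close> and a point \<open>Q\<close> of the curve lies on the curve again; for
  \<open>Q\<close> in the plane \<open>Z = Z(P)\<close> it lies at infinity, which leaves at most \<open>d + 1\<close> of the \<open>2d\<close> points of the curve in
  that plane.
\<close>

text \<open>A minimal position of the interior lattice points does not keep the polygon within
  distance one of them. Past a side that contains two adjacent interior points it does
  (\<open>edge_bound\<close>), but past a side touched in a single point the polygon may reach
  farther. \<open>squeeze\<close> controls this: a far lattice point forces the interior points into
  an opposite unimodular cone, and minimality then pins down further corners of the interior. Where
  a long row remains, it is the base of a trapezoid of excess E, which only the later substitutions
  centred at curve points remove; hence the arbitrary E in \<open>box_model\<close> and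
  \<open>tri_model\<close>. Rational functions on the curve are compared off finite sets, and an
  inverse of zero is zero, so that field operations are total and no domains have to be tracked. The
  characteristic matters only for multiples of \<open>upsilon\<close>: the count of points in a
  plane section needs a derivative that does not vanish identically, and when every exponent is
  divisible by the characteristic a root of the equation takes its place.\<close>

section \<open>Lattice points of planar sets and unimodular pullbacks\<close>

definition lpt :: "int => int => real \<times> real" where
 "lpt i j = (real_of_int i, real_of_int j)"

definition pt :: "(real \<times> real) set => int => int => bool" where
 "pt D i j \<longleftrightarrow> lpt i j : D"

definition ip :: "(real \<times> real) set => int => int => bool" where
 "ip D i j \<longleftrightarrow> lpt i j : interior D"

text \<open>Preimages rather than images: membership in a pullback rewrites to explicit integer
  combinations without inverting a matrix, and since inverses of unimodular maps are unimodular the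
  same equivalence class is reached.\<close>

definition pull :: "int => int => int => int => int => int => (real \<times> real) set => (real \<times> real) set" where
 "pull a b c d e h D = {p. (of_int a * fst p + of_int b * snd p + of_int e,
      of_int c * fst p + of_int d * snd p + of_int h) : D}"

lemma lpt_eq_iff [simp]: "lpt i j = lpt i' j' \<longleftrightarrow> i = i' & j = j'"
 by (simp add: lpt_def)

lemma pt_pull [simp]: "pt (pull a b c d e h D) i j = pt D (a * i + b * j + e) (c * i + d * j + h)"
 by (simp add: pt_def pull_def lpt_def)

lemma pull_pull:
 "pull a b c d e h (pull a' b' c' d' e' h' D) =
 pull (a' * a + b' * c) (a' * b + b' * d) (c' * a + d' * c) (c' * b + d' * d)
  (a' * e + b' * h + e') (c' * e + d' * h + h') D"
 by (auto simp: pull_def algebra_simps)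

lemma pull_id: "pull 1 0 0 1 0 0 D = D"
 by (auto simp: pull_def)

lemma open_pull: "open D ==> open (pull a b c d e h D)"
proof -
 assume "open D"
 have "pull a b c d e h D = (%p. (of_int a * fst p + of_int b * snd p + of_int e,
      of_int c * fst p + of_int d * snd p + of_int h)) -` D"
  by (auto simp: pull_def)
 moreover have "open \<dots>"
  by (rule open_vimage[OF \<open>open D\<close>]) (intro continuous_intros)
 ultimately show ?thesis by simp
qed

lemma interior_pull_ge: "pull a b c d e h (interior D) \<subseteq> interior (pull a b c d e h D)"
 by (rule interior_maximal) (use interior_subset open_pull[OF open_interior] in \<open>auto simp: pull_def\<close>)

lemma unimodular_cases:
 assumes "\<bar>a * d - b * c\<bar> = (1::int)"
 obtains s where "s = 1 \<or> s = -1" "a * d - b * c = s"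
 using assms that[of 1] that[of "-1"] by linarith

lemma pull_inverse:
 assumes "\<bar>a * d - b * c\<bar> = (1::int)"
 obtains a' b' c' d' e' h' where "\<bar>a' * d' - b' * c'\<bar> = (1::int)"
  "!!D. pull a b c d e h (pull a' b' c' d' e' h' D) = D"
  "!!D. pull a' b' c' d' e' h' (pull a b c d e h D) = D"
proof -
 obtain s where s: "s = 1 \<or> s = -1" "a * d - b * c = s" using unimodular_cases[OF assms] by blast
 hence ss: "s * s = 1" by auto
 have 1: "s * (a * d) - s * (b * c) = 1" using s(2) ss by (metis right_diff_distrib)
 have "s * d * (s * a) - - s * b * (- s * c) = (s * s) * (a * d - b * c)" by (simp add: algebra_simps)
 hence A: "\<bar>s * d * (s * a) - - s * b * (- s * c)\<bar> = 1" using ss assms by simp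
 have e: "s * d * a + - s * b * c = 1" "s * d * b + - s * b * d = 0" "- s * c * a + s * a * c = 0"
   "- s * c * b + s * a * d = 1"
   using 1 by (simp_all add: algebra_simps)
 have B: "pull a b c d e h (pull (s * d) (- s * b) (- s * c) (s * a) (s * (b * h - d * e)) (s * (c * e - a * h)) D) = D" for D
   unfolding pull_pull e by (simp add: algebra_simps pull_id)
 have e': "a * (s * d) + b * (- s * c) = 1" "a * (- s * b) + b * (s * a) = 0"
   "c * (s * d) + d * (- s * c) = 0" "c * (- s * b) + d * (s * a) = 1"
   using 1 by (simp_all add: algebra_simps)
 have e0: "a * (s * (b * h - d * e)) + b * (s * (c * e - a * h)) + e = - e * (s * (a * d) - s * (b * c)) + e"
   "c * (s * (b * h - d * e)) + d * (s * (c * e - a * h)) + h = - h * (s * (a * d) - s * (b * c)) + h"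
   by (simp_all add: algebra_simps)
 have C: "pull (s * d) (- s * b) (- s * c) (s * a) (s * (b * h - d * e)) (s * (c * e - a * h)) (pull a b c d e h D) = D" for D
   unfolding pull_pull e' e0 1 by (simp add: pull_id)
 show ?thesis by (rule that[OF A B C])
qed

text \<open>One inclusion is continuity; the other is the same inclusion for the inverse
  map.\<close>

lemma interior_pull:
 assumes "\<bar>a * d - b * c\<bar> = (1::int)"
 shows "interior (pull a b c d e h D) = pull a b c d e h (interior D)"
proof
 obtain a' b' c' d' e' h' where i:
  "!!D. pull a b c d e h (pull a' b' c' d' e' h' D) = D"
  "!!D. pull a' b' c' d' e' h' (pull a b c d e h D) = D"
  using pull_inverse[OF assms] by metis
 have m: "A \<subseteq> B ==> pull a b c d e h A \<subseteq> pull a b c d e h B" for A B by (auto simp: pull_def)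
 show "interior (pull a b c d e h D) \<subseteq> pull a b c d e h (interior D)"
  using m[OF interior_pull_ge[of a' b' c' d' e' h' "pull a b c d e h D"]] by (simp add: i)
qed (rule interior_pull_ge)

lemma ip_pull:
 assumes "\<bar>a * d - b * c\<bar> = (1::int)"
 shows "ip (pull a b c d e h D) i j = ip D (a * i + b * j + e) (c * i + d * j + h)"
 by (simp add: ip_def interior_pull[OF assms]) (simp add: pull_def lpt_def)

text \<open>The part of being a two-dimensional lattice polygon that survives pullback and carries
  the row arguments. The later bounds concern the lattice points \<open>pt\<close>, which include
  all exponents of the equation.\<close>

definition body :: "(real \<times> real) set => bool" where
 "body D \<longleftrightarrow> convex D & interior D ~= {} & finite {(i, j). pt D i j} & {(i, j). pt D i j} ~= {}"

lemma convex_pull: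
 assumes "convex D"
 shows "convex (pull a b c d e h D)"
proof (rule convexI)
 fix p q :: "real \<times> real" and u v :: real
 assume *: "p : pull a b c d e h D" "q : pull a b c d e h D" "0 <= u" "0 <= v" "u + v = 1"
 let ?T = "%p. (of_int a * fst p + of_int b * snd p + of_int e, of_int c * fst p + of_int d * snd p + of_int h)"
 have "u *\<^sub>R ?T p + v *\<^sub>R ?T q : D"
  using assms * by (intro convexD) (auto simp: pull_def)
 moreover have "u *\<^sub>R ?T p + v *\<^sub>R ?T q = ?T (u *\<^sub>R p + v *\<^sub>R q)"
 proof -
  have v: "v = 1 - u" using * by simp
  show ?thesis by (simp add: v algebra_simps)
 qed
 ultimately show "u *\<^sub>R p + v *\<^sub>R q : pull a b c d e h D" by (simp add: pull_def)
qed

lemma body_pull: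
 assumes "\<bar>a * d - b * c\<bar> = (1::int)" "body D"
 shows "body (pull a b c d e h D)"
proof -
 obtain a' b' c' d' e' h' where i:
  "!!D. pull a b c d e h (pull a' b' c' d' e' h' D) = D"
  "!!D. pull a' b' c' d' e' h' (pull a b c d e h D) = D"
  using pull_inverse[OF assms(1)] by metis
 let ?T = "%(i, j). (a' * i + b' * j + e', c' * i + d' * j + h')"
 have "{(i, j). pt (pull a b c d e h D) i j} \<subseteq> ?T ` {(i, j). pt D i j}"
 proof clarify
  fix i j assume p: "pt (pull a b c d e h D) i j"
  have "pull a b c d e h (pull a' b' c' d' e' h' {lpt i j}) = {lpt i j}" by (rule i)
  hence "pt (pull a b c d e h (pull a' b' c' d' e' h' {lpt i j})) i j" by (simp add: pt_def)
  hence "pt {lpt i j} (a' * (a * i + b * j + e) + b' * (c * i + d * j + h) + e')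
    (c' * (a * i + b * j + e) + d' * (c * i + d * j + h) + h')" by simp
  hence "?T (a * i + b * j + e, c * i + d * j + h) = (i, j)" by (simp only: pt_def singleton_iff lpt_eq_iff prod.case)
  moreover have "(a * i + b * j + e, c * i + d * j + h) : {(i, j). pt D i j}" using p by simp
  ultimately show "(i, j) : ?T ` {(i, j). pt D i j}" by (intro image_eqI[of _ _ "(a * i + b * j + e, c * i + d * j + h)"]) simp_all
 qed
 moreover have "{(i, j). pt (pull a b c d e h D) i j} ~= {}"
 proof -
  obtain x y where "pt D x y" using assms(2) by (auto simp: body_def)
  hence "pt (pull a' b' c' d' e' h' (pull a b c d e h D)) x y" by (simp only: i)
  hence "pt (pull a b c d e h D) (a' * x + b' * y + e') (c' * x + d' * y + h')"
   by (simp only: pt_pull[of a' b' c' d' e' h'])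
  thus ?thesis by blast
 qed
 moreover have "interior (pull a b c d e h D) ~= {}"
 proof -
  have "pull a' b' c' d' e' h' (pull a b c d e h (interior D)) ~= {}" using i assms(2) by (simp add: body_def)
  hence "pull a b c d e h (interior D) ~= {}" by (auto simp: pull_def)
  thus ?thesis by (simp add: interior_pull[OF assms(1)])
 qed
 moreover have "finite (?T ` {(i, j). pt D i j})" "convex (pull a b c d e h D)"
  using assms(2) convex_pull by (simp_all add: body_def)
 ultimately show ?thesis unfolding body_def using finite_subset by blast
qed

section \<open>Segments and rows of a convex set\<close>

lemma interior_segment:
 fixes x y x' y' t :: real
 assumes "convex D" "(x, y) : interior D" "(x', y') : D" "0 < t" "t <= 1"
 shows "(t * x + (1 - t) * x', t * y + (1 - t) * y') : interior D"
proof -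
 have "(x', y') - t *\<^sub>R ((x', y') - (x, y)) : interior D"
  by (rule mem_interior_convex_shrink) (use assms in auto)
 thus ?thesis by (simp add: algebra_simps)
qed

lemma interior_between:
 fixes x y x' c :: real
 assumes "convex D" "(x, y) : interior D" "(x', y) : D" "x <= c & c < x' \<or> x' < c & c <= x"
 shows "(c, y) : interior D"
proof -
 define t where "t = (x' - c) / (x' - x)"
 have t: "0 < t" "t <= 1" "x' ~= x" using assms(4) by (auto simp: t_def divide_simps)
 have "(t * x + (1 - t) * x', t * y + (1 - t) * y) : interior D"
  by (rule interior_segment) (use assms t in auto)
 moreover have "t * x + (1 - t) * x' = c"
 proof -
  have "t * (x' - x) = x' - c" using t(3) by (simp add: t_def)
  thus ?thesis by (simp add: algebra_simps)
 qed
 ultimately show ?thesis by (simp add: algebra_simps)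
qed

text \<open>A segment from an interior point stays interior up to its far end, so it crosses every
  row strictly before that end in an interior point; the fraction is the abscissa of the
  crossing.\<close>

lemma interior_crossing:
 fixes x y x' y' c :: real
 assumes "convex D" "(x, y) : interior D" "(x', y') : D" "y' < c" "c <= y"
 shows "(x' + (c - y') * (x - x') / (y - y'), c) : interior D"
proof -
 define t where "t = (c - y') / (y - y')"
 have t: "0 < t" "t <= 1" "y ~= y'" using assms(4,5) by (auto simp: t_def divide_simps)
 have "(t * x + (1 - t) * x', t * y + (1 - t) * y') : interior D"
  by (rule interior_segment) (use assms t in auto)
 moreover have "t * y + (1 - t) * y' = c"
 proof -
  have "t * (y - y') = c - y'" using t(3) by (simp add: t_def)
  thus ?thesis by (simp add: algebra_simps)
 qed
 moreover have "t * x + (1 - t) * x' = x' + (c - y') * (x - x') / (y - y')"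
 proof -
  have "(c - y') * (x - x') / (y - y') = t * (x - x')" by (simp add: t_def)
  thus ?thesis by (simp add: algebra_simps)
 qed
 ultimately show ?thesis by simp
qed

lemma crossing:
 fixes x y x' y' c :: real
 assumes "convex D" "(x, y) : D" "(x', y') : D" "y' < c" "c <= y"
 shows "(x' + (c - y') * (x - x') / (y - y'), c) : D"
proof -
 define t where "t = (c - y') / (y - y')"
 have t: "0 < t" "t <= 1" "y ~= y'" using assms(4,5) by (auto simp: t_def divide_simps)
 have "t *\<^sub>R (x, y) + (1 - t) *\<^sub>R (x', y') : D"
  by (rule convexD) (use assms t in auto)
 moreover have "t * y + (1 - t) * y' = c"
 proof -
  have "t * (y - y') = c - y'" using t(3) by (simp add: t_def)
  thus ?thesis by (simp add: algebra_simps)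
 qed
 moreover have "t * x + (1 - t) * x' = x' + (c - y') * (x - x') / (y - y')"
 proof -
  have "(c - y') * (x - x') / (y - y') = t * (x - x')" by (simp add: t_def)
  thus ?thesis by (simp add: algebra_simps)
 qed
 ultimately show ?thesis by simp
qed

lemma interior_room:
 fixes x y :: real
 assumes "(x, y) : interior D"
 obtains e where "e > 0" "(x + e, y) : D" "(x - e, y) : D" "(x, y + e) : D" "(x, y - e) : D"
proof -
 obtain e where e: "e > 0" "ball (x, y) e \<subseteq> D" using assms mem_interior by blast
 show ?thesis
  by (rule that[of "e / 2"]) (use e in \<open>auto simp: subset_iff dist_prod_def dist_real_def\<close>)
qed

section \<open>Consequences of a lattice point beyond a row without interior lattice points\<close>

text \<open>The segment from the origin to (p, -h) crosses row -1 in an interior point that is not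
  integral, so the slice of row -1 is caught in a slit [m, m+1]. Deep points are seen from the
  origin through the slit, high points are seen from (p, -h) through it; after the shear i + m j
  both lie in fixed cones.\<close>

lemma squeeze:
 assumes D: "convex D" and 0: "ip D 0 0" and n: "!!i. ~ ip D i (-1)" and p: "pt D p (-h)" "h >= 2"
 obtains m where "m * h < p" "p < (m + 1) * h"
  "!!i j. pt D i j ==> j <= -2 ==> 0 < i + m * j & i + m * j < - j"
  "!!i j. pt D i j ==> j >= -1 ==> i + m * j <= 1 & i + m * j + j >= -1"
  "!!i j. ip D i j ==> j >= 0 ==> i + m * j <= 0 & i + m * j + j >= 0"
proof -
 define m where "m = \<lfloor>of_int p / (of_int h :: real)\<rfloor>"
 have deep: "(of_int i / of_int (- j), -1) : interior D" if "pt D i j" "j <= -2" for i j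
 proof -
  have "(of_int i + (-1 - of_int j) * (0 - of_int i) / (0 - of_int j), -1) : interior D"
   by (rule interior_crossing) (use D 0 that in \<open>auto simp: ip_def pt_def lpt_def\<close>)
  moreover have "of_int i + (-1 - of_int j) * (0 - of_int i) / (0 - of_int j) = of_int i / (of_int (- j) :: real)"
   using that(2) by (simp add: field_simps)
  ultimately show ?thesis by metis
 qed
 have noint: "x ~= of_int k" if "(x, -1) : interior D" for x :: real and k
  using n[of k] that by (auto simp: ip_def lpt_def)
 have q: "(of_int p / of_int h, -1) : interior D" using deep[of p "-h"] p by simp
 have m: "of_int m < (of_int p / of_int h :: real)" "(of_int p / of_int h :: real) < of_int m + 1"
  using noint[OF q, of m] unfolding m_def by linarith+
 have row: "of_int m <= x & x <= of_int m + 1" if "(x, -1) : D" for x :: real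
 proof (rule ccontr)
  assume "~ ?thesis"
  then consider "x < of_int m" | "x > of_int (m + 1)" by auto
  thus False
  proof cases
   case 1
   hence "(of_int m, -1) : interior D" by (intro interior_between[OF D q that]) (use m in auto)
   thus False using noint by blast
  next
   case 2
   hence "(of_int (m + 1), -1) : interior D" by (intro interior_between[OF D q that]) (use m in auto)
   thus False using noint by blast
  qed
 qed
 have h0: "(of_int h :: real) >= 2" using p by simp
 have mp: "of_int m * of_int h < (of_int p :: real)" "(of_int p :: real) < (of_int m + 1) * of_int h"
  using m h0 by (simp_all add: field_simps)
 have "of_int (m * h) < (of_int p :: real)" "(of_int p :: real) < of_int ((m + 1) * h)" using mp by simp_all
 hence mpi: "m * h < p" "p < (m + 1) * h" by (simp_all only: of_int_less_iff)
 have cone: "x + of_int m * y <= 1 & x + of_int m * y + y >= -1" if "(x, y) : D" "y >= -1" for x y :: real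
 proof -
  let ?h = "of_int h :: real" and ?p = "of_int p :: real" and ?m = "of_int m :: real"
  \<comment> \<open>The sight line from (p, -h) meets row -1 inside the slit. As p is an integer
    strictly between m h and (m+1) h, it keeps distance 1 from both, and this is what produces the
    constants 1 and -1 for every y >= -1.\<close>
  have "(?p + (-1 - (- ?h)) * (x - ?p) / (y - (- ?h)), -1) : D"
   by (rule crossing) (use D that p in \<open>auto simp: pt_def lpt_def\<close>)
  hence r: "?m <= ?p + (?h - 1) * (x - ?p) / (y + ?h)" "?p + (?h - 1) * (x - ?p) / (y + ?h) <= ?m + 1"
   using row by fastforce+
  have yh: "y + ?h > 0" using that h0 by linarith
  have r1: "(?h - 1) * (x - ?p) >= (?m - ?p) * (y + ?h)" "(?h - 1) * (x - ?p) <= (?m + 1 - ?p) * (y + ?h)"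
   using r yh by (simp_all add: field_simps)
  have i1: "?p >= ?m * ?h + 1" "?p <= (?m + 1) * ?h - 1"
  proof -
   have "p >= m * h + 1" "p <= (m + 1) * h - 1" using mpi by linarith+
   hence "of_int p >= (of_int (m * h + 1) :: real)" "of_int p <= (of_int ((m + 1) * h - 1) :: real)"
    by (simp_all only: of_int_le_iff)
   thus "?p >= ?m * ?h + 1" "?p <= (?m + 1) * ?h - 1" by simp_all
  qed
  have "(?h - 1) * (x + ?m * y - 1) = (?h - 1) * (x - ?p) - (?m + 1 - ?p) * (y + ?h) - (?p - ?m * ?h - 1) * (y + 1)"
   by (simp add: algebra_simps)
  also have "\<dots> <= 0" using r1(2) mult_nonneg_nonneg[of "?p - ?m * ?h - 1" "y + 1"] i1 that by linarith
  finally have a: "x + ?m * y - 1 <= 0" using h0 by (simp add: mult_le_0_iff)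
  have "(?h - 1) * (x + ?m * y + y + 1) = (?h - 1) * (x - ?p) - (?m - ?p) * (y + ?h) + ((?m + 1) * ?h - 1 - ?p) * (y + 1)"
   by (simp add: algebra_simps)
  also have "\<dots> >= 0" using r1(1) mult_nonneg_nonneg[of "(?m + 1) * ?h - 1 - ?p" "y + 1"] i1 that by linarith
  finally have "x + ?m * y + y + 1 >= 0" using h0 by (simp add: zero_le_mult_iff)
  thus ?thesis using a by linarith
 qed
 show ?thesis
 proof (rule that[of m])
  show "m * h < p" "p < (m + 1) * h" by (rule mpi)+
 next
  fix i j assume ij: "pt D i j" "j <= -2"
  have d: "(of_int i / of_int (- j), -1) : interior D" by (rule deep[OF ij])
  have "of_int m < (of_int i / of_int (- j) :: real)" "(of_int i / of_int (- j) :: real) < of_int (m + 1)"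
   using row[of "of_int i / of_int (- j)"] d noint[OF d, of m] noint[OF d, of "m + 1"] interior_subset[of D]
   by force+
  moreover have "(of_int (- j) :: real) > 0" using ij by simp
  ultimately have "of_int m * of_int (- j) < (of_int i :: real)" "of_int i < (of_int (m + 1) * of_int (- j) :: real)"
   by (simp_all add: field_simps)
  hence "m * (- j) < i" "i < (m + 1) * (- j)" by (simp_all only: of_int_mult[symmetric] of_int_less_iff)
  thus "0 < i + m * j & i + m * j < - j" by (simp add: algebra_simps)
 next
  fix i j assume ij: "pt D i j" "j >= -1"
  have "of_int i + of_int m * of_int j <= (1::real) & of_int i + of_int m * of_int j + of_int j >= (-1::real)"
   by (rule cone) (use ij in \<open>auto simp: pt_def lpt_def\<close>)
  hence "of_int (i + m * j) <= (of_int 1::real) & of_int (i + m * j + j) >= (of_int (-1)::real)" by simp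
  thus "i + m * j <= 1 & i + m * j + j >= -1" by (simp only: of_int_le_iff)
 next
  \<comment> \<open>Room to the left and to the right makes both bounds strict, and integrality
    improves them to 0.\<close>
  fix i j assume ij: "ip D i j" "j >= 0"
  then obtain e where e: "e > 0" "(of_int i + e, of_int j) : D" "(of_int i - e, of_int j) : D"
   by (auto simp: ip_def lpt_def elim: interior_room)
  have j: "(of_int j :: real) >= -1" using ij(2) by simp
  have "of_int i + of_int m * of_int j < (1::real) & of_int i + of_int m * of_int j + of_int j > (-1::real)"
   using cone[OF e(2) j] cone[OF e(3) j] e(1) by linarith
  hence "of_int (i + m * j) < (of_int 1::real) & of_int (i + m * j + j) > (of_int (-1)::real)" by simp
  hence "i + m * j < 1 & i + m * j + j > -1" by (simp only: of_int_less_iff)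
  thus "i + m * j <= 0 & i + m * j + j >= 0" by linarith
 qed
qed

text \<open>\<open>squeeze\<close> in the lattice basis (a, c), (b, d) with origin (e, f); the
  second basis vector leads away from the empty row.\<close>

lemma squeeze_pull:
 assumes D: "convex D" and u: "\<bar>a * d - b * c\<bar> = 1" and 0: "ip D e f"
  and n: "!!i. ~ ip D (a * i - b + e) (c * i - d + f)"
  and p: "pt D (a * p - b * h + e) (c * p - d * h + f)" "h >= 2"
 obtains m where "m * h < p" "p < (m + 1) * h"
  "!!i j. pt D (a * i + b * j + e) (c * i + d * j + f) ==> j <= -2 ==> 0 < i + m * j & i + m * j < - j"
  "!!i j. pt D (a * i + b * j + e) (c * i + d * j + f) ==> j >= -1 ==> i + m * j <= 1 & i + m * j + j >= -1"
  "!!i j. ip D (a * i + b * j + e) (c * i + d * j + f) ==> j >= 0 ==> i + m * j <= 0 & i + m * j + j >= 0"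
proof -
 let ?D = "pull a b c d e f D"
 have "convex ?D" "ip ?D 0 0" "!!i. ~ ip ?D i (-1)" "pt ?D p (-h)"
  using convex_pull[OF D] 0 n p by (simp_all add: ip_pull[OF u])
 from squeeze[OF this p(2)] show ?thesis
  using that unfolding ip_pull[OF u] pt_pull by blast
qed

text \<open>By \<open>squeeze\<close>, a lattice point two or more rows below would leave room for
  only one interior lattice point on row 0, but there are two.\<close>

lemma edge_bound:
 assumes D: "convex D" and u: "\<bar>a * d - b * c\<bar> = 1" and 0: "ip D e f" "ip D (e + a) (f + c)"
  and n: "!!i. ~ ip D (a * i - b + e) (c * i - d + f)"
  and p: "pt D (a * p + b * q + e) (c * p + d * q + f)"
 shows "q >= -1"
proof (rule ccontr)
 assume "~ ?thesis"
 hence q: "- q >= 2" by simp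
 have "pt D (a * p - b * (- q) + e) (c * p - d * (- q) + f)" using p by simp
 from squeeze_pull[OF D u 0(1) n this q] obtain m where
  m: "!!i j. ip D (a * i + b * j + e) (c * i + d * j + f) ==> j >= 0 ==> i + m * j <= 0" by metis
 from m[of 1 0] 0(2) show False by (simp add: add.commute)
qed

lemma ip_pt: "ip D i j ==> pt D i j"
 unfolding ip_def pt_def by (rule subsetD[OF interior_subset])

lemma ip_between:
 assumes "convex D" "ip D i j" "pt D i' j" "i <= k & k < i' \<or> i' < k & k <= i"
 shows "ip D k j"
 unfolding ip_def lpt_def
 by (rule interior_between[OF assms(1) assms(2)[unfolded ip_def lpt_def] assms(3)[unfolded pt_def lpt_def]])
  (use assms(4) in linarith)

text \<open>Row 1 starts no earlier than l - 1, because otherwise (l - 1, 1) would be interior.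
  Projecting from (l0, 0) through row 1 propagates this bound linearly to all higher rows.\<close>

lemma row_lower:
 assumes D: "convex D" and "pt D l0 0" "ip D l 1" "~ ip D (l - 1) 1" "pt D i j" "j >= 1"
 shows "i >= l0 + j * (l - 1 - l0)"
proof -
 have "(of_int l0 + (1 - 0) * (of_int i - of_int l0) / (of_int j - 0), 1) : D" (is "(?x, 1) : D")
  by (rule crossing) (use assms in \<open>auto simp: pt_def lpt_def\<close>)
 have "?x >= of_int (l - 1)"
 proof (rule ccontr)
  assume "~ ?thesis"
  hence "?x < of_int (l - 1) & of_int (l - 1) <= (of_int l :: real)" by simp
  moreover have "(of_int l, 1) : interior D" using assms(3) by (simp add: ip_def lpt_def)
  ultimately have "(of_int (l - 1), 1) : interior D"
   using interior_between[OF D _ \<open>(?x, 1) : D\<close>] by blast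
  thus False using assms(4) by (simp add: ip_def lpt_def)
 qed
 hence "of_int j * of_int (l - 1 - l0) <= (of_int (i - l0) :: real)" using assms(6) by (simp add: field_simps)
 hence "j * (l - 1 - l0) <= i - l0" by (simp only: of_int_mult[symmetric] of_int_le_iff)
 thus ?thesis by linarith
qed

lemma row_upper:
 assumes D: "convex D" and "pt D r0 0" "ip D r 1" "~ ip D (r + 1) 1" "pt D i j" "j >= 1"
 shows "i <= r0 + j * (r + 1 - r0)"
proof -
 let ?D = "pull (-1) 0 0 1 0 0 D"
 have "- i >= - r0 + j * (- r - 1 - - r0)"
  by (rule row_lower[of ?D]) (use assms convex_pull[OF D] in \<open>auto simp: ip_pull add.commute\<close>)
 thus ?thesis by (simp add: algebra_simps)
qed

section \<open>Unimodular equivalence and extremal lattice points\<close>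

definition ueq :: "(real \<times> real) set => (real \<times> real) set => bool" (infix "\<sim>" 50) where
 "D \<sim> D' \<longleftrightarrow> (\<exists>a b c d e h. \<bar>a * d - b * c\<bar> = 1 & D' = pull a b c d e h D)"

lemma ueqI: "\<bar>a * d - b * c\<bar> = 1 ==> D \<sim> pull a b c d e h D"
 unfolding ueq_def by blast

lemma ueq_refl: "D \<sim> D"
 using ueqI[of 1 1 0 0 D 0 0] by (simp add: pull_id)

lemma ueq_sym: "D \<sim> D' ==> D' \<sim> D"
proof -
 assume "D \<sim> D'"
 then obtain a b c d e h where *: "\<bar>a * d - b * c\<bar> = 1" "D' = pull a b c d e h D" by (auto simp: ueq_def)
 obtain a' b' c' d' e' h' where "\<bar>a' * d' - b' * c'\<bar> = 1"
  "pull a' b' c' d' e' h' (pull a b c d e h D) = D" using pull_inverse[OF *(1), of e h] by metis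
 thus ?thesis using ueqI *(2) by metis
qed

lemma ueq_trans: "D \<sim> D' ==> D' \<sim> D'' ==> D \<sim> D''"
proof -
 assume "D \<sim> D'" "D' \<sim> D''"
 then obtain a b c d e h a' b' c' d' e' h' where *: "\<bar>a * d - b * c\<bar> = 1" "\<bar>a' * d' - b' * c'\<bar> = 1"
  "D'' = pull a' b' c' d' e' h' (pull a b c d e h D)" by (auto simp: ueq_def)
 have "(a * a' + b * c') * (c * b' + d * d') - (a * b' + b * d') * (c * a' + d * c') = (a * d - b * c) * (a' * d' - b' * c')"
  by (simp add: algebra_simps)
 hence "\<bar>(a * a' + b * c') * (c * b' + d * d') - (a * b' + b * d') * (c * a' + d * c')\<bar> = 1"
  using * by (simp add: abs_mult)
 thus ?thesis unfolding *(3) pull_pull by (rule ueqI)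
qed

lemma ueq_body: "D \<sim> D' ==> body D ==> body D'"
 by (auto simp: ueq_def body_pull)

lemma body_convex: "body D ==> convex D"
 by (simp add: body_def)

lemma body_bounded:
 assumes "body D"
 obtains M where "M >= 0" "!!i j. pt D i j ==> \<bar>i\<bar> <= M & \<bar>j\<bar> <= M"
proof -
 let ?S = "(%(i, j). \<bar>i\<bar> + \<bar>j\<bar>) ` {(i, j). pt D i j}"
 have f: "finite ?S" using assms by (simp add: body_def)
 show ?thesis
 proof (rule that[of "\<bar>Max ?S\<bar>"])
  fix i j assume "pt D i j"
  hence "\<bar>i\<bar> + \<bar>j\<bar> : ?S" by (intro image_eqI[of _ _ "(i, j)"]) auto
  hence "\<bar>i\<bar> + \<bar>j\<bar> <= Max ?S" using f by (rule Max_ge[rotated])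
  thus "\<bar>i\<bar> <= \<bar>Max ?S\<bar> & \<bar>j\<bar> <= \<bar>Max ?S\<bar>" by linarith
 qed simp
qed

lemma body_row_max:
 assumes "body D" "pt D i j"
 obtains t where "pt D t j" "i <= t" "!!k. pt D k j ==> k <= t"
proof -
 let ?S = "{k. pt D k j}"
 obtain M where M: "!!i j. pt D i j ==> \<bar>i\<bar> <= M & \<bar>j\<bar> <= M" using body_bounded[OF assms(1)] by metis
 have f: "finite ?S" by (rule finite_subset[of _ "{-M..M}"]) (use M in fastforce)+
 have ne: "?S ~= {}" using assms by blast
 show ?thesis using that[of "Max ?S"] Max_in[OF f ne] Max_ge[OF f] assms by blast
qed

lemma body_row_min:
 assumes "body D" "pt D i j"
 obtains l where "pt D l j" "l <= i" "!!k. pt D k j ==> l <= k"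
proof -
 let ?D = "pull (-1) 0 0 1 0 0 D"
 have b: "body ?D" by (rule body_pull) (use assms in auto)
 have "pt ?D (- i) j" using assms by simp
 from body_row_max[OF b this] obtain t where t: "pt ?D t j" "- i <= t" "!!k. pt ?D k j ==> k <= t" by blast
 show ?thesis
 proof (rule that[of "- t"])
  show "pt D (- t) j" "- t <= i" using t by simp_all
  fix k assume "pt D k j" hence "pt ?D (- k) j" by simp
  thus "- t <= k" using t(3)[of "- k"] by linarith
 qed
qed

lemma least_int:
 fixes P :: "int => bool"
 assumes "P n" "!!k. P k ==> k >= 0"
 obtains m where "P m" "!!k. P k ==> m <= k"
proof -
 define m where "m = (LEAST k. P (int k))"
 have ex: "P (int (nat n))" using assms by simp
 show ?thesis
 proof (rule that[of "int m"])
  show "P (int m)" unfolding m_def by (rule LeastI[of "%k. P (int k)", OF ex])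
  fix k assume k: "P k"
  hence "P (int (nat k))" using assms(2) by simp
  hence "m <= nat k" unfolding m_def by (rule Least_le)
  thus "int m <= k" using assms(2)[OF k] by linarith
 qed
qed

section \<open>Polygons whose interior lattice points are absent, single or in one column\<close>

text \<open>In coordinates with the least number w of row steps and w >= 2, row 1 is a slit of
  length at most one. Sight lines through it from the two ends of row 0 confine all other rows, and
  the length r of row 0 distinguishes the cases.\<close>

lemma no_interior_points:
 assumes D: "body D" and n: "!!i j. ~ ip D i j"
 obtains D' where "D \<sim> D'" "(\<forall>i j. pt D' i j --> 0 <= j & j <= 1) \<or> (\<forall>i j. pt D' i j --> 0 <= i & 0 <= j & i + j <= 2)"
proof -
 let ?P = "%w. w >= 0 & (\<exists>D'. D \<sim> D' & (\<forall>i j. pt D' i j --> 0 <= j & j <= w))"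
 obtain M where M: "M >= 0" "!!i j. pt D i j ==> \<bar>i\<bar> <= M & \<bar>j\<bar> <= M" using body_bounded[OF D] by metis
 have "?P (2 * M)"
  using M by (intro conjI exI[of _ "pull 1 0 0 1 0 (-M) D"] ueqI) fastforce+
 from least_int[of ?P, OF this] obtain w where w: "?P w" "!!k. ?P k ==> w <= k" by blast
 then obtain D1 where D1: "D \<sim> D1" "!!i j. pt D1 i j ==> 0 <= j & j <= w" by blast
 have n1: "~ ip D1 i j" for i j
  using D1(1) n unfolding ueq_def by (auto simp: ip_pull)
 have b1: "body D1" using ueq_body D1(1) D by blast
 show ?thesis
 proof (cases "w <= 1")
  case True
  thus ?thesis using that[OF D1(1)] D1(2) by fastforce
 next
  case w2: False
  have wmin: "w <= k" if "k >= 0" "D \<sim> D'" "!!i j. pt D' i j ==> 0 <= j & j <= k" for k D'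
   using w(2)[of k] that by blast
  have "\<exists>i. pt D1 i 0"
  proof (rule ccontr)
   assume neg: "~ ?thesis"
   have "w <= w - 1"
   proof (rule wmin)
    show "D \<sim> pull 1 0 0 1 0 1 D1" by (rule ueq_trans[OF D1(1) ueqI]) simp
    fix i j assume "pt (pull 1 0 0 1 0 1 D1) i j"
    hence "pt D1 i (j + 1)" by simp
    moreover from this have "j + 1 ~= 0" using neg by metis
    ultimately show "0 <= j & j <= w - 1" using D1(2) by fastforce
   qed (use w2 in simp)
   thus False by simp
  qed
  then obtain i0 where "pt D1 i0 0" by blast
  from body_row_min[OF b1 this] obtain a where a: "pt D1 a 0" "!!k. pt D1 k 0 ==> a <= k" by metis
  have "\<exists>i. pt D1 i w"
  proof (rule ccontr)
   assume neg: "~ ?thesis"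
   have "w <= w - 1"
   proof (rule wmin)
    show "D \<sim> D1" by fact
    fix i j assume "pt D1 i j"
    moreover from this have "j ~= w" using neg by metis
    ultimately show "0 <= j & j <= w - 1" using D1(2) by fastforce
   qed (use w2 in simp)
   thus False by simp
  qed
  then obtain bb where bb: "pt D1 bb w" by blast
  have cv: "convex D1" using b1 body_convex by blast
  obtain q1 q2 where q: "(q1, q2) : interior D1" using b1 by (auto simp: body_def)
  have "\<exists>x y. (x, y) : interior D1 & y < 1"
  proof -
   define t where "t = 1 / (2 * (1 + \<bar>q2\<bar>))"
   have t: "0 < t" "t <= 1" "t * q2 < 1" by (auto simp: t_def field_simps abs_if)
   have "(t * q1 + (1 - t) * of_int a, t * q2 + (1 - t) * 0) : interior D1"
    by (rule interior_segment[OF cv q]) (use a t in \<open>auto simp: pt_def lpt_def\<close>)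
   thus ?thesis using t by auto
  qed
  then obtain x1 y1 where x1: "(x1, y1) : interior D1" "y1 < 1" by blast
  have "\<exists>x y. (x, y) : interior D1 & y >= 1"
  proof -
   define t where "t = 1 / (2 * (1 + \<bar>of_int w - q2\<bar>))"
   define X where "X = \<bar>of_int w - q2\<bar>"
   have X: "X >= 0" "t = 1 / (2 * (1 + X))" by (simp_all add: X_def t_def)
   have t: "0 < t" "t <= 1" "t * X <= 1" using X by (simp_all add: divide_le_eq_1)
   have "t * (of_int w - q2) <= t * \<bar>of_int w - q2\<bar>" using t by (intro mult_left_mono) auto
   also have "\<dots> <= 1" using t(3) by (simp add: X_def)
   finally have t3: "t * q2 + (1 - t) * of_int w >= of_int w - 1" by (simp add: algebra_simps)
   have "(t * q1 + (1 - t) * of_int bb, t * q2 + (1 - t) * of_int w) : interior D1"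
    by (rule interior_segment[OF cv q]) (use bb t in \<open>auto simp: pt_def lpt_def\<close>)
   moreover have "(of_int w :: real) >= 2" using w2 by simp
   moreover from this t3 have "t * q2 + (1 - t) * of_int w >= 1" by linarith
   ultimately show ?thesis by blast
  qed
  then obtain x2 y2 where x2: "(x2, y2) : interior D1" "y2 >= 1" by blast
  define c where "c = x1 + (1 - y1) * (x2 - x1) / (y2 - y1)"
  have c: "(c, 1) : interior D1" unfolding c_def
   by (rule crossing[OF convex_interior[OF cv] x2(1) x1(1)]) (use x1 x2 in auto)
  define m where "m = \<lfloor>c\<rfloor>"
  have noint: "(of_int k, 1) \<notin> interior D1" for k using n1[of k 1] by (simp add: ip_def lpt_def)
  have m: "of_int m < c" "c < of_int (m + 1)"
  proof -
   have "c ~= of_int m" using noint[of m] c by metis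
   thus "of_int m < c" "c < of_int (m + 1)" unfolding m_def by linarith+
  qed
  have row: "of_int m <= x & x <= of_int (m + 1)" if "(x, 1) : D1" for x :: real
  proof (rule ccontr)
   assume "~ ?thesis"
   then consider "x < of_int m" | "x > of_int (m + 1)" by linarith
   thus False
   proof cases
    case 1
    hence "(of_int m, 1) : interior D1" by (intro interior_between[OF cv c that]) (use m in auto)
    thus False using noint by blast
   next
    case 2
    hence "(of_int (m + 1), 1) : interior D1" by (intro interior_between[OF cv c that]) (use m in auto)
    thus False using noint by blast
   qed
  qed
  have between: "l + j * (m - l) <= i & i <= l + j * (m + 1 - l)" if "pt D1 l 0" "pt D1 i j" "j >= 1" for l i j
  proof -
   have "(of_int l + (1 - 0) * (of_int i - of_int l) / (of_int j - 0), 1) : D1"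
    by (rule crossing[OF cv]) (use that in \<open>auto simp: pt_def lpt_def\<close>)
   from row[OF this] that(3) have "of_int j * of_int (m - l) <= (of_int (i - l) :: real)"
    "(of_int (i - l) :: real) <= of_int j * of_int (m + 1 - l)" by (simp_all add: field_simps)
   hence "j * (m - l) <= i - l" "i - l <= j * (m + 1 - l)"
    by (simp_all only: of_int_mult[symmetric] of_int_le_iff)
   thus ?thesis by linarith
  qed
  define k where "k = a - m"
  define D2 where "D2 = pull 1 (- k) 0 1 a 0 D1"
  have D2: "D \<sim> D2" unfolding D2_def by (rule ueq_trans[OF D1(1) ueqI]) simp
  have pt2: "pt D2 i j \<longleftrightarrow> pt D1 (i - k * j + a) j" for i j by (simp add: D2_def)
  have b2: "body D2" using ueq_body D2 D by blast
  have p2: "0 <= j & j <= w" "j >= 1 ==> 0 <= i & i <= j" "j = 0 ==> i >= 0"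
   if "pt D2 i j" for i j
   using that D1(2) between[OF a(1), of "i - k * j + a" j] a(2)[of "a + i"]
   by (auto simp: pt2 k_def algebra_simps)
  have "pt D2 0 0" using a by (simp add: pt2)
  from body_row_max[OF b2 this] obtain r where r: "pt D2 r 0" "0 <= r" "!!k. pt D2 k 0 ==> k <= r" by metis
  have up: "i <= r + j * (1 - r)" if "pt D2 i j" "j >= 1" for i j
   using between[of "r + a" "i - k * j + a" j] that r by (auto simp: pt2 k_def algebra_simps)
  have top: "\<exists>i. pt D2 i w" using bb pt2[of "bb + k * w - a" w] by auto
  show ?thesis
  proof (cases "r = 0")
   case r0: True
   have p3: "0 <= i & i <= j & j <= w" if "pt D2 i j" for i j
   proof (cases "j >= 1")
    case False
    hence "j = 0" using p2(1)[OF that] by linarith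
    thus ?thesis using that p2[OF that] r(3)[of i] r0 by auto
   qed (use p2 that in blast)
   \<comment> \<open>All points satisfy 0 <= i <= j <= w; minimality of w in the directions i and j
     - i forces both upper corners of this triangle to belong to \<open>D2\<close>.\<close>
   have "pt D2 w w"
   proof (rule ccontr)
    assume neg: "~ ?thesis"
    have "w <= w - 1"
    proof (rule wmin)
     show "D \<sim> pull 0 1 1 0 0 0 D2" by (rule ueq_trans[OF D2 ueqI]) simp
     fix i j assume "pt (pull 0 1 1 0 0 0 D2) i j"
     hence "pt D2 j i" by simp
     thus "0 <= j & j <= w - 1" using p3[of j i] neg by (cases "j = w") auto
    qed (use w2 in simp)
    thus False by simp
   qed
   have "pt D2 0 w"
   proof (rule ccontr)
    assume neg: "~ ?thesis"
    have "w <= w - 1"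
    proof (rule wmin)
     show "D \<sim> pull 1 0 1 1 0 0 D2" by (rule ueq_trans[OF D2 ueqI]) simp
     fix i j assume "pt (pull 1 0 1 1 0 0 D2) i j"
     hence "pt D2 i (i + j)" by simp
     thus "0 <= j & j <= w - 1" using p3[of i "i + j"] neg by (cases "j = w") auto
    qed (use w2 in simp)
    thus False by simp
   qed
   have "w <= 2"
   proof (rule ccontr)
    assume "~ w <= 2"
    hence w3: "(of_int w :: real) >= 3" by simp
    have cv2: "convex D2" using b2 body_convex by blast
    have "(c - of_int m, 1) : pull 1 (- k) 0 1 a 0 (interior D1)" using c by (simp add: pull_def k_def)
    hence c2: "(c - of_int m, 1) : interior D2" unfolding D2_def by (simp add: interior_pull)
    define g where "g = c - of_int m"
    have g: "0 < g" "g < 1" using m by (simp_all add: g_def)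
    \<comment> \<open>The point of the top row for which the segment to (g, 1) passes through (1,
      2), which then is an interior lattice point.\<close>
    define X where "X = g + (of_int w - 1) * (1 - g)"
    have X: "0 <= X" "X <= of_int w"
    proof -
     have "(of_int w - 1) * (1 - g) >= 0" using w3 g by simp
     thus "0 <= X" using g by (simp add: X_def)
     have "(of_int w - 1) * (1 - g) <= (of_int w - 1) * 1" using w3 g by (intro mult_left_mono) auto
     thus "X <= of_int w" using g by (simp add: X_def)
    qed
    have "(X, of_int w) : D2"
    proof -
     have "(X / of_int w) *\<^sub>R (of_int w, of_int w) + (1 - X / of_int w) *\<^sub>R (0, of_int w) : D2"
      by (rule convexD[OF cv2]) (use \<open>pt D2 w w\<close> \<open>pt D2 0 w\<close> X w3 in \<open>auto simp: pt_def lpt_def field_simps\<close>)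
     thus ?thesis using w3 by (simp add: algebra_simps)
    qed
    define t where "t = (of_int w - 2) / (of_int w - 1 :: real)"
    have t: "0 < t" "t <= 1" using w3 by (simp_all add: t_def)
    have "(t * g + (1 - t) * X, t * 1 + (1 - t) * of_int w) : interior D2"
     by (rule interior_segment[OF cv2]) (use c2 \<open>(X, of_int w) : D2\<close> t in \<open>auto simp: g_def\<close>)
    moreover have t1: "(1 - t) * (of_int w - 1) = 1" using w3 by (simp add: t_def field_simps)
    moreover have "t * 1 + (1 - t) * of_int w = 1 + (1 - t) * (of_int w - 1)" by (simp add: algebra_simps)
    moreover have "t * g + (1 - t) * X = g + (1 - t) * (of_int w - 1) * (1 - g)"
     by (simp add: X_def algebra_simps)
    ultimately have "(1, 2) : interior D2" by simp
    hence "ip D2 1 2" by (simp add: ip_def lpt_def)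
    thus False using n1 unfolding D2_def by (simp add: ip_pull)
   qed
   hence "w = 2" using w2 by simp
   show ?thesis
   proof (rule that)
    show "D \<sim> pull 1 0 0 (-1) 0 2 D2" by (rule ueq_trans[OF D2 ueqI]) simp
    have "0 <= i & 0 <= j & i + j <= 2" if "pt (pull 1 0 0 (-1) 0 2 D2) i j" for i j
     using p3[of i "2 - j"] that \<open>w = 2\<close> by simp
    thus "(\<forall>i j. pt (pull 1 0 0 (-1) 0 2 D2) i j --> 0 <= j & j <= 1) \<or> (\<forall>i j. pt (pull 1 0 0 (-1) 0 2 D2) i j --> 0 <= i & 0 <= j & i + j <= 2)" by blast
   qed
  next
   case r1: False
   show ?thesis
   proof (cases "r = 1")
    case True
    have "0 <= i & i <= 1" if "pt D2 i j" for i j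
     using p2[OF that] up[OF that] r(3)[of i] that True by (cases "j >= 1") (auto, (metis antisym_conv2 int_one_le_iff_zero_less)+)
    hence "\<forall>i j. pt (pull 0 1 1 0 0 0 D2) i j --> 0 <= j & j <= 1" by simp
    moreover have "D \<sim> pull 0 1 1 0 0 0 D2" by (rule ueq_trans[OF D2 ueqI]) simp
    ultimately show ?thesis using that by blast
   next
    case False
    hence r2: "r >= 2" using r r1 by linarith
    obtain i where i: "pt D2 i w" using top by blast
    have e: "0 <= r + w * (1 - r)" using up[OF i] p2(2)[OF i] w2 by linarith
    \<comment> \<open>The bounds on the top row leave r + w (1 - r) >= 0, that is (w - 1) (r - 1) <=
      1.\<close>
    define P where "P = (w - 1) * (r - 1)"
    have "P >= (w - 1) * 1" "P >= 1 * (r - 1)"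
     unfolding P_def using r2 w2 by (intro mult_left_mono mult_right_mono; simp)+
    moreover have "P = 1 - (r + w * (1 - r))" by (simp add: P_def algebra_simps)
    ultimately have "w <= 2" "r <= 2" using e by simp_all
    hence wr: "w = 2" "r = 2" using r2 w2 by simp_all
    have "0 <= i & 0 <= j & i + j <= 2" if "pt D2 i j" for i j
    proof (cases "j >= 1")
     case True
     thus ?thesis using up[OF that] p2[OF that] wr by simp
    next
     case False
     hence "j = 0" using p2(1)[OF that] by linarith
     thus ?thesis using p2[OF that] r(3)[of i] that wr by auto
    qed
    thus ?thesis using that[OF D2] by blast
   qed
  qed
 qed
qed

lemma pull_ueq: "D \<sim> D1 ==> \<bar>a * d - b * c\<bar> = 1 ==> D \<sim> pull a b c d e h D1"
 by (rule ueq_trans[OF _ ueqI])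

lemma body_finite_coords:
 assumes "body D"
 shows "finite {i. \<exists>j. pt D i j}" "finite {j. \<exists>i. pt D i j}"
proof -
 have f: "finite {(i, j). pt D i j}" using assms by (simp add: body_def)
 have "{i. \<exists>j. pt D i j} = fst ` {(i, j). pt D i j}" "{j. \<exists>i. pt D i j} = snd ` {(i, j). pt D i j}" by force+
 thus "finite {i. \<exists>j. pt D i j}" "finite {j. \<exists>i. pt D i j}" using f by simp_all
qed

text \<open>An outer column of length at least b + 2 becomes the base row and E is its excess over b
  + 2. If both outer columns are shorter, a shear fixing the middle column aligns them with the rows
  -1 to b + 1.\<close>

lemma three_columns:
 assumes D: "body D" and p: "!!i j. pt D i j ==> \<bar>i\<bar> <= 1" and b: "b >= 0"
  and ip: "ip D 0 0" "ip D 0 b" "~ ip D 0 (-1)" "~ ip D 0 (b + 1)"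
 obtains D' E where "D \<sim> D'" "E >= 0" "!!i j. pt D' i j ==> 0 <= i & 0 <= j & j <= 2 & i + E * j <= b + 2 + E"
proof -
 note fin = that
 have long: thesis if s: "s = 1 \<or> s = -1" and l: "pt D s l" and t: "pt D s t"
  and lt: "!!k. pt D s k ==> l <= k & k <= t" and E: "t - l >= b + 2" for s l t
 proof -
  let ?D = "pull 0 (-s) 1 0 s 0 D"
  have u: "\<bar>0 * 0 - (- s) * 1\<bar> = (1::int)" using s by auto
  have pt': "pt ?D i j \<longleftrightarrow> pt D (s - s * j) i" for i j by (simp add: algebra_simps)
  have ip': "ip ?D i j \<longleftrightarrow> ip D (s - s * j) i" for i j by (simp add: ip_pull[OF u] algebra_simps)
  have cv: "convex ?D" using convex_pull body_convex[OF D] by blast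
  have low: "i >= l + j * (-1 - l)" if "pt ?D i j" "j >= 1" for i j
   using row_lower[OF cv, of l 0 i j] that l ip by (simp add: pt' ip')
  have up: "i <= t + j * (b + 1 - t)" if "pt ?D i j" "j >= 1" for i j
   using row_upper[OF cv, of t b i j] that t ip by (simp add: pt' ip')
  let ?D' = "pull 1 (-1 - l) 0 1 l 0 ?D"
  show thesis
  proof (rule fin)
   show "D \<sim> ?D'" by (rule pull_ueq[OF ueqI[OF u]]) simp
   show "t - l - b - 2 >= 0" using E by simp
   fix i j assume "pt ?D' i j"
   hence ij: "pt ?D (i + (-1 - l) * j + l) j" by simp
   hence "\<bar>s - s * j\<bar> <= 1" using p pt' by blast
   hence j: "0 <= j" "j <= 2" using s by auto
   show "0 <= i & 0 <= j & j <= 2 & i + (t - l - b - 2) * j <= b + 2 + (t - l - b - 2)"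
   proof (cases "j >= 1")
    case True
    thus ?thesis using j low[OF ij] up[OF ij] by (simp add: algebra_simps)
   next
    case False
    hence "j = 0" using j by simp
    hence "pt D s (i + l)" using ij pt'[of "i + l" 0] by simp
    thus ?thesis using lt[of "i + l"] \<open>j = 0\<close> by simp
   qed
  qed
 qed
 have col0: "-1 <= j & j <= b + 1" if "pt D 0 j" for j
 proof -
  let ?D = "pull 0 1 1 0 0 0 D"
  have cv: "convex ?D" using convex_pull body_convex[OF D] by blast
  have "~ j < -1"
  proof
   assume "j < -1"
   with that have "ip ?D (-1) 0" by (rule_tac i = 0 and i' = j in ip_between[OF cv]) (use that ip(1) in \<open>simp_all add: ip_pull\<close>)
   thus False using ip(3) by (simp add: ip_pull)
  qed
  moreover have "~ j > b + 1"
  proof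
   assume "j > b + 1"
   with that have "ip ?D (b + 1) 0" by (rule_tac i = b and i' = j in ip_between[OF cv]) (use that ip(2) in \<open>simp_all add: ip_pull\<close>)
   thus False using ip(4) by (simp add: ip_pull)
  qed
  ultimately show ?thesis by simp
 qed
 have range: "\<exists>l t. pt D s l & pt D s t & (\<forall>k. pt D s k --> l <= k & k <= t)" if "pt D s k" for s k
 proof -
  let ?D = "pull 0 1 1 0 0 0 D"
  have bd: "body ?D" by (rule body_pull) (use D in auto)
  have "pt ?D k s" using that by simp
  from body_row_max[OF bd this] body_row_min[OF bd this] obtain l t where
   "pt ?D l s" "pt ?D t s" "!!k. pt ?D k s ==> l <= k" "!!k. pt ?D k s ==> k <= t" by metis
  thus ?thesis by (intro exI[of _ l] exI[of _ t]) simp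
 qed
 have short: thesis if "!!k. pt D 1 k ==> -1 <= k + x & k + x <= b + 1" "!!k. pt D (-1) k ==> -1 <= k - x & k - x <= b + 1" for x
 proof -
  let ?D = "pull 0 1 1 (-x) (-1) (x-1) D"
  show thesis
  proof (rule fin)
   show "D \<sim> ?D" by (rule ueqI) simp
   show "(0::int) <= 0" by simp
   fix i j assume "pt ?D i j"
   hence ij: "pt D (j - 1) (i - x * j + x - 1)" by (simp add: algebra_simps)
   from p[OF ij] have "j = 0 \<or> j = 1 \<or> j = 2" by linarith
   thus "0 <= i & 0 <= j & j <= 2 & i + 0 * j <= b + 2 + 0"
   proof (elim disjE)
    assume "j = 0" thus ?thesis using that(2)[of "i + x - 1"] ij by simp
   next
    assume "j = 1" thus ?thesis using col0[of "i - 1"] ij by simp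
   next
    assume "j = 2" thus ?thesis using that(1)[of "i - x - 1"] ij by simp
   qed
  qed
 qed
 show thesis
 proof (cases "\<exists>k. pt D 1 k")
  case False
  show thesis
  proof (cases "\<exists>k. pt D (-1) k")
   case False
   thus thesis using \<open>~ (\<exists>k. pt D 1 k)\<close> by (intro short[of 0]) auto
  next
   case True
   with range obtain l t where lt: "pt D (-1) l" "pt D (-1) t" "!!k. pt D (-1) k ==> l <= k & k <= t" by metis
   show thesis
   proof (cases "t - l >= b + 2")
    case True
    thus thesis using long[of "-1" l t] lt by blast
   next
    case False
    thus thesis using \<open>~ (\<exists>k. pt D 1 k)\<close> lt(3) by (intro short[of "l + 1"]) force+
   qed
  qed
 next
  case True
  with range obtain l t where lt: "pt D 1 l" "pt D 1 t" "!!k. pt D 1 k ==> l <= k & k <= t" by metis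
  show thesis
  proof (cases "t - l >= b + 2")
   case True
   thus thesis using long[of 1 l t] lt by blast
  next
   case s1: False
   show thesis
   proof (cases "\<exists>k. pt D (-1) k")
    case False
    thus thesis using s1 lt(3) by (intro short[of "- 1 - l"]) force+
   next
    case True
    with range obtain l2 t2 where lt2: "pt D (-1) l2" "pt D (-1) t2" "!!k. pt D (-1) k ==> l2 <= k & k <= t2" by metis
    show thesis
    proof (cases "t2 - l2 >= b + 2")
     case True
     thus thesis using long[of "-1" l2 t2] lt2 by blast
    next
     case s2: False
     let ?D = "pull 0 (-1) 1 0 1 0 D"
     have u: "\<bar>0 * 0 - (- 1) * 1\<bar> = (1::int)" by auto
     have cv: "convex ?D" using convex_pull body_convex[OF D] by blast
     have low: "l2 >= -2 - l"
      using row_lower[OF cv, of l 0 l2 2] lt lt2 ip by (simp add: ip_pull[OF u])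
     have up: "t2 <= 2 * (b + 1) - t"
      using row_upper[OF cv, of t b t2 2] lt lt2 ip by (simp add: ip_pull[OF u])
     \<comment> \<open>The shear has two lower and two upper bounds. Two of the four comparisons are
       the lengths of the outer columns, the other two are the constraints that the outer columns
       put on each other through the middle one.\<close>
     define x where "x = max (-1 - l) (t2 - b - 1)"
     have x: "-1 - l <= x" "t2 - b - 1 <= x" "x <= b + 1 - t" "x <= l2 + 1"
      using low up s1 s2 by (auto simp: x_def)
     have "-1 <= k + x & k + x <= b + 1" if "pt D 1 k" for k using lt(3)[OF that] x by linarith
     moreover have "-1 <= k - x & k - x <= b + 1" if "pt D (-1) k" for k using lt2(3)[OF that] x by linarith
     ultimately show thesis by (rule short)
    qed
   qed
  qed
 qed
qed

definition single_ip :: "(real \<times> real) set => bool" where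
 "single_ip D \<longleftrightarrow> (\<forall>i j. ip D i j \<longleftrightarrow> i = 0 & j = 0)"

lemma single_ip_pull:
 assumes u: "\<bar>a * d - b * c\<bar> = 1" and s: "single_ip D"
 shows "single_ip (pull a b c d 0 0 D)"
proof -
 have "a * i + b * j = 0 & c * i + d * j = 0 \<longleftrightarrow> i = 0 & j = 0" for i j
 proof
  assume *: "a * i + b * j = 0 & c * i + d * j = 0"
  have "(a * d - b * c) * i = d * (a * i + b * j) - b * (c * i + d * j)"
   "(a * d - b * c) * j = a * (c * i + d * j) - c * (a * i + b * j)" by (simp_all add: algebra_simps)
  hence "(a * d - b * c) * i = 0" "(a * d - b * c) * j = 0" using * by simp_all
  thus "i = 0 & j = 0" using u by auto
 qed simp
 thus ?thesis using s by (simp add: single_ip_def ip_pull[OF u])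
qed

text \<open>If no equivalent polygon lies in three columns, two descents lead to the triangle. The
  first lowers the depth below the interior point until both coordinates are at least -1, the second
  lowers the sum of the two maximal coordinates; each descent step is a shear provided by
  \<open>squeeze\<close>.\<close>

lemma one_interior_point:
 assumes D: "body D" and s: "single_ip D"
 obtains D' where "D \<sim> D'" "single_ip D'" "!!i j. pt D' i j ==> \<bar>i\<bar> <= 1"
 | D' where "D \<sim> D'" "!!i j. pt D' i j ==> i >= -1 & j >= -1 & i + j <= 1"
proof -
 define \<C> where "\<C> = {D'. D \<sim> D' & single_ip D'}"
 have Cpull: "pull a b c d 0 0 D' : \<C>" if "D' : \<C>" "\<bar>a * d - b * c\<bar> = 1" for a b c d D'
  using that pull_ueq single_ip_pull by (auto simp: \<C>_def)
 have D0: "D : \<C>" using s ueq_refl by (simp add: \<C>_def)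
 have cv: "convex D'" if "D' : \<C>" for D' using that ueq_body D body_convex by (auto simp: \<C>_def)
 have ip0: "ip D' i j \<longleftrightarrow> i = 0 & j = 0" if "D' : \<C>" for D' i j using that by (simp add: \<C>_def single_ip_def)
 show thesis
 proof (cases "\<exists>D'\<in>\<C>. \<forall>i j. pt D' i j --> \<bar>i\<bar> <= 1")
  case True
  thus thesis using that(1) by (auto simp: \<C>_def)
 next
  case False
  hence viol: "\<exists>i j. pt D' i j & \<bar>i\<bar> >= 2" if "D' : \<C>" for D' using that by fastforce
  define md where "md h \<longleftrightarrow> h >= 2 & (\<exists>D'\<in>\<C>. (\<exists>i. pt D' i (-h)) & (\<forall>i j. pt D' i j --> j >= -h))" for h
  have mdI: "\<exists>h\<le>H. md h" if "D' : \<C>" "pt D' i j" "j <= -2" "!!i j. pt D' i j ==> j >= -H" for D' i j H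
  proof -
   let ?S = "{j. \<exists>i. pt D' i j}"
   have "body D'" using that(1) ueq_body D by (auto simp: \<C>_def)
   hence f: "finite ?S" by (rule body_finite_coords)
   have ne: "?S ~= {}" using that by blast
   obtain i0 where i0: "pt D' i0 (Min ?S)" using Min_in[OF f ne] by blast
   have le: "Min ?S <= j'" if "pt D' i' j'" for i' j' using Min_le[OF f] that by blast
   have "md (- Min ?S)" unfolding md_def using that(1) i0 le le[OF that(2)] that(3) by auto
   moreover have "- Min ?S <= H" using that(4)[OF i0] by simp
   ultimately show ?thesis by blast
  qed
  obtain h0 where "md h0"
  proof -
   obtain i j where ij: "pt D i j" "\<bar>i\<bar> >= 2" using viol[OF D0] by blast
   obtain M where M: "!!i j. pt D i j ==> \<bar>i\<bar> <= M & \<bar>j\<bar> <= M" using body_bounded[OF D] by metis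
   show ?thesis
   proof (cases "i >= 0")
    case True
    have "\<exists>h\<le>M. md h"
    proof (rule mdI[OF Cpull[OF D0, of 0 0 "-1" 1], of j "- i"])
     fix x y assume "pt (pull 0 (- 1) 1 0 0 0 D) x y"
     thus "- M <= y" using M[of "- y" x] by simp linarith
    qed (use ij True in simp_all)
    thus ?thesis using that by blast
   next
    case False
    have "\<exists>h\<le>M. md h"
    proof (rule mdI[OF Cpull[OF D0, of 0 0 "1" 1], of j i])
     fix x y assume "pt (pull 0 1 1 0 0 0 D) x y"
     thus "- M <= y" using M[of y x] by simp linarith
    qed (use ij False in simp_all)
    thus ?thesis using that by blast
   qed
  qed
  have mdpos: "md k ==> k >= 0" for k by (simp add: md_def)
  obtain h where h: "md h" "!!k. md k ==> h <= k" by (rule least_int[of md, OF \<open>md h0\<close> mdpos]) blast+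
  then obtain D1 p where D1: "D1 : \<C>" "pt D1 p (-h)" "!!i j. pt D1 i j ==> j >= -h" "h >= 2" unfolding md_def by blast
  have "ip D1 0 0" "!!i. ~ ip D1 i (-1)" using ip0[OF D1(1)] by auto
  from squeeze[OF cv[OF D1(1)] this D1(2,4)] obtain m where
   m: "!!i j. pt D1 i j ==> j <= -2 ==> 0 < i + m * j & i + m * j < - j"
    "!!i j. pt D1 i j ==> j >= -1 ==> i + m * j <= 1 & i + m * j + j >= -1" by metis
  \<comment> \<open>New coordinates x, y with x + y = j and -x = i + m j. For deep points
    \<open>squeeze\<close> makes both negative, so both depths are below h; minimality of h then
    leaves no coordinate below -1.\<close>
  let ?D4 = "pull (-1 - m) (- m) 1 1 0 0 D1"
  have D4: "?D4 : \<C>" by (rule Cpull[OF D1(1)]) (simp add: algebra_simps)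
  have b4: "-1 <= i & -1 <= j" if "pt ?D4 i j" for i j
  proof -
   have a: "x >= - (h - 1) & y >= - (h - 1)" if "pt ?D4 x y" for x y
   proof -
    have q: "pt D1 ((-1 - m) * x + (- m) * y) (x + y)" using that by simp
    have e: "(-1 - m) * x + (- m) * y + m * (x + y) = - x" by (simp add: algebra_simps)
    show ?thesis using m(1)[OF q] m(2)[OF q] D1(3)[OF q] D1(4) unfolding e by linarith
   qed
   have "j >= -1"
   proof (rule ccontr)
    assume "~ ?thesis"
    hence "j <= -2" by simp
    from mdI[OF D4 that this, of "h - 1"] a obtain k where "k <= h - 1" "md k" by blast
    thus False using h(2)[of k] by linarith
   qed
   moreover have "i >= -1"
   proof (rule ccontr)
    assume "~ ?thesis"
    hence "i <= -2" by simp
    have "pt (pull 0 1 1 0 0 0 ?D4) j i" using that by (simp only: pt_pull) simp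
    moreover have "y >= - (h - 1)" if "pt (pull 0 1 1 0 0 0 ?D4) x y" for x y
    proof -
     have "pt ?D4 y x" using that by (simp only: pt_pull[of 0 1 1 0 0 0]) simp
     thus ?thesis using a by blast
    qed
    ultimately obtain k where "k <= h - 1" "md k"
     using mdI[OF Cpull[OF D4, of 0 0 1 1] _ \<open>i <= -2\<close>, of j "h - 1"] by auto
    thus False using h(2)[of k] by linarith
   qed
   ultimately show ?thesis by simp
  qed
  define good where "good D' n \<longleftrightarrow> D' : \<C> & (\<forall>i j. pt D' i j --> -1 <= i & -1 <= j) &
   (\<exists>M M'. 2 <= M & 2 <= M' & n = M + M' & (\<exists>j. pt D' M j) & (\<exists>i. pt D' i M') &
   (\<forall>i j. pt D' i j --> i <= M & j <= M'))" for D' n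
  have goodI: "\<exists>n\<le>N+N'. good D' n" if "D' : \<C>" "!!i j. pt D' i j ==> -1 <= i & -1 <= j"
   "!!i j. pt D' i j ==> i <= N & j <= N'" for D' N N'
  proof -
   note T = that
   let ?S = "{i. \<exists>j. pt D' i j}" and ?S' = "{j. \<exists>i. pt D' i j}"
   have "body D'" using that(1) ueq_body D by (auto simp: \<C>_def)
   note f = body_finite_coords[OF this]
   obtain i j where ij: "pt D' i j" "\<bar>i\<bar> >= 2" using viol[OF T(1)] by blast
   obtain i' j' where ij': "pt D' i' j'" "\<bar>j'\<bar> >= 2" using viol[OF Cpull[OF T(1), of 0 0 1 1]] by auto
   have ne: "?S ~= {}" "?S' ~= {}" using ij by blast+
   have le: "x <= Max ?S & y <= Max ?S'" if "pt D' x y" for x y using Max_ge[OF f(1)] Max_ge[OF f(2)] that by blast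
   have "Max ?S : ?S" "Max ?S' : ?S'" using Max_in[OF f(1) ne(1)] Max_in[OF f(2) ne(2)] by blast+
   moreover have "Max ?S >= 2" "Max ?S' >= 2" using le[OF ij(1)] le[OF ij'(1)] ij ij' that(2) by fastforce+
   moreover have "Max ?S + Max ?S' <= N + N'" 
   proof -
    obtain x y where "pt D' (Max ?S) y" "pt D' x (Max ?S')" using calculation(1,2) by blast
    thus ?thesis using T(3) by (meson add_mono)
   qed
   ultimately have "good D' (Max ?S + Max ?S')" unfolding good_def using that le by blast
   thus ?thesis using \<open>Max ?S + Max ?S' <= N + N'\<close> by blast
  qed
  obtain n0 where "\<exists>D'. good D' n0"
  proof -
   have "body ?D4" using D4 ueq_body D by (auto simp: \<C>_def)
   then obtain M where "!!i j. pt ?D4 i j ==> \<bar>i\<bar> <= M & \<bar>j\<bar> <= M" using body_bounded by metis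
   hence "\<exists>n\<le>M+M. good ?D4 n" by (intro goodI[OF D4]) (use b4 in fastforce)+
   thus ?thesis using that by blast
  qed
  have gpos: "k >= 0" if "\<exists>D'. good D' k" for k
  proof -
   from that obtain M M' where "2 <= M" "2 <= M'" "k = M + M'" unfolding good_def by blast
   thus ?thesis by simp
  qed
  obtain n where n: "\<exists>D'. good D' n" "!!k. \<exists>D'. good D' k ==> n <= k"
   by (rule least_int[of "%n. \<exists>D'. good D' n", OF \<open>\<exists>D'. good D' n0\<close> gpos]) blast+
  have key: "\<exists>m. (m = -1 \<or> m = 0) & (\<forall>i j. pt D' i j --> i >= 2 --> 0 < j - m * i & j - m * i < i) &
    (\<forall>i j. pt D' i j --> i <= 1 --> j - m * i <= 1)" if g: "good D' n" for D'
  proof -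
   from g obtain M M' y0 where M: "2 <= M" "2 <= M'" "n = M + M'" "pt D' M y0"
    "!!i j. pt D' i j ==> i <= M & j <= M'" and C: "D' : \<C>" and ge: "!!i j. pt D' i j ==> -1 <= i & -1 <= j"
    unfolding good_def by blast
   have u: "\<bar>0 * 0 - (-1) * 1\<bar> = (1::int)" by simp
   obtain m where m: "m * M < y0" "y0 < (m + 1) * M"
     "!!i j. pt D' (0 * i + (-1) * j + 0) (1 * i + 0 * j + 0) ==> j <= -2 ==> 0 < i + m * j & i + m * j < - j"
     "!!i j. pt D' (0 * i + (-1) * j + 0) (1 * i + 0 * j + 0) ==> j >= -1 ==> i + m * j <= 1 & i + m * j + j >= -1"
    by (rule squeeze_pull[OF cv[OF C] u, of 0 0 y0 M]) (use M ip0[OF C] in auto)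
   have deep: "0 < j - m * i & j - m * i < i" if "pt D' i j" "i >= 2" for i j
    using m(3)[of j "- i"] that by simp
   have shallow: "j - m * i <= 1 & j - m * i - i >= -1" if "pt D' i j" "i <= 1" for i j
    using m(4)[of j "- i"] that by simp
   have "m >= -1"
   proof (rule ccontr)
    assume "~ ?thesis"
    hence "(m + 1) * M <= (-1) * M" using M by (intro mult_right_mono) auto
    thus False using m(2) ge[OF M(4)] M(1) by linarith
   qed
   \<comment> \<open>For m >= 1 the shear by m brings the second maximum down to M - 1, whereas
     before it exceeded m M >= M; the sum of the maxima would fall below n.\<close>
   moreover have "m <= 0"
   proof (rule ccontr)
    assume "~ ?thesis"
    hence m1: "m >= 1" by simp
    let ?E = "pull 1 0 m 1 0 0 D'"
    have E: "?E : \<C>" by (rule Cpull[OF C]) simp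
    have z: "-1 <= i & -1 <= z & i <= M & z <= M - 1" if "pt ?E i z" for i z
    proof -
     have q: "pt D' i (m * i + z)" using that by simp
     show ?thesis
     proof (cases "i >= 2")
      case True
      thus ?thesis using deep[OF q] M(5)[OF q] by simp
     next
      case False
      hence i: "i = -1 \<or> i = 0 \<or> i = 1" using ge[OF q] by linarith
      thus ?thesis using shallow[OF q] False ge[OF q] m1 M(1) by auto
     qed
    qed
    have "\<exists>k\<le>M + (M - 1). good ?E k" by (rule goodI[OF E]) (use z in blast)+
    hence "n <= M + (M - 1)" using n(2) by fastforce
    moreover have "1 * M <= m * M" using m1 M by (intro mult_right_mono) auto
    ultimately show False using M(3) m(1) M(5)[OF M(4)] by linarith
   qed
   ultimately have "m = -1 \<or> m = 0" by linarith
   thus ?thesis using deep shallow by blast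
  qed
  from n(1) obtain D5 where D5: "good D5 n" by blast
  let ?D5 = "pull 0 1 1 0 0 0 D5"
  have D5': "good ?D5 n"
  proof -
   from D5 obtain M M' x y where "2 <= M" "2 <= M'" "n = M + M'" "pt D5 M y" "pt D5 x M'" "D5 : \<C>"
    "\<forall>i j. pt D5 i j --> i <= M & j <= M'" "\<forall>i j. pt D5 i j --> -1 <= i & -1 <= j"
    unfolding good_def by blast
   moreover from this have "?D5 : \<C>" by (intro Cpull) simp_all
   moreover have sw: "pt ?D5 i j = pt D5 j i" for i j by simp
   ultimately show ?thesis unfolding good_def sw
    by (intro conjI, blast, blast, rule_tac exI[of _ M'], rule_tac exI[of _ M]) (auto simp: add.commute)
  qed
  from key[OF D5] obtain m where m: "m = -1 \<or> m = 0" "!!i j. pt D5 i j ==> i >= 2 ==> 0 < j - m * i & j - m * i < i"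
    "!!i j. pt D5 i j ==> i <= 1 ==> j - m * i <= 1" by blast
  from key[OF D5'] obtain m' where m': "m' = -1 \<or> m' = 0" "!!i j. pt D5 j i ==> i >= 2 ==> 0 < j - m' * i & j - m' * i < i"
    "!!i j. pt D5 j i ==> i <= 1 ==> j - m' * i <= 1" by auto
  from D5 obtain M M' xx yy where M: "2 <= M" "2 <= M'" "pt D5 M yy" "pt D5 xx M'" "D5 : \<C>"
   "!!i j. pt D5 i j ==> -1 <= i & -1 <= j" unfolding good_def by blast
  have "m = -1"
  proof (rule ccontr)
   assume "m ~= -1"
   hence "m = 0" using m by simp
   hence "xx >= 2" using m(3)[OF M(4)] M(2) by fastforce
   thus False using m(2)[OF M(4)] m'(2)[OF M(4)] m'(1) M(2) \<open>m = 0\<close> by auto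
  qed
  have "m' = -1"
  proof (rule ccontr)
   assume "m' ~= -1"
   hence "m' = 0" using m' by simp
   hence "yy >= 2" using m'(3)[OF M(3)] M(1) by fastforce
   thus False using m(2)[OF M(3)] M(1) \<open>m = -1\<close> by auto
  qed
  have "i + j <= 1" if "pt D5 i j" for i j
  proof (cases "i <= 1")
   case True
   thus ?thesis using m(3)[OF that] \<open>m = -1\<close> by simp
  next
   case False
   hence "j < 0" using m(2)[OF that] \<open>m = -1\<close> by simp
   thus ?thesis using m'(3)[OF that] \<open>m' = -1\<close> by simp
  qed
  thus thesis using that(2) M(5,6) by (auto simp: \<C>_def)
 qed
qed

section \<open>Models adapted to the lattice width and to the square size\<close>

text \<open>This and the next two definitions express that the interior polygon fits into a standard
  shape by its lattice points alone, without forming their hull; \<open>fits_iff\<close> makes the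
  connection.\<close>

definition tri_bound :: "(real \<times> real) set => int => bool" where
 "tri_bound D n \<longleftrightarrow> n >= 0 & (\<exists>D'. D \<sim> D' & (\<forall>i j. ip D' i j --> 0 <= i & 0 <= j & i + j <= n))"

definition strip_bound :: "(real \<times> real) set => int => bool" where
 "strip_bound D n \<longleftrightarrow> n >= 0 & (\<exists>D'. D \<sim> D' & (\<forall>i j. ip D' i j --> 0 <= i & i <= n))"

definition box_bound :: "(real \<times> real) set => int => int => bool" where
 "box_bound D m n \<longleftrightarrow> m >= 0 & n >= 0 &
  (\<exists>D'. D \<sim> D' & (\<forall>i j. ip D' i j --> 0 <= i & i <= m & 0 <= j & j <= n))"

lemma bound_ueq:
 assumes "D \<sim> D'"
 shows "tri_bound D' n \<longleftrightarrow> tri_bound D n" "strip_bound D' n \<longleftrightarrow> strip_bound D n" "box_bound D' m n \<longleftrightarrow> box_bound D m n"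
 unfolding tri_bound_def strip_bound_def box_bound_def using assms ueq_trans ueq_sym by blast+

lemma ip_mid:
 assumes "convex D" "ip D i j" "ip D i' j" "i <= k" "k <= i'"
 shows "ip D k j"
proof (cases "k = i'")
 case False
 hence "i <= k & k < i' \<or> i' < k & k <= i" using assms by simp
 thus ?thesis using ip_between[OF assms(1,2) ip_pt[OF assms(3)]] by blast
qed (use assms in simp)

lemma ip_mid_pull:
 assumes "convex D" "\<bar>a * d - b * c\<bar> = 1" "ip D (a * i + b * j + e) (c * i + d * j + f)"
  "ip D (a * i' + b * j + e) (c * i' + d * j + f)" "i <= k" "k <= i'"
 shows "ip D (a * k + b * j + e) (c * k + d * j + f)"
 using ip_mid[OF convex_pull[OF assms(1)], of a b c d e f i j i' k] assms by (simp add: ip_pull)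

text \<open>\<open>squeeze\<close> confines the interior points to a triangle of size w with apex on
  row 0. Its three side directions have width at least w, so its three corners are interior points,
  and \<open>edge_bound\<close> along each side gives a triangle of size w + 3.\<close>

lemma violated_width_direction:
 assumes D: "body D" and w: "w >= 1" "!!n. strip_bound D n ==> w <= n"
  and ip: "!!i j. ip D i j ==> 0 <= j & j <= w" and p: "pt D p q" "q <= -2"
 obtains D' where "D \<sim> D'" "!!i j. pt D' i j ==> 0 <= i & 0 <= j & i + j <= w + 3"
proof -
 note fin = that
 have cv: "convex D" using D body_convex by blast
 have narrow: "\<exists>i j. ip D' i j & ~ (0 <= i & i <= w - 1)" if "D \<sim> D'" for D'
  using w(2)[of "w - 1"] w(1) that unfolding strip_bound_def by fastforce
 obtain a where a: "ip D a 0"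
 proof -
  from narrow[OF ueqI[of 0 0 1 1 D 0 1]] obtain i j where "ip D j (i + 1)" "~ (0 <= i & i <= w - 1)"
   by (auto simp: ip_pull)
  hence "ip D j 0" using ip[of j "i + 1"] by (cases "i = -1") auto
  thus ?thesis using that by blast
 qed
 have u: "\<bar>1 * 1 - 0 * 0\<bar> = (1::int)" by simp
 obtain m where m: "!!i j. ip D (1 * i + 0 * j + a) (0 * i + 1 * j + 0) ==> j >= 0 ==> i + m * j <= 0 & i + m * j + j >= 0"
  by (rule squeeze_pull[OF cv u a, of "p - a" "- q"]) (use p ip[of _ "-1"] in fastforce)+
 let ?D = "pull 1 (- m) 0 1 a 0 D"
 have u1: "\<bar>1 * 1 - (- m) * 0\<bar> = (1::int)" by simp
 have D2: "D \<sim> ?D" by (rule ueqI[OF u1])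
 have cv2: "convex ?D" using convex_pull[OF cv] .
 have ip2: "i <= 0 & i + j >= 0 & j <= w" if "ip ?D i j" for i j
 proof -
  have "ip D (i - m * j + a) j" using that by (simp add: ip_pull)
  thus ?thesis using ip[of "i - m * j + a" j] m[of "i - m * j" j] by simp
 qed
 have c0: "ip ?D 0 0" using a by (simp add: ip_pull)
 \<comment> \<open>Without this corner the coordinate -i would only take the values 0 to w - 1 on
   the interior points, against the minimality of w; the next corner follows in the same way from i
   + j.\<close>
 have c1: "ip ?D (- w) w"
 proof -
  from narrow[OF pull_ueq[OF D2, of "-1" 1 0 0 0 0]] obtain i j where
   "ip (pull (-1) 0 0 1 0 0 ?D) i j" "~ (0 <= i & i <= w - 1)" by auto
  hence q: "ip ?D (- i) j" "~ (0 <= i & i <= w - 1)" by (simp_all add: ip_pull[of "-1" 1 0 0 0 0])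
  from ip2[OF q(1)] q(2) have "i = w" "j = w" by linarith+
  thus ?thesis using q by simp
 qed
 have c2: "ip ?D 0 w"
 proof -
  have "\<exists>i j. ip (pull 0 1 1 (-1) 0 0 ?D) i j & ~ (0 <= i & i <= w - 1)"
   by (rule narrow[OF pull_ueq[OF D2]]) simp
  then obtain i j where "ip (pull 0 1 1 (-1) 0 0 ?D) i j" "~ (0 <= i & i <= w - 1)" by blast
  hence q: "ip ?D j (i - j)" "~ (0 <= i & i <= w - 1)" by (simp_all add: ip_pull[of 0 "-1" 1 1 0 0])
  from ip2[OF q(1)] q(2) have "j = 0" "i = w" by linarith+
  thus ?thesis using q by simp
 qed
 have s1: "j <= w + 1" if "pt ?D i j" for i j
 proof -
  have m1: "ip ?D (-1) w" by (rule ip_mid[OF cv2 c1 c2]) (use w in auto)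
  have "w - j >= -1"
   by (rule edge_bound[OF cv2, of 1 "-1" 0 0 "-1" w "i + 1"]) (use m1 c2 ip2[of _ "w + 1"] that in \<open>auto simp: add.commute\<close>)
  thus ?thesis by simp
 qed
 have s2: "i <= 1" if "pt ?D i j" for i j
 proof -
  have m1: "ip ?D 0 1" using ip_mid_pull[OF cv2, of 0 0 1 1 0 0 0 0 w 1] c0 c2 w by simp
  have "- i >= -1"
   by (rule edge_bound[OF cv2, of 0 0 "-1" 1 0 0 j]) (use m1 c0 ip2[of 1] that in auto)
  thus ?thesis by simp
 qed
 have s3: "i + j >= -1" if "pt ?D i j" for i j
 proof -
  have m1: "ip ?D (-1) 1" using ip_mid_pull[OF cv2, of "-1" 1 0 1 0 0 0 0 w 1] c0 c1 w by simp
  show ?thesis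
   by (rule edge_bound[OF cv2, of "-1" 1 0 1 0 0 "- i"]) (use m1 c0 ip2[of "- i" "i - 1" for i] that in force)+
 qed
 show thesis
 proof (rule fin)
  show "D \<sim> pull (-1) 0 1 1 1 (-2) ?D" by (rule pull_ueq[OF D2]) simp
  fix i j assume "pt (pull (-1) 0 1 1 1 (-2) ?D) i j"
  hence "pt ?D (1 - i) (i + j - 2)" by (simp only: pt_pull[of "-1" 0 1 1 1 "-2"]) simp
  from s1[OF this] s2[OF this] s3[OF this] show "0 <= i & 0 <= j & i + j <= w + 3" by linarith
 qed
qed

text \<open>Reduction of a lattice basis: a direction of minimal width can be completed to a basis whose
  second direction is no wider than a given square.\<close>

lemma box_bound_of_square:
 assumes D: "body D" and ne: "ip D i0 j0" and w: "strip_bound D w" and b: "box_bound D b b" and wb: "w <= b"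
 shows "box_bound D w b"
proof -
 obtain D1 where D1: "D \<sim> D1" "!!i j. ip D1 i j ==> 0 <= i & i <= b & 0 <= j & j <= b"
  using b unfolding box_bound_def by blast
 obtain D2 where D2: "D \<sim> D2" "!!i j. ip D2 i j ==> 0 <= i & i <= w" using w unfolding strip_bound_def by blast
 have "D2 \<sim> D1" using D1(1) D2(1) ueq_sym ueq_trans by blast
 then obtain s t s' t' e e' where u: "\<bar>s * t' - t * s'\<bar> = 1" and D1e: "D1 = pull s t s' t' e e' D2" by (auto simp: ueq_def)
 have wd: "0 <= s * i + t * j + e & s * i + t * j + e <= w" if "ip D1 i j" for i j
  using that D2(2) by (simp add: D1e ip_pull[OF u])
 have b0: "0 <= w" "0 <= b" using w b by (simp_all add: strip_bound_def box_bound_def)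
 \<comment> \<open>Any (x, y) that completes (s, t) to a lattice basis and has width at most b on
   the interior points can serve as the second side of the box.\<close>
 have fin: "box_bound D w b" if det: "\<bar>s * y - t * x\<bar> = 1" and width: "!!i j i' j'. ip D1 i j ==> ip D1 i' j' ==> (x * i + y * j) - (x * i' + y * j') <= b" for x y
 proof -
  let ?V = "{x * i + y * j | i j. ip D1 i j}"
  have "body D1" using ueq_body D D1 by blast
  hence "finite {(i, j). pt D1 i j}" by (simp add: body_def)
  hence "finite {(i, j). ip D1 i j}" by (rule finite_subset[rotated]) (use ip_pt in blast)
  moreover have "?V = (%(i, j). x * i + y * j) ` {(i, j). ip D1 i j}" by force
  ultimately have f: "finite ?V" by simp
  obtain a1 b1 c1 d1 e1 f1 where uu: "\<bar>a1 * d1 - b1 * c1\<bar> = 1" "D = pull a1 b1 c1 d1 e1 f1 D1"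
   using D1(1) ueq_sym unfolding ueq_def by metis
  hence "ip D1 (a1 * i0 + b1 * j0 + e1) (c1 * i0 + d1 * j0 + f1)" using ne by (simp add: ip_pull)
  hence nev: "?V ~= {}" by blast
  define v0 where "v0 = Min ?V"
  obtain i1 j1 where v0: "v0 = x * i1 + y * j1" "ip D1 i1 j1" using Min_in[OF f nev] unfolding v0_def by auto
  have ge: "v0 <= x * i + y * j" if "ip D1 i j" for i j using Min_le[OF f] that unfolding v0_def by blast
  obtain a b' c d e2 h2 where p: "\<bar>a * d - b' * c\<bar> = 1"
   "!!D. pull s t x y e (- v0) (pull a b' c d e2 h2 D) = D" "!!D. pull a b' c d e2 h2 (pull s t x y e (- v0) D) = D"
   using pull_inverse[OF det, of e "- v0"] by metis
  let ?D = "pull a b' c d e2 h2 D1"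
  have bck: "\<exists>i' j'. ip D1 i' j' & i = s * i' + t * j' + e & j = x * i' + y * j' - v0" if "ip ?D i j" for i j
  proof -
   have "ip D1 (a * i + b' * j + e2) (c * i + d * j + h2)" using that by (simp add: ip_pull[OF p(1)])
   moreover have "pt (pull a b' c d e2 h2 (pull s t x y e (- v0) {lpt i j})) i j" unfolding p(3) by (simp add: pt_def)
   hence "s * (a * i + b' * j + e2) + t * (c * i + d * j + h2) + e = i" "x * (a * i + b' * j + e2) + y * (c * i + d * j + h2) - v0 = j"
    unfolding pt_pull by (simp_all add: pt_def)
   ultimately show ?thesis by metis
  qed
  have "0 <= i & i <= w & 0 <= j & j <= b" if "ip ?D i j" for i j
  proof -
   from bck[OF that] obtain i' j' where q: "ip D1 i' j'" "i = s * i' + t * j' + e" "j = x * i' + y * j' - v0" by blast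
   show ?thesis using wd[OF q(1)] ge[OF q(1)] width[OF q(1) v0(2)] q(2,3) v0(1) by linarith
  qed
  moreover have "D \<sim> ?D" by (rule pull_ueq[OF D1(1) p(1)])
  ultimately show ?thesis unfolding box_bound_def using b0 by blast
 qed
 show ?thesis
 proof (cases "t = 0")
  case True
  hence "\<bar>s\<bar> = 1" using u by (metis abs_mult abs_zmult_eq_1 diff_zero mult_zero_left)
  show ?thesis
  proof (rule fin[of 1 0])
   show "\<bar>s * 1 - t * 0\<bar> = 1" using \<open>\<bar>s\<bar> = 1\<close> by simp
   fix i j i' j' assume "ip D1 i j" "ip D1 i' j'"
   from D1(2)[OF this(1)] D1(2)[OF this(2)] show "(0 * i + 1 * j) - (0 * i' + 1 * j') <= b" by simp
  qed
 next
  case False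
  define q where "q = t' div t"
  define r where "r = t' mod t"
  have tr: "t' = t * q + r" by (simp add: q_def r_def)
  have rb: "\<bar>r\<bar> <= \<bar>t\<bar> - 1"
   using False pos_mod_bound[of t t'] neg_mod_bound[of t t'] pos_mod_sign[of t t'] neg_mod_sign[of t t'] unfolding r_def by linarith
  obtain \<delta> where \<delta>: "\<delta> = 1 \<or> \<delta> = -1" "s * t' - t * s' = \<delta>" using unimodular_cases[OF u] by blast
  let ?x = "s' - q * s" and ?y = "t' - q * t"
  show ?thesis
  proof (rule fin[of ?y ?x])
   have "s * ?y - t * ?x = s * t' - t * s'" by (simp add: algebra_simps)
   thus "\<bar>s * ?y - t * ?x\<bar> = 1" using u by simp
   fix i j i' j' assume ij: "ip D1 i j" "ip D1 i' j'"
   define A where "A = (s * i + t * j) - (s * i' + t * j')"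
   define B where "B = i - i'"
   define V where "V = (?x * i + ?y * j) - (?x * i' + ?y * j')"
   have A: "\<bar>A\<bar> <= b" using wd[OF ij(1)] wd[OF ij(2)] wb unfolding A_def by linarith
   have B: "\<bar>B\<bar> <= b" using D1(2)[OF ij(1)] D1(2)[OF ij(2)] unfolding B_def by linarith
   \<comment> \<open>A is the difference in the direction of minimal width, at most w <= b, and B
     that of the first coordinate, at most b. With a remainder r of size at most |t| - 1 the right
     side is at most |t| b.\<close>
   have "t * V = (t' - q * t) * A - (s * t' - t * s') * B" by (simp add: V_def A_def B_def algebra_simps)
   also have "t' - q * t = r" using tr by (simp add: algebra_simps)
   finally have "t * V = r * A - \<delta> * B" using \<delta>(2) by simp
   hence "\<bar>t\<bar> * \<bar>V\<bar> <= \<bar>r * A\<bar> + \<bar>\<delta> * B\<bar>" by (metis abs_mult abs_triangle_ineq4)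
   also have "\<dots> = \<bar>r\<bar> * \<bar>A\<bar> + \<bar>B\<bar>" using \<delta>(1) by (auto simp: abs_mult)
   also have "\<dots> <= (\<bar>t\<bar> - 1) * b + b" using A B rb by (intro add_mono mult_mono) auto
   also have "\<dots> = \<bar>t\<bar> * b" by (simp add: algebra_simps)
   finally have "\<bar>V\<bar> <= b" using False by simp
   thus "(?x * i + ?y * j) - (?x * i' + ?y * j') <= b" unfolding V_def by linarith
  qed
 qed
qed

lemma ueq_ip:
 assumes "D \<sim> D'" "ip D i j"
 obtains i' j' where "ip D' i' j'"
proof -
 from ueq_sym[OF assms(1)] obtain a b c d e h where u: "\<bar>a * d - b * c\<bar> = 1" "D = pull a b c d e h D'" by (auto simp: ueq_def)
 thus ?thesis using assms(2) that by (simp add: ip_pull)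
qed

definition box_min :: "(real \<times> real) set => int => int => bool" where
 "box_min D w b \<longleftrightarrow> (\<forall>n. strip_bound D n --> w <= n) & (\<forall>n. box_bound D w n --> b <= n) & w >= 0 & b >= 0 &
  (\<forall>i j. ip D i j --> 0 <= i & i <= w & 0 <= j & j <= b)"

lemma box_min_flip_i: "box_min D w b ==> box_min (pull (-1) 0 0 1 w 0 D) w b"
 using bound_ueq[OF ueqI[of "-1" 1 0 0 D w 0]] unfolding box_min_def by (auto simp: ip_pull) fastforce+

lemma box_min_flip_j: "box_min D w b ==> box_min (pull 1 0 0 (-1) 0 b D) w b"
 using bound_ueq[OF ueqI[of 1 "-1" 0 0 D 0 b]] unfolding box_min_def by (auto simp: ip_pull) fastforce+

lemma box_min_touch:
 assumes m: "box_min D w b"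
 shows "w >= 1 ==> \<exists>j. ip D 0 j" "w >= 1 ==> \<exists>j. ip D w j" "b >= 1 ==> \<exists>i. ip D i 0" "b >= 1 ==> \<exists>i. ip D i b"
proof -
 have A: "\<exists>i j. ip D' i j & ~ (0 <= i & i <= w - 1)" if "w >= 1" "D \<sim> D'" for D'
 proof (rule ccontr)
  assume "~ ?thesis"
  hence "\<forall>i j. ip D' i j --> 0 <= i & i <= w - 1" by blast
  hence "strip_bound D (w - 1)" unfolding strip_bound_def using that by (intro conjI exI[of _ D']) auto
  thus False using m unfolding box_min_def by fastforce
 qed
 have B: "\<exists>i j. ip D' i j & ~ (0 <= i & i <= w & 0 <= j & j <= b - 1)" if "b >= 1" "D \<sim> D'" for D'
 proof (rule ccontr)
  assume "~ ?thesis"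
  hence "\<forall>i j. ip D' i j --> 0 <= i & i <= w & 0 <= j & j <= b - 1" by blast
  hence "box_bound D w (b - 1)" unfolding box_bound_def using that m[unfolded box_min_def]
   by (intro conjI exI[of _ D']) auto
  thus False using m unfolding box_min_def by fastforce
 qed
 have r: "0 <= i & i <= w & 0 <= j & j <= b" if "ip D i j" for i j using m that by (simp add: box_min_def)
 show "\<exists>j. ip D 0 j" if "w >= 1"
 proof -
  have "\<exists>i j. ip (pull 1 0 0 1 1 0 D) i j & ~ (0 <= i & i <= w - 1)" by (rule A[OF that ueqI]) simp
  then obtain i j where q: "ip D (i + 1) j" "~ (0 <= i & i <= w - 1)" by (auto simp: ip_pull)
  hence "i + 1 = 0" using r[OF q(1)] by linarith
  thus ?thesis using q by metis
 qed
 show "\<exists>j. ip D w j" if "w >= 1"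
 proof -
  from A[OF that ueq_refl] obtain i j where q: "ip D i j" "~ (0 <= i & i <= w - 1)" by blast
  hence "i = w" using r[OF q(1)] by linarith
  thus ?thesis using q by metis
 qed
 show "\<exists>i. ip D i 0" if "b >= 1"
 proof -
  have "\<exists>i j. ip (pull 1 0 0 1 0 1 D) i j & ~ (0 <= i & i <= w & 0 <= j & j <= b - 1)" by (rule B[OF that ueqI]) simp
  then obtain i j where q: "ip D i (j + 1)" "~ (0 <= i & i <= w & 0 <= j & j <= b - 1)" by (auto simp: ip_pull)
  hence "j + 1 = 0" using r[OF q(1)] by linarith
  thus ?thesis using q by metis
 qed
 show "\<exists>i. ip D i b" if "b >= 1"
 proof -
  from B[OF that ueq_refl] obtain i j where q: "ip D i j" "~ (0 <= i & i <= w & 0 <= j & j <= b - 1)" by blast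
  hence "j = b" using r[OF q(1)] by linarith
  thus ?thesis using q by metis
 qed
qed

text \<open>\<open>squeeze\<close> puts the interior points into a cone with apex on row 0; as w <
  b, only the shears k = 0 and k = -1 keep row b inside the strip. A shear preserving the strip
  would shorten the box unless an outer column reaches both from row 0 and to row b, so minimality
  of b yields both of its ends.\<close>

lemma violated_second_direction:
 assumes D: "body D" and m: "box_min D w b" and w: "1 <= w" "w < b"
  and str: "\<forall>i j. pt D i j --> -1 <= i & i <= w + 1" and p: "pt D p q" "q <= -2"
 shows "(ip D w 0 & ip D w b & (\<forall>i. ip D i 0 --> i = w) & (\<forall>i j. pt D i j --> j <= -2 --> i = w + 1)) \<or>
    (ip D 0 0 & ip D 0 b & (\<forall>i. ip D i 0 --> i = 0) & (\<forall>i j. pt D i j --> j <= -2 --> i = -1))"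
proof -
 have cv: "convex D" using D body_convex by blast
 have r: "0 <= i & i <= w & 0 <= j & j <= b" if "ip D i j" for i j using m that by (simp add: box_min_def)
 obtain a where a: "ip D a 0" using box_min_touch(3)[OF m] w by auto
 obtain c where c: "ip D c b" using box_min_touch(4)[OF m] w by auto
 obtain y0 where y0: "ip D 0 y0" using box_min_touch(1)[OF m] w by auto
 obtain y1 where y1: "ip D w y1" using box_min_touch(2)[OF m] w by auto
 have u: "\<bar>1 * 1 - 0 * 0\<bar> = (1::int)" by simp
 obtain k where k: "!!i j. pt D (1 * i + 0 * j + a) (0 * i + 1 * j + 0) ==> j <= -2 ==> 0 < i + k * j & i + k * j < - j"
  "!!i j. ip D (1 * i + 0 * j + a) (0 * i + 1 * j + 0) ==> j >= 0 ==> i + k * j <= 0 & i + k * j + j >= 0"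
  by (rule squeeze_pull[OF cv u a, of "p - a" "- q"]) (use p r[of _ "-1"] in fastforce)+
 have deep: "0 < i - a + k * j & i - a + k * j < - j" if "pt D i j" "j <= -2" for i j
  using k(1)[of "i - a" j] that by simp
 have ipk: "i - a + k * j <= 0 & i - a + k * j + j >= 0" if "ip D i j" for i j
  using k(2)[of "i - a" j] that r[OF that] by simp
 have uniq: "i = a" if "ip D i 0" for i using ipk[OF that] by simp
 have B: "\<exists>i j. ip D' i j & ~ (0 <= i & i <= w & 0 <= j & j <= b - 1)" if "D \<sim> D'" for D'
 proof (rule ccontr)
  assume "~ ?thesis"
  hence "\<forall>i j. ip D' i j --> 0 <= i & i <= w & 0 <= j & j <= b - 1" by blast
  hence "box_bound D w (b - 1)" unfolding box_bound_def using that w by (intro conjI exI[of _ D']) auto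
  thus False using m unfolding box_min_def by fastforce
 qed
 have "k = 0 \<or> k = -1"
 proof (rule ccontr)
  assume "~ ?thesis"
  then consider "k >= 1" | "k <= -2" by linarith
  thus False
  proof cases
   case 1
   hence "1 * b <= k * b" using w by (intro mult_right_mono) auto
   thus False using ipk[OF c] r[OF c] r[OF a] w by linarith
  next
   case 2
   hence "k * b <= (-2) * b" using w by (intro mult_right_mono) auto
   thus False using ipk[OF c] r[OF c] r[OF a] w by linarith
  qed
 qed
 thus ?thesis
 proof
  assume k0: "k = 0"
  have aw: "a = w" using ipk[OF y1] r[OF a] k0 by simp
  have "\<exists>i j. ip (pull 1 0 (-1) 1 0 w D) i j & ~ (0 <= i & i <= w & 0 <= j & j <= b - 1)"
   by (rule B[OF ueqI]) simp
  then obtain i j where q: "ip D i (- i + j + w)" "~ (0 <= i & i <= w & 0 <= j & j <= b - 1)" by (auto simp: ip_pull)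
  have "i = w & j = b" using ipk[OF q(1)] r[OF q(1)] q(2) k0 aw by (simp, (linarith)?)
  hence "ip D w b" using q(1) by simp
  moreover have "i = w + 1" if "pt D i j" "j <= -2" for i j using deep[OF that] str[rule_format, OF that(1)] k0 aw by simp
  ultimately show ?thesis using a uniq aw by blast
 next
  assume k1: "k = -1"
  have a0: "a = 0" using ipk[OF y0] r[OF a] k1 by simp
  have "\<exists>i j. ip (pull 1 0 1 1 0 0 D) i j & ~ (0 <= i & i <= w & 0 <= j & j <= b - 1)"
   by (rule B[OF ueqI]) simp
  then obtain i j where q: "ip D i (i + j)" "~ (0 <= i & i <= w & 0 <= j & j <= b - 1)" by (auto simp: ip_pull)
  have "i = 0 & j = b" using ipk[OF q(1)] r[OF q(1)] q(2) k1 a0 by (simp, (linarith)?)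
  hence "ip D 0 b" using q(1) by simp
  moreover have "i = -1" if "pt D i j" "j <= -2" for i j using deep[OF that] str[rule_format, OF that(1)] k1 a0 by simp
  ultimately show ?thesis using a uniq a0 by blast
 qed
qed

text \<open>The two shapes that lead to bidegree (w + 2, b + 2). Substitutions at curve points
  remove the excess E and leave a rectangle with sides b + 2 and w + 2; the triangle is a curve of
  degree w + 3, whose projection from two of its points has bidegree (w + 2, w + 2).\<close>

definition box_model :: "int => int => (real \<times> real) set => bool" where
 "box_model w b D \<longleftrightarrow> (\<exists>D' E. D \<sim> D' & E >= 0 & (\<forall>i j. pt D' i j --> 0 <= i & 0 <= j & j <= w + 2 & i + E * j <= b + 2 + E)) \<or>
  (\<exists>D'. D \<sim> D' & (\<forall>i j. pt D' i j --> 0 <= i & 0 <= j & i + j <= w + 3))"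

lemma box_model_ueq: "D \<sim> D' ==> box_model w b D' ==> box_model w b D"
 unfolding box_model_def using ueq_trans by blast

text \<open>The outer column w + 1, the only one that goes deep, becomes row 0. The full interior
  column w next to it bounds all further rows by \<open>row_lower\<close> and
  \<open>row_upper\<close>, and the excess is the length of the new base row minus b + 2.\<close>

lemma box_model_column:
 assumes D: "body D" and m: "box_min D w b" and w: "1 <= w" "w < b"
  and str: "\<forall>i j. pt D i j --> -1 <= i & i <= w + 1"
  and c: "ip D w 0" "ip D w b" "pt D p q" "q <= -2" "!!i j. pt D i j ==> j <= -2 ==> i = w + 1"
 shows "box_model w b D"
proof -
 have r: "0 <= i & i <= w & 0 <= j & j <= b" if "ip D i j" for i j using m that by (simp add: box_min_def)
 have top: "i = w + 1" if "pt D i j" "j >= b + 2" for i j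
 proof -
  let ?D = "pull 1 0 0 (-1) 0 b D"
  have bd: "body ?D" by (rule body_pull) (use D in auto)
  have p1: "pt ?D i (b - j)" "b - j <= -2" using that by simp_all
  have s: "\<forall>i j. pt ?D i j --> -1 <= i & i <= w + 1" using str by auto
  obtain y0 where y0: "ip D 0 y0" using box_min_touch(1)[OF m] w by auto
  have i1: "ip ?D w 0" using c by (simp add: ip_pull)
  from violated_second_direction[OF bd box_min_flip_j[OF m] w s p1] i1 w
  have "\<forall>i j. pt ?D i j --> j <= -2 --> i = w + 1" by auto
  thus ?thesis using p1 by blast
 qed
 let ?D = "pull 0 (-1) 1 0 (w + 1) 0 D"
 have u: "\<bar>0 * 0 - (-1) * 1\<bar> = (1::int)" by simp
 have bd: "body ?D" by (rule body_pull[OF u D])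
 have cv: "convex ?D" using bd body_convex by blast
 have pt': "pt ?D i j \<longleftrightarrow> pt D (w + 1 - j) i" for i j by (simp add: algebra_simps)
 have ip': "ip ?D i j \<longleftrightarrow> ip D (w + 1 - j) i" for i j by (simp add: ip_pull[OF u] algebra_simps)
 have "pt ?D q 0" using c by (simp add: pt')
 from body_row_min[OF bd this] obtain l where l: "pt ?D l 0" "l <= q" "!!k. pt ?D k 0 ==> l <= k" by metis
 from body_row_max[OF bd \<open>pt ?D q 0\<close>] obtain t where t: "pt ?D t 0" "!!k. pt ?D k 0 ==> k <= t" by metis
 have n1: "~ ip D w (-1)" "~ ip D w (b + 1)" using r[of w "-1"] r[of w "b + 1"] by auto
 have low: "i >= l + j * (-1 - l)" if "pt ?D i j" "j >= 1" for i j
  using row_lower[OF cv l(1), of 0 i j] that c(1,2) n1 by (simp add: ip')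
 have up: "i <= t + j * (b + 1 - t)" if "pt ?D i j" "j >= 1" for i j
  using row_upper[OF cv t(1), of b i j] that c(1,2) n1 by (simp add: ip')
 have l2: "l <= -2" using l c(4) by simp
 let ?D' = "pull 1 (-1 - l) 0 1 l 0 ?D"
 have D': "D \<sim> ?D'" by (rule pull_ueq[OF ueqI[OF u]]) simp
 have red: "pt ?D (i + (-1 - l) * j + l) j" if "pt ?D' i j" for i j using that by (simp only: pt_pull[of 1 "-1 - l" 0 1 l 0]) simp
 have jr: "0 <= j & j <= w + 2" if "pt ?D i j" for i j using str[rule_format, of "w + 1 - j" i] that by (simp add: pt')
 show ?thesis
 proof (cases "t - l - b - 2 >= 0")
  case True
  have "0 <= i & 0 <= j & j <= w + 2 & i + (t - l - b - 2) * j <= b + 2 + (t - l - b - 2)" if "pt ?D' i j" for i j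
  proof (cases "j >= 1")
   case j: True
   thus ?thesis using low[OF red[OF that] j] up[OF red[OF that] j] jr[OF red[OF that]] by (simp add: algebra_simps)
  next
   case False
   hence "j = 0" using jr[OF red[OF that]] by linarith
   thus ?thesis using red[OF that] l(3)[of "i + l"] t(2)[of "i + l"] w by simp
  qed
  thus ?thesis unfolding box_model_def using D' True by blast
 next
  case False
  have "0 <= i & 0 <= j & j <= w + 2 & i + 0 * j <= b + 2 + 0" if "pt ?D' i j" for i j
  proof (cases "j >= 1")
   case j: True
   have q: "pt D (w + 1 - j) (i + (-1 - l) * j + l)" using red[OF that] by (simp only: pt')
   \<comment> \<open>The base row is too short for a nonnegative excess. With E = 0 the upper bound
     comes from the flipped statement \<open>top\<close>: points above row b + 1 lie only in the
     base column.\<close>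
   have "i + (-1 - l) * j + l <= b + 1" using top[OF q] j by fastforce
   moreover have "(-1 - l) * j >= (-1 - l) * 1" using l2 j by (intro mult_left_mono) auto
   ultimately have "i <= b + 2" by (simp add: algebra_simps)
   thus ?thesis using low[OF red[OF that] j] jr[OF red[OF that]] by (simp add: algebra_simps)
  next
   case j: False
   hence "j = 0" using jr[OF red[OF that]] by linarith
   thus ?thesis using red[OF that] l(3)[of "i + l"] t(2)[of "i + l"] w False by simp
  qed
  thus ?thesis unfolding box_model_def using D' by blast
 qed
qed

text \<open>The argument runs with the least height b' of a box of width w.
  \<open>box_bound_of_square\<close> gives b' <= b, and the shapes for b' are contained in those for
  b.\<close>

theorem box_model_exists:
 assumes D: "body D" and ne: "ip D i0 j0"
  and w: "strip_bound D w" "!!n. strip_bound D n ==> w <= n" and b: "box_bound D b b"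
 shows "box_model w b D"
proof -
 have "strip_bound D b" using b unfolding box_bound_def strip_bound_def by blast
 hence "w <= b" by (rule w(2))
 have bb: "box_bound D w b" by (rule box_bound_of_square[OF D ne w(1) b \<open>w <= b\<close>])
 have pos: "box_bound D w k ==> k >= 0" for k by (simp add: box_bound_def)
 obtain b' where b': "box_bound D w b'" "!!k. box_bound D w k ==> b' <= k"
  by (rule least_int[of "box_bound D w", OF bb pos]) blast+
 have "b' <= b" using b' bb by blast
 have mono: "box_model w b D" if "box_model w b' D"
  using that \<open>b' <= b\<close> unfolding box_model_def by fastforce
 obtain D1 where D1: "D \<sim> D1" "!!i j. ip D1 i j ==> 0 <= i & i <= w & 0 <= j & j <= b'" "0 <= w" "0 <= b'"
  using b'(1) unfolding box_bound_def by blast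
 have m1: "box_min D1 w b'" unfolding box_min_def using bound_ueq[OF D1(1)] w(2) b'(2) D1(2,3,4) by auto
 have bd1: "body D1" using ueq_body D D1 by blast
 obtain i1 j1 where i1: "ip D1 i1 j1" using ueq_ip[OF D1(1) ne] by blast
 have "box_model w b' D1"
 proof (cases "w = 0")
  case True
  have ip1: "i = 0 & 0 <= j & j <= b'" if "ip D1 i j" for i j using D1(2)[OF that] True by simp
  show ?thesis
  proof (cases "b' = 0")
   case b0: True
   have "single_ip D1" unfolding single_ip_def using ip1 i1 b0 by (metis order_antisym)
   from one_interior_point[OF bd1 this] show ?thesis
   proof cases
    case (1 D2)
    have bd2: "body D2" using ueq_body bd1 1 by blast
    have "ip D2 0 0" "ip D2 0 0" "~ ip D2 0 (-1)" "~ ip D2 0 (0 + 1)" using 1(2) by (simp_all add: single_ip_def)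
    then obtain D3 E where "D2 \<sim> D3" "E >= 0"
     "!!i j. pt D3 i j ==> 0 <= i & 0 <= j & j <= 2 & i + E * j <= 0 + 2 + E"
     using three_columns[OF bd2 _ order_refl] 1(3) by metis
    hence "box_model w b' D2" unfolding box_model_def using True b0 by auto
    thus ?thesis using box_model_ueq 1(1) by blast
   next
    case (2 D2)
    have "D1 \<sim> pull 1 0 0 1 (-1) (-1) D2" by (rule pull_ueq[OF 2(1)]) simp
    moreover have "0 <= i & 0 <= j & i + j <= w + 3" if "pt (pull 1 0 0 1 (-1) (-1) D2) i j" for i j
     using 2(2)[of "i - 1" "j - 1"] that True by simp
    ultimately show ?thesis unfolding box_model_def by blast
   qed
  next
   case False
   hence b1: "b' >= 1" using D1 by simp
   obtain x y where "ip D1 x 0" "ip D1 y b'" using box_min_touch(3,4)[OF m1 b1] by blast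
   hence c: "ip D1 0 0" "ip D1 0 b'" using ip1 by metis+
   have cv: "convex D1" using bd1 body_convex by blast
   have c1: "ip D1 0 1" using ip_mid_pull[OF cv, of 0 0 1 1 0 0 0 0 b' 1] c b1 by simp
   have "\<bar>i\<bar> <= 1" if "pt D1 i j" for i j
   proof -
    have "- i >= -1" by (rule edge_bound[OF cv, of 0 0 "-1" 1 0 0 j]) (use c1 c ip1[of 1] that in auto)
    moreover have "i >= -1" by (rule edge_bound[OF cv, of 0 0 1 1 0 0 j]) (use c1 c ip1[of "-1"] that in auto)
    ultimately show ?thesis by linarith
   qed
   moreover have "~ ip D1 0 (-1)" "~ ip D1 0 (b' + 1)" using ip1[of 0 "-1"] ip1[of 0 "b' + 1"] by auto
   ultimately obtain D3 E where "D1 \<sim> D3" "E >= 0"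
     "!!i j. pt D3 i j ==> 0 <= i & 0 <= j & j <= 2 & i + E * j <= b' + 2 + E"
    using three_columns[OF bd1 _ D1(4) c] by metis
   thus ?thesis unfolding box_model_def using True by auto
  qed
 next
  case False
  hence w1: "w >= 1" using D1 by simp
  have wmin: "!!D' n. D1 \<sim> D' ==> strip_bound D' n ==> w <= n" using bound_ueq(2) m1 unfolding box_min_def by blast
  have viol: "box_model w b' D1" if "D1 \<sim> D'" "!!i j. ip D' i j ==> 0 <= j & j <= w" "pt D' p q" "q <= -2" for D' p q
  proof -
   note T = that
   have bd': "body D'" using that(1) bd1 ueq_body by blast
   obtain D'' where "D' \<sim> D''" "!!i j. pt D'' i j ==> 0 <= i & 0 <= j & i + j <= w + 3"
    by (rule violated_width_direction[OF bd' w1 _ _ T(3,4)]) (use wmin[OF T(1)] T(2) in blast)+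
   thus ?thesis unfolding box_model_def using ueq_trans[OF that(1)] by blast
  qed
  show ?thesis
  proof (cases "\<forall>i j. pt D1 i j --> -1 <= i & i <= w + 1")
   case str: False
   then obtain i j where ij: "pt D1 i j" "i <= -2 \<or> i >= w + 2" by fastforce
   show ?thesis
   proof (cases "i <= -2")
    case True
    show ?thesis
     by (rule viol[OF ueqI[of 0 0 1 1 D1 0 0], of j i]) (use ij True D1(2) in \<open>auto simp: ip_pull\<close>)
   next
    case False
    show ?thesis
     by (rule viol[OF ueqI[of 0 0 "-1" 1 D1 w 0], of j "w - i"]) (use ij False D1(2) in \<open>force simp: ip_pull\<close>)+
   qed
  next
   case True
   note str = this
   show ?thesis
   proof (cases "\<forall>i j. pt D1 i j --> -1 <= j & j <= b' + 1")
    case True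
    have "D1 \<sim> pull 0 1 1 0 (-1) (-1) D1" by (rule ueqI) simp
    moreover have "0 <= i & 0 <= j & j <= w + 2 & i + 0 * j <= b' + 2 + 0" if "pt (pull 0 1 1 0 (-1) (-1) D1) i j" for i j
     using str[rule_format, of "j - 1" "i - 1"] True[rule_format, of "j - 1" "i - 1"] that by simp
    ultimately show ?thesis unfolding box_model_def by blast
   next
    case False
    then obtain i j where ij: "pt D1 i j" "j <= -2 \<or> j >= b' + 2" by fastforce
    have "D \<sim> pull 0 1 1 0 0 0 D1" by (rule pull_ueq[OF D1(1)]) simp
    moreover have "0 <= i & i <= b'" if "ip (pull 0 1 1 0 0 0 D1) i j" for i j
     using D1(2)[of j i] that by (simp add: ip_pull)
    ultimately have "strip_bound D b'" unfolding strip_bound_def using D1(4) by blast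
    hence "w <= b'" by (rule w(2))
    show ?thesis
    proof (cases "w = b'")
     \<comment> \<open>In a square the second direction has minimal width too, so a violation there
       is again one of the width direction.\<close>
     case True
     show ?thesis
     proof (cases "j <= -2")
      case j: True
      show ?thesis by (rule viol[OF ueq_refl _ ij(1) j]) (use D1(2) True in blast)
     next
      case False
      show ?thesis
      by (rule viol[OF ueqI[of 1 "-1" 0 0 D1 0 b'], of i "b' - j"]) (use ij False D1(2) True in \<open>force simp: ip_pull\<close>)+
     qed
    next
     case False
     hence wb: "w < b'" using \<open>w <= b'\<close> by simp
     have bottom: "box_model w b' D2" if bd2: "body D2" and m2: "box_min D2 w b'" and p2: "pt D2 p q" "q <= -2"
      and str2: "\<forall>i j. pt D2 i j --> -1 <= i & i <= w + 1" for D2 p q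
      using violated_second_direction[OF bd2 m2 w1 wb str2 p2]
     proof (elim disjE conjE)
      assume "ip D2 w 0" "ip D2 w b'" "\<forall>i j. pt D2 i j --> j <= -2 --> i = w + 1"
      thus ?thesis using box_model_column[OF bd2 m2 w1 wb str2 _ _ p2] by blast
     next
      assume a: "ip D2 0 0" "ip D2 0 b'" "\<forall>i j. pt D2 i j --> j <= -2 --> i = -1"
      let ?D = "pull (-1) 0 0 1 w 0 D2"
      have "body ?D" by (rule body_pull) (use bd2 in auto)
      moreover note box_min_flip_i[OF m2]
      moreover have "\<forall>i j. pt ?D i j --> -1 <= i & i <= w + 1"
      proof (intro allI impI)
      fix i j assume "pt ?D i j"
      thus "-1 <= i & i <= w + 1" using str2[rule_format, of "w - i" j] by simp
      qed
      moreover have "ip ?D w 0" "ip ?D w b'" using a by (simp_all add: ip_pull)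
      moreover have "pt ?D (w - p) q" using p2 by simp
      moreover have "i = w + 1" if "pt ?D i j" "j <= -2" for i j using a(3)[rule_format, of "w - i" j] that by simp
      ultimately have "box_model w b' ?D" using box_model_column[OF _ _ w1 wb _ _ _ _ p2(2)] by blast
      thus ?thesis using box_model_ueq[OF ueqI[of "-1" 1 0 0]] by simp
     qed
     show ?thesis
     proof (cases "j <= -2")
      case j: True
      show ?thesis by (rule bottom[OF bd1 m1 ij(1) j str])
     next
      case False
      let ?D = "pull 1 0 0 (-1) 0 b' D1"
      have "body ?D" by (rule body_pull) (use bd1 in auto)
      moreover note box_min_flip_j[OF m1]
      moreover have "pt ?D i (b' - j)" "b' - j <= -2" using ij False by simp_all
      moreover have "\<forall>i j. pt ?D i j --> -1 <= i & i <= w + 1" using str by auto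
      ultimately have "box_model w b' ?D" using bottom by blast
      thus ?thesis using box_model_ueq[OF ueqI[of 1 "-1" 0 0]] by simp
     qed
    qed
   qed
  qed
 qed
 thus ?thesis using mono box_model_ueq[OF D1(1)] by blast
qed

section \<open>Models adapted to the triangle size\<close>

text \<open>Both shapes lead to degree n + 3: E - 1 substitutions turn the first into the triangle i
  + j <= n + 3, and a rectangle with A + B = n + 4 loses its corner once the coordinates are
  inverted about a point of the curve.\<close>

definition tri_model :: "int => (real \<times> real) set => bool" where
 "tri_model n D \<longleftrightarrow> (\<exists>D' E. D \<sim> D' & E >= 1 & (\<forall>i j. pt D' i j --> 0 <= i & 0 <= j & i + E * j <= n + 2 + E)) \<or>
  (\<exists>D' A B. D \<sim> D' & A >= 0 & B >= 0 & A + B = n + 4 & (\<forall>i j. pt D' i j --> 0 <= i & i <= A & 0 <= j & j <= B))"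

lemma tri_model_ueq: "D \<sim> D' ==> tri_model n D' ==> tri_model n D"
 unfolding tri_model_def using ueq_trans by blast

lemma tri_model_rows:
 assumes "D \<sim> D'" "E >= 1" "!!i j. pt D' i j ==> 0 <= i & 0 <= j & i + E * j <= n + 2 + E"
 shows "tri_model n D"
 using assms unfolding tri_model_def by blast

lemma tri_model_rect:
 assumes "D \<sim> D'" "A >= 0" "B >= 0" "A + B = n + 4" "!!i j. pt D' i j ==> 0 <= i & i <= A & 0 <= j & j <= B"
 shows "tri_model n D"
 using assms unfolding tri_model_def by blast

text \<open>The interior triangle is translated by (1, 1), so that moving each side out by one unit
  gives i, j >= 0 and i + j <= d + 3. The corner (1, 1) must be an interior point because
  \<open>squeeze\<close> starts from it; interior points on one line are excluded and treated
  separately.\<close>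

definition apex :: "int => (real \<times> real) set => bool" where
 "apex d D \<longleftrightarrow> body D & d >= 1 & (\<forall>n. tri_bound D n --> d <= n) & ~ strip_bound D 0 & ip D 1 1 &
  (\<forall>i j. ip D i j --> 1 <= i & 1 <= j & i + j <= d + 2)"

lemma apex_ueq:
 assumes "apex d D" "D \<sim> D'" "ip D' 1 1" "!!i j. ip D' i j ==> 1 <= i & 1 <= j & i + j <= d + 2"
 shows "apex d D'"
 using assms bound_ueq[OF assms(2)] ueq_body unfolding apex_def by blast

lemma apex_swap:
 assumes "apex d D"
 shows "apex d (pull 0 1 1 0 0 0 D)"
proof (rule apex_ueq[OF assms ueqI])
 show "ip (pull 0 1 1 0 0 0 D) 1 1" using assms by (simp add: apex_def ip_pull)
 fix i j assume "ip (pull 0 1 1 0 0 0 D) i j"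
 hence "ip D j i" by (simp add: ip_pull)
 hence "1 <= j & 1 <= i & j + i <= d + 2" using assms unfolding apex_def by blast
 thus "1 <= i & 1 <= j & i + j <= d + 2" by simp
qed simp

lemma apexD:
 assumes "apex d D"
 shows "convex D" "body D" "d >= 1" "ip D 1 1" "!!i j. ip D i j ==> 1 <= i & 1 <= j & i + j <= d + 2"
  "\<exists>i j. ip D i j & j ~= 1" "!!D'. D \<sim> D' ==> \<exists>i j. ip D' i j & ~ (0 <= i & 0 <= j & i + j <= d - 1)"
proof -
 show "convex D" "body D" "d >= 1" "ip D 1 1" "!!i j. ip D i j ==> 1 <= i & 1 <= j & i + j <= d + 2"
  using assms body_convex unfolding apex_def by blast+
 show "\<exists>i j. ip D i j & j ~= 1"
 proof (rule ccontr)
  assume "~ ?thesis"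
  hence neg: "j = 1" if "ip D i j" for i j using that by blast
  have "\<forall>i j. ip (pull 0 1 1 0 0 1 D) i j --> 0 <= i & i <= 0"
  proof (intro allI impI)
   fix i j assume "ip (pull 0 1 1 0 0 1 D) i j"
   hence "ip D j (i + 1)" by (simp add: ip_pull)
   from neg[OF this] show "0 <= i & i <= 0" by simp
  qed
  moreover have "D \<sim> pull 0 1 1 0 0 1 D" by (rule ueqI) simp
  ultimately have "strip_bound D 0" unfolding strip_bound_def by blast
  thus False using assms by (simp add: apex_def)
 qed
 fix D' assume "D \<sim> D'"
 show "\<exists>i j. ip D' i j & ~ (0 <= i & 0 <= j & i + j <= d - 1)"
 proof (rule ccontr)
  assume "~ ?thesis"
  hence "\<forall>i j. ip D' i j --> 0 <= i & 0 <= j & i + j <= d - 1" by blast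
  hence "tri_bound D (d - 1)" unfolding tri_bound_def using \<open>d >= 1\<close> \<open>D \<sim> D'\<close> by (intro conjI exI[of _ D']) auto
  thus False using assms unfolding apex_def by fastforce
 qed
qed

text \<open>Minimality of d forces the corner (d + 1, 1) as well, so the bottom side has two
  adjacent interior points and nothing lies below row 0. Points left of column 0 are then confined
  to row 0, which becomes the base of the trapezoid.\<close>

lemma apex_side_violated:
 assumes ap: "apex d D" and p: "pt D x y" "x <= -1"
 shows "tri_model d D"
proof -
 note A = apexD[OF ap]
 have u: "\<bar>0 * 0 - 1 * 1\<bar> = (1::int)" by simp
 obtain m where m: "!!i j. pt D (0 * i + 1 * j + 1) (1 * i + 0 * j + 1) ==> j <= -2 ==> 0 < i + m * j & i + m * j < - j"
  "!!i j. pt D (0 * i + 1 * j + 1) (1 * i + 0 * j + 1) ==> j >= -1 ==> i + m * j <= 1 & i + m * j + j >= -1"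
  "!!i j. ip D (0 * i + 1 * j + 1) (1 * i + 0 * j + 1) ==> j >= 0 ==> i + m * j <= 0 & i + m * j + j >= 0"
  by (rule squeeze_pull[OF A(1) u A(4), of "y - 1" "1 - x"]) (use p A(5)[of 0] in auto)
 have deep: "0 < j - 1 + m * (i - 1) & j - 1 + m * (i - 1) < 1 - i" if "pt D i j" "i <= -1" for i j
  using m(1)[of "j - 1" "i - 1"] that by simp
 have ipm: "j - 1 + m * (i - 1) <= 0 & j - 1 + m * (i - 1) + (i - 1) >= 0" if "ip D i j" for i j
  using m(3)[of "j - 1" "i - 1"] that A(5)[OF that] by simp
 have c1: "ip D (d + 1) 1"
 proof -
  \<comment> \<open>Here \<open>squeeze\<close> gives i, j >= 0 for the interior points, so
    minimality of d produces one with i + j >= d; in the old coordinates its abscissa is at least d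
    + 1, which only (d + 1, 1) allows.\<close>
  let ?D = "pull 1 1 (-1 - m) (- m) 1 1 D"
  have u': "\<bar>1 * (- m) - 1 * (-1 - m)\<bar> = (1::int)" by simp
  obtain i j where ij: "ip ?D i j" "~ (0 <= i & 0 <= j & i + j <= d - 1)" using A(7)[OF ueqI[OF u']] by blast
  hence q: "ip D (i + j + 1) ((-1 - m) * i + (- m) * j + 1)" by (simp add: ip_pull[OF u'])
  have e: "(-1 - m) * i + (- m) * j + 1 - 1 + m * (i + j + 1 - 1) = - i" by (simp add: algebra_simps)
  have "i >= 0" "j >= 0" using ipm[OF q] unfolding e by simp_all
  hence "i + j >= d" using ij(2) by simp
  moreover note A(5)[OF q]
  ultimately have "i + j + 1 = d + 1" "(-1 - m) * i + (- m) * j + 1 = 1" by linarith+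
  thus ?thesis using q by simp
 qed
 have "m = -1"
 proof -
  have "m * d <= 0" "m * d + d >= 0" using ipm[OF c1] by simp_all
  hence "m <= 0" using A(3) by (simp add: mult_le_0_iff)
  moreover have "0 <= (m + 1) * d" using \<open>m * d + d >= 0\<close> by (simp add: algebra_simps)
  hence "m >= -1" using A(3) by (simp add: zero_le_mult_iff)
  moreover have "m ~= 0"
  proof
   assume "m = 0"
   hence "j = 1" if "ip D i j" for i j using ipm[OF that] A(5)[OF that] by simp
   thus False using A(6) by blast
  qed
  ultimately show ?thesis by simp
 qed
 have c2: "ip D 2 1" by (rule ip_mid[OF A(1) A(4) c1]) (use A(3) in auto)
 have j0: "j >= 0" if "pt D i j" for i j
 proof -
  have "j - 1 >= -1" by (rule edge_bound[OF A(1), of 1 1 0 0 1 1 "i - 1"]) (use A(4) c2 A(5)[of _ 0] that in auto)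
  thus ?thesis by simp
 qed
 have deep0: "j = 0" if "pt D i j" "i <= -1" for i j
  using deep[OF that] j0[OF that(1)] \<open>m = -1\<close> by simp
 have px: "pt D x 0" using p deep0 by metis
 from body_row_min[OF A(2) px] obtain l where l: "pt D l 0" "l <= x" "!!k. pt D k 0 ==> l <= k" by metis
 from body_row_max[OF A(2) px] obtain t where t: "pt D t 0" "!!k. pt D k 0 ==> k <= t" by metis
 have n1: "~ ip D 0 1" "~ ip D (d + 2) 1" using A(5)[of 0 1] A(5)[of "d + 2" 1] by auto
 have low: "i >= l + j * (0 - l)" if "pt D i j" "j >= 1" for i j
  using row_lower[OF A(1) l(1) A(4), of i j] n1 that by simp
 have up: "i <= t + j * (d + 2 - t)" if "pt D i j" "j >= 1" for i j
  using row_upper[OF A(1) t(1) c1, of i j] n1 that by (simp add: add.commute)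
 have l1: "l <= -1" using l p by simp
 let ?D = "pull 1 (- l) 0 1 l 0 D"
 have D': "D \<sim> ?D" by (rule ueqI) simp
 have red: "pt D (i + (- l) * j + l) j" if "pt ?D i j" for i j using that by simp
 show ?thesis
 proof (cases "t - l - d - 2 >= 1")
  case True
  show ?thesis
  proof (rule tri_model_rows[OF D' True])
   fix i j assume "pt ?D i j"
   note q = red[OF this]
   show "0 <= i & 0 <= j & i + (t - l - d - 2) * j <= d + 2 + (t - l - d - 2)"
   proof (cases "j >= 1")
    case j: True
    thus ?thesis using low[OF q j] up[OF q j] by (simp add: algebra_simps)
   next
    case False
    hence "j = 0" using j0[OF q] by linarith
    thus ?thesis using q l(3)[of "i + l"] t(2)[of "i + l"] by simp
   qed
  qed
 next
  case False
  have top: "i + j <= d + 3" if ij: "pt D i j" "j >= 1" for i j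
  proof (rule ccontr)
   assume neg: "~ ?thesis"
   have u: "\<bar>(-1) * 0 - (-1) * 1\<bar> = (1::int)" by simp
   obtain m where m: "m * (i + j - d - 2) < j - 1" "j - 1 < (m + 1) * (i + j - d - 2)"
    "!!i j. ip D ((-1) * i + (-1) * j + (d + 1)) (1 * i + 0 * j + 1) ==> j >= 0 ==> i + m * j <= 0 & i + m * j + j >= 0"
    by (rule squeeze_pull[OF A(1) u c1, of "j - 1" "i + j - d - 2"]) (use ij neg A(5) in force)+
   have ipm: "y - 1 + m * (d + 2 - x - y) <= 0 & y - 1 + m * (d + 2 - x - y) + (d + 2 - x - y) >= 0" if "ip D x y" for x y
    using m(3)[of "y - 1" "d + 2 - x - y"] A(5)[OF that] that by simp
   have "m * d <= 0" "(m + 1) * d >= 0" using ipm[OF A(4)] by (simp_all add: algebra_simps)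
   hence "m <= 0" "m >= -1" using A(3) by (simp_all add: mult_le_0_iff zero_le_mult_iff)
   moreover have "m ~= 0"
   proof
    assume "m = 0"
    hence "j = 1" if "ip D i j" for i j using ipm[OF that] A(5)[OF that] by simp
    thus False using A(6) by blast
   qed
   ultimately have "m = -1" by simp
   thus False using m(2) ij by simp
  qed
  show ?thesis
  proof (rule tri_model_rows[OF D' order_refl])
   fix i j assume "pt ?D i j"
   note q = red[OF this]
   show "0 <= i & 0 <= j & i + 1 * j <= d + 2 + 1"
   proof (cases "j >= 1")
    case j: True
    have "(- l) * j >= (- l) * 1" using l1 j by (intro mult_left_mono) auto
    thus ?thesis using low[OF q j] top[OF q j] j by (simp add: algebra_simps)
   next
    case j: False
    hence "j = 0" using j0[OF q] by linarith
    thus ?thesis using q l(3)[of "i + l"] t(2)[of "i + l"] False by simp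
   qed
  qed
 qed
qed

text \<open>When the two legs are respected, only the hypotenuse can be exceeded.
  \<open>squeeze\<close> at an interior point (q1, q2) on it leaves the slopes -1, 0 and 1. In each
  case (q1, q2) is the corner of another \<open>apex\<close> position: either a leg is exceeded
  there, or these legs supply the missing inequalities.\<close>

lemma apex_model:
 assumes ap: "apex d D"
 shows "tri_model d D"
proof -
 note A = apexD[OF ap]
 have side: "tri_model d D" if "apex d D'" "D \<sim> D'" "pt D' x y" "x <= -1 \<or> y <= -1" for D' x y
  using that(4)
 proof
  assume "x <= -1"
  thus ?thesis using apex_side_violated[OF that(1,3)] tri_model_ueq[OF that(2)] by blast
 next
  assume "y <= -1"
  moreover have "pt (pull 0 1 1 0 0 0 D') y x" using that(3) by simp
  ultimately have "tri_model d (pull 0 1 1 0 0 0 D')" using apex_side_violated[OF apex_swap[OF that(1)]] by blast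
  thus ?thesis using tri_model_ueq pull_ueq[OF that(2), of 0 0 1 1 0 0] by simp
 qed
 show ?thesis
 proof (cases "\<exists>x y. pt D x y & (x <= -1 \<or> y <= -1)")
  case True
  thus ?thesis using side[OF ap ueq_refl] by blast
 next
  case False
  hence nn: "0 <= i & 0 <= j" if "pt D i j" for i j using that by fastforce
  show ?thesis
  proof (cases "\<forall>i j. pt D i j --> i + j <= d + 3")
   case True
   show ?thesis by (rule tri_model_rows[OF ueq_refl order_refl]) (use nn True in fastforce)
  next
   case False
   then obtain x y where xy: "pt D x y" "x + y >= d + 4" by fastforce
   obtain q1 q2 where q: "ip D q1 q2" "q1 + q2 = d + 2"
   proof -
    have "D \<sim> pull 1 0 0 1 1 1 D" by (rule ueqI) simp
    from A(7)[OF this] obtain i j where "ip D (i + 1) (j + 1)" "~ (0 <= i & 0 <= j & i + j <= d - 1)" by (auto simp: ip_pull)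
    moreover from A(5)[OF this(1)] this(2) have "(i + 1) + (j + 1) = d + 2" by linarith
    ultimately show ?thesis using that by blast
   qed
   have u: "\<bar>(-1) * 0 - (-1) * 1\<bar> = (1::int)" by simp
   obtain m where m: "!!i j. ip D ((-1) * i + (-1) * j + q1) (1 * i + 0 * j + q2) ==> j >= 0 ==> i + m * j <= 0 & i + m * j + j >= 0"
   proof -
    have e: "(-1) * (y - q2) - (-1) * (x + y - d - 2) + q1 = x" "1 * (y - q2) - 0 * (x + y - d - 2) + q2 = y"
     using q(2) by simp_all
    have P: "pt D ((-1) * (y - q2) - (-1) * (x + y - d - 2) + q1) (1 * (y - q2) - 0 * (x + y - d - 2) + q2)"
     unfolding e by (rule xy)
    have n: "~ ip D ((-1) * i - (-1) + q1) (1 * i - 0 + q2)" for i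
     using A(5)[of "(-1) * i - (-1) + q1" "1 * i - 0 + q2"] q(2) by auto
    have h: "x + y - d - 2 >= 2" using xy by simp
    show ?thesis
    proof (rule squeeze_pull[OF A(1) u q(1) n P h])
     fix m assume "!!i j. ip D ((-1) * i + (-1) * j + q1) (1 * i + 0 * j + q2) ==> j >= 0 ==> i + m * j <= 0 & i + m * j + j >= 0"
     thus ?thesis by (rule that)
    qed
   qed
   have ipm: "j - q2 + m * (d + 2 - i - j) <= 0 & j - q2 + m * (d + 2 - i - j) + (d + 2 - i - j) >= 0" if "ip D i j" for i j
   proof -
    have e: "(-1) * (j - q2) + (-1) * (d + 2 - i - j) + q1 = i" "1 * (j - q2) + 0 * (d + 2 - i - j) + q2 = j" using q(2) by simp_all
    show ?thesis using m[of "j - q2" "d + 2 - i - j"] A(5)[OF that] that unfolding e by simp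
   qed
   have q2: "1 <= q2" "q2 <= d + 1" using A(5)[OF q(1)] q(2) by linarith+
   have m1: "m * d <= q2 - 1" "(m + 1) * d >= q2 - 1" using ipm[OF A(4)] by (simp_all add: algebra_simps)
   have "m <= 1"
   proof (rule ccontr)
    assume "~ ?thesis"
    hence "2 * d <= m * d" using A(3) by (intro mult_right_mono) auto
    thus False using m1(1) q2 A(3) by linarith
   qed
   moreover have "m >= -1"
   proof (rule ccontr)
    assume "~ ?thesis"
    hence "(m + 1) * d <= (-1) * d" using A(3) by (intro mult_right_mono) auto
    thus False using m1(2) q2 A(3) by linarith
   qed
   ultimately consider "m = 0" | "m = -1" | "m = 1" by linarith
   thus ?thesis
   proof cases
    case 1
    let ?D = "pull (-1) 0 0 (-1) (q1 + 1) (q2 + 1) D"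
    have u2: "\<bar>(-1) * (-1) - 0 * 0\<bar> = (1::int)" by simp
    have D2: "D \<sim> ?D" by (rule ueqI[OF u2])
    have ap2: "apex d ?D"
    proof (rule apex_ueq[OF ap D2])
     show "ip ?D 1 1" using q by (simp add: ip_pull)
     fix i j assume "ip ?D i j"
     hence "ip D (q1 + 1 - i) (q2 + 1 - j)" by (simp add: ip_pull add.commute)
     from ipm[OF this] A(5)[OF this] q(2) 1 show "1 <= i & 1 <= j & i + j <= d + 2" by simp
    qed
    show ?thesis
    proof (cases "\<exists>x y. pt ?D x y & (x <= -1 \<or> y <= -1)")
     case True
     thus ?thesis using side[OF ap2 D2] by blast
    next
     case False
     show ?thesis
     proof (rule tri_model_rect[OF ueq_refl, of "q1 + 1" "q2 + 1"])
      show "q1 + 1 >= 0" "q2 + 1 >= 0" "q1 + 1 + (q2 + 1) = d + 4" using A(5)[OF q(1)] q(2) by simp_all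
      fix i j assume ij: "pt D i j"
      hence "pt ?D (q1 + 1 - i) (q2 + 1 - j)" by simp
      hence "q1 + 1 - i >= 0" "q2 + 1 - j >= 0" using False by fastforce+
      thus "0 <= i & i <= q1 + 1 & 0 <= j & j <= q2 + 1" using nn[OF ij] by simp
     qed
    qed
   next
    case 2
    hence qq: "q2 = 1" "q1 = d + 1" using m1 q2 q(2) by simp_all
    let ?D = "pull (-1) (-2) 0 1 (d + 4) 0 D"
    have u2: "\<bar>(-1) * 1 - (-2) * 0\<bar> = (1::int)" by simp
    have D2: "D \<sim> ?D" by (rule ueqI[OF u2])
    have ap2: "apex d ?D"
    proof (rule apex_ueq[OF ap D2])
     show "ip ?D 1 1" using q qq by (simp add: ip_pull add.commute)
     fix i j assume "ip ?D i j"
     hence "ip D (d + 4 - i - 2 * j) j" by (simp add: ip_pull algebra_simps)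
     from ipm[OF this] A(5)[OF this] q(2) 2 qq show "1 <= i & 1 <= j & i + j <= d + 2" by simp
    qed
    show ?thesis
    proof (cases "\<exists>x y. pt ?D x y & (x <= -1 \<or> y <= -1)")
     case True
     thus ?thesis using side[OF ap2 D2] by blast
    next
     case False
     show ?thesis
     proof (rule tri_model_rows[OF ueq_refl, of 2])
      fix i j assume ij: "pt D i j"
      hence "pt ?D (d + 4 - i - 2 * j) j" by simp
      hence "d + 4 - i - 2 * j >= 0" using False by fastforce
      thus "0 <= i & 0 <= j & i + 2 * j <= d + 2 + 2" using nn[OF ij] by simp
     qed simp
    qed
   next
    case 3
    hence qq: "q2 = d + 1" "q1 = 1" using m1 q2 q(2) by simp_all
    let ?D = "pull 0 1 (-1) (-2) 0 (d + 4) D"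
    have u2: "\<bar>0 * (-2) - 1 * (-1)\<bar> = (1::int)" by simp
    have D2: "D \<sim> ?D" by (rule ueqI[OF u2])
    have ap2: "apex d ?D"
    proof (rule apex_ueq[OF ap D2])
     show "ip ?D 1 1" using q qq by (simp add: ip_pull add.commute)
     fix i j assume "ip ?D i j"
     hence "ip D j (d + 4 - i - 2 * j)" by (simp add: ip_pull algebra_simps)
     from ipm[OF this] A(5)[OF this] q(2) 3 qq show "1 <= i & 1 <= j & i + j <= d + 2" by simp
    qed
    show ?thesis
    proof (cases "\<exists>x y. pt ?D x y & (x <= -1 \<or> y <= -1)")
     case True
     thus ?thesis using side[OF ap2 D2] by blast
    next
     case False
     show ?thesis
     proof (rule tri_model_rows[OF ueqI[of 0 0 1 1 D 0 0], of 2])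
      fix i j assume "pt (pull 0 1 1 0 0 0 D) i j"
      hence ij: "pt D j i" by simp
      hence "pt ?D (d + 4 - i - 2 * j) j" by simp
      hence "d + 4 - i - 2 * j >= 0" using False by fastforce
      thus "0 <= i & 0 <= j & i + 2 * j <= d + 2 + 2" using nn[OF ij] by simp
     qed simp_all
    qed
   qed
  qed
 qed
qed

text \<open>Interior points on one line are covered by the box models for w = 0, which are triangle
  models since b <= d. Otherwise a side of the triangle exceeded by two units makes an interior
  point on that side the corner of an \<open>apex\<close> position.\<close>

theorem tri_model_exists:
 assumes D: "body D" and ne: "ip D i0 j0" and d: "tri_bound D d" "!!n. tri_bound D n ==> d <= n"
 shows "tri_model d D"
proof (cases "strip_bound D 0")
 case True
 hence w: "!!n. strip_bound D n ==> 0 <= n" by (simp add: strip_bound_def)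
 obtain D1 where D1: "D \<sim> D1" "!!i j. ip D1 i j ==> 0 <= i & 0 <= j & i + j <= d" "0 <= d" using d(1) unfolding tri_bound_def by blast
 have "0 <= i & i <= d & 0 <= j & j <= d" if "ip D1 i j" for i j using D1(2)[OF that] by simp
 hence "box_bound D d d" unfolding box_bound_def using D1 by blast
 have bb: "box_bound D 0 d" by (rule box_bound_of_square[OF D ne True \<open>box_bound D d d\<close> D1(3)])
 have bs: "box_bound D b b" if "box_bound D 0 b" for b using that unfolding box_bound_def by fastforce
 have pos: "box_bound D 0 k ==> k >= 0" for k by (simp add: box_bound_def)
 obtain b where b: "box_bound D 0 b" "!!k. box_bound D 0 k ==> b <= k"
  by (rule least_int[of "box_bound D 0", OF bb pos]) blast+
 have "b <= d" using b bb by blast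
 from box_model_exists[OF D ne True w bs[OF b(1)]]
 consider D' E where "D \<sim> D'" "E >= 0" "!!i j. pt D' i j ==> 0 <= i & 0 <= j & j <= 2 & i + E * j <= b + 2 + E"
  | D' where "D \<sim> D'" "!!i j. pt D' i j ==> 0 <= i & 0 <= j & i + j <= 3"
  unfolding box_model_def by auto
 thus ?thesis
 proof cases
  case (1 D' E)
  show ?thesis
  proof (cases "E = 0")
   case True
   show ?thesis by (rule tri_model_rect[OF 1(1), of "d + 2" 2]) (use D1(3) 1(3) True \<open>b <= d\<close> in fastforce)+
  next
   case False
   show ?thesis by (rule tri_model_rows[OF 1(1), of E]) (use False 1(2,3) \<open>b <= d\<close> in fastforce)+
  qed
 next
  case (2 D')
  show ?thesis by (rule tri_model_rows[OF 2(1), of 1]) (use 2(2) D1(3) in fastforce)+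
 qed
next
 case ns: False
 have viol: "tri_model d D" if D2: "D \<sim> D2" and ip2: "!!i j. ip D2 i j ==> 0 <= i & 0 <= j & i + j <= d" and p: "pt D2 p q" "q <= -2" and d1: "d >= 1" for D2 p q
 proof -
  have bd: "body D2" using ueq_body D D2 by blast
  have cv: "convex D2" using bd body_convex by blast
  obtain a where a: "ip D2 a 0"
  proof -
   have "\<exists>i. ip D2 i 0"
   proof (rule ccontr)
    assume neg: "~ ?thesis"
    have "0 <= i & 0 <= j & i + j <= d - 1" if "ip (pull 1 0 0 1 0 1 D2) i j" for i j
    proof -
     have q: "ip D2 i (j + 1)" using that by (simp add: ip_pull)
     hence "j + 1 ~= 0" using neg by metis
     thus ?thesis using ip2[OF q] by linarith
    qed
    moreover have "D \<sim> pull 1 0 0 1 0 1 D2" by (rule pull_ueq[OF D2]) simp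
    ultimately have "tri_bound D (d - 1)" unfolding tri_bound_def using d1 by (intro conjI exI[of _ "pull 1 0 0 1 0 1 D2"]) auto
    thus False using d(2) by fastforce
   qed
   thus ?thesis using that by blast
  qed
  have u: "\<bar>1 * 1 - 0 * 0\<bar> = (1::int)" by simp
  obtain m where m: "!!i j. ip D2 (1 * i + 0 * j + a) (0 * i + 1 * j + 0) ==> j >= 0 ==> i + m * j <= 0 & i + m * j + j >= 0"
   by (rule squeeze_pull[OF cv u a, of "p - a" "- q"]) (use p ip2[of _ "-1"] in fastforce)+
  let ?D = "pull (-1 - m) (- m) 1 1 (1 + a + 2 * m) (-2) D2"
  have u3: "\<bar>(-1 - m) * 1 - (- m) * 1\<bar> = (1::int)" by simp
  have D3: "D \<sim> ?D" by (rule pull_ueq[OF D2 u3])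
  have ip3: "ip ?D i j \<longleftrightarrow> ip D2 ((1 - i) - m * (i + j - 2) + a) (i + j - 2)" for i j
   by (simp add: ip_pull[OF u3] algebra_simps)
  have "apex d ?D" unfolding apex_def
  proof (intro conjI allI impI)
   show "body ?D" using ueq_body D D3 by blast
   show "d >= 1" by fact
   show "d <= n" if "tri_bound ?D n" for n using d(2) bound_ueq(1)[OF D3] that by blast
   show "~ strip_bound ?D 0" using ns bound_ueq(2)[OF D3] by blast
   show "ip ?D 1 1" using a by (simp add: ip3)
   fix i j assume "ip ?D i j"
   hence q: "ip D2 ((1 - i) - m * (i + j - 2) + a) (i + j - 2)" by (simp only: ip3)
   have "(1 - i) - m * (i + j - 2) + m * (i + j - 2) <= 0 & (1 - i) - m * (i + j - 2) + m * (i + j - 2) + (i + j - 2) >= 0"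
    by (rule m) (use q ip2[OF q] in simp_all)
   thus "1 <= i" "1 <= j" "i + j <= d + 2" using ip2[OF q] by simp_all
  qed
  thus ?thesis using apex_model tri_model_ueq[OF D3] by blast
 qed
 obtain D1 where D1: "D \<sim> D1" "!!i j. ip D1 i j ==> 0 <= i & 0 <= j & i + j <= d" "0 <= d" using d(1) unfolding tri_bound_def by blast
 have d1: "d >= 1"
 proof (rule ccontr)
  assume "~ d >= 1"
  hence "0 <= i & i <= 0" if "ip D1 i j" for i j using D1(2)[OF that] by linarith
  hence "strip_bound D 0" unfolding strip_bound_def using D1(1) by auto
  thus False using ns by simp
 qed
 show ?thesis
 proof (cases "\<forall>i j. pt D1 i j --> i >= -1 & j >= -1 & i + j <= d + 1")
  case True
  have "D \<sim> pull 1 0 0 1 (-1) (-1) D1" by (rule pull_ueq[OF D1(1)]) simp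
  thus ?thesis
   by (rule tri_model_rows[OF _ order_refl]) (use True in force)
 next
  case False
  then obtain i j where ij: "pt D1 i j" "i <= -2 \<or> j <= -2 \<or> i + j >= d + 2" by fastforce
  from ij(2) show ?thesis
  proof (elim disjE)
   assume "j <= -2"
   thus ?thesis using viol[OF D1(1) D1(2) ij(1) _ d1] by blast
  next
   assume i: "i <= -2"
   have "D \<sim> pull 0 1 1 0 0 0 D1" by (rule pull_ueq[OF D1(1)]) simp
   thus ?thesis
    by (rule viol[of _ j i]) (use ij i D1(2) d1 in \<open>force simp: ip_pull\<close>)+
  next
   assume i: "i + j >= d + 2"
   have "D \<sim> pull 1 0 (-1) (-1) 0 d D1" by (rule pull_ueq[OF D1(1)]) simp
   thus ?thesis
    by (rule viol[of _ i "d - i - j"]) (use ij i D1(2) d1 in \<open>force simp: ip_pull\<close>)+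
  qed
 qed
qed

section \<open>Evaluation of finitely supported functions\<close>

abbreviation "evL \<equiv> eval_laurent2"
abbreviation "pdeg \<equiv> Polynomial.degree"
abbreviation "keys \<equiv> Poly_Mapping.keys"
abbreviation "lookup \<equiv> Poly_Mapping.lookup"
abbreviation "single \<equiv> Poly_Mapping.single"

text \<open>One evaluation for all exponent monoids; it is multiplicative as soon as \<phi> turns
  sums into products.\<close>

definition pmev :: "('x => 'k) => ('x \<Rightarrow>\<^sub>0 'k::comm_ring_1) => 'k" where
 "pmev \<phi> P = (\<Sum>k\<in>keys P. lookup P k * \<phi> k)"

lemma pmev_superset: "finite S ==> keys P \<subseteq> S ==> pmev \<phi> P = (\<Sum>k\<in>S. lookup P k * \<phi> k)"
 unfolding pmev_def by (rule sum.mono_neutral_left) (auto simp: in_keys_iff)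

lemma pmev_0 [simp]: "pmev \<phi> 0 = 0"
 by (simp add: pmev_def)

lemma pmev_add: "pmev \<phi> (P + Q) = pmev \<phi> P + pmev \<phi> Q"
proof -
 let ?S = "keys P \<union> keys Q"
 have "keys (P + Q) \<subseteq> ?S" by (rule Poly_Mapping.keys_add)
 thus ?thesis
  by (simp add: pmev_superset[of ?S] lookup_add distrib_right sum.distrib)
qed

lemma pmev_single: "pmev \<phi> (single k c) = c * \<phi> k"
 by (simp add: pmev_def)

lemma pmev_sum: "pmev \<phi> (sum P A) = (\<Sum>a\<in>A. pmev \<phi> (P a))"
 by (induction A rule: infinite_finite_induct) (simp_all add: pmev_add)

lemma sum_single: "(\<Sum>k\<in>keys P. single k (lookup P k)) = P"
proof (rule poly_mapping_eqI)
 fix k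
 have "lookup (\<Sum>k\<in>keys P. single k (lookup P k)) k = (\<Sum>x\<in>keys P. if x = k then lookup P x else 0)"
  unfolding lookup_sum by (rule sum.cong) (simp_all add: lookup_single when_def)
 also have "\<dots> = lookup P k" by (simp add: in_keys_iff)
 finally show "lookup (\<Sum>k\<in>keys P. single k (lookup P k)) k = lookup P k" .
qed

lemma mult_as_sum:
 "P * Q = (\<Sum>a\<in>keys P. \<Sum>b\<in>keys Q. single (a + b) (lookup P a * lookup Q b))"
proof -
 have "P * Q = (\<Sum>k\<in>keys P. single k (lookup P k)) * (\<Sum>k\<in>keys Q. single k (lookup Q k))" by (simp only: sum_single)
 thus ?thesis by (simp add: sum_product mult_single)
qed

lemma pmev_mult:
 assumes "!!a b. \<phi> (a + b) = \<phi> a * \<phi> b"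
 shows "pmev \<phi> (P * Q) = pmev \<phi> P * pmev \<phi> Q"
proof -
 have "pmev \<phi> (P * Q) = (\<Sum>a\<in>keys P. \<Sum>b\<in>keys Q. lookup P a * lookup Q b * \<phi> (a + b))"
  by (simp add: mult_as_sum[of P Q] pmev_sum pmev_single)
 also have "\<dots> = pmev \<phi> P * pmev \<phi> Q"
  unfolding pmev_def sum_product by (intro sum.cong refl) (simp add: assms mult_ac)
 finally show ?thesis .
qed

lemma pmev_uminus: "pmev \<phi> (- P) = - pmev \<phi> P"
 using pmev_add[of \<phi> P "- P"] by (simp add: add_eq_0_iff2)

lemma pmev_one: "\<phi> 0 = 1 ==> pmev \<phi> 1 = 1"
 using pmev_single[of \<phi> 0 1] by simp

text \<open>Additive maps to the integers that separate the support, as a substitute for a monomial order.\<close>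

definition separated :: "'x::comm_monoid_add set => bool" where
 "separated S \<longleftrightarrow> (\<exists>\<kappa>::'x => int. (\<forall>a b. \<kappa> (a + b) = \<kappa> a + \<kappa> b) & inj_on \<kappa> S)"

lemma separated_nat: "separated (S :: nat set)"
 unfolding separated_def by (intro exI[of _ int]) (simp add: inj_on_def)

text \<open>N exceeds twice the size of \<kappa> on S, so N \<omega> + \<kappa> compares by \<omega>
  first and uses \<kappa> only to break ties.\<close>

lemma separated_combine:
 fixes \<kappa> \<omega> :: "'x::comm_monoid_add => int"
 assumes "finite S"
 obtains N where "N > 0" "!!a b. a : S ==> b : S ==> N * \<omega> a + \<kappa> a <= N * \<omega> b + \<kappa> b ==> \<omega> a <= \<omega> b"
proof -
 obtain M where M: "!!a. a : S ==> \<bar>\<kappa> a\<bar> <= M" "M >= 0"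
 proof -
  have "\<bar>\<kappa> a\<bar> <= (\<Sum>a\<in>S. \<bar>\<kappa> a\<bar>)" if "a : S" for a using member_le_sum[of a S "%a. \<bar>\<kappa> a\<bar>"] that assms by simp
  thus ?thesis using that[of "\<Sum>a\<in>S. \<bar>\<kappa> a\<bar>"] by (simp add: sum_nonneg)
 qed
 show ?thesis
 proof (rule that[of "2 * M + 1"])
  fix a b assume ab: "a : S" "b : S" "(2 * M + 1) * \<omega> a + \<kappa> a <= (2 * M + 1) * \<omega> b + \<kappa> b"
  show "\<omega> a <= \<omega> b"
  proof (rule ccontr)
   assume "~ ?thesis"
   hence "(2 * M + 1) * (\<omega> b + 1) <= (2 * M + 1) * \<omega> a" using M(2) by (intro mult_left_mono) auto
   moreover have "(2 * M + 1) * (\<omega> b + 1) = (2 * M + 1) * \<omega> b + (2 * M + 1)" by (simp add: algebra_simps)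
   ultimately show False using ab M(1)[OF ab(1)] M(1)[OF ab(2)] by linarith
  qed
 qed (use M in simp)
qed

lemma separated_prod:
 fixes S :: "('x::comm_monoid_add \<times> 'y::comm_monoid_add) set"
 assumes f: "finite S" and s: "separated (fst ` S)" "separated (snd ` S)"
 shows "separated S"
proof -
 obtain \<kappa>1 :: "'x => int" and \<kappa>2 :: "'y => int" where k: "!!a b. \<kappa>1 (a + b) = \<kappa>1 a + \<kappa>1 b" "inj_on \<kappa>1 (fst ` S)"
  "!!a b. \<kappa>2 (a + b) = \<kappa>2 a + \<kappa>2 b" "inj_on \<kappa>2 (snd ` S)" using s unfolding separated_def by blast
 obtain N where N: "N > 0" "!!a b. a : S ==> b : S ==> N * \<kappa>1 (fst a) + \<kappa>2 (snd a) <= N * \<kappa>1 (fst b) + \<kappa>2 (snd b) ==> \<kappa>1 (fst a) <= \<kappa>1 (fst b)"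
  using separated_combine[OF f, of "%a. \<kappa>1 (fst a)" "%a. \<kappa>2 (snd a)"] by metis
 have "inj_on (%a. N * \<kappa>1 (fst a) + \<kappa>2 (snd a)) S"
 proof (rule inj_onI)
  fix a b assume ab: "a : S" "b : S" "N * \<kappa>1 (fst a) + \<kappa>2 (snd a) = N * \<kappa>1 (fst b) + \<kappa>2 (snd b)"
  hence "\<kappa>1 (fst a) = \<kappa>1 (fst b)" using N(2)[of a b] N(2)[of b a] by simp
  moreover from this have "\<kappa>2 (snd a) = \<kappa>2 (snd b)" using ab by simp
  ultimately show "a = b" using k(2,4) ab by (metis imageI inj_onD prod.expand)
 qed
 thus ?thesis unfolding separated_def
  by (intro exI[of _ "%a. N * \<kappa>1 (fst a) + \<kappa>2 (snd a)"]) (simp add: k algebra_simps)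
qed

lemma separated_poly2: "finite S ==> separated (S :: (nat \<times> nat) set)"
 by (intro separated_prod separated_nat) auto

lemma separated_poly3: "finite S ==> separated (S :: (nat \<times> nat \<times> nat) set)"
 by (intro separated_prod separated_nat) auto

lemma separated_poly22: "finite S ==> separated (S :: ((nat \<times> nat) \<times> (nat \<times> nat)) set)"
 by (intro separated_prod separated_nat) auto

text \<open>With ties broken, each factor has a unique leading exponent. The two leading exponents
  combine in only one way, so their coefficient in the product is a product of nonzero elements:
  weighted degrees add.\<close>

lemma weight_mult:
 fixes P Q :: "'x::comm_monoid_add \<Rightarrow>\<^sub>0 'k::idom" and \<omega> :: "'x => nat"
 assumes "P ~= 0" "Q ~= 0" and s: "separated (keys P \<union> keys Q)" and w: "!!a b. \<omega> (a + b) = \<omega> a + \<omega> b"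
 obtains p q where "p : keys P" "q : keys Q" "p + q : keys (P * Q)"
  "!!a. a : keys P ==> \<omega> a <= \<omega> p" "!!b. b : keys Q ==> \<omega> b <= \<omega> q"
proof -
 let ?S = "keys P \<union> keys Q"
 obtain \<kappa> :: "'x => int" where k: "!!a b. \<kappa> (a + b) = \<kappa> a + \<kappa> b" "inj_on \<kappa> ?S" using s unfolding separated_def by blast
 obtain N where N: "N > 0" "!!a b. a : ?S ==> b : ?S ==> N * int (\<omega> a) + \<kappa> a <= N * int (\<omega> b) + \<kappa> b ==> int (\<omega> a) <= int (\<omega> b)"
  using separated_combine[of ?S "%a. int (\<omega> a)" \<kappa>] by auto
 define L where "L a = N * int (\<omega> a) + \<kappa> a" for a
 have add: "L (a + b) = L a + L b" for a b by (simp add: L_def k w algebra_simps)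
 have inj: "a = b" if "a : ?S" "b : ?S" "L a = L b" for a b
 proof -
  have "int (\<omega> a) = int (\<omega> b)" using N(2)[of a b] N(2)[of b a] that by (simp add: L_def)
  hence "\<kappa> a = \<kappa> b" using that by (simp add: L_def)
  thus ?thesis using k(2) that by (simp add: inj_on_def)
 qed
 have ex: "\<exists>p\<in>keys R. \<forall>a\<in>keys R. L a <= L p" if "R ~= 0" for R :: "'x \<Rightarrow>\<^sub>0 'k"
 proof -
  have "finite (L ` keys R)" "L ` keys R ~= {}" using that by auto
  hence "Max (L ` keys R) : L ` keys R" "\<forall>a\<in>keys R. L a <= Max (L ` keys R)" by (simp_all add: Max_ge)
  thus ?thesis by (metis imageE)
 qed
 obtain p where p: "p : keys P" "!!a. a : keys P ==> L a <= L p" using ex[OF assms(1)] by blast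
 obtain q where q: "q : keys Q" "!!a. a : keys Q ==> L a <= L q" using ex[OF assms(2)] by blast
 have uniq: "a = p & b = q" if "a : keys P" "b : keys Q" "a + b = p + q" for a b
 proof -
  have "L a + L b = L p + L q" using that(3) add by metis
  hence "L a = L p" "L b = L q" using p(2)[OF that(1)] q(2)[OF that(2)] by linarith+
  thus ?thesis using inj that p q by blast
 qed
 have "lookup (P * Q) (p + q) = (\<Sum>a\<in>keys P. \<Sum>b\<in>keys Q. if a = p & b = q then lookup P p * lookup Q q else 0)"
  unfolding mult_as_sum[of P Q] lookup_sum
  by (intro sum.cong refl) (use uniq in \<open>auto simp: lookup_single when_def\<close>)
 also have "\<dots> = (\<Sum>a\<in>keys P. if a = p then lookup P p * lookup Q q else 0)"
  by (intro sum.cong refl) (simp add: q)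
 also have "\<dots> = lookup P p * lookup Q q" by (simp add: p)
 finally have "p + q : keys (P * Q)" using p q by (simp add: in_keys_iff)
 moreover have "\<omega> a <= \<omega> p" if "a : keys P" for a using N(2)[of a p] p that by (simp add: L_def)
 moreover have "\<omega> b <= \<omega> q" if "b : keys Q" for b using N(2)[of b q] q that by (simp add: L_def)
 ultimately show ?thesis using that p q by blast
qed

lemma infinite_alg_closed: "infinite (UNIV :: 'k::alg_closed_field set)"
proof
 assume f: "finite (UNIV :: 'k set)"
 let ?p = "(\<Prod>a\<in>UNIV. [:- a, 1:]) + (1 :: 'k poly)"
 have "pdeg (\<Prod>a\<in>UNIV. [:- a, 1 :: 'k:]) = card (UNIV :: 'k set)"
  by (subst degree_prod_eq_sum_degree) auto
 hence "pdeg ?p > 0"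
  using f by (subst degree_add_eq_left) (auto simp: card_gt_0_iff)
 then obtain x where "poly ?p x = 0" using alg_closed_imp_poly_has_root by blast
 moreover have "poly (\<Prod>a\<in>UNIV. [:- a, 1:]) x = 0" using f by (simp add: poly_prod)
 ultimately show False by simp
qed

lemma poly_nonroot:
 fixes p :: "'k::alg_closed_field poly"
 assumes "p ~= 0" "finite S"
 obtains a where "poly p a ~= 0" "a \<notin> S"
proof -
 have "finite ({a. poly p a = 0} \<union> S)" using assms poly_roots_finite by blast
 then obtain a where "a \<notin> {a. poly p a = 0} \<union> S" using infinite_alg_closed ex_new_if_finite by metis
 thus ?thesis using that by blast
qed

section \<open>Bivariate polynomials\<close>

text \<open>The outer variable receives b and the inner one a, so degree and pseudo-division refer
  to the second coordinate.\<close>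

definition ev2 :: "'k::comm_ring_1 poly poly => 'k => 'k => 'k" where
 "ev2 p a b = poly (poly p [:b:]) a"

lemma ev2_mult: "ev2 (p * q) a b = ev2 p a b * ev2 q a b" and ev2_add: "ev2 (p + q) a b = ev2 p a b + ev2 q a b"
 and ev2_diff: "ev2 (p - q) a b = ev2 p a b - ev2 q a b"
 by (simp_all add: ev2_def)

lemma ev2_map: "ev2 p a b = poly (map_poly (%c. poly c a) p) b"
 by (induction p) (simp_all add: ev2_def map_poly_pCons)

lemma ev2_nonzero:
 fixes p :: "'k::alg_closed_field poly poly"
 assumes "p ~= 0"
 obtains a b where "ev2 p a b ~= 0"
proof -
 obtain a where "poly (lead_coeff p) a ~= 0" using poly_nonroot[of "lead_coeff p" "{}"] assms by auto
 hence "coeff (map_poly (%c. poly c a) p) (pdeg p) ~= 0" by (simp add: coeff_map_poly)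
 hence "map_poly (%c. poly c a) p ~= 0" by auto
 then obtain b where "poly (map_poly (%c. poly c a) p) b ~= 0" using poly_nonroot[of _ "{}"] by blast
 thus ?thesis using that by (simp add: ev2_map)
qed

lemma ev2_inject:
 fixes p q :: "'k::alg_closed_field poly poly"
 assumes "!!a b. ev2 p a b = ev2 q a b"
 shows "p = q"
 using ev2_nonzero[of "p - q"] assms by (force simp: ev2_diff)

lemma linear_dvd_iff:
 fixes p :: "'k::idom poly poly"
 shows "[:[:- a, 1:]:] dvd p \<longleftrightarrow> map_poly (%c. poly c a) p = 0"
proof -
 have "[:[:- a, 1:]:] dvd p \<longleftrightarrow> (\<forall>n. [:- a, 1:] dvd coeff p n)" by (rule const_poly_dvd_iff)
 also have "\<dots> \<longleftrightarrow> (\<forall>n. coeff (map_poly (%c. poly c a) p) n = 0)" by (simp add: coeff_map_poly poly_eq_0_iff_dvd)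
 also have "\<dots> \<longleftrightarrow> map_poly (%c. poly c a) p = 0" by (simp add: poly_eq_iff)
 finally show ?thesis .
qed

lemma map_eval_mult:
 fixes p q :: "'k::idom poly poly"
 shows "map_poly (%c. poly c a) (p * q) = map_poly (%c. poly c a) p * map_poly (%c. poly c a) q"
 by (rule poly_eqI) (simp add: coeff_map_poly coeff_mult poly_sum)

lemma linear_prime:
 fixes p q :: "'k::idom poly poly"
 assumes "[:[:- a, 1:]:] dvd p * q"
 shows "[:[:- a, 1:]:] dvd p \<or> [:[:- a, 1:]:] dvd q"
 using assms unfolding linear_dvd_iff map_eval_mult by simp

lemma const_mult_const_mult: "[:u:] * ([:v:] * w) = [:u * v:] * (w :: 'a::comm_ring_1 poly)"
 by (simp add: mult.commute)

text \<open>Over an algebraically closed field every nonconstant factor in the first variable splits into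
  linear factors, which are prime; this replaces Gauss' lemma.\<close>

lemma split_content:
 fixes p s t :: "'k::alg_closed_field poly poly"
 assumes "[:c:] * p = s * t" "c ~= 0"
 shows "\<exists>c1 c2 s' t'. c1 ~= 0 & c2 ~= 0 & s = [:c1:] * s' & t = [:c2:] * t' & p = s' * t'"
 using assms
proof (induction "pdeg c" arbitrary: c s t)
 case 0
 then obtain k where k: "c = [:k:]" using degree_eq_zeroE by metis
 hence "k ~= 0" using 0 by auto
 have "p = ([:[:inverse k:]:] * s) * t"
 proof -
  have "[:[:inverse k:]:] * ([:c:] * p) = p" using \<open>k ~= 0\<close> by (simp add: k pCons_one)
  thus ?thesis using 0(2) by (metis mult.assoc)
 qed
 moreover have "s = [:c:] * ([:[:inverse k:]:] * s)" using \<open>k ~= 0\<close> by (simp add: k pCons_one)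
 moreover have "t = [:1:] * t" by simp
 ultimately show ?case using 0(3) one_neq_zero by blast
next
 case (Suc n)
 then obtain x where "poly c x = 0" using alg_closed_imp_poly_has_root[of c] by auto
 then obtain c' where c': "c = [:- x, 1:] * c'" by (metis poly_eq_0_iff_dvd dvdE)
 have c0: "c' ~= 0" using c' Suc by auto
 have dg: "pdeg c' = n" using c' c0 Suc(2) by (simp add: degree_mult_eq del: mult_pCons_left)
 let ?l = "[:[:- x, 1:]:] :: 'k poly poly"
 have l0: "?l ~= 0" by simp
 have cl: "[:c:] = ?l * [:c':]" by (simp add: c')
 have st: "s * t = ?l * ([:c':] * p)" using Suc(3) unfolding cl by (simp only: mult.assoc)
 hence "?l dvd s * t" by (rule dvdI)
 hence "?l dvd s \<or> ?l dvd t" by (rule linear_prime)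
 then consider s' where "s = ?l * s'" | t' where "t = ?l * t'" by (auto simp only: dvd_def)
 thus ?case
 proof cases
  case 1
  hence "?l * ([:c':] * p) = ?l * (s' * t)" using st by (simp only: mult.assoc)
  hence "[:c':] * p = s' * t" using l0 by (simp only: mult_cancel_left) simp
  from Suc(1)[OF dg[symmetric] this c0] obtain c1 c2 s'' t' where
   h: "c1 ~= 0" "c2 ~= 0" "s' = [:c1:] * s''" "t = [:c2:] * t'" "p = s'' * t'" by blast
  have "s = [:[:- x, 1:] * c1:] * s''" using 1 h(3) by (simp only: const_mult_const_mult)
  moreover have "[:- x, 1:] * c1 ~= 0" using h(1) by (simp del: mult_pCons_left)
  ultimately show ?thesis using h by blast
 next
  case 2
  hence "?l * ([:c':] * p) = ?l * (s * t')" using st by (simp only: mult.left_commute)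
  hence "[:c':] * p = s * t'" using l0 by (simp only: mult_cancel_left) simp
  from Suc(1)[OF dg[symmetric] this c0] obtain c1 c2 s' t'' where
   h: "c1 ~= 0" "c2 ~= 0" "s = [:c1:] * s'" "t' = [:c2:] * t''" "p = s' * t''" by blast
  have "t = [:[:- x, 1:] * c2:] * t''" using 2 h(4) by (simp only: const_mult_const_mult)
  moreover have "[:- x, 1:] * c2 ~= 0" using h(2) by (simp del: mult_pCons_left)
  ultimately show ?thesis using h by blast
 qed
qed

lemma poly_poly_unit_const:
 fixes p :: "'k::field poly poly"
 assumes "p dvd 1"
 obtains k where "k ~= 0" "p = [:[:k:]:]"
proof -
 from assms obtain c where c: "p = [:c:]" "c dvd 1" using is_unit_polyE by blast
 then obtain k where "c = [:k:]" "k dvd 1" using is_unit_polyE by blast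
 moreover from this have "k ~= 0" by auto
 ultimately show ?thesis using c that[of k] by auto
qed

text \<open>Pseudo-division shows that an element s of least outer degree in the ideal of p and q
  divides p and q up to factors free of the outer variable. If s had positive degree,
  \<open>split_content\<close> would make p an associate of its essential part, and p would divide
  q.\<close>

lemma irreducible_resultant:
 fixes p q :: "'k::alg_closed_field poly poly"
 assumes p: "irreducible p" "pdeg p > 0" and q: "~ p dvd q"
 obtains r g h where "r ~= 0" "[:r:] = g * p + h * q"
proof -
 define I where "I = {s. s ~= 0 & (\<exists>g h. s = g * p + h * q)}"
 have p0: "p ~= 0" using p by auto
 have "p : I" unfolding I_def using p0 by (auto intro: exI[of _ 1] exI[of _ 0])
 then obtain s where s: "s : I" "!!t. t : I ==> pdeg s <= pdeg t"
  using ex_has_least_nat[of "%s. s : I" p pdeg] by blast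
 from s(1) obtain g h where gh: "s = g * p + h * q" "s ~= 0" by (auto simp: I_def)
 have div: "\<exists>a t. a ~= 0 & [:a:] * f = s * t" if f: "\<exists>g h. f = g * p + h * q" for f
 proof -
  obtain a t where at: "a ~= 0" "smult a f = s * t + pseudo_mod f s" using pseudo_mod(1)[OF gh(2)] by blast
  from f obtain g' h' where f': "f = g' * p + h' * q" by blast
  have "pseudo_mod f s = [:a:] * f - s * t" using at(2) by simp
  also have "\<dots> = ([:a:] * g' - t * g) * p + ([:a:] * h' - t * h) * q" unfolding f' gh(1) by (simp add: algebra_simps)
  finally have "pseudo_mod f s : I \<or> pseudo_mod f s = 0" unfolding I_def by blast
  hence "pseudo_mod f s = 0" using s(2) pseudo_mod(2)[OF gh(2), of f] by (meson leD)
  thus ?thesis using at by auto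
 qed
 have "pdeg s = 0"
 proof (rule ccontr)
  assume ds: "pdeg s ~= 0"
  obtain a t where "a ~= 0" "[:a:] * p = s * t" using div[of p] by (metis add.right_neutral mult_1 mult_zero_left)
  from split_content[OF this(2,1)] obtain c1 c2 s' t' where
   c: "c1 ~= 0" "s = [:c1:] * s'" "p = s' * t'" by blast
  have "~ s' dvd 1"
  proof
   assume "s' dvd 1"
   then obtain k where "s' = [:[:k:]:]" using poly_poly_unit_const by blast
   thus False using ds c(2) by simp
  qed
  hence "t' dvd 1" using p(1) c(3) irreducibleD by blast
  hence "p dvd s'" using c(3) by (metis dvd_mult_unit_iff' dvd_refl mult.commute)
  then obtain s2 where s2: "s = p * s2" using c(2) by (metis dvdE dvd_mult)
  obtain a' t'' where a': "a' ~= 0" "[:a':] * q = s * t''" using div[of q] by (metis add.left_neutral mult_1 mult_zero_left)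
  hence "[:a':] * q = p * (s2 * t'')" using s2 by (simp add: mult.assoc)
  from split_content[OF this a'(1)] obtain c1' c2' p' t3 where
   d: "c1' ~= 0" "p = [:c1':] * p'" "q = p' * t3" by blast
  have "~ p' dvd 1"
  proof
   assume "p' dvd 1"
   then obtain k where "p' = [:[:k:]:]" using poly_poly_unit_const by blast
   thus False using p(2) d(2) by simp
  qed
  hence "[:c1':] dvd 1" using p(1) d(2) irreducibleD by blast
  hence "p dvd p'" using d(2) by (metis dvd_mult_unit_iff dvd_refl mult.commute)
  thus False using q d(3) by (metis dvd_mult2)
 qed
 then obtain r where "s = [:r:]" using degree_eq_zeroE by blast
 thus ?thesis using that[of r g h] gh by auto
qed

text \<open>The eliminant r leaves finitely many first coordinates a, and over each of them p is not
  identically zero, as x - a cannot divide it. A polynomial p of outer degree 0 is itself some x - a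
  up to a unit.\<close>

theorem finite_common_zeros:
 fixes p q :: "'k::alg_closed_field poly poly"
 assumes p: "irreducible p" and q: "~ p dvd q"
 shows "finite {(a, b). ev2 p a b = 0 & ev2 q a b = 0}" (is "finite ?Z")
proof (cases "pdeg p = 0")
 case False
 hence dp: "pdeg p > 0" by simp
 obtain r g h where r: "r ~= 0" "[:r:] = g * p + h * q" using irreducible_resultant[OF p dp q] by blast
 let ?A = "{a. poly r a = 0}"
 have fib: "map_poly (%c. poly c a) p ~= 0" for a
 proof
  assume "map_poly (%c. poly c a) p = 0"
  then obtain p' where p': "p = [:[:- a, 1:]:] * p'" unfolding linear_dvd_iff[symmetric] by (metis dvdE)
  have "~ [:[:- a, 1:]:] dvd (1 :: 'k poly poly)"
  proof
   assume "[:[:- a, 1:]:] dvd (1 :: 'k poly poly)"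
   then obtain k where "[:[:- a, 1:]:] = [:[:k:]:]" using poly_poly_unit_const by blast
   thus False by simp
  qed
  hence "p' dvd 1" using p p' irreducibleD by blast
  then obtain k where "p' = [:[:k:]:]" using poly_poly_unit_const by blast
  thus False using p' dp by simp
 qed
 have "?Z \<subseteq> (\<Union>a\<in>?A. {a} \<times> {b. poly (map_poly (%c. poly c a) p) b = 0})"
 proof clarify
  fix a b assume z: "ev2 p a b = 0" "ev2 q a b = 0"
  have "poly r a = ev2 [:r:] a b" by (simp add: ev2_def)
  also have "\<dots> = 0" unfolding r(2) by (simp add: ev2_add ev2_mult z)
  finally show "(a, b) : (\<Union>a\<in>?A. {a} \<times> {b. poly (map_poly (%c. poly c a) p) b = 0})"
   using z(1) by (simp add: ev2_map)
 qed
 moreover have "finite (\<Union>a\<in>?A. {a} \<times> {b. poly (map_poly (%c. poly c a) p) b = 0})"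
  by (intro finite_UN_I finite_cartesian_product poly_roots_finite r fib) simp
 ultimately show ?thesis by (rule finite_subset)
next
 case True
 then obtain c where c: "p = [:c:]" using degree_eq_zeroE by metis
 have c0: "c ~= 0" using p c by auto
 have "pdeg c ~= 0"
 proof
  assume "pdeg c = 0"
  then obtain k where k: "c = [:k:]" using degree_eq_zeroE by metis
  hence "k ~= 0" using c0 by simp
  hence "p * [:[:inverse k:]:] = 1" unfolding c k by (simp add: pCons_one)
  hence "p dvd 1" by (metis dvd_triv_left)
  thus False using p irreducible_not_unit by blast
 qed
 then obtain x where "poly c x = 0" using alg_closed_imp_poly_has_root[of c] by auto
 then obtain c' where c': "c = [:- x, 1:] * c'" by (metis poly_eq_0_iff_dvd dvdE)
 have pc: "p = [:[:- x, 1:]:] * [:c':]" by (simp add: c c')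
 have "~ [:[:- x, 1:]:] dvd (1 :: 'k poly poly)"
 proof
  assume "[:[:- x, 1:]:] dvd (1 :: 'k poly poly)"
  then obtain k where "[:[:- x, 1:]:] = [:[:k:]:]" using poly_poly_unit_const by blast
  thus False by simp
 qed
 hence u: "[:c':] dvd 1" using p pc irreducibleD by blast
 then obtain k where k: "k ~= 0" "c' = [:k:]" using poly_poly_unit_const[of "[:c':]"] by auto
 have "map_poly (%c. poly c x) q ~= 0"
 proof
  assume "map_poly (%c. poly c x) q = 0"
  hence "[:[:- x, 1:]:] dvd q" unfolding linear_dvd_iff .
  hence "p dvd q" unfolding pc using u by (metis mult_unit_dvd_iff)
  thus False using q by simp
 qed
 hence "finite ({x} \<times> {b. poly (map_poly (%c. poly c x) q) b = 0})" by (simp add: poly_roots_finite)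
 moreover have "?Z \<subseteq> {x} \<times> {b. poly (map_poly (%c. poly c x) q) b = 0}"
 proof (rule subsetI)
  fix w assume "w : ?Z"
  then obtain a b where z: "w = (a, b)" "ev2 p a b = 0" "ev2 q a b = 0" by auto
  have "poly c a = 0" using z(2) by (simp add: c ev2_def)
  hence "a = x" using k by (simp add: c')
  thus "w : {x} \<times> {b. poly (map_poly (%c. poly c x) q) b = 0}" using z by (simp add: ev2_map)
 qed
 ultimately show ?thesis using finite_subset by blast
qed

section \<open>Bivariate polynomials with visible support\<close>

type_synonym 'a poly2 = "(nat \<times> nat) \<Rightarrow>\<^sub>0 'a"

definition ev :: "'k::comm_ring_1 poly2 => 'k => 'k => 'k" where
 "ev P a b = pmev (%(i, j). a ^ i * b ^ j) P"

lemma ev_add: "ev (P + Q) a b = ev P a b + ev Q a b"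
 and ev_uminus: "ev (- P) a b = - ev P a b"
 and ev_0 [simp]: "ev 0 a b = 0"
 and ev_1 [simp]: "ev 1 a b = 1"
 and ev_single: "ev (single k c) a b = c * (a ^ fst k * b ^ snd k)"
 and ev_mult: "ev (P * Q) a b = ev P a b * ev Q a b"
 and ev_sum: "ev (sum R A) a b = (\<Sum>x\<in>A. ev (R x) a b)"
 unfolding ev_def
 by (simp_all add: pmev_add pmev_uminus pmev_one pmev_single pmev_sum case_prod_unfold)
  (rule pmev_mult, simp add: case_prod_unfold power_add mult_ac)

lemma ev_diff: "ev (P - Q) a b = ev P a b - ev Q a b"
 using ev_add[of P "- Q"] by (simp add: ev_uminus)

lemma ev_power: "ev (P ^ n) a b = ev P a b ^ n"
 by (induction n) (simp_all add: ev_mult)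

text \<open>Finitely supported maps show supports and weighted degrees, nested polynomials provide
  pseudo-division. The two are identified through their values, which determine a polynomial over an
  infinite field.\<close>

definition to_pp :: "'k::comm_ring_1 poly2 => 'k poly poly" where
 "to_pp P = (\<Sum>k\<in>keys P. monom (monom (lookup P k) (fst k)) (snd k))"

lemma ev2_monom: "ev2 (monom (monom c i) j) a b = c * (a ^ i * b ^ j)"
 by (simp add: ev2_def poly_monom mult.assoc)

lemma ev2_sum: "ev2 (sum p A) a b = (\<Sum>x\<in>A. ev2 (p x) a b)"
 by (simp add: ev2_def poly_sum)

lemma ev2_to_pp: "ev2 (to_pp P) a b = ev P a b"
 unfolding to_pp_def ev2_sum ev2_monom ev_def pmev_def by (simp add: case_prod_unfold)

lemma coeff_to_pp: "coeff (coeff (to_pp P) j) i = lookup P (i, j)"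
proof -
 have "coeff (coeff (to_pp P) j) i = (\<Sum>k\<in>keys P. if k = (i, j) then lookup P k else 0)"
  unfolding to_pp_def coeff_sum by (intro sum.cong refl) (auto simp: prod_eq_iff)
 also have "\<dots> = lookup P (i, j)" by (simp add: in_keys_iff)
 finally show ?thesis .
qed

lemma to_pp_eq_0: "to_pp P = 0 \<longleftrightarrow> P = 0"
proof
 assume "to_pp P = 0"
 hence "lookup P k = 0" for k using coeff_to_pp[of P "snd k" "fst k"] by simp
 thus "P = 0" by (intro poly_mapping_eqI) simp
qed (simp add: to_pp_def)

lemma ev_nonzero:
 fixes P :: "'k::alg_closed_field poly2"
 assumes "P ~= 0"
 obtains a b where "ev P a b ~= 0"
 using ev2_nonzero[of "to_pp P"] assms by (auto simp: to_pp_eq_0 ev2_to_pp)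

lemma ev_inject:
 fixes P Q :: "'k::alg_closed_field poly2"
 assumes "!!a b. ev P a b = ev Q a b"
 shows "P = Q"
 using ev_nonzero[of "P - Q"] assms by (force simp: ev_diff)

lemma poly2_mult_nonzero:
 fixes P Q :: "'k::idom poly2"
 assumes "P ~= 0" "Q ~= 0"
 shows "P * Q ~= 0"
 using weight_mult[OF assms separated_poly2, of "%_. 0"] by fastforce

lemma of_pp:
 fixes p :: "'k::comm_ring_1 poly poly"
 obtains P where "!!a b. ev P a b = ev2 p a b"
proof -
 let ?P = "\<Sum>j\<le>pdeg p. \<Sum>i\<le>pdeg (coeff p j). single (i, j) (coeff (coeff p j) i)"
 have "ev ?P a b = ev2 p a b" for a b
 proof -
  have "ev2 p a b = (\<Sum>j\<le>pdeg p. poly (coeff p j) a * b ^ j)"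
   unfolding ev2_def by (subst poly_altdef) (simp add: poly_sum)
  also have "\<dots> = ev ?P a b"
   unfolding ev_sum ev_single poly_altdef sum_distrib_right by (simp add: mult.assoc)
  finally show ?thesis by simp
 qed
 thus ?thesis using that by blast
qed

definition tdeg :: "'k::zero poly2 => nat" where
 "tdeg P = Max (insert 0 ((%(i, j). i + j) ` keys P))"

lemma tdeg_ge: "(i, j) : keys P ==> i + j <= tdeg P"
 unfolding tdeg_def by (rule Max_ge) force+

lemma tdeg_le: "(!!i j. (i, j) : keys P ==> i + j <= n) ==> tdeg P <= n"
 unfolding tdeg_def by (subst Max_le_iff) auto

lemma tdeg_mult:
 fixes P Q :: "'k::idom poly2"
 assumes "P ~= 0" "Q ~= 0"
 shows "tdeg (P * Q) = tdeg P + tdeg Q"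
proof (rule antisym)
 show "tdeg (P * Q) <= tdeg P + tdeg Q"
 proof (rule tdeg_le)
  fix i j assume "(i, j) : keys (P * Q)"
  then obtain a b where ab: "a : keys P" "b : keys Q" "(i, j) = a + b" using keys_mult by blast
  hence "fst a + snd a <= tdeg P" "fst b + snd b <= tdeg Q" using tdeg_ge by (metis prod.collapse)+
  thus "i + j <= tdeg P + tdeg Q" using ab(3) by (simp add: plus_prod_def)
 qed
 obtain p q where pq: "p : keys P" "q : keys Q" "p + q : keys (P * Q)"
  "!!a. a : keys P ==> fst a + snd a <= fst p + snd p" "!!b. b : keys Q ==> fst b + snd b <= fst q + snd q"
  by (rule weight_mult[OF assms separated_poly2, of "%a. fst a + snd a"]) auto
 have "tdeg P <= fst p + snd p" "tdeg Q <= fst q + snd q" using pq by (intro tdeg_le; fastforce)+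
 moreover have "(fst p + fst q) + (snd p + snd q) <= tdeg (P * Q)" using pq(3) by (intro tdeg_ge) (simp add: plus_prod_def)
 ultimately show "tdeg P + tdeg Q <= tdeg (P * Q)" by linarith
qed

lemma tdeg_0_unit:
 fixes P :: "'k::field poly2"
 assumes "P ~= 0" "tdeg P = 0"
 obtains c where "c ~= 0" "P = single 0 c"
proof -
 have "keys P \<subseteq> {0}" using tdeg_ge[of _ _ P] assms(2) by (force simp: zero_prod_def)
 hence "P = single 0 (lookup P 0)" by (intro poly_mapping_eqI) (auto simp: lookup_single when_def in_keys_iff)
 moreover have "lookup P 0 ~= 0" using calculation assms(1) by (metis single_zero)
 ultimately show ?thesis using that by blast
qed

text \<open>Total degree is additive and is zero exactly for the constants, which are the units; so
  factorizations only have to be tested on degrees.\<close>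

lemma to_pp_irreducibleI:
 fixes P :: "'k::alg_closed_field poly2"
 assumes P: "P ~= 0" "!!c. P ~= single 0 c"
  and m: "!!G H. P = G * H ==> G ~= 0 ==> H ~= 0 ==> tdeg G = 0 \<or> tdeg H = 0"
 shows "irreducible (to_pp P)"
proof (rule irreducibleI)
 show "to_pp P ~= 0" using P by (simp add: to_pp_eq_0)
 show "~ to_pp P dvd 1"
 proof
  assume "to_pp P dvd 1"
  then obtain k where "to_pp P = [:[:k:]:]" using poly_poly_unit_const by blast
  hence "ev P a b = k" for a b using ev2_to_pp[of P a b] by (simp add: ev2_def)
  hence "P = single 0 k" by (intro ev_inject) (simp add: ev_single)
  thus False using P by blast
 qed
next
 fix g h assume gh: "to_pp P = g * h"
 obtain G where G: "!!a b. ev G a b = ev2 g a b" using of_pp by blast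
 obtain H where H: "!!a b. ev H a b = ev2 h a b" using of_pp by blast
 have PGH: "P = G * H"
 proof (rule ev_inject)
  fix a b
  have "ev P a b = ev2 (g * h) a b" by (simp only: gh[symmetric] ev2_to_pp)
  thus "ev P a b = ev (G * H) a b" by (simp add: ev2_mult ev_mult G H)
 qed
 have nz: "G ~= 0" "H ~= 0" using PGH P by auto
 have unit: "q dvd 1" if "tdeg Q = 0" "Q ~= 0" "!!a b. ev Q a b = ev2 q a b" for Q :: "'k poly2" and q
 proof -
  from tdeg_0_unit[OF that(2,1)] obtain c where c: "c ~= 0" "Q = single 0 c" by blast
  have "q = [:[:c:]:]" by (rule ev2_inject) (simp add: that(3)[symmetric] c ev_single, simp add: ev2_def)
  hence "q * [:[:inverse c:]:] = 1" using c by (simp add: pCons_one)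
  thus ?thesis by (metis dvd_triv_left)
 qed
 show "g dvd 1 \<or> h dvd 1" using m[OF PGH nz] unit G H nz by blast
qed

section \<open>Laurent polynomials\<close>

lemma eval_laurent2_pmev: "evL f (x, y) = pmev (%(i, j). x powi i * y powi j) f"
 unfolding eval_laurent2_def pmev_def by (simp add: case_prod_unfold mult.assoc)

lemma evL_add: "evL (f + g) z = evL f z + evL g z"
 and evL_uminus: "evL (- f) z = - evL f z"
 and evL_0 [simp]: "evL 0 z = 0"
 and evL_1 [simp]: "evL 1 z = 1"
 and evL_single: "evL (single k c) z = c * (fst z powi fst k * snd z powi snd k)"
 and evL_sum: "evL (sum R A) z = (\<Sum>x\<in>A. evL (R x) z)"
 by (cases z; simp add: eval_laurent2_pmev pmev_add pmev_uminus pmev_one pmev_single pmev_sum case_prod_unfold)+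

lemma evL_mult:
 assumes "fst z ~= 0" "snd z ~= 0"
 shows "evL (f * g) z = evL f z * evL g z"
 using assms by (cases z) (simp add: eval_laurent2_pmev pmev_mult case_prod_unfold power_int_add mult_ac)

lemma evL_power:
 assumes "fst z ~= 0" "snd z ~= 0"
 shows "evL (f ^ n) z = evL f z ^ n"
 by (induction n) (simp_all add: evL_mult[OF assms])

definition lau :: "'k::comm_ring_1 poly2 => 'k laurent2" where
 "lau P = (\<Sum>k\<in>keys P. single (int (fst k), int (snd k)) (lookup P k))"

lemma lau_superset: "finite S ==> keys P \<subseteq> S ==> lau P = (\<Sum>k\<in>S. single (int (fst k), int (snd k)) (lookup P k))"
 unfolding lau_def by (rule sum.mono_neutral_left) (auto simp: in_keys_iff)

lemma lau_add: "lau (P + Q) = lau P + lau Q"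
proof -
 let ?S = "keys P \<union> keys Q"
 have "keys (P + Q) \<subseteq> ?S" by (rule Poly_Mapping.keys_add)
 thus ?thesis by (simp add: lau_superset[of ?S] lookup_add single_add sum.distrib)
qed

lemma lau_single: "lau (single k c) = single (int (fst k), int (snd k)) c"
 by (simp add: lau_def)

lemma lau_sum: "lau (sum P A) = (\<Sum>a\<in>A. lau (P a))"
 by (induction A rule: infinite_finite_induct) (simp_all add: lau_add, simp_all add: lau_def)

lemma lau_mult: "lau (P * Q) = lau P * lau Q"
proof -
 have "lau (P * Q) = (\<Sum>a\<in>keys P. \<Sum>b\<in>keys Q. single (int (fst a) + int (fst b), int (snd a) + int (snd b)) (lookup P a * lookup Q b))"
  by (simp add: mult_as_sum[of P Q] lau_sum lau_single)
 also have "\<dots> = lau P * lau Q" unfolding lau_def sum_product by (simp add: mult_single)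
 finally show ?thesis .
qed

lemma evL_lau: "fst z ~= 0 ==> snd z ~= 0 ==> evL (lau P) z = ev P (fst z) (snd z)"
 unfolding lau_def evL_sum evL_single ev_def pmev_def by (simp add: case_prod_unfold)

lemma single_unit:
 fixes c :: "'k::field"
 assumes "c ~= 0"
 shows "single (k :: int \<times> int) c dvd 1"
proof -
 have "single k c * single (- k) (inverse c) = 1" using assms by (simp add: mult_single)
 thus ?thesis by (metis dvd_triv_left)
qed

lemma laurent_clear:
 fixes g :: "'k::field laurent2"
 obtains N P where "lau P = single (int N, int N) 1 * g"
proof -
 obtain N :: nat where N: "!!k. k : keys g ==> \<bar>fst k\<bar> + \<bar>snd k\<bar> <= int N"
 proof -
  have "\<bar>fst k\<bar> + \<bar>snd k\<bar> <= (\<Sum>k\<in>keys g. \<bar>fst k\<bar> + \<bar>snd k\<bar>)" if "k : keys g" for k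
   using member_le_sum[of k "keys g" "%k. \<bar>fst k\<bar> + \<bar>snd k\<bar>"] that by simp
  thus ?thesis using that[of "nat (\<Sum>k\<in>keys g. \<bar>fst k\<bar> + \<bar>snd k\<bar>)"] by (simp add: sum_nonneg)
 qed
 let ?P = "\<Sum>k\<in>keys g. single (nat (fst k + int N), nat (snd k + int N)) (lookup g k)"
 have nn: "fst k + int N >= 0 & snd k + int N >= 0" if "k : keys g" for k using N[OF that] by linarith
 have "lau ?P = (\<Sum>k\<in>keys g. single (fst k + int N, snd k + int N) (lookup g k))"
  unfolding lau_sum lau_single by (rule sum.cong) (use nn in auto)
 also have "\<dots> = single (int N, int N) 1 * (\<Sum>k\<in>keys g. single k (lookup g k))"
  unfolding sum_distrib_left mult_single by (simp add: plus_prod_def add.commute)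
 finally have "lau ?P = single (int N, int N) 1 * g" by (simp only: sum_single)
 thus ?thesis by (rule that)
qed

text \<open>Among the polynomials that differ from f by a Laurent unit, one of least total degree
  has no monomial factor left, and this makes irreducibility pass from Laurent polynomials to
  polynomials.\<close>

lemma irreducible_clear:
 fixes f :: "'k::alg_closed_field laurent2"
 assumes f: "irreducible f"
 obtains P U where "irreducible (to_pp P)" "U dvd 1" "lau P = U * f"
proof -
 define C where "C = {P. \<exists>U. U dvd 1 & lau P = U * f}"
 have f0: "f ~= 0" "~ f dvd 1" using f by (auto simp: irreducible_def)
 have nz: "P ~= 0" if "P : C" for P
 proof
  assume "P = 0"
  with that obtain U where U: "U dvd 1" "0 = U * f" by (auto simp: C_def lau_def)
  from U(1) obtain V where V: "U * V = 1" by (auto simp: dvd_def)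
  have "f = V * (U * f)" using V by (simp add: mult.assoc[symmetric] mult.commute)
  thus False using U(2) f0(1) by (metis mult_zero_right)
 qed
 obtain N P0 where "lau P0 = single (int N, int N) 1 * f" using laurent_clear by blast
 hence "P0 : C" unfolding C_def using single_unit[of 1] by auto
 then obtain P where P: "P : C" "!!Q. Q : C ==> tdeg P <= tdeg Q"
  using ex_has_least_nat[of "%P. P : C" P0 tdeg] by blast
 then obtain U where U: "U dvd 1" "lau P = U * f" by (auto simp: C_def)
 have half: "tdeg H = 0" if "P = G * H" "G ~= 0" "H ~= 0" "lau H dvd 1" for G H
 proof -
  from that(4) obtain V where V: "1 = lau H * V" by (auto simp: dvd_def)
  have "lau G * lau H = U * f" using U(2) that(1) by (simp add: lau_mult)
  moreover have "V * (lau G * lau H) = lau G * (lau H * V)" by (simp only: mult_ac)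
  hence "lau G = V * (lau G * lau H)" by (simp add: V[symmetric])
  ultimately have "lau G = V * U * f" by (simp add: mult.assoc)
  moreover have "V * U dvd 1"
  proof -
   have "V dvd 1" unfolding V by (rule dvd_triv_right)
   thus ?thesis using mult_dvd_mono[OF _ U(1), of V 1] by simp
  qed
  ultimately have "G : C" by (auto simp: C_def)
  hence "tdeg P <= tdeg G" by (rule P(2))
  thus ?thesis using tdeg_mult[OF that(2,3)] that(1) by simp
 qed
 have "irreducible (to_pp P)"
 proof (rule to_pp_irreducibleI)
  show "P ~= 0" using nz P by blast
  show "P ~= single 0 c" for c
  proof
   assume Pc: "P = single 0 c"
   hence "c ~= 0" using nz P by force
   hence "lau P dvd 1" unfolding Pc lau_single by (rule single_unit)
   moreover have "f dvd lau P" unfolding U(2) by (rule dvd_triv_right)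
   ultimately have "f dvd 1" by (rule dvd_trans[rotated])
   thus False using f0 by simp
  qed
  fix G H assume GH: "P = G * H" "G ~= 0" "H ~= 0"
  obtain V where V: "U * V = 1" using U(1) by (auto simp: dvd_def)
  have "f = V * (U * f)" using V by (simp add: mult.assoc[symmetric] mult.commute)
  hence "f = (V * lau G) * lau H" using U(2) GH(1) by (simp add: lau_mult mult.assoc)
  hence "V * lau G dvd 1 \<or> lau H dvd 1" using f irreducibleD by blast
  thus "tdeg G = 0 \<or> tdeg H = 0"
  proof
   assume "V * lau G dvd 1"
   hence "lau G dvd 1" using dvd_mult_right by blast
   thus ?thesis using half[of H G] GH by (simp add: mult.commute)
  next
   assume "lau H dvd 1"
   thus ?thesis using half[of G H] GH by simp
  qed
 qed
 thus ?thesis using that U by blast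
qed

definition torus_zeros :: "'k::field laurent2 => ('k \<times> 'k) set" where
 "torus_zeros f = {z. fst z ~= 0 & snd z ~= 0 & evL f z = 0}"

text \<open>Monomials are Laurent units, so P is divisible neither by x nor by y. For almost every x
  the polynomial P(x, y) in y then has positive degree and nonzero constant term, hence a nonzero
  root; if y does not occur, the curve contains a whole vertical line of the torus.\<close>

lemma torus_zeros_infinite:
 fixes f :: "'k::alg_closed_field laurent2"
 assumes f: "irreducible f"
 shows "infinite (torus_zeros f)"
proof -
 obtain P U where P: "irreducible (to_pp P)" "U dvd 1" "lau P = U * f" using irreducible_clear[OF f] by blast
 have f0: "~ f dvd 1" using f by (rule irreducible_not_unit)
 have zero: "(x, y) : torus_zeros f" if "x ~= 0" "y ~= 0" "ev2 (to_pp P) x y = 0" for x y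
 proof -
  have "evL (lau P) (x, y) = 0" using that by (simp add: evL_lau ev2_to_pp)
  hence "evL U (x, y) * evL f (x, y) = 0" using that by (simp add: P evL_mult)
  moreover obtain V where "1 = U * V" using P(2) by (auto simp: dvd_def)
  hence "evL U (x, y) * evL V (x, y) = 1" using that evL_mult[of "(x, y)" U V] by (metis evL_1 fst_conv snd_conv)
  ultimately show ?thesis using that by (auto simp: torus_zeros_def)
 qed
 have nomon: False if "to_pp P = [:[:k:]:] * to_pp (single m 1)" "k ~= 0" for k m
 proof -
  have "ev P a b = ev2 [:[:k:]:] a b * ev (single m 1) a b" for a b
   by (simp only: ev2_to_pp[symmetric] that ev2_mult)
  hence "P = single m k" by (intro ev_inject) (simp add: ev_single, simp add: ev2_def)
  hence "lau P dvd 1" using that by (simp add: lau_single single_unit)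
  moreover have "f dvd lau P" unfolding P(3) by (rule dvd_triv_right)
  ultimately show False using f0 dvd_trans by blast
 qed
 have mon: "~ to_pp (single m 1) dvd to_pp P" if "~ to_pp (single m (1::'k)) dvd 1" for m
 proof
  assume "to_pp (single m 1) dvd to_pp P"
  then obtain r where r: "to_pp P = to_pp (single m 1) * r" by (metis dvdE)
  hence "r dvd 1" using P(1) that irreducibleD by blast
  then obtain k where "k ~= 0" "r = [:[:k:]:]" using poly_poly_unit_const by blast
  thus False using nomon[of k m] r by (simp add: mult.commute)
 qed
 have pp10: "to_pp (single (1, 0) 1) = [:[:0, 1 :: 'k:]:]"
  by (rule ev2_inject) (simp add: ev2_to_pp ev_single, simp add: ev2_def)
 have pp01: "to_pp (single (0, 1) 1) = [:0, 1 :: 'k poly:]"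
  by (rule ev2_inject) (simp add: ev2_to_pp ev_single, simp add: ev2_def)
 let ?p = "to_pp P"
 have c0: "coeff ?p 0 ~= 0"
 proof
  assume "coeff ?p 0 = 0"
  hence "[:0, 1:] dvd ?p" by (metis poly_0_coeff_0 poly_eq_0_iff_dvd minus_zero)
  moreover have "~ [:0, 1 :: 'k poly:] dvd 1" using poly_poly_unit_const[of "[:0, 1 :: 'k poly:]"] by auto
  ultimately show False using mon[of "(0, 1)"] pp01 by simp
 qed
 have inf: "infinite {y :: 'k. y ~= 0}" using infinite_alg_closed
  by (metis Collect_neg_eq Compl_eq_Diff_UNIV Diff_infinite_finite finite.emptyI finite.insertI singleton_conv)
 show ?thesis
 proof (cases "pdeg ?p = 0")
  case True
  then obtain c where c: "?p = [:c:]" using degree_eq_zeroE by metis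
  have "pdeg c ~= 0"
  proof
   assume "pdeg c = 0"
   then obtain k where k: "c = [:k:]" using degree_eq_zeroE by metis
   hence "k ~= 0" using c c0 by auto
   hence "?p * [:[:inverse k:]:] = 1" unfolding c k by (simp add: pCons_one)
   hence "?p dvd 1" by (metis dvd_triv_left)
   thus False using P(1) irreducible_not_unit by blast
  qed
  then obtain x where x: "poly c x = 0" using alg_closed_imp_poly_has_root[of c] by auto
  have "x ~= 0"
  proof
   assume "x = 0"
   hence "[:[:0, 1:]:] dvd ?p" using linear_dvd_iff[of 0 ?p] x by (simp add: c map_poly_pCons)
   moreover have "~ [:[:0, 1 :: 'k:]:] dvd 1" using poly_poly_unit_const[of "[:[:0, 1 :: 'k:]:]"] by auto
   ultimately show False using mon[of "(1, 0)"] pp10 by simp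
  qed
  have "(%y. (x, y)) ` {y. y ~= 0} \<subseteq> torus_zeros f" using zero \<open>x ~= 0\<close> x by (auto simp: c ev2_def)
  moreover have "infinite ((%y. (x, y)) ` {y :: 'k. y ~= 0})" using inf by (simp add: finite_image_iff inj_on_def)
  ultimately show ?thesis using infinite_super by blast
 next
  case False
  let ?B = "{x. poly (coeff ?p 0) x = 0} \<union> {x. poly (lead_coeff ?p) x = 0} \<union> {0}"
  have "?p ~= 0" using c0 by auto
  hence "finite ?B" using c0 by (intro finite_UnI poly_roots_finite) auto
  hence "infinite (- ?B)" using infinite_alg_closed by (metis Compl_eq_Diff_UNIV Diff_infinite_finite)
  moreover have "- ?B \<subseteq> fst ` torus_zeros f"
  proof
   fix x assume x: "x : - ?B"
   let ?q = "map_poly (%c. poly c x) ?p"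
   have "coeff ?q (pdeg ?p) ~= 0" using x by (simp add: coeff_map_poly)
   hence "pdeg ?q > 0" using False le_degree by fastforce
   then obtain y where y: "poly ?q y = 0" using alg_closed_imp_poly_has_root by blast
   have "y ~= 0"
   proof
    assume "y = 0"
    hence "coeff ?q 0 = 0" using y by (simp add: poly_0_coeff_0)
    thus False using x by (simp add: coeff_map_poly)
   qed
   hence "(x, y) : torus_zeros f" using zero[of x y] x y by (simp add: ev2_map)
   thus "x : fst ` torus_zeros f" by force
  qed
  ultimately show ?thesis by (meson finite_imageI finite_subset)
 qed
qed

text \<open>After clearing denominators either P divides Q or the two have only finitely many common
  zeros.\<close>

lemma laurent_dichotomy:
 fixes f g :: "'k::alg_closed_field laurent2"
 assumes f: "irreducible f"
 shows "finite {z : torus_zeros f. evL g z = 0} \<or> (\<forall>z\<in>torus_zeros f. evL g z = 0)"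
proof -
 obtain P U where P: "irreducible (to_pp P)" "U dvd 1" "lau P = U * f" using irreducible_clear[OF f] by blast
 obtain N Q where Q: "lau Q = single (int N, int N) 1 * g" using laurent_clear by blast
 have zP: "ev P (fst z) (snd z) = 0" if "z : torus_zeros f" for z
  using that evL_lau[of z P] by (simp add: torus_zeros_def P evL_mult)
 have zQ: "ev Q (fst z) (snd z) = 0 \<longleftrightarrow> evL g z = 0" if "z : torus_zeros f" for z
 proof -
  have "ev Q (fst z) (snd z) = fst z ^ N * snd z ^ N * evL g z"
   using that evL_lau[of z Q] by (simp add: torus_zeros_def Q evL_mult evL_single)
  thus ?thesis using that by (simp add: torus_zeros_def)
 qed
 show ?thesis
 proof (cases "to_pp P dvd to_pp Q")
  case True
  then obtain r where "to_pp Q = to_pp P * r" by (metis dvdE)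
  hence "ev Q a b = ev P a b * ev2 r a b" for a b by (simp add: ev2_to_pp[symmetric] ev2_mult)
  thus ?thesis using zP zQ by simp
 next
  case False
  have "{z : torus_zeros f. evL g z = 0} \<subseteq> {(a, b). ev2 (to_pp P) a b = 0 & ev2 (to_pp Q) a b = 0}"
   using zP zQ by (auto simp: ev2_to_pp)
  thus ?thesis using finite_common_zeros[OF P(1) False] finite_subset by blast
 qed
qed

section \<open>The function field of a curve in the torus\<close>

text \<open>Functions that agree eventually along this filter agree off a finite set of curve
  points; their germs model the function field.\<close>

definition cofin :: "'k::field laurent2 => ('k \<times> 'k) filter" where
 "cofin f = inf cofinite (principal (torus_zeros f))"

lemma eventually_cofin: "eventually P (cofin f) \<longleftrightarrow> finite {z : torus_zeros f. ~ P z}"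
proof -
 have "{z : torus_zeros f. ~ P z} = {z. ~ (z : torus_zeros f --> P z)}" by auto
 thus ?thesis by (simp add: cofin_def eventually_inf_principal eventually_cofinite)
qed

lemma eventually_torus: "eventually (%z. z : torus_zeros f) (cofin f)"
 by (simp add: eventually_cofin)

text \<open>The subfield generated by S, saturated under eventual equality. Total inverses do no
  harm, because on the curve a rational function is eventually zero or eventually nonzero
  (\<open>K_dich\<close>).\<close>

inductive_set gen :: "'z filter => ('z => 'k::field) set => ('z => 'k) set" for F S where
 gen_base: "h : S ==> h : gen F S"
| gen_const: "(%z. c) : gen F S"
| gen_add: "g : gen F S ==> h : gen F S ==> (%z. g z + h z) : gen F S"
| gen_mult: "g : gen F S ==> h : gen F S ==> (%z. g z * h z) : gen F S"
| gen_uminus: "g : gen F S ==> (%z. - g z) : gen F S"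
| gen_inverse: "g : gen F S ==> (%z. inverse (g z)) : gen F S"
| gen_cong: "g : gen F S ==> eventually (%z. g z = h z) F ==> h : gen F S"

lemma gen_trans: "h : gen F S ==> (!!g. g : S ==> g : gen F T) ==> h : gen F T"
 by (induction rule: gen.induct) (auto intro: gen.intros)

lemma gen_diff: "g : gen F S ==> h : gen F S ==> (%z. g z - h z) : gen F S"
 using gen_add[OF _ gen_uminus, of g F S h] by simp

lemma gen_divide: "g : gen F S ==> h : gen F S ==> (%z. g z / h z) : gen F S"
 using gen_mult[OF _ gen_inverse, of g F S h] by (simp add: field_simps)

lemma gen_power: "g : gen F S ==> (%z. g z ^ n) : gen F S"
 by (induction n) (auto intro: gen_const gen_mult)

lemma gen_powi: "g : gen F S ==> (%z. g z powi n) : gen F S"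
 unfolding power_int_def by (cases "n >= 0") (auto intro: gen_power gen_inverse)

lemma gen_sum: "(!!a. a : A ==> g a : gen F S) ==> (%z. \<Sum>a\<in>A. g a z) : gen F S"
 by (induction A rule: infinite_finite_induct) (auto intro: gen_const gen_add)

lemma gen_ev: "u : gen F S ==> v : gen F S ==> (%z. ev P (u z) (v z)) : gen F S"
 unfolding ev_def pmev_def case_prod_unfold by (intro gen_sum gen_mult gen_const gen_power)

lemmas gen_intros = gen_const gen_add gen_mult gen_uminus gen_inverse gen_diff gen_divide gen_power gen_ev

text \<open>R acts as a ring of numerators without zero divisors: the dichotomy decides whether an
  inverse is the swapped fraction or zero.\<close>

lemma gen_fraction:
 assumes h: "h : gen F S" and S: "S \<subseteq> R" and c: "!!c. (%z. c) : R"
  and add: "!!g h. g : R ==> h : R ==> (%z. g z + h z) : R"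
  and mult: "!!g h. g : R ==> h : R ==> (%z. g z * h z) : R"
  and dich: "!!g. g : R ==> eventually (%z. g z = 0) F \<or> eventually (%z. g z ~= 0) F"
 shows "\<exists>n\<in>R. \<exists>d\<in>R. eventually (%z. d z ~= 0 & h z = n z / d z) F"
 using h
proof induction
 case (gen_base h)
 thus ?case using S c[of 1] by (intro bexI[of _ h] bexI[of _ "%z. 1"]) auto
next
 case (gen_const k)
 show ?case using c[of k] c[of 1] by (intro bexI[of _ "%z. k"] bexI[of _ "%z. 1"]) auto
next
 case (gen_add g h)
 then obtain n d n' d' where *: "n : R" "d : R" "n' : R" "d' : R"
  "eventually (%z. d z ~= 0 & g z = n z / d z) F" "eventually (%z. d' z ~= 0 & h z = n' z / d' z) F" by blast
 have "eventually (%z. d z * d' z ~= 0 & g z + h z = (n z * d' z + n' z * d z) / (d z * d' z)) F"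
  using *(5,6) by eventually_elim (simp add: field_simps)
 moreover have "(%z. n z * d' z + n' z * d z) : R" "(%z. d z * d' z) : R" using * by (auto intro: add mult)
 ultimately show ?case by (intro bexI[of _ "%z. n z * d' z + n' z * d z"] bexI[of _ "%z. d z * d' z"])
next
 case (gen_mult g h)
 then obtain n d n' d' where *: "n : R" "d : R" "n' : R" "d' : R"
  "eventually (%z. d z ~= 0 & g z = n z / d z) F" "eventually (%z. d' z ~= 0 & h z = n' z / d' z) F" by blast
 have "eventually (%z. d z * d' z ~= 0 & g z * h z = (n z * n' z) / (d z * d' z)) F"
  using *(5,6) by eventually_elim (simp add: field_simps)
 moreover have "(%z. n z * n' z) : R" "(%z. d z * d' z) : R" using * by (auto intro: mult)
 ultimately show ?case by (intro bexI[of _ "%z. n z * n' z"] bexI[of _ "%z. d z * d' z"])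
next
 case (gen_uminus g)
 then obtain n d where *: "n : R" "d : R" "eventually (%z. d z ~= 0 & g z = n z / d z) F" by blast
 have "eventually (%z. d z ~= 0 & - g z = ((-1) * n z) / d z) F"
  using *(3) by eventually_elim simp
 moreover have "(%z. (-1) * n z) : R" using mult[OF c *(1)] .
 ultimately show ?case using *(2) by (intro bexI[of _ "%z. (-1) * n z"] bexI[of _ d])
next
 case (gen_inverse g)
 then obtain n d where *: "n : R" "d : R" "eventually (%z. d z ~= 0 & g z = n z / d z) F" by blast
 from dich[OF *(1)] show ?case
 proof
  assume "eventually (%z. n z = 0) F"
  hence "eventually (%z. (1::'b) ~= 0 & inverse (g z) = 0 / 1) F" using *(3) by eventually_elim simp
  thus ?thesis using c[of 0] c[of 1] by (intro bexI[of _ "%z. 0"] bexI[of _ "%z. 1"]) auto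
 next
  assume "eventually (%z. n z ~= 0) F"
  hence "eventually (%z. n z ~= 0 & inverse (g z) = d z / n z) F" using *(3) by eventually_elim simp
  thus ?thesis using * by blast
 qed
next
 case (gen_cong g h)
 then obtain n d where *: "n : R" "d : R" "eventually (%z. d z ~= 0 & g z = n z / d z) F" by blast
 have "eventually (%z. d z ~= 0 & h z = n z / d z) F" using *(3) gen_cong(2) by eventually_elim simp
 thus ?case using * by blast
qed

locale curve =
 fixes f :: "'k::alg_closed_field laurent2"
 assumes irr: "irreducible f"
begin

abbreviation "F \<equiv> cofin f"
abbreviation "Z \<equiv> torus_zeros f"

lemma F_neq_bot: "F ~= bot"
proof
 assume "F = bot"
 hence "eventually (%z. False) F" by simp
 thus False using torus_zeros_infinite[OF irr] by (simp add: eventually_cofin)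
qed

lemma laurent_zero_everywhere:
 assumes "eventually (%z. evL g z = 0) F" "z : Z"
 shows "evL g z = 0"
proof -
 have "finite {z : Z. evL g z = 0} ==> False"
 proof -
  assume "finite {z : Z. evL g z = 0}"
  moreover have "finite {z : Z. evL g z ~= 0}" using assms(1) by (simp add: eventually_cofin)
  ultimately have "finite ({z : Z. evL g z = 0} \<union> {z : Z. evL g z ~= 0})" by simp
  moreover have "{z : Z. evL g z = 0} \<union> {z : Z. evL g z ~= 0} = Z" by blast
  ultimately show False using torus_zeros_infinite[OF irr] by simp
 qed
 thus ?thesis using laurent_dichotomy[OF irr, of g] assms(2) by blast
qed

lemma laurent_dich: "eventually (%z. evL g z = 0) F \<or> eventually (%z. evL g z ~= 0) F"
proof -
 have "{z : Z. ~ evL g z ~= 0} = {z : Z. evL g z = 0}"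
  "(\<forall>z\<in>Z. evL g z = 0) ==> {z : Z. ~ evL g z = 0} = {}" by auto
 thus ?thesis using laurent_dichotomy[OF irr, of g] unfolding eventually_cofin by (metis finite.emptyI)
qed

abbreviation "K \<equiv> gen F {fst, snd}"

lemma K_fraction:
 assumes "h : K"
 shows "\<exists>n d. eventually (%z. evL d z ~= 0 & h z = evL n z / evL d z) F"
proof -
 let ?R = "{h :: 'k \<times> 'k => 'k. \<exists>n. \<forall>z. fst z ~= 0 & snd z ~= 0 --> h z = evL n z}"
 have tor: "eventually (%z. fst z ~= 0 & snd z ~= 0) F"
  using eventually_torus by (rule eventually_mono) (simp add: torus_zeros_def)
 have "\<exists>n\<in>?R. \<exists>d\<in>?R. eventually (%z. d z ~= 0 & h z = n z / d z) F"
 proof (rule gen_fraction[OF assms])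
  have "fst : ?R" by (auto intro!: exI[of _ "single (1, 0) 1"] simp: evL_single)
  moreover have "snd : ?R" by (auto intro!: exI[of _ "single (0, 1) 1"] simp: evL_single)
  ultimately show "{fst, snd} \<subseteq> ?R" by blast
  show "(%z. c) : ?R" for c by (auto intro!: exI[of _ "single 0 c"] simp: evL_single)
  fix g h assume "g : ?R" "h : ?R"
  then obtain n m where nm: "\<forall>z. fst z ~= 0 & snd z ~= 0 --> g z = evL n z"
   "\<forall>z. fst z ~= 0 & snd z ~= 0 --> h z = evL m z" by blast
  show "(%z. g z + h z) : ?R" using nm by (intro CollectI exI[of _ "n + m"]) (simp add: evL_add)
  show "(%z. g z * h z) : ?R" using nm by (intro CollectI exI[of _ "n * m"]) (simp add: evL_mult)
 next
  fix g assume "g : ?R"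
  then obtain n where n: "!!z. fst z ~= 0 & snd z ~= 0 ==> g z = evL n z" by blast
  from laurent_dich[of n] show "eventually (%z. g z = 0) F \<or> eventually (%z. g z ~= 0) F"
  proof
   assume "eventually (%z. evL n z = 0) F"
   hence "eventually (%z. g z = 0) F" using tor by eventually_elim (simp add: n)
   thus ?thesis ..
  next
   assume "eventually (%z. evL n z ~= 0) F"
   hence "eventually (%z. g z ~= 0) F" using tor by eventually_elim (simp add: n)
   thus ?thesis ..
  qed
 qed
 then obtain n d n' d' where *: "!!z. fst z ~= 0 & snd z ~= 0 ==> n z = evL n' z"
  "!!z. fst z ~= 0 & snd z ~= 0 ==> d z = evL d' z" "eventually (%z. d z ~= 0 & h z = n z / d z) F" by blast
 have "eventually (%z. evL d' z ~= 0 & h z = evL n' z / evL d' z) F"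
  using *(3) tor by eventually_elim (simp add: *(1,2))
 thus ?thesis by blast
qed

lemma K_dich:
 assumes "h : K"
 shows "eventually (%z. h z = 0) F \<or> eventually (%z. h z ~= 0) F"
proof -
 obtain n d where *: "eventually (%z. evL d z ~= 0 & h z = evL n z / evL d z) F"
  using K_fraction[OF assms] by blast
 from laurent_dich[of n] show ?thesis
 proof
  assume "eventually (%z. evL n z = 0) F"
  hence "eventually (%z. h z = 0) F" using * by eventually_elim simp
  thus ?thesis ..
 next
  assume "eventually (%z. evL n z ~= 0) F"
  hence "eventually (%z. h z ~= 0) F" using * by eventually_elim simp
  thus ?thesis ..
 qed
qed

lemma eventually_point:
 assumes "eventually P F"
 obtains z where "z : Z" "P z"
proof -
 have "infinite (Z - {z : Z. ~ P z})" using assms torus_zeros_infinite[OF irr] by (simp add: eventually_cofin)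
 then obtain z where "z : Z - {z : Z. ~ P z}" by (metis finite.emptyI ex_in_conv)
 thus ?thesis using that by blast
qed

definition gens :: "('k \<times> 'k => 'k) => ('k \<times> 'k => 'k) => bool" where
 "gens u v \<longleftrightarrow> u : K & v : K & fst : gen F {u, v} & snd : gen F {u, v}"

lemma gens_change:
 assumes "gens u v" "u' : gen F {u, v}" "v' : gen F {u, v}" "u : gen F {u', v'}" "v : gen F {u', v'}"
 shows "gens u' v'"
 unfolding gens_def
proof (intro conjI)
 show "u' : K" "v' : K" using assms(1,2,3) gen_trans[of _ F "{u, v}"] by (auto simp: gens_def)
 show "fst : gen F {u', v'}" "snd : gen F {u', v'}" using assms(1,4,5) gen_trans[of _ F "{u, v}"] by (auto simp: gens_def)
qed

lemma gens_K: "gens u v ==> h : gen F {u, v} ==> h : K"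
 using gen_trans[of h F "{u, v}"] by (auto simp: gens_def)

lemma gens_fraction:
 assumes g: "gens u v" and h: "h : gen F {u, v}"
 shows "\<exists>n d. eventually (%z. ev d (u z) (v z) ~= 0 & h z = ev n (u z) (v z) / ev d (u z) (v z)) F"
proof -
 let ?R = "range (%P z. ev P (u z) (v z))"
 have "\<exists>n\<in>?R. \<exists>d\<in>?R. eventually (%z. d z ~= 0 & h z = n z / d z) F"
 proof (rule gen_fraction[OF h])
  have "u : ?R" by (rule range_eqI[of _ _ "single (1, 0) 1"]) (simp add: ev_single)
  moreover have "v : ?R" by (rule range_eqI[of _ _ "single (0, 1) 1"]) (simp add: ev_single)
  ultimately show "{u, v} \<subseteq> ?R" by blast
  show "(%z. c) : ?R" for c by (intro range_eqI[of _ _ "single 0 c"]) (simp add: ev_single)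
  fix g h assume "g : ?R" "h : ?R"
  then obtain n m where "g = (%z. ev n (u z) (v z))" "h = (%z. ev m (u z) (v z))" by blast
  thus "(%z. g z + h z) : ?R" "(%z. g z * h z) : ?R"
   by (auto intro: range_eqI[of _ _ "n + m"] range_eqI[of _ _ "n * m"] simp: ev_add ev_mult)
 next
  fix h assume "h : ?R"
  hence "h : K" using g by (auto simp: gens_def intro: gen_ev)
  thus "eventually (%z. h z = 0) F \<or> eventually (%z. h z ~= 0) F" by (rule K_dich)
 qed
 thus ?thesis by blast
qed

text \<open>Both torus coordinates are fractions in u and v, so off a finite set a point is
  determined by its values of u and v.\<close>

lemma gens_infinite_image:
 assumes g: "gens u v" and P: "eventually P F"
 shows "infinite ((%z. (u z, v z)) ` {z : Z. P z})"
proof -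
 obtain n d where 1: "eventually (%z. ev d (u z) (v z) ~= 0 & fst z = ev n (u z) (v z) / ev d (u z) (v z)) F"
  using gens_fraction[OF g, of fst] g by (auto simp: gens_def)
 obtain n' d' where 2: "eventually (%z. ev d' (u z) (v z) ~= 0 & snd z = ev n' (u z) (v z) / ev d' (u z) (v z)) F"
  using gens_fraction[OF g, of snd] g by (auto simp: gens_def)
 let ?G = "%z. P z & fst z = ev n (u z) (v z) / ev d (u z) (v z) & snd z = ev n' (u z) (v z) / ev d' (u z) (v z)"
 have "eventually ?G F" using 1 2 P by eventually_elim auto
 hence "finite {z : Z. ~ ?G z}" by (simp add: eventually_cofin)
 hence "infinite (Z - {z : Z. ~ ?G z})" using torus_zeros_infinite[OF irr] by simp
 moreover have "Z - {z : Z. ~ ?G z} = {z : Z. ?G z}" by blast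
 ultimately have "infinite {z : Z. ?G z}" by simp
 moreover have "inj_on (%z. (u z, v z)) {z : Z. ?G z}"
  by (rule inj_onI) (auto simp: prod_eq_iff)
 ultimately have "infinite ((%z. (u z, v z)) ` {z : Z. ?G z})" using finite_imageD by blast
 thus ?thesis by (rule infinite_super[rotated]) auto
qed

end

section \<open>Morphisms and birational maps\<close>

text \<open>Two elements of one piece are pulled back with the same nonzero factor c, which
  preserves quotients and vanishing on U. Because G' vanishes outside U, the preimage of an open set
  is the complement of a zero locus in all of X.\<close>

lemma morphism_onI:
 assumes U: "zariski_open X U" and im: "\<phi> ` U \<subseteq> points Y"
  and ne: "!!p. p : points X ==> p ~= {}" "!!q. q : points Y ==> q ~= {}"
  and pb: "!!D G H. D : pieces Y ==> G : D ==> H : D ==> \<exists>E\<in>pieces X. \<exists>G'\<in>E. \<exists>H'\<in>E.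
   (\<forall>p\<in>U. \<forall>v\<in>p. \<forall>w\<in>\<phi> p. \<exists>c. c ~= 0 & G' v = c * G w & H' v = c * H w) & (\<forall>p\<in>points X - U. \<forall>v\<in>p. G' v = 0)"
 shows "morphism_on X U Y \<phi>"
proof -
 have UX: "U \<subseteq> points X" using U by (auto simp: zariski_open_def)
 have op: "zariski_open X {p : U. \<phi> p : W}" if "zariski_open Y W" for W
 proof -
  from that obtain \<F> where \<F>: "\<F> \<subseteq> \<Union>(pieces Y)" "W = points Y - zero_locus Y \<F>" by (auto simp: zariski_open_def)
  define \<G> where "\<G> = {G'. \<exists>E\<in>pieces X. G' : E & (\<exists>G\<in>\<F>. (\<forall>p\<in>U. \<forall>v\<in>p. \<forall>w\<in>\<phi> p. \<exists>c. c ~= 0 & G' v = c * G w) & (\<forall>p\<in>points X - U. \<forall>v\<in>p. G' v = 0))}"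
  have "{p : U. \<phi> p : W} = points X - zero_locus X \<G>"
  proof (intro equalityI subsetI)
   fix p assume "p : {p : U. \<phi> p : W}"
   hence p: "p : U" "\<phi> p : W" by auto
   then obtain G w where G: "G : \<F>" "w : \<phi> p" "G w ~= 0" using im \<F>(2) by (auto simp: zero_locus_def)
   then obtain D where "D : pieces Y" "G : D" using \<F>(1) by auto
   from pb[OF this this(2)] obtain E G' where E: "E : pieces X" "G' : E"
    "\<forall>p\<in>U. \<forall>v\<in>p. \<forall>w\<in>\<phi> p. \<exists>c. c ~= 0 & G' v = c * G w" "\<forall>p\<in>points X - U. \<forall>v\<in>p. G' v = 0" by meson
   hence "G' : \<G>" using G(1) by (auto simp: \<G>_def)
   moreover obtain v where "v : p" using ne(1) p UX by blast
   moreover have "G' v ~= 0" using E(3) p(1) \<open>v : p\<close> G(2,3) by fastforce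
   ultimately show "p : points X - zero_locus X \<G>" using p UX by (auto simp: zero_locus_def)
  next
   fix p assume "p : points X - zero_locus X \<G>"
   then obtain G' v where p: "p : points X" "G' : \<G>" "v : p" "G' v ~= 0" by (auto simp: zero_locus_def)
   then obtain G where G: "G : \<F>" "\<forall>p\<in>U. \<forall>v\<in>p. \<forall>w\<in>\<phi> p. \<exists>c. c ~= 0 & G' v = c * G w" "\<forall>p\<in>points X - U. \<forall>v\<in>p. G' v = 0"
    by (auto simp: \<G>_def)
   have pU: "p : U" using G(3) p by blast
   then obtain w where w: "w : \<phi> p" using ne(2) im by blast
   have "G w ~= 0" using G(2) pU p(3,4) w by fastforce
   thus "p : {p : U. \<phi> p : W}" using pU im w G(1) \<F>(2) by (auto simp: zero_locus_def)
  qed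
  moreover have "\<G> \<subseteq> \<Union>(pieces X)" by (auto simp: \<G>_def)
  ultimately show ?thesis by (auto simp: zariski_open_def)
 qed
 have "regular_on X {p : U. \<phi> p : W} (g \<circ> \<phi>)" if r: "regular_on Y W g" for W g
  unfolding regular_on_def
 proof (intro conjI ballI)
  show "zariski_open X {p : U. \<phi> p : W}" using op r by (simp add: regular_on_def)
  fix p assume "p : {p : U. \<phi> p : W}"
  hence p: "p : U" "\<phi> p : W" by auto
  with r obtain V D G H where V: "zariski_open Y V" "\<phi> p : V" "V \<subseteq> W" "D : pieces Y" "G : D" "H : D"
   "\<forall>q\<in>V. \<forall>v\<in>q. H v ~= 0 & g q = G v / H v" unfolding regular_on_def by meson
  from pb[OF V(4-6)] obtain E G' H' where E: "E : pieces X" "G' : E" "H' : E"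
   "\<forall>p\<in>U. \<forall>v\<in>p. \<forall>w\<in>\<phi> p. \<exists>c. c ~= 0 & G' v = c * G w & H' v = c * H w" by meson
  have "H' v ~= 0 & (g \<circ> \<phi>) q = G' v / H' v" if q: "q : {p : U. \<phi> p : V}" "v : q" for q v
  proof -
   obtain w where w: "w : \<phi> q" using ne(2) im q by blast
   then obtain c where "c ~= 0" "G' v = c * G w" "H' v = c * H w" using E(4) q by blast
   moreover have "H w ~= 0" "g (\<phi> q) = G w / H w" using V(7) q w by auto
   ultimately show ?thesis by simp
  qed
  thus "\<exists>V. zariski_open X V & p : V & V \<subseteq> {p : U. \<phi> p : W} &
    (\<exists>D\<in>pieces X. \<exists>G\<in>D. \<exists>H\<in>D. \<forall>q\<in>V. \<forall>v\<in>q. H v ~= 0 & (g \<circ> \<phi>) q = G v / H v)"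
   using op[OF V(1)] p V(2,3) E(1-3) by (intro exI[of _ "{p : U. \<phi> p : V}"]) blast
 qed
 thus ?thesis using U im op by (simp add: morphism_on_def)
qed

text \<open>Every large exponent k is allowed, so that several compositions can be cleared by the
  same power of the denominator.\<close>

lemma compose_ev_laurent:
 fixes M :: "'k::field poly2" and N0 N1 N2 :: "'k laurent2"
 shows "\<exists>k0. \<forall>k\<ge>k0. \<exists>g. \<forall>z. fst z ~= 0 & snd z ~= 0 & evL N0 z ~= 0 -->
  evL g z = evL N0 z ^ k * ev M (evL N1 z / evL N0 z) (evL N2 z / evL N0 z)"
proof (intro exI[of _ "tdeg M"] allI impI)
 fix k assume k: "tdeg M <= k"
 let ?g = "\<Sum>m\<in>keys M. single 0 (lookup M m) * N1 ^ fst m * N2 ^ snd m * N0 ^ (k - (fst m + snd m))"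
 have "evL ?g z = evL N0 z ^ k * ev M (evL N1 z / evL N0 z) (evL N2 z / evL N0 z)"
  if z: "fst z ~= 0" "snd z ~= 0" "evL N0 z ~= 0" for z
 proof -
  have "evL ?g z = (\<Sum>m\<in>keys M. lookup M m * evL N1 z ^ fst m * evL N2 z ^ snd m * evL N0 z ^ (k - (fst m + snd m)))"
   unfolding evL_sum by (simp add: evL_mult[OF z(1,2)] evL_power[OF z(1,2)] evL_single)
  also have "\<dots> = (\<Sum>m\<in>keys M. evL N0 z ^ k * (lookup M m * ((evL N1 z / evL N0 z) ^ fst m * (evL N2 z / evL N0 z) ^ snd m)))"
  proof (rule sum.cong)
   fix m assume "m : keys M"
   hence "fst m + snd m <= k" using tdeg_ge[of "fst m" "snd m" M] k by simp
   hence "evL N0 z ^ k = evL N0 z ^ (k - (fst m + snd m)) * evL N0 z ^ fst m * evL N0 z ^ snd m"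
    by (simp flip: power_add)
   thus "lookup M m * evL N1 z ^ fst m * evL N2 z ^ snd m * evL N0 z ^ (k - (fst m + snd m)) =
    evL N0 z ^ k * (lookup M m * ((evL N1 z / evL N0 z) ^ fst m * (evL N2 z / evL N0 z) ^ snd m))"
    using z(3) by (simp add: power_divide field_simps)
  qed simp
  finally show ?thesis by (simp add: ev_def pmev_def case_prod_unfold sum_distrib_left)
 qed
 thus "\<exists>g. \<forall>z. fst z ~= 0 & snd z ~= 0 & evL N0 z ~= 0 -->
  evL g z = evL N0 z ^ k * ev M (evL N1 z / evL N0 z) (evL N2 z / evL N0 z)" by blast
qed

text \<open>A power of M0 M1 M2 clears the denominators M0 and also the negative powers of M1/M0 and
  M2/M0.\<close>

lemma compose_laurent_ev:
 fixes M0 M1 M2 :: "'k::field poly2" and g :: "'k laurent2"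
 shows "\<exists>k0. \<forall>k\<ge>k0. \<exists>Q. \<forall>a b. ev (M0 * M1 * M2) a b ~= 0 -->
  ev Q a b = ev (M0 * M1 * M2) a b ^ k * evL g (ev M1 a b / ev M0 a b, ev M2 a b / ev M0 a b)"
proof -
 define k0 where "k0 = nat (\<Sum>m\<in>keys g. \<bar>fst m\<bar> + \<bar>snd m\<bar>)"
 have k0: "\<bar>fst m\<bar> + \<bar>snd m\<bar> <= int k0" if "m : keys g" for m
  using member_le_sum[of m "keys g" "%m. \<bar>fst m\<bar> + \<bar>snd m\<bar>"] that by (simp add: k0_def sum_nonneg)
 show ?thesis
 proof (intro exI[of _ k0] allI impI)
  fix k assume k: "k0 <= k"
  let ?Q = "\<Sum>m\<in>keys g. single 0 (lookup g m) * M0 ^ nat (int k - fst m - snd m) * M1 ^ nat (int k + fst m) * M2 ^ nat (int k + snd m)"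
  have "ev ?Q a b = ev (M0 * M1 * M2) a b ^ k * evL g (ev M1 a b / ev M0 a b, ev M2 a b / ev M0 a b)"
   if z: "ev (M0 * M1 * M2) a b ~= 0" for a b
  proof -
   define x y w where xyw: "x = ev M0 a b" "y = ev M1 a b" "w = ev M2 a b"
   have nz: "x ~= 0" "y ~= 0" "w ~= 0" using z by (auto simp: xyw ev_mult)
   have "ev ?Q a b = (\<Sum>m\<in>keys g. lookup g m * x ^ nat (int k - fst m - snd m) * y ^ nat (int k + fst m) * w ^ nat (int k + snd m))"
    unfolding ev_sum by (simp add: ev_mult ev_power ev_single xyw)
   also have "\<dots> = (\<Sum>m\<in>keys g. (x * y * w) ^ k * (lookup g m * ((y / x) powi fst m * (w / x) powi snd m)))"
   proof (rule sum.cong)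
    fix m assume "m : keys g"
    hence m: "\<bar>fst m\<bar> + \<bar>snd m\<bar> <= int k" using k0 k by fastforce
    have p: "c ^ nat n = c powi n" if "n >= 0" for c :: 'k and n using that by (simp add: power_int_def)
    have "x ^ nat (int k - fst m - snd m) = x powi (int k - fst m - snd m)"
     "y ^ nat (int k + fst m) = y powi (int k + fst m)" "w ^ nat (int k + snd m) = w powi (int k + snd m)"
     using m by (intro p; linarith)+
    moreover have "x powi (int k - fst m - snd m) = x ^ k * x powi (- fst m) * x powi (- snd m)"
     using nz by (simp flip: power_int_of_nat power_int_add)
    moreover have "y powi (int k + fst m) = y ^ k * y powi fst m" "w powi (int k + snd m) = w ^ k * w powi snd m"
     using nz by (simp_all add: power_int_add)
    ultimately show "lookup g m * x ^ nat (int k - fst m - snd m) * y ^ nat (int k + fst m) * w ^ nat (int k + snd m) =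
     (x * y * w) ^ k * (lookup g m * ((y / x) powi fst m * (w / x) powi snd m))"
     by (simp add: power_int_divide_distrib power_int_minus power_mult_distrib field_simps)
   qed simp
   finally show ?thesis by (simp add: eval_laurent2_pmev pmev_def case_prod_unfold sum_distrib_left ev_mult xyw)
  qed
  thus "\<exists>Q. \<forall>a b. ev (M0 * M1 * M2) a b ~= 0 -->
   ev Q a b = ev (M0 * M1 * M2) a b ^ k * evL g (ev M1 a b / ev M0 a b, ev M2 a b / ev M0 a b)" by blast
 qed
qed

text \<open>An affine chart of a variety: \<open>vec a b\<close> is a coordinate vector of the point \<open>cls a b\<close>.\<close>

locale chart =
 fixes Y :: "('w, 'k::alg_closed_field) variety" and vec :: "'k => 'k => 'w" and cls :: "'k => 'k => 'w set"
 assumes cls_points: "cls a b : points Y" and vec_cls: "vec a b : cls a b"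
  and cls_inj: "cls a b = cls a' b' ==> a = a' & b = b'"
  and points_ne: "q : points Y ==> q ~= {}"
  and piece_poly: "D : pieces Y ==> G : D ==> \<exists>M. \<forall>a b. G (vec a b) = ev M a b"
  and piece_hom: "D : pieces Y ==> w : cls a b ==> \<exists>c. c ~= 0 & (\<forall>G\<in>D. G w = c * G (vec a b))"
  and homogenize: "\<exists>D\<in>pieces Y. \<exists>G\<in>D. \<exists>H\<in>D. (\<forall>a b. G (vec a b) = ev M a b & H (vec a b) = ev N a b) &
   (\<forall>q\<in>points Y. (\<forall>a b. q ~= cls a b) --> (\<forall>w\<in>q. G w = 0))"

locale curve_chart = curve f + chart Y vec cls for f :: "'k::alg_closed_field laurent2" and Y vec and cls :: "'k => 'k => 'w set"
begin

lemma points_torus_curve: "points (torus_curve f) = (%z. {z}) ` Z"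
 unfolding torus_curve_def subvariety_def zero_locus_def torus2_def torus_zeros_def by (auto simp: image_iff)

lemma pieces_torus_curve: "pieces (torus_curve f) = {range evL}"
 by (simp add: torus_curve_def subvariety_def torus2_def)

text \<open>On the curve u and v are N1/N0 and N2/N0, and conversely the torus coordinates are M1/M0
  and M2/M0 in u and v. The two maps live where N0, respectively M0 M1 M2, does not vanish;
  identities known off a finite set extend to all these points by \<open>lin\<close> and
  \<open>vanP\<close>.\<close>

theorem birational_chart:
 assumes g: "gens u v" and P: "irreducible (to_pp P)" "eventually (%z. ev P (u z) (v z) = 0) F"
  and F0: "D0 : pieces Y" "F0 : D0" "!!a b. F0 (vec a b) = ev P a b"
 shows "birational (torus_curve f) (subvariety Y F0)"
proof -
 let ?e = evL
 have tor: "eventually (%z. fst z ~= 0 & snd z ~= 0) F"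
  using eventually_torus by (rule eventually_mono) (simp add: torus_zeros_def)
 have uv: "u : K" "v : K" "fst : gen F {u, v}" "snd : gen F {u, v}" using g by (auto simp: gens_def)
 obtain nu du where u: "eventually (%z. ?e du z ~= 0 & u z = ?e nu z / ?e du z) F" using K_fraction[OF uv(1)] by blast
 obtain nv dv where v: "eventually (%z. ?e dv z ~= 0 & v z = ?e nv z / ?e dv z) F" using K_fraction[OF uv(2)] by blast
 obtain N0 N1 N2 where N: "eventually (%z. ?e N0 z ~= 0 & u z = ?e N1 z / ?e N0 z & v z = ?e N2 z / ?e N0 z) F"
 proof (rule that)
  show "eventually (%z. ?e (du * dv) z ~= 0 & u z = ?e (nu * dv) z / ?e (du * dv) z & v z = ?e (nv * du) z / ?e (du * dv) z) F"
   using u v tor by eventually_elim (simp add: evL_mult)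
 qed
 obtain n1 d1 where x: "eventually (%z. ev d1 (u z) (v z) ~= 0 & fst z = ev n1 (u z) (v z) / ev d1 (u z) (v z)) F"
  using gens_fraction[OF g uv(3)] by blast
 obtain n2 d2 where y: "eventually (%z. ev d2 (u z) (v z) ~= 0 & snd z = ev n2 (u z) (v z) / ev d2 (u z) (v z)) F"
  using gens_fraction[OF g uv(4)] by blast
 obtain M0 M1 M2 where M: "eventually (%z. ev M0 (u z) (v z) ~= 0 & fst z = ev M1 (u z) (v z) / ev M0 (u z) (v z) &
   snd z = ev M2 (u z) (v z) / ev M0 (u z) (v z)) F"
 proof (rule that)
  show "eventually (%z. ev (d1 * d2) (u z) (v z) ~= 0 & fst z = ev (n1 * d2) (u z) (v z) / ev (d1 * d2) (u z) (v z) &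
   snd z = ev (n2 * d1) (u z) (v z) / ev (d1 * d2) (u z) (v z)) F"
   using x y by eventually_elim (simp add: ev_mult)
 qed
 define a where "a z = ?e N1 z / ?e N0 z" for z
 define b where "b z = ?e N2 z / ?e N0 z" for z
 let ?m = "M0 * M1 * M2"
 define X' where "X' s t = (ev M1 s t / ev M0 s t, ev M2 s t / ev M0 s t)" for s t
 have Zt: "fst z ~= 0 & snd z ~= 0" if "z : Z" for z using that by (simp add: torus_zeros_def)
 have compN: "\<exists>k0. \<forall>k\<ge>k0. \<exists>g. \<forall>z. fst z ~= 0 & snd z ~= 0 & ?e N0 z ~= 0 --> ?e g z = ?e N0 z ^ k * ev Q (a z) (b z)" for Q
  using compose_ev_laurent[of N0 Q N1 N2] unfolding a_def b_def .
 have compM: "\<exists>k0. \<forall>k\<ge>k0. \<exists>Q. \<forall>s t. ev ?m s t ~= 0 --> ev Q s t = ev ?m s t ^ k * ?e g (X' s t)" for g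
  using compose_laurent_ev[of M0 M1 M2 g] unfolding X'_def .
 have lin: "ev Q1 (a z) (b z) * c1 z = ev Q2 (a z) (b z)" if "z : Z" "?e N0 z ~= 0"
  "eventually (%z. ev Q1 (u z) (v z) * c1 z = ev Q2 (u z) (v z)) F" "!!z. fst z ~= 0 ==> snd z ~= 0 ==> c1 z = ?e C z" for Q1 Q2 c1 C z
 proof -
  obtain k1 where k1: "\<forall>k\<ge>k1. \<exists>g. \<forall>z. fst z ~= 0 & snd z ~= 0 & ?e N0 z ~= 0 --> ?e g z = ?e N0 z ^ k * ev Q1 (a z) (b z)" using compN by blast
  obtain k2 where k2: "\<forall>k\<ge>k2. \<exists>g. \<forall>z. fst z ~= 0 & snd z ~= 0 & ?e N0 z ~= 0 --> ?e g z = ?e N0 z ^ k * ev Q2 (a z) (b z)" using compN by blast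
  let ?k = "max k1 k2"
  obtain g1 where g1: "!!z. fst z ~= 0 & snd z ~= 0 & ?e N0 z ~= 0 ==> ?e g1 z = ?e N0 z ^ ?k * ev Q1 (a z) (b z)" using k1 by fastforce
  obtain g2 where g2: "!!z. fst z ~= 0 & snd z ~= 0 & ?e N0 z ~= 0 ==> ?e g2 z = ?e N0 z ^ ?k * ev Q2 (a z) (b z)" using k2 by fastforce
  have d: "?e (g1 * C - g2) z = ?e N0 z ^ ?k * (ev Q1 (a z) (b z) * c1 z - ev Q2 (a z) (b z))"
   if "fst z ~= 0" "snd z ~= 0" "?e N0 z ~= 0" for z
  proof -
   have "?e (g1 * C - g2) z = ?e (g1 * C) z + ?e (- g2) z" by (simp flip: evL_add)
   also have "\<dots> = ?e N0 z ^ ?k * (ev Q1 (a z) (b z) * c1 z - ev Q2 (a z) (b z))"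
    using that \<open>!!z. fst z ~= 0 ==> snd z ~= 0 ==> c1 z = ?e C z\<close> by (simp add: evL_mult evL_uminus g1 g2 algebra_simps)
   finally show ?thesis .
  qed
  have "eventually (%z. ?e (g1 * C - g2) z = 0) F"
   using that(3) N tor by eventually_elim (simp add: d a_def b_def)
  from laurent_zero_everywhere[OF this that(1)] show ?thesis using d[of z] that Zt by simp
 qed
 have van: "ev Q (a z) (b z) = 0" if "z : Z" "?e N0 z ~= 0" "eventually (%z. ev Q (u z) (v z) = 0) F" for Q z
  using lin[of z Q "%_. 1" 0 1] that by simp
 \<comment> \<open>A polynomial that vanishes on the image has infinitely many zeros in common with
   the irreducible P, so it is a multiple of P.\<close>
 have vanP: "ev Q s t = 0" if "ev P s t = 0" "eventually (%z. ev Q (u z) (v z) = 0) F" for Q s t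
 proof -
  have "to_pp P dvd to_pp Q"
  proof (rule ccontr)
   assume neg: "~ ?thesis"
   have "eventually (%z. ev P (u z) (v z) = 0 & ev Q (u z) (v z) = 0) F" using P(2) that(2) by eventually_elim simp
   from gens_infinite_image[OF g this] have "infinite {(s, t). ev2 (to_pp P) s t = 0 & ev2 (to_pp Q) s t = 0}"
    by (rule infinite_super[rotated]) (auto simp: ev2_to_pp)
   thus False using finite_common_zeros[OF P(1) neg] by simp
  qed
  then obtain r where "to_pp Q = to_pp P * r" by (auto simp: dvd_def)
  hence "ev Q s t = ev P s t * ev2 r s t" by (simp add: ev2_to_pp[symmetric] ev2_mult)
  thus ?thesis using that(1) by simp
 qed
 have mnz: "eventually (%z. ev ?m (u z) (v z) ~= 0) F" using M tor by eventually_elim (auto simp: ev_mult)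
 have X'uv: "eventually (%z. X' (u z) (v z) = z) F" using M by eventually_elim (simp add: X'_def prod_eq_iff)
 let ?X = "torus_curve f" and ?Y = "subvariety Y F0"
 define U where "U = (%z. {z}) ` {z : Z. ?e N0 z ~= 0}"
 define V where "V = {cls s t | s t. ev P s t = 0 & ev ?m s t ~= 0}"
 define \<phi> where "\<phi> p = cls (a (the_elem p)) (b (the_elem p))" for p :: "('k \<times> 'k) set"
 \<comment> \<open>The chart coordinates of a point are picked by choice; \<open>cls_inj\<close>
   makes them unique.\<close>
 define \<psi> where "\<psi> q = {X' (fst (SOME r. q = cls (fst r) (snd r))) (snd (SOME r. q = cls (fst r) (snd r)))}" for q
 have psi: "\<psi> (cls s t) = {X' s t}" for s t
 proof -
  have "cls s t = cls (fst (SOME r. cls s t = cls (fst r) (snd r))) (snd (SOME r. cls s t = cls (fst r) (snd r)))"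
   by (rule someI[of _ "(s, t)"]) simp
  from cls_inj[OF this] show ?thesis by (simp add: \<psi>_def)
 qed
 have phi: "\<phi> {z} = cls (a z) (b z)" for z by (simp add: \<phi>_def)
 have F0cls: "F0 w = 0 \<longleftrightarrow> ev P s t = 0" if "w : cls s t" for w s t
  using piece_hom[OF F0(1) that] F0(2,3) by force
 have pY: "points ?Y = {q : points Y. \<forall>w\<in>q. F0 w = 0}" by (simp add: subvariety_def zero_locus_def)
 have piY: "pieces ?Y = pieces Y" by (simp add: subvariety_def)
 have clsY: "cls s t : points ?Y \<longleftrightarrow> ev P s t = 0" for s t
  unfolding pY using cls_points F0cls vec_cls by blast
 have ux: "zariski_open ?X U" unfolding zariski_open_def
 proof (intro exI[of _ "{?e N0}"] conjI)
  show "{?e N0} \<subseteq> \<Union>(pieces ?X)" by (simp add: pieces_torus_curve)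
  show "U = points ?X - zero_locus ?X {?e N0}" unfolding points_torus_curve zero_locus_def U_def by auto
 qed
 have vy: "zariski_open ?Y V" unfolding zariski_open_def
 proof -
  obtain D G where G: "D : pieces Y" "G : D" "\<forall>a b. G (vec a b) = ev ?m a b"
   "\<forall>q\<in>points Y. (\<forall>a b. q ~= cls a b) --> (\<forall>w\<in>q. G w = 0)" using homogenize[of ?m ?m] by blast
  have Gc: "G w = 0 \<longleftrightarrow> ev ?m s t = 0" if "w : cls s t" for w s t using piece_hom[OF G(1) that] G(2,3) by force
  have "V = points ?Y - zero_locus ?Y {G}"
  proof (intro equalityI subsetI)
   fix q assume "q : V"
   then obtain s t where q: "q = cls s t" "ev P s t = 0" "ev ?m s t ~= 0" by (auto simp: V_def)
   thus "q : points ?Y - zero_locus ?Y {G}" using clsY Gc[OF vec_cls, of s t] vec_cls[of s t] by (auto simp: zero_locus_def)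
  next
   fix q assume q: "q : points ?Y - zero_locus ?Y {G}"
   then obtain w where w: "w : q" "G w ~= 0" by (auto simp: zero_locus_def)
   have "q : points Y" using q pY by blast
   then obtain s t where st: "q = cls s t" using G(4) w by blast
   hence "ev P s t = 0" using q clsY by blast
   thus "q : V" using st Gc w by (auto simp: V_def)
  qed
  thus "\<exists>\<F>\<subseteq>\<Union> (pieces ?Y). V = points ?Y - zero_locus ?Y \<F>" using G by (intro exI[of _ "{G}"]) (auto simp: piY)
 qed
 have neX: "p ~= {}" if "p : points ?X" for p using that by (auto simp: points_torus_curve)
 have neY: "q ~= {}" if "q : points ?Y" for q using that points_ne by (auto simp: pY)
 have m1: "morphism_on ?X U ?Y \<phi>"
 proof (rule morphism_onI[OF ux _ neX neY])
  show "\<phi> ` U \<subseteq> points ?Y" using van P(2) by (auto simp: U_def phi clsY)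
  fix D G H assume D: "D : pieces ?Y" "G : D" "H : D"
  hence D': "D : pieces Y" by (simp add: piY)
  obtain Q1 where Q1: "!!s t. G (vec s t) = ev Q1 s t" using piece_poly[OF D' D(2)] by blast
  obtain Q2 where Q2: "!!s t. H (vec s t) = ev Q2 s t" using piece_poly[OF D' D(3)] by blast
  obtain k1 where k1: "\<forall>k\<ge>k1. \<exists>g. \<forall>z. fst z ~= 0 & snd z ~= 0 & ?e N0 z ~= 0 --> ?e g z = ?e N0 z ^ k * ev Q1 (a z) (b z)" using compN by blast
  obtain k2 where k2: "\<forall>k\<ge>k2. \<exists>g. \<forall>z. fst z ~= 0 & snd z ~= 0 & ?e N0 z ~= 0 --> ?e g z = ?e N0 z ^ k * ev Q2 (a z) (b z)" using compN by blast
  let ?k = "max k1 k2"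
  obtain g1 where g1: "!!z. fst z ~= 0 & snd z ~= 0 & ?e N0 z ~= 0 ==> ?e g1 z = ?e N0 z ^ ?k * ev Q1 (a z) (b z)" using k1 by fastforce
  obtain g2 where g2: "!!z. fst z ~= 0 & snd z ~= 0 & ?e N0 z ~= 0 ==> ?e g2 z = ?e N0 z ^ ?k * ev Q2 (a z) (b z)" using k2 by fastforce
  \<comment> \<open>The extra factor N0 makes the pulled back forms vanish outside U.\<close>
  have "\<exists>c. c ~= 0 & ?e (N0 * g1) z = c * G w & ?e (N0 * g2) z = c * H w"
   if "z : Z" "?e N0 z ~= 0" "w : cls (a z) (b z)" for z w
  proof -
   obtain c where c: "c ~= 0" "G w = c * G (vec (a z) (b z))" "H w = c * H (vec (a z) (b z))"
    using piece_hom[OF D' \<open>w : cls (a z) (b z)\<close>] D by blast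
   show ?thesis
    by (rule exI[of _ "?e N0 z ^ Suc ?k / c"]) (use c that Zt[OF that(1)] in \<open>simp add: evL_mult g1 g2 Q1 Q2\<close>)
  qed
  moreover have "?e (N0 * g1) z = 0" if "z : Z" "?e N0 z = 0" for z using that Zt[OF that(1)] by (simp add: evL_mult)
  ultimately show "\<exists>E\<in>pieces ?X. \<exists>G'\<in>E. \<exists>H'\<in>E.
   (\<forall>p\<in>U. \<forall>v\<in>p. \<forall>w\<in>\<phi> p. \<exists>c. c ~= 0 & G' v = c * G w & H' v = c * H w) & (\<forall>p\<in>points ?X - U. \<forall>v\<in>p. G' v = 0)"
   unfolding pieces_torus_curve points_torus_curve
   by (intro bexI[of _ "range ?e"] bexI[of _ "?e (N0 * g1)"] bexI[of _ "?e (N0 * g2)"] conjI) (auto simp: U_def phi)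
 qed
 have compM_van: "ev Q s t = 0" if "ev P s t = 0" "ev ?m s t ~= 0" "eventually (%z. ev Q (u z) (v z) = 0) F" for Q s t
  using vanP that by blast
 have fX': "X' s t : Z" if st: "ev P s t = 0" "ev ?m s t ~= 0" for s t
 proof -
  obtain k Q where Q: "!!s t. ev ?m s t ~= 0 ==> ev Q s t = ev ?m s t ^ k * ?e f (X' s t)" using compM[of f] by blast
  have "eventually (%z. ev Q (u z) (v z) = 0) F"
   using mnz X'uv eventually_torus by eventually_elim (simp add: Q torus_zeros_def)
  from vanP[OF st(1) this] have "?e f (X' s t) = 0" using Q st by simp
  moreover have "fst (X' s t) ~= 0 & snd (X' s t) ~= 0" using st by (auto simp: X'_def ev_mult)
  ultimately show ?thesis by (simp add: torus_zeros_def)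
 qed
 have m2: "morphism_on ?Y V ?X \<psi>"
 proof (rule morphism_onI[OF vy _ neY neX])
  show "\<psi> ` V \<subseteq> points ?X" using fX' by (auto simp: V_def psi points_torus_curve)
  fix D G H assume D: "D : pieces ?X" "G : D" "H : D"
  then obtain g1 g2 where g12: "G = ?e g1" "H = ?e g2" by (auto simp: pieces_torus_curve)
  obtain k1 where k1: "\<forall>k\<ge>k1. \<exists>Q. \<forall>s t. ev ?m s t ~= 0 --> ev Q s t = ev ?m s t ^ k * ?e g1 (X' s t)" using compM by blast
  obtain k2 where k2: "\<forall>k\<ge>k2. \<exists>Q. \<forall>s t. ev ?m s t ~= 0 --> ev Q s t = ev ?m s t ^ k * ?e g2 (X' s t)" using compM by blast
  let ?k = "max k1 k2"
  obtain Q1 where Q1: "!!s t. ev ?m s t ~= 0 ==> ev Q1 s t = ev ?m s t ^ ?k * ?e g1 (X' s t)" using k1 by fastforce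
  obtain Q2 where Q2: "!!s t. ev ?m s t ~= 0 ==> ev Q2 s t = ev ?m s t ^ ?k * ?e g2 (X' s t)" using k2 by fastforce
  from homogenize[of "?m * Q1" "?m * Q2"] obtain E G' H' where E0: "E : pieces Y" "G' : E" "H' : E"
   "\<forall>s t. G' (vec s t) = ev (?m * Q1) s t & H' (vec s t) = ev (?m * Q2) s t"
   "\<forall>q\<in>points Y. (\<forall>a b. q ~= cls a b) --> (\<forall>w\<in>q. G' w = 0)" by (elim bexE conjE) iprover
  have E: "E : pieces Y" "G' : E" "H' : E" "!!s t. G' (vec s t) = ev (?m * Q1) s t" "!!s t. H' (vec s t) = ev (?m * Q2) s t"
   "!!q w. q : points Y ==> (\<forall>a b. q ~= cls a b) ==> w : q ==> G' w = 0" using E0 by simp_all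
  have e1: "\<exists>c. c ~= 0 & G' w = c * G (X' s t) & H' w = c * H (X' s t)" if "ev ?m s t ~= 0" "w : cls s t" for s t w
  proof -
   from piece_hom[OF E(1) that(2)] E(2,3) obtain c where c: "c ~= 0" "G' w = c * G' (vec s t)" "H' w = c * H' (vec s t)" by blast
   show ?thesis by (rule exI[of _ "c * ev ?m s t ^ Suc ?k"]) (use c that(1) in \<open>simp add: E(4,5) ev_mult[of ?m] Q1 Q2 g12\<close>)
  qed
  have e2: "G' w = 0" if "q : points ?Y" "q \<notin> V" "w : q" for q w
  proof (cases "\<exists>s t. q = cls s t")
   case True
   then obtain s t where q: "q = cls s t" by blast
   hence "ev ?m s t = 0" using that clsY by (auto simp: V_def)
   moreover from that(3) q have "w : cls s t" by simp
   from piece_hom[OF E(1) this] E(2) obtain c where "G' w = c * G' (vec s t)" by blast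
   ultimately show ?thesis by (simp add: E(4) ev_mult[of ?m])
  next
   case False
   thus ?thesis using E(6)[of q w] that pY by blast
  qed
  have A: "\<forall>p\<in>V. \<forall>v\<in>p. \<forall>w\<in>\<psi> p. \<exists>c. c ~= 0 & G' v = c * G w & H' v = c * H w" using e1 by (auto simp: V_def psi)
  have B: "\<forall>p\<in>points ?Y - V. \<forall>v\<in>p. G' v = 0" using e2 by blast
  show "\<exists>E\<in>pieces ?Y. \<exists>G'\<in>E. \<exists>H'\<in>E.
   (\<forall>p\<in>V. \<forall>v\<in>p. \<forall>w\<in>\<psi> p. \<exists>c. c ~= 0 & G' v = c * G w & H' v = c * H w) & (\<forall>p\<in>points ?Y - V. \<forall>v\<in>p. G' v = 0)"
   unfolding piY by (rule bexI[of _ E], rule bexI[of _ G'], rule bexI[of _ H'], rule conjI[OF A B]) (rule E)+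
 qed
 have back1: "X' (a z) (b z) = z" if z: "z : Z" "?e N0 z ~= 0" "ev ?m (a z) (b z) ~= 0" for z
 proof -
  have "eventually (%z. ev M0 (u z) (v z) * fst z = ev M1 (u z) (v z)) F" using M by eventually_elim simp
  moreover have "eventually (%z. ev M0 (u z) (v z) * snd z = ev M2 (u z) (v z)) F" using M by eventually_elim simp
  ultimately have "ev M0 (a z) (b z) * fst z = ev M1 (a z) (b z)" "ev M0 (a z) (b z) * snd z = ev M2 (a z) (b z)"
   using lin[of z M0 fst M1 "single (1, 0) 1"] lin[of z M0 snd M2 "single (0, 1) 1"] z by (simp_all add: evL_single)
  moreover have "ev M0 (a z) (b z) ~= 0" using z(3) by (auto simp: ev_mult)
  ultimately show ?thesis by (simp add: X'_def prod_eq_iff field_simps)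
 qed
 have back2: "a (X' s t) = s & b (X' s t) = t" if st: "ev P s t = 0" "ev ?m s t ~= 0" "?e N0 (X' s t) ~= 0" for s t
 proof -
  obtain k0 where k0: "\<forall>k\<ge>k0. \<exists>Q. \<forall>s t. ev ?m s t ~= 0 --> ev Q s t = ev ?m s t ^ k * ?e N0 (X' s t)" using compM by blast
  obtain k1 where k1: "\<forall>k\<ge>k1. \<exists>Q. \<forall>s t. ev ?m s t ~= 0 --> ev Q s t = ev ?m s t ^ k * ?e N1 (X' s t)" using compM by blast
  obtain k2 where k2: "\<forall>k\<ge>k2. \<exists>Q. \<forall>s t. ev ?m s t ~= 0 --> ev Q s t = ev ?m s t ^ k * ?e N2 (X' s t)" using compM by blast
  let ?k = "k0 + k1 + k2"
  obtain Q0 where Q0: "!!s t. ev ?m s t ~= 0 ==> ev Q0 s t = ev ?m s t ^ ?k * ?e N0 (X' s t)" using k0 by fastforce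
  obtain Q1 where Q1: "!!s t. ev ?m s t ~= 0 ==> ev Q1 s t = ev ?m s t ^ ?k * ?e N1 (X' s t)" using k1 by fastforce
  obtain Q2 where Q2: "!!s t. ev ?m s t ~= 0 ==> ev Q2 s t = ev ?m s t ^ ?k * ?e N2 (X' s t)" using k2 by fastforce
  have s1: "eventually (%z. ev (single (1, 0) 1 * Q0 - Q1) (u z) (v z) = 0) F"
   using N mnz X'uv by eventually_elim (simp add: ev_diff ev_mult[of "single _ _"] ev_single Q0 Q1 Q2)
  have s2: "eventually (%z. ev (single (0, 1) 1 * Q0 - Q2) (u z) (v z) = 0) F"
   using N mnz X'uv by eventually_elim (simp add: ev_diff ev_mult[of "single _ _"] ev_single Q0 Q1 Q2)
  from vanP[OF st(1) s1] vanP[OF st(1) s2] st(2)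
  have "s * ?e N0 (X' s t) = ?e N1 (X' s t)" "t * ?e N0 (X' s t) = ?e N2 (X' s t)"
   by (simp_all add: ev_diff ev_mult[of "single _ _"] ev_single Q0 Q1 Q2)
  thus ?thesis using st(3) by (simp add: a_def b_def field_simps)
 qed
 have "eventually (%z. ?e N0 z ~= 0 & ev P (a z) (b z) = 0 & ev ?m (a z) (b z) ~= 0) F"
  using N P(2) mnz by eventually_elim (simp add: a_def b_def)
 from eventually_point[OF this] obtain z where z: "z : Z" "?e N0 z ~= 0" "ev P (a z) (b z) = 0" "ev ?m (a z) (b z) ~= 0" by blast
 show ?thesis unfolding birational_def
 proof (intro exI[of _ U] exI[of _ V] exI[of _ \<phi>] exI[of _ \<psi>] conjI ballI impI)
  show "morphism_on ?X U ?Y \<phi>" "morphism_on ?Y V ?X \<psi>" by fact+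
  have "{z} : U" "\<phi> {z} : V" using z by (auto simp: U_def V_def phi)
  thus "{p : U. \<phi> p : V} ~= {}" by blast
  have "cls (a z) (b z) : V" "\<psi> (cls (a z) (b z)) : U" using z back1[of z] by (auto simp: U_def V_def psi)
  thus "{q : V. \<psi> q : U} ~= {}" by blast
 next
  fix p assume "p : U" "\<phi> p : V"
  then obtain z where z: "p = {z}" "z : Z" "?e N0 z ~= 0" "cls (a z) (b z) : V" by (auto simp: U_def phi)
  from z(4) obtain s t where st: "cls (a z) (b z) = cls s t" "ev ?m s t ~= 0" unfolding V_def by blast
  hence "ev ?m (a z) (b z) ~= 0" using cls_inj[OF st(1)] by simp
  thus "\<psi> (\<phi> p) = p" using back1 z by (simp add: phi psi)
 next
  fix q assume "q : V" "\<psi> q : U"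
  then obtain s t where st: "q = cls s t" "ev P s t = 0" "ev ?m s t ~= 0" "{X' s t} : U" by (auto simp: V_def psi)
  hence "?e N0 (X' s t) ~= 0" by (auto simp: U_def)
  thus "\<phi> (\<psi> q) = q" using back2[of s t] st by (simp add: psi phi)
 qed
qed

end

section \<open>Reindexing of exponents and irreducibility of homogenizations\<close>

definition push :: "('x => 'y) => ('x \<Rightarrow>\<^sub>0 'k::comm_ring_1) => ('y \<Rightarrow>\<^sub>0 'k)" where
 "push \<pi> P = (\<Sum>k\<in>keys P. single (\<pi> k) (lookup P k))"

lemma push_superset: "finite S ==> keys P \<subseteq> S ==> push \<pi> P = (\<Sum>k\<in>S. single (\<pi> k) (lookup P k))"
 unfolding push_def by (rule sum.mono_neutral_left) (auto simp: in_keys_iff)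

lemma push_add: "push \<pi> (P + Q) = push \<pi> P + push \<pi> Q"
proof -
 let ?S = "keys P \<union> keys Q"
 have "keys (P + Q) \<subseteq> ?S" by (rule Poly_Mapping.keys_add)
 thus ?thesis by (simp add: push_superset[of ?S] lookup_add single_add sum.distrib)
qed

lemma push_single: "push \<pi> (single k c) = single (\<pi> k) c"
 by (simp add: push_def)

lemma push_0 [simp]: "push \<pi> 0 = 0"
 by (simp add: push_def)

lemma push_sum: "push \<pi> (sum P A) = (\<Sum>a\<in>A. push \<pi> (P a))"
 by (induction A rule: infinite_finite_induct) (simp_all add: push_add)

lemma push_mult:
 assumes "!!a b. \<pi> (a + b) = \<pi> a + \<pi> b"
 shows "push \<pi> (P * Q) = push \<pi> P * push \<pi> Q"
proof -
 have "push \<pi> (P * Q) = (\<Sum>a\<in>keys P. \<Sum>b\<in>keys Q. single (\<pi> a + \<pi> b) (lookup P a * lookup Q b))"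
  by (simp add: mult_as_sum[of P Q] push_sum push_single assms)
 also have "\<dots> = push \<pi> P * push \<pi> Q" unfolding push_def sum_product by (simp add: mult_single)
 finally show ?thesis .
qed

lemma keys_push: "keys (push \<pi> P) \<subseteq> \<pi> ` keys P"
proof -
 have "keys (push \<pi> P) \<subseteq> (\<Union>k\<in>keys P. keys (single (\<pi> k) (lookup P k)))" unfolding push_def by (rule Poly_Mapping.keys_sum)
 thus ?thesis by (auto split: if_splits)
qed

lemma pmev_push: "pmev \<phi> (push \<pi> P) = pmev (%k. \<phi> (\<pi> k)) P"
 unfolding push_def pmev_sum pmev_single by (simp add: pmev_def)

lemma push_push_inverse: "(!!k. \<pi> (\<rho> k) = k) ==> push \<pi> (push \<rho> P) = P"
 unfolding push_def[of \<rho>] push_sum push_single by (simp add: sum_single)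

lemma single_0_unit:
 fixes c :: "'k::field"
 assumes "c ~= 0"
 shows "single (0 :: 'x::comm_monoid_add) c dvd 1"
proof -
 have "single (0 :: 'x) c * single 0 (inverse c) = 1" using assms by (simp add: mult_single)
 thus ?thesis by (metis dvd_triv_left)
qed

lemma to_pp_mult:
 fixes P Q :: "'k::alg_closed_field poly2"
 shows "to_pp (P * Q) = to_pp P * to_pp Q"
 by (rule ev2_inject) (simp add: ev2_mult ev2_to_pp ev_mult)

lemma to_pp_unit:
 fixes P :: "'k::alg_closed_field poly2"
 assumes "to_pp P dvd 1"
 obtains c where "c ~= 0" "P = single 0 c"
proof -
 obtain k where k: "k ~= 0" "to_pp P = [:[:k:]:]" using poly_poly_unit_const[OF assms] by blast
 have "ev P a b = k" for a b using ev2_to_pp[of P a b] k by (simp add: ev2_def)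
 hence "P = single 0 k" by (intro ev_inject) (simp add: ev_single)
 thus ?thesis using that k by blast
qed

lemma keys_const_mult:
 fixes P :: "'x::comm_monoid_add \<Rightarrow>\<^sub>0 'k::field"
 assumes "c ~= 0"
 shows "keys (P * single 0 c) = keys P"
proof -
 have sub: "keys (P * single 0 c) \<subseteq> keys P" for P :: "'x \<Rightarrow>\<^sub>0 'k" and c
  using keys_mult[of P "single 0 c"] by (fastforce split: if_splits)
 have "P = (P * single 0 c) * single 0 (inverse c)" using assms by (simp add: mult.assoc mult_single)
 hence "keys P \<subseteq> keys (P * single 0 c)" using sub[of "P * single 0 c" "inverse c"] by metis
 thus ?thesis using sub by blast
qed

text \<open>A polynomial that is homogeneous for the weights in \<open>\<Omega>\<close> is irreducible if its dehomogenization
  along \<open>\<pi>\<close> is, provided that no weight drops.\<close>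

lemma irreducible_homogeneous:
 fixes F :: "'x::comm_monoid_add \<Rightarrow>\<^sub>0 'k::alg_closed_field" and \<pi> :: "'x => nat \<times> nat" and \<Omega> :: "(('x => nat) \<times> (nat \<times> nat => nat) \<times> nat) set"
 assumes irr: "irreducible (to_pp (push \<pi> F))" and pi: "!!a b. \<pi> (a + b) = \<pi> a + \<pi> b" "\<pi> 0 = 0"
  and sep: "!!S :: 'x set. finite S ==> separated S"
  and add: "!!\<omega> \<omega>' W a b. (\<omega>, \<omega>', W) : \<Omega> ==> \<omega> (a + b) = \<omega> a + \<omega> b"
  and le: "!!\<omega> \<omega>' W k. (\<omega>, \<omega>', W) : \<Omega> ==> \<omega>' (\<pi> k) <= \<omega> k"
  and hom: "!!\<omega> \<omega>' W k. (\<omega>, \<omega>', W) : \<Omega> ==> k : keys F ==> \<omega> k = W"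
  and att: "!!\<omega> \<omega>' W. (\<omega>, \<omega>', W) : \<Omega> ==> \<exists>k\<in>keys (push \<pi> F). \<omega>' k = W"
  and zero: "!!k. (!!\<omega> \<omega>' W. (\<omega>, \<omega>', W) : \<Omega> ==> \<omega> k = 0) ==> k = 0"
 shows "irreducible F"
proof (rule irreducibleI)
 have p0: "push \<pi> F ~= 0" using irr to_pp_eq_0[of "push \<pi> F"] by auto
 thus F0: "F ~= 0" by auto
 show "~ F dvd 1"
 proof
  assume "F dvd 1"
  then obtain H where "1 = F * H" by (auto simp: dvd_def)
  hence "push \<pi> 1 = push \<pi> F * push \<pi> H" using push_mult[OF pi(1)] by metis
  moreover have "push \<pi> (1 :: 'x \<Rightarrow>\<^sub>0 'k) = 1" using push_single[of \<pi> 0 1] pi(2) by simp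
  ultimately have "1 = push \<pi> F * push \<pi> H" by simp
  hence "to_pp 1 = to_pp (push \<pi> F) * to_pp (push \<pi> H)" by (metis to_pp_mult)
  moreover have "to_pp (1 :: 'k poly2) = 1" by (rule ev2_inject) (simp add: ev2_to_pp, simp add: ev2_def)
  ultimately have "to_pp (push \<pi> F) dvd 1" by (metis dvd_triv_left)
  thus False using irr irreducible_not_unit by blast
 qed
 \<comment> \<open>The dehomogenization of B is constant, so A has the same dehomogenized support as
   F. Every weight W is attained there and is thus used up by A; all weights of B vanish and B is a
   constant.\<close>
 have half: "B dvd 1" if AB: "F = A * B" and u: "to_pp (push \<pi> B) dvd 1" for A B
 proof -
  have nz: "A ~= 0" "B ~= 0" using AB F0 by auto
  obtain c where c: "c ~= 0" "push \<pi> B = single 0 c" using to_pp_unit[OF u] by blast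
  have "push \<pi> F = push \<pi> A * single 0 c" using AB c by (simp add: push_mult[OF pi(1)])
  hence kA: "keys (push \<pi> F) = keys (push \<pi> A)" using keys_const_mult[OF c(1)] by metis
  have "k = 0" if k: "k : keys B" for k
  proof (rule zero)
   fix \<omega> \<omega>' W assume w: "(\<omega>, \<omega>', W) : \<Omega>"
   obtain p q where pq: "p : keys A" "q : keys B" "p + q : keys (A * B)"
    "!!a. a : keys A ==> \<omega> a <= \<omega> p" "!!b. b : keys B ==> \<omega> b <= \<omega> q"
    using weight_mult[OF nz sep, of \<omega>] add[OF w] by auto
   have "\<omega> p + \<omega> q = W" using hom[OF w] pq(3) AB add[OF w] by metis
   moreover obtain k' where "k' : keys (push \<pi> A)" "\<omega>' k' = W" using att[OF w] kA by blast
   moreover from this have "k' : \<pi> ` keys A" using keys_push[of \<pi> A] by blast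
   then obtain k0 where "k0 : keys A" "k' = \<pi> k0" by blast
   ultimately have "\<omega> q = 0" using le[OF w, of k0] pq(4)[of k0] by simp
   thus "\<omega> k = 0" using pq(5)[OF k] by simp
  qed
  hence "keys B \<subseteq> {0}" by blast
  hence "B = single 0 (lookup B 0)" by (intro poly_mapping_eqI) (auto simp: lookup_single when_def in_keys_iff)
  moreover from this have "lookup B 0 ~= 0" using nz by (metis single_zero)
  ultimately show ?thesis using single_0_unit by metis
 qed
 fix A B assume AB: "F = A * B"
 have "to_pp (push \<pi> F) = to_pp (push \<pi> A) * to_pp (push \<pi> B)" by (simp add: AB push_mult[OF pi(1)] to_pp_mult)
 hence "to_pp (push \<pi> A) dvd 1 \<or> to_pp (push \<pi> B) dvd 1" using irr irreducibleD by blast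
 thus "A dvd 1 \<or> B dvd 1" using half[OF AB] half[of B A] AB by (metis mult.commute)
qed

section \<open>Charts of the projective plane and of the product of two lines\<close>

lemma eval_poly3_pmev: "eval_poly3 F (x, y, z) = pmev (%(i, j, l). x ^ i * y ^ j * z ^ l) F"
 unfolding eval_poly3_def pmev_def by (simp add: case_prod_unfold mult.assoc)

lemma eval_poly22_pmev: "eval_poly22 F ((x, y), (z, w)) = pmev (%((i, j), (l, m)). x ^ i * y ^ j * z ^ l * w ^ m) F"
 unfolding eval_poly22_def pmev_def by (simp add: case_prod_unfold mult.assoc)

definition hom3 :: "nat => 'k::comm_ring_1 poly2 => 'k poly3" where
 "hom3 d = push (%(i, j). (i, j, d - (i + j)))"

definition hom22 :: "nat => nat => 'k::comm_ring_1 poly2 => 'k poly22" where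
 "hom22 m n = push (%(i, j). ((i, m - i), (j, n - j)))"

lemma hom3_homogeneous: "(!!i j. (i, j) : keys P ==> i + j <= d) ==> homogeneous d (hom3 d P)"
 using keys_push[of "%(i, j). (i, j, d - (i + j))" P] unfolding homogeneous_def hom3_def by fastforce

lemma hom22_bihomogeneous: "(!!i j. (i, j) : keys P ==> i <= m & j <= n) ==> bihomogeneous m n (hom22 m n P)"
 using keys_push[of "%(i, j). ((i, m - i), (j, n - j))" P] unfolding bihomogeneous_def hom22_def by fastforce

lemma eval_hom3: "eval_poly3 (hom3 d P) (a, b, 1) = ev P a b"
 unfolding eval_poly3_pmev hom3_def pmev_push ev_def by (simp add: case_prod_unfold)

lemma eval_hom22: "eval_poly22 (hom22 m n P) ((a, 1), (b, 1)) = ev P a b"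
 unfolding eval_poly22_pmev hom22_def pmev_push ev_def by (simp add: case_prod_unfold)

lemma eval_poly3_scale:
 fixes F :: "'k::comm_ring_1 poly3"
 assumes "homogeneous d F"
 shows "eval_poly3 F (c * x, c * y, c * z) = c ^ d * eval_poly3 F (x, y, z)"
proof -
 have "eval_poly3 F (c * x, c * y, c * z) = (\<Sum>k\<in>keys F. c ^ d * (lookup F k * (x ^ fst k * y ^ fst (snd k) * z ^ snd (snd k))))"
  unfolding eval_poly3_pmev pmev_def case_prod_unfold
 proof (rule sum.cong)
  fix k assume "k : keys F"
  hence "c ^ d = c ^ fst k * c ^ fst (snd k) * c ^ snd (snd k)" using assms unfolding homogeneous_def by (fastforce simp flip: power_add)
  thus "lookup F k * ((c * x) ^ fst k * (c * y) ^ fst (snd k) * (c * z) ^ snd (snd k)) = c ^ d * (lookup F k * (x ^ fst k * y ^ fst (snd k) * z ^ snd (snd k)))"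
   by (simp add: power_mult_distrib mult_ac)
 qed simp
 thus ?thesis unfolding eval_poly3_pmev pmev_def case_prod_unfold by (simp add: sum_distrib_left)
qed

lemma eval_poly22_scale:
 fixes F :: "'k::comm_ring_1 poly22"
 assumes "bihomogeneous m n F"
 shows "eval_poly22 F ((c * x, c * y), (e * z, e * w)) = c ^ m * e ^ n * eval_poly22 F ((x, y), (z, w))"
proof -
 have "eval_poly22 F ((c * x, c * y), (e * z, e * w)) = (\<Sum>k\<in>keys F. (c ^ m * e ^ n) * (lookup F k * (x ^ fst (fst k) * y ^ snd (fst k) * z ^ fst (snd k) * w ^ snd (snd k))))"
  unfolding eval_poly22_pmev pmev_def case_prod_unfold
 proof (rule sum.cong)
  fix k assume "k : keys F"
  hence "fst (fst k) + snd (fst k) = m" "fst (snd k) + snd (snd k) = n" using assms unfolding bihomogeneous_def by fastforce+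
  hence "c ^ m = c ^ fst (fst k) * c ^ snd (fst k)" "e ^ n = e ^ fst (snd k) * e ^ snd (snd k)" by (simp_all flip: power_add)
  thus "lookup F k * ((c * x) ^ fst (fst k) * (c * y) ^ snd (fst k) * (e * z) ^ fst (snd k) * (e * w) ^ snd (snd k)) =
   (c ^ m * e ^ n) * (lookup F k * (x ^ fst (fst k) * y ^ snd (fst k) * z ^ fst (snd k) * w ^ snd (snd k)))"
   by (simp add: power_mult_distrib mult_ac)
 qed simp
 thus ?thesis unfolding eval_poly22_pmev pmev_def case_prod_unfold by (simp add: sum_distrib_left)
qed

lemma keys_le_tdeg: "(i, j) : keys P ==> tdeg P < d ==> i + j < d"
 using tdeg_ge[of i j P] by linarith

lemma hom3_at_infinity:
 fixes P :: "'k::comm_ring_1 poly2"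
 assumes "tdeg P < d"
 shows "eval_poly3 (hom3 d P) (x, y, 0) = 0"
 unfolding eval_poly3_pmev hom3_def pmev_push unfolding pmev_def
proof (rule sum.neutral, rule ballI)
 fix k assume "k : keys P"
 hence "d - (fst k + snd k) > 0" using keys_le_tdeg[of "fst k" "snd k" P d] assms by simp
 thus "lookup P k * (case case k of (i, j) => (i, j, d - (i + j)) of (i, j, l) => x ^ i * y ^ j * 0 ^ l) = 0"
  by (simp add: case_prod_unfold zero_power)
qed

lemma hom22_at_infinity:
 fixes P :: "'k::comm_ring_1 poly2"
 assumes "tdeg P < m" "tdeg P < n" "y = 0 \<or> w = 0"
 shows "eval_poly22 (hom22 m n P) ((x, y), (z, w)) = 0"
 unfolding eval_poly22_pmev hom22_def pmev_push unfolding pmev_def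
proof (rule sum.neutral, rule ballI)
 fix k assume "k : keys P"
 hence "m - fst k > 0" "n - snd k > 0" using keys_le_tdeg[of "fst k" "snd k" P m] keys_le_tdeg[of "fst k" "snd k" P n] assms by simp_all
 thus "lookup P k * (%((i, j), (l, m)). x ^ i * y ^ j * z ^ l * w ^ m) ((%(i, j). ((i, m - i), (j, n - j))) k) = 0"
  using assms(3) by (auto simp: case_prod_unfold zero_power)
qed

definition plane_pt :: "'k::field => 'k => ('k \<times> 'k \<times> 'k) set" where
 "plane_pt a b = {(c * a, c * b, c) | c. c ~= 0}"

definition lines_pt :: "'k::field => 'k => (('k \<times> 'k) \<times> ('k \<times> 'k)) set" where
 "lines_pt a b = {((c * a, c), (e * b, e)) | c e. c ~= 0 & e ~= 0}"

lemma plane_pt_scale: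
 fixes z :: "'k::field"
 assumes z: "z ~= 0"
 shows "{(c * x, c * y, c * z) | c. c ~= 0} = plane_pt (x / z) (y / z)"
proof (intro equalityI subsetI)
 fix w assume "w : {(c * x, c * y, c * z) | c. c ~= 0}"
 then obtain c where c: "w = (c * x, c * y, c * z)" "c ~= 0" by blast
 hence "w = ((c * z) * (x / z), (c * z) * (y / z), c * z)" "c * z ~= 0" using z by simp_all
 thus "w : plane_pt (x / z) (y / z)" unfolding plane_pt_def by blast
next
 fix w assume "w : plane_pt (x / z) (y / z)"
 then obtain c where c: "w = (c * (x / z), c * (y / z), c)" "c ~= 0" unfolding plane_pt_def by blast
 hence "w = ((c / z) * x, (c / z) * y, (c / z) * z)" "c / z ~= 0" using z by simp_all
 thus "w : {(c * x, c * y, c * z) | c. c ~= 0}" by blast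
qed

lemma lines_pt_scale:
 fixes y t :: "'k::field"
 assumes z: "y ~= 0" "t ~= 0"
 shows "{((c * x, c * y), (e * z, e * t)) | c e. c ~= 0 & e ~= 0} = lines_pt (x / y) (z / t)"
proof (intro equalityI subsetI)
 fix w assume "w : {((c * x, c * y), (e * z, e * t)) | c e. c ~= 0 & e ~= 0}"
 then obtain c e where c: "w = ((c * x, c * y), (e * z, e * t))" "c ~= 0" "e ~= 0" by blast
 hence "w = (((c * y) * (x / y), c * y), ((e * t) * (z / t), e * t))" "c * y ~= 0" "e * t ~= 0" using z by simp_all
 thus "w : lines_pt (x / y) (z / t)" unfolding lines_pt_def by blast
next
 fix w assume "w : lines_pt (x / y) (z / t)"
 then obtain c e where c: "w = ((c * (x / y), c), (e * (z / t), e))" "c ~= 0" "e ~= 0" unfolding lines_pt_def by blast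
 hence "w = (((c / y) * x, (c / y) * y), ((e / t) * z, (e / t) * t))" "c / y ~= 0" "e / t ~= 0" using z by simp_all
 thus "w : {((c * x, c * y), (e * z, e * t)) | c e. c ~= 0 & e ~= 0}" by blast
qed

lemma plane_points_cases:
 assumes "q : points (proj_plane :: ('k::field \<times> 'k \<times> 'k, 'k) variety)"
 shows "(\<exists>a b. q = plane_pt a b) \<or> (\<forall>w\<in>q. \<exists>x y. w = (x, y, 0))"
proof -
 obtain x y z where q: "q = {(c * x, c * y, c * z) | c. c ~= 0}" using assms unfolding proj_plane_def by auto
 show ?thesis
 proof (cases "z = 0")
  case True
  thus ?thesis unfolding q by auto
 next
  case False
  thus ?thesis unfolding q plane_pt_scale[OF False] by blast
 qed
qed

lemma lines_points_cases:
 assumes "q : points (proj_line_sq :: (('k::field \<times> 'k) \<times> ('k \<times> 'k), 'k) variety)"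
 shows "(\<exists>a b. q = lines_pt a b) \<or> (\<forall>w\<in>q. \<exists>x y z t. w = ((x, y), (z, t)) & (y = 0 \<or> t = 0))"
proof -
 obtain x y z t where q: "q = {((c * x, c * y), (e * z, e * t)) | c e. c ~= 0 & e ~= 0}" using assms unfolding proj_line_sq_def by auto
 show ?thesis
 proof (cases "y = 0 \<or> t = 0")
  case True
  thus ?thesis unfolding q by auto
 next
  case False
  hence "y ~= 0" "t ~= 0" by auto
  from lines_pt_scale[OF this] show ?thesis unfolding q by blast
 qed
qed

lemma plane_pt_points: "plane_pt a b : points (proj_plane :: ('k::field \<times> 'k \<times> 'k, 'k) variety)"
proof -
 have "plane_pt a b = {(c * a, c * b, c * 1) | c. c ~= 0}" using plane_pt_scale[of "1::'k" a b] by simp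
 moreover have "(a, b, 1::'k) ~= (0, 0, 0)" by simp
 ultimately show ?thesis unfolding proj_plane_def variety.simps by blast
qed

lemma lines_pt_points: "lines_pt a b : points (proj_line_sq :: (('k::field \<times> 'k) \<times> ('k \<times> 'k), 'k) variety)"
proof -
 have "lines_pt a b = {((c * a, c * 1), (e * b, e * 1)) | c e. c ~= 0 & e ~= 0}" using lines_pt_scale[of "1::'k" 1 a b] by simp
 moreover have "(a, 1::'k) ~= (0, 0)" "(b, 1::'k) ~= (0, 0)" by simp_all
 ultimately show ?thesis unfolding proj_line_sq_def variety.simps by blast
qed

lemma plane_pt_mem: "(a, b, 1) : plane_pt a b"
 unfolding plane_pt_def by (auto intro: exI[of _ 1])

lemma lines_pt_mem: "((a, 1), (b, 1)) : lines_pt a b"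
 unfolding lines_pt_def by (auto intro: exI[of _ 1])

lemma plane_pt_inj: "plane_pt a b = plane_pt a' b' ==> a = a' & b = b'"
 using plane_pt_mem[of a b] by (simp add: plane_pt_def)

lemma lines_pt_inj: "lines_pt a b = lines_pt a' b' ==> a = a' & b = b'"
 using lines_pt_mem[of a b] by (simp add: lines_pt_def)

lemma plane_chart: "chart (proj_plane :: ('k::alg_closed_field \<times> 'k \<times> 'k, 'k) variety) (%a b. (a, b, 1)) plane_pt"
proof (rule chart.intro)
 show "plane_pt a b : points (proj_plane :: ('k \<times> 'k \<times> 'k, 'k) variety)" for a b by (rule plane_pt_points)
 show "(a, b, 1) : plane_pt a b" for a b :: 'k by (rule plane_pt_mem)
 show "a = a' & b = b'" if "plane_pt a b = plane_pt a' b'" for a b a' b' :: 'k using that by (rule plane_pt_inj)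
 show "q ~= {}" if T: "q : points (proj_plane :: ('k \<times> 'k \<times> 'k, 'k) variety)" for q
  using T unfolding proj_plane_def by (auto intro: exI[of _ 1])
 show "\<exists>M. \<forall>a b. G (a, b, 1) = ev M a b" if T: "D : pieces (proj_plane :: ('k \<times> 'k \<times> 'k, 'k) variety)" "G : D" for D G
 proof -
  obtain F where F: "G = eval_poly3 F" using T unfolding proj_plane_def by auto
  have "G (a, b, 1) = ev (push (%(i, j, l). (i, j)) F) a b" for a b
   unfolding F eval_poly3_pmev ev_def pmev_push by (simp add: case_prod_unfold)
  thus ?thesis by blast
 qed
 show "\<exists>c. c ~= 0 & (\<forall>G\<in>D. G w = c * G (a, b, 1))" if T: "D : pieces (proj_plane :: ('k \<times> 'k \<times> 'k, 'k) variety)" "w : plane_pt a b" for D w a b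
 proof -
  obtain d c where d: "D = eval_poly3 ` {F. homogeneous d F}" "w = (c * a, c * b, c)" "c ~= 0"
   using T unfolding proj_plane_def plane_pt_def by auto
  have "G w = c ^ d * G (a, b, 1)" if GD: "G : D" for G
  proof -
   obtain F where "G = eval_poly3 F" "homogeneous d F" using d GD by blast
   thus ?thesis using eval_poly3_scale[of d F c a b 1] d by simp
  qed
  thus ?thesis using d(3) by (intro exI[of _ "c ^ d"]) simp
 qed
 show "\<exists>D\<in>pieces proj_plane. \<exists>G\<in>D. \<exists>H\<in>D. (\<forall>a b. G (a, b, 1) = ev M a b & H (a, b, 1) = ev N a b) &
   (\<forall>q\<in>points proj_plane. (\<forall>a b. q ~= plane_pt a b) --> (\<forall>w\<in>q. G w = 0))" for M N :: "'k poly2"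
 proof -
  \<comment> \<open>Strictly above both degrees, so that each term contains the coordinate that is
    zero at infinity.\<close>
  define d where "d = Suc (tdeg M + tdeg N)"
  define D where "D = eval_poly3 ` {F :: 'k poly3. homogeneous d F}"
  have "D : pieces proj_plane" unfolding proj_plane_def D_def by auto
  moreover have "i + j <= d" if "(i, j) : keys M \<or> (i, j) : keys N" for i j
   using that tdeg_ge[of i j M] tdeg_ge[of i j N] by (auto simp: d_def)
  hence "homogeneous d (hom3 d M)" "homogeneous d (hom3 d N)" by (auto intro!: hom3_homogeneous)
  hence "eval_poly3 (hom3 d M) : D" "eval_poly3 (hom3 d N) : D" unfolding D_def by auto
  moreover have "eval_poly3 (hom3 d M) w = 0" if T: "q : points proj_plane" "\<forall>a b. q ~= plane_pt a b" "w : q" for q w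
  proof -
   obtain x y where "w = (x, y, 0)" using plane_points_cases[OF T(1)] T(2,3) by blast
   thus ?thesis using hom3_at_infinity[of M d x y] by (simp add: d_def)
  qed
  ultimately show ?thesis
   by (intro bexI[of _ D] bexI[of _ "eval_poly3 (hom3 d M)"] bexI[of _ "eval_poly3 (hom3 d N)"]) (simp_all add: eval_hom3)
 qed
qed

lemma lines_chart: "chart (proj_line_sq :: (('k::alg_closed_field \<times> 'k) \<times> ('k \<times> 'k), 'k) variety) (%a b. ((a, 1), (b, 1))) lines_pt"
proof (rule chart.intro)
 show "lines_pt a b : points (proj_line_sq :: (('k \<times> 'k) \<times> ('k \<times> 'k), 'k) variety)" for a b by (rule lines_pt_points)
 show "((a, 1), (b, 1)) : lines_pt a b" for a b :: 'k by (rule lines_pt_mem)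
 show "a = a' & b = b'" if "lines_pt a b = lines_pt a' b'" for a b a' b' :: 'k using that by (rule lines_pt_inj)
 show "q ~= {}" if T: "q : points (proj_line_sq :: (('k \<times> 'k) \<times> ('k \<times> 'k), 'k) variety)" for q
 proof -
  obtain x y z t where q: "q = {((c * x, c * y), (e * z, e * t)) | c e. c ~= 0 & e ~= 0}" using T unfolding proj_line_sq_def by auto
  have "((1 * x, 1 * y), (1 * z, 1 * t)) : q" unfolding q by (rule CollectI, rule exI[of _ 1], rule exI[of _ 1]) simp
  thus ?thesis by blast
 qed
 show "\<exists>M. \<forall>a b. G ((a, 1), (b, 1)) = ev M a b" if T: "D : pieces (proj_line_sq :: (('k \<times> 'k) \<times> ('k \<times> 'k), 'k) variety)" "G : D" for D G
 proof -
  obtain F where F: "G = eval_poly22 F" using T unfolding proj_line_sq_def by auto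
  have "G ((a, 1), (b, 1)) = ev (push (%((i, j), (l, m)). (i, l)) F) a b" for a b
   unfolding F eval_poly22_pmev ev_def pmev_push by (simp add: case_prod_unfold)
  thus ?thesis by blast
 qed
 show "\<exists>c. c ~= 0 & (\<forall>G\<in>D. G w = c * G ((a, 1), (b, 1)))"
  if T: "D : pieces (proj_line_sq :: (('k \<times> 'k) \<times> ('k \<times> 'k), 'k) variety)" "w : lines_pt a b" for D w a b
 proof -
  obtain m n c e where d: "D = eval_poly22 ` {F. bihomogeneous m n F}" "w = ((c * a, c), (e * b, e))" "c ~= 0" "e ~= 0"
   using T unfolding proj_line_sq_def lines_pt_def by auto
  have "G w = c ^ m * e ^ n * G ((a, 1), (b, 1))" if GD: "G : D" for G
  proof -
   obtain F where "G = eval_poly22 F" "bihomogeneous m n F" using d GD by blast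
   thus ?thesis using eval_poly22_scale[of m n F c a 1 e b 1] d by simp
  qed
  thus ?thesis using d(3,4) by (intro exI[of _ "c ^ m * e ^ n"]) simp
 qed
 show "\<exists>D\<in>pieces proj_line_sq. \<exists>G\<in>D. \<exists>H\<in>D. (\<forall>a b. G ((a, 1), (b, 1)) = ev M a b & H ((a, 1), (b, 1)) = ev N a b) &
   (\<forall>q\<in>points proj_line_sq. (\<forall>a b. q ~= lines_pt a b) --> (\<forall>w\<in>q. G w = 0))" for M N :: "'k poly2"
 proof -
  define d where "d = Suc (tdeg M + tdeg N)"
  define D where "D = eval_poly22 ` {F :: 'k poly22. bihomogeneous d d F}"
  have "D : pieces proj_line_sq" unfolding proj_line_sq_def D_def by auto
  moreover have "i <= d & j <= d" if "(i, j) : keys M \<or> (i, j) : keys N" for i j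
   using that tdeg_ge[of i j M] tdeg_ge[of i j N] by (auto simp: d_def)
  hence "bihomogeneous d d (hom22 d d M)" "bihomogeneous d d (hom22 d d N)" by (auto intro!: hom22_bihomogeneous)
  hence "eval_poly22 (hom22 d d M) : D" "eval_poly22 (hom22 d d N) : D" unfolding D_def by auto
  moreover have "eval_poly22 (hom22 d d M) w = 0" if T: "q : points proj_line_sq" "\<forall>a b. q ~= lines_pt a b" "w : q" for q w
  proof -
   obtain x y z t where "w = ((x, y), (z, t))" "y = 0 \<or> t = 0" using lines_points_cases[OF T(1)] T(2,3) by blast
   thus ?thesis using hom22_at_infinity[of M d d y t x z] by (simp add: d_def)
  qed
  ultimately show ?thesis
   by (intro bexI[of _ D] bexI[of _ "eval_poly22 (hom22 d d M)"] bexI[of _ "eval_poly22 (hom22 d d N)"]) (simp_all add: eval_hom22)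
 qed
qed

section \<open>From relations between generators to the invariants of the curve\<close>

text \<open>The description in \<open>s11_curve\<close> denotes: take the least first component and
  then the least second one belonging to it.\<close>

lemma lex_minimum:
 fixes S :: "(nat \<times> nat) set"
 assumes "s : S"
 shows "lex_le (THE m. m : S & (\<forall>m'\<in>S. lex_le m m')) s"
proof -
 define a where "a = (LEAST a. \<exists>b. (a, b) : S)"
 define b where "b = (LEAST b. (a, b) : S)"
 have "\<exists>b. (a, b) : S" unfolding a_def by (rule LeastI[of _ "fst s"]) (use assms in \<open>auto intro: exI[of _ "snd s"]\<close>)
 hence ab: "(a, b) : S" unfolding b_def by (rule LeastI_ex)
 have min: "lex_le (a, b) m" if "m : S" for m
 proof -
  have "a <= fst m" unfolding a_def by (rule Least_le) (use that in \<open>auto intro: exI[of _ "snd m"]\<close>)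
  moreover have "b <= snd m" if "fst m = a" unfolding b_def by (rule Least_le) (use that \<open>m : S\<close> in \<open>metis prod.collapse\<close>)
  ultimately show ?thesis by (auto simp: lex_le_def)
 qed
 have "(THE m. m : S & (\<forall>m'\<in>S. lex_le m m')) = (a, b)"
 proof (rule the_equality)
  fix m assume m: "m : S & (\<forall>m'\<in>S. lex_le m m')"
  hence "lex_le m (a, b)" "lex_le (a, b) m" using ab min by blast+
  thus "m = (a, b)" by (auto simp: lex_le_def prod_eq_iff)
 qed (use ab min in blast)
 thus ?thesis using min[OF assms] by simp
qed

lemma lex_le_trans: "lex_le p q ==> lex_le q r ==> lex_le p r"
 by (auto simp: lex_le_def)

lemma tdeg_attained:
 assumes "P ~= 0"
 obtains k where "k : keys P" "fst k + snd k = tdeg P"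
proof -
 have "tdeg P : insert 0 ((%(i, j). i + j) ` keys P)" unfolding tdeg_def by (rule Max_in) auto
 then consider "tdeg P = 0" | k where "k : keys P" "tdeg P = fst k + snd k" by (auto simp: case_prod_unfold)
 thus ?thesis
 proof cases
  case 1
  obtain k where k: "k : keys P" using assms by (metis ex_in_conv keys_eq_empty)
  hence "fst k + snd k <= tdeg P" using tdeg_ge[of "fst k" "snd k" P] by simp
  thus ?thesis using that[OF k] 1 by simp
 next
  case 2
  thus ?thesis using that by simp
 qed
qed

lemma max_attained:
 fixes w :: "'x => nat"
 assumes "P ~= 0"
 obtains k where "k : keys P" "!!l. l : keys P ==> w l <= w k"
proof -
 obtain k where k: "k : keys P" "w k = Max (w ` keys P)" using Max_in[of "w ` keys P"] assms by fastforce
 show ?thesis by (rule that[OF k(1)]) (simp add: k(2))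
qed

lemma irreducible_push_swap:
 fixes P :: "'k::alg_closed_field poly2"
 assumes irr: "irreducible (to_pp P)"
 shows "irreducible (to_pp (push prod.swap P))"
proof (rule to_pp_irreducibleI)
 have sw: "push prod.swap (push prod.swap Q) = Q" for Q :: "'k poly2" by (rule push_push_inverse) simp
 have P0: "P ~= 0" using irr to_pp_eq_0[of P] by auto
 show "push prod.swap P ~= 0" using P0 sw[of P] by (metis push_0)
 show "push prod.swap P ~= single 0 c" for c
 proof
  assume *: "push prod.swap P = single 0 c"
  hence P: "P = single 0 c" using sw[of P] by (simp add: push_single zero_prod_def)
  hence "c ~= 0" using P0 by auto
  have "to_pp P * to_pp (single 0 (inverse c)) = to_pp (single 0 1)" using P \<open>c ~= 0\<close> by (simp add: to_pp_mult[symmetric] mult_single)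
  moreover have "to_pp (single 0 1 :: 'k poly2) = 1" by (rule ev2_inject) (simp add: ev2_to_pp, simp add: ev2_def)
  ultimately have "to_pp P dvd 1" by (metis dvd_triv_left)
  thus False using irr irreducible_not_unit by blast
 qed
 fix G H assume "push prod.swap P = G * H"
 hence "P = push prod.swap G * push prod.swap H" using sw[of P] push_mult[of prod.swap G H] by (simp add: prod_eq_iff)
 hence "to_pp P = to_pp (push prod.swap G) * to_pp (push prod.swap H)" by (simp add: to_pp_mult)
 hence d: "to_pp (push prod.swap G) dvd 1 \<or> to_pp (push prod.swap H) dvd 1" using irr irreducibleD by blast
 have unit: "tdeg G = 0" if u: "to_pp (push prod.swap G) dvd 1" for G :: "'k poly2"
 proof -
  obtain c where "push prod.swap G = single 0 c" using to_pp_unit[OF u] by blast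
  hence "G = single 0 c" using sw[of G] by (simp add: push_single zero_prod_def)
  thus ?thesis by (simp add: tdeg_def zero_prod_def split: if_splits)
 qed
 from d show "tdeg G = 0 \<or> tdeg H = 0"
 proof
  assume "to_pp (push prod.swap G) dvd 1"
  thus ?thesis using unit[of G] by simp
 next
  assume "to_pp (push prod.swap H) dvd 1"
  thus ?thesis using unit[of H] by simp
 qed
qed

context curve begin

text \<open>A degree bound is carried by the support S of some nonzero relation. Coordinate changes
  may spoil irreducibility; it is recovered once at the end by passing to a factor.\<close>

definition rel :: "('k \<times> 'k => 'k) => ('k \<times> 'k => 'k) => (nat \<times> nat) set => bool" where
 "rel u v S \<longleftrightarrow> gens u v & (\<exists>P. P ~= 0 & keys P \<subseteq> S & eventually (%z. ev P (u z) (v z) = 0) F)"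

lemma relI: "gens u v ==> P ~= 0 ==> keys P \<subseteq> S ==> eventually (%z. ev P (u z) (v z) = 0) F ==> rel u v S"
 unfolding rel_def by blast

lemma rel_mono: "rel u v S ==> S \<subseteq> T ==> rel u v T"
 unfolding rel_def by blast

lemma gens_swap: "gens u v ==> gens v u"
 unfolding gens_def by (simp add: insert_commute)

text \<open>A relation of minimal total degree among those supported in a set cut out by upper bounds for
  additive weights is irreducible, because its factors are supported in the same set.\<close>

lemma irreducible_relation:
 fixes \<omega> \<omega>' :: "nat \<times> nat => nat"
 assumes r: "rel u v {k. \<omega> k <= n & \<omega>' k <= n'}"
  and add: "!!a b. \<omega> (a + b) = \<omega> a + \<omega> b" "!!a b. \<omega>' (a + b) = \<omega>' a + \<omega>' b"
 obtains P where "irreducible (to_pp P)" "keys P \<subseteq> {k. \<omega> k <= n & \<omega>' k <= n'}" "eventually (%z. ev P (u z) (v z) = 0) F"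
proof -
 let ?S = "{k. \<omega> k <= n & \<omega>' k <= n'}"
 define C where "C = {P. P ~= 0 & keys P \<subseteq> ?S & eventually (%z. ev P (u z) (v z) = 0) F}"
 have g: "gens u v" and "\<exists>P. P : C" using r unfolding rel_def C_def by auto
 then obtain P where P: "P : C" "!!Q. Q : C ==> tdeg P <= tdeg Q"
  using exists_least_iff[of "%n. \<exists>P\<in>C. tdeg P = n"] by (metis not_le)
 hence P1: "P ~= 0" "keys P \<subseteq> ?S" "eventually (%z. ev P (u z) (v z) = 0) F" by (auto simp: C_def)
 have uv: "u : K" "v : K" using g by (auto simp: gens_def)
 have sub: "keys G \<subseteq> ?S" if GH: "P = G * H" "G ~= 0" "H ~= 0" for G H
 proof -
  obtain p q where pq: "p + q : keys (G * H)" "!!a. a : keys G ==> \<omega> a <= \<omega> p"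
   by (rule weight_mult[OF GH(2,3) separated_poly2 add(1)]) auto
  obtain p' q' where pq': "p' + q' : keys (G * H)" "!!a. a : keys G ==> \<omega>' a <= \<omega>' p'"
   by (rule weight_mult[OF GH(2,3) separated_poly2 add(2)]) auto
  have "\<omega> p + \<omega> q <= n" "\<omega>' p' + \<omega>' q' <= n'" using pq(1) pq'(1) GH(1) P1(2) add by (metis (mono_tags) mem_Collect_eq subsetD)+
  thus ?thesis using pq(2) pq'(2) by fastforce
 qed
 have half: "tdeg H = 0" if "P = G * H" "G ~= 0" "H ~= 0" "eventually (%z. ev G (u z) (v z) = 0) F" for G H
 proof -
  have "G : C" using that sub[OF that(1-3)] by (auto simp: C_def)
  hence "tdeg P <= tdeg G" by (rule P(2))
  thus ?thesis using tdeg_mult[OF that(2,3)] that(1) by simp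
 qed
 have "irreducible (to_pp P)"
 proof (rule to_pp_irreducibleI[OF P1(1)])
  show "P ~= single 0 c" for c
  proof
   assume "P = single 0 c"
   hence "c ~= 0" "eventually (%z. c = 0) F" using P1 by (auto simp: ev_single)
   thus False using F_neq_bot by simp
  qed
  fix G H assume GH: "P = G * H" "G ~= 0" "H ~= 0"
  have "(%z. ev G (u z) (v z)) : K" using uv by (rule gen_ev)
  from K_dich[OF this] show "tdeg G = 0 \<or> tdeg H = 0"
  proof
   assume "eventually (%z. ev G (u z) (v z) = 0) F"
   from half[OF GH this] show ?thesis ..
  next
   assume "eventually (%z. ev G (u z) (v z) ~= 0) F"
   hence "eventually (%z. ev H (u z) (v z) = 0) F" using P1(3) by eventually_elim (simp add: GH ev_mult)
   thus ?thesis using half[of H G] GH by (simp add: mult.commute)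
  qed
 qed
 thus ?thesis using that P1 by blast
qed

theorem s2_le:
 assumes "rel u v {(i, j). i + j <= d}"
 shows "s2_curve (torus_curve f) <= d"
proof -
 have "rel u v {k. fst k + snd k <= d & fst k + snd k <= d}" using assms by (simp add: case_prod_unfold)
 from irreducible_relation[OF this] obtain P where P: "irreducible (to_pp P)" "keys P \<subseteq> {k. fst k + snd k <= d}"
  "eventually (%z. ev P (u z) (v z) = 0) F" by auto
 have P0: "P ~= 0" using P(1) to_pp_eq_0[of P] by auto
 let ?F = "hom3 (tdeg P) P"
 let ?\<pi> = "%(i, j, l). (i, j) :: nat \<times> nat"
 have pi: "push ?\<pi> ?F = P" unfolding hom3_def by (rule push_push_inverse) auto
 obtain k where k: "k : keys P" "fst k + snd k = tdeg P" using tdeg_attained[OF P0] by blast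
 have hom: "homogeneous (tdeg P) ?F" by (rule hom3_homogeneous) (rule tdeg_ge)
 have "irreducible ?F"
 proof (rule irreducible_homogeneous[where \<pi> = ?\<pi> and \<Omega> = "{(%(i, j, l). i + j + l, %(i, j). i + j, tdeg P)}"])
  show "irreducible (to_pp (push ?\<pi> ?F))" unfolding pi by (rule P(1))
  show "!!S :: (nat \<times> nat \<times> nat) set. finite S ==> separated S" by (rule separated_poly3)
  show "\<omega> k = W" if "(\<omega>, \<omega>', W) : {(%(i, j, l). i + j + l, %(i, j). i + j, tdeg P)}" "k : keys ?F" for \<omega> \<omega>' W k
   using that hom by (auto simp: homogeneous_def)
 qed (use k pi in \<open>auto simp: zero_prod_def case_prod_unfold\<close>)
 hence "plane_curve_of_degree (tdeg P) (subvariety proj_plane (eval_poly3 ?F))"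
  using hom unfolding plane_curve_of_degree_def by blast
 moreover have "birational (torus_curve f) (subvariety proj_plane (eval_poly3 ?F))"
 proof (rule curve_chart.birational_chart[OF curve_chart.intro[OF curve_axioms plane_chart]])
  show "gens u v" using assms by (simp add: rel_def)
  show "eval_poly3 ` {F. homogeneous (tdeg P) F} : pieces proj_plane" by (auto simp: proj_plane_def)
  show "eval_poly3 ?F : eval_poly3 ` {F. homogeneous (tdeg P) F}" using hom by blast
 qed (rule P eval_hom3)+
 ultimately have "s2_curve (torus_curve f) <= tdeg P" unfolding s2_curve_def by (intro Least_le) blast
 also have "\<dots> <= d" using P(2) by (intro tdeg_le) auto
 finally show ?thesis .
qed

text \<open>The exponents k1 and k2 attain m and n; otherwise the bihomogenization would contain one
  of the added coordinates as a factor.\<close>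

lemma s11_le_irreducible:
 assumes g: "gens u v" and P: "irreducible (to_pp P)" "eventually (%z. ev P (u z) (v z) = 0) F"
  and m: "m <= n" "!!k. k : keys P ==> fst k <= m & snd k <= n" "k1 : keys P" "fst k1 = m" "k2 : keys P" "snd k2 = n"
 shows "lex_le (s11_curve (torus_curve f)) (m, n)"
proof -
 let ?F = "hom22 m n P"
 let ?\<pi> = "%((i, j), (l, m)). (i, l) :: nat \<times> nat"
 let ?W = "{(%((i, j), (l, m)). i + j, fst, m), (%((i, j), (l, m)). l + m, snd, n)}"
 have pi: "push ?\<pi> ?F = P" unfolding hom22_def by (rule push_push_inverse) auto
 have hom: "bihomogeneous m n ?F" by (rule hom22_bihomogeneous) (use m(2) in force)
 have "irreducible ?F"
 proof (rule irreducible_homogeneous[where \<pi> = ?\<pi> and \<Omega> = ?W])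
  show "irreducible (to_pp (push ?\<pi> ?F))" unfolding pi by (rule P(1))
  show "!!S :: ((nat \<times> nat) \<times> (nat \<times> nat)) set. finite S ==> separated S" by (rule separated_poly22)
  show "\<omega> k = W" if "(\<omega>, \<omega>', W) : ?W" "k : keys ?F" for \<omega> \<omega>' W k
   using that hom by (auto simp: bihomogeneous_def)
  show "\<exists>k\<in>keys (push ?\<pi> ?F). \<omega>' k = W" if "(\<omega>, \<omega>', W) : ?W" for \<omega> \<omega>' W
   unfolding pi using that m by auto
  show "k = 0" if "!!\<omega> \<omega>' W. (\<omega>, \<omega>', W) : ?W ==> \<omega> k = 0" for k :: "(nat \<times> nat) \<times> (nat \<times> nat)"
  proof -
   have "(%((i, j), (l, m)). i + j) k = (0::nat)" "(%((i, j), (l, m)). l + m) k = (0::nat)" using that by blast+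
   thus ?thesis by (auto simp: zero_prod_def case_prod_unfold prod_eq_iff)
  qed
 qed (auto simp: zero_prod_def)
 hence c: "curve_of_bidegree m n (subvariety proj_line_sq (eval_poly22 ?F))"
  using hom unfolding curve_of_bidegree_def by blast
 have b: "birational (torus_curve f) (subvariety proj_line_sq (eval_poly22 ?F))"
 proof (rule curve_chart.birational_chart[OF curve_chart.intro[OF curve_axioms lines_chart]])
  show "eval_poly22 ` {F. bihomogeneous m n F} : pieces proj_line_sq" by (auto simp: proj_line_sq_def)
  show "eval_poly22 ?F : eval_poly22 ` {F. bihomogeneous m n F}" using hom by blast
 qed (rule g P eval_hom22)+
 show ?thesis unfolding s11_curve_def Let_def by (rule lex_minimum) (use c b m in blast)
qed

theorem s11_le:
 assumes "rel u v {(i, j). i <= a & j <= b}"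
 shows "lex_le (s11_curve (torus_curve f)) (min a b, max a b)"
proof -
 have "rel u v {k. fst k <= a & snd k <= b}" using assms by (simp add: case_prod_unfold)
 from irreducible_relation[OF this] obtain P where P: "irreducible (to_pp P)" "keys P \<subseteq> {k. fst k <= a & snd k <= b}"
  "eventually (%z. ev P (u z) (v z) = 0) F" by auto
 have g: "gens u v" using assms by (simp add: rel_def)
 have P0: "P ~= 0" using P(1) to_pp_eq_0[of P] by auto
 obtain k1 where k1: "k1 : keys P" "!!l. l : keys P ==> fst l <= fst k1" using max_attained[OF P0] by blast
 obtain k2 where k2: "k2 : keys P" "!!l. l : keys P ==> snd l <= snd k2" using max_attained[OF P0] by blast
 have ab: "fst k1 <= a" "snd k2 <= b" using k1 k2 P(2) by auto
 show ?thesis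
 proof (cases "fst k1 <= snd k2")
  case True
  have "lex_le (s11_curve (torus_curve f)) (fst k1, snd k2)"
   by (rule s11_le_irreducible[OF g P(1,3) True _ k1(1) _ k2(1)]) (use k1 k2 in auto)
  thus ?thesis by (rule lex_le_trans) (use True ab in \<open>auto simp: lex_le_def\<close>)
 next
  case False
  \<comment> \<open>The invariant admits only pairs with a <= b, so the two lines are
    exchanged.\<close>
  let ?P = "push prod.swap P"
  have e: "ev ?P y x = ev P x y" for x y unfolding ev_def pmev_push by (simp add: case_prod_unfold mult.commute)
  have "push prod.swap ?P = P" by (rule push_push_inverse) simp
  hence k: "keys P \<subseteq> prod.swap ` keys ?P" using keys_push[of prod.swap ?P] by simp
  have k': "keys ?P \<subseteq> prod.swap ` keys P" by (rule keys_push)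
  have "lex_le (s11_curve (torus_curve f)) (snd k2, fst k1)"
  proof (rule s11_le_irreducible[OF gens_swap[OF g] irreducible_push_swap[OF P(1)], where ?k1.0 = "prod.swap k2" and ?k2.0 = "prod.swap k1"])
   show "eventually (%z. ev ?P (v z) (u z) = 0) F" using P(3) by (simp add: e)
   show "prod.swap k1 : keys ?P" "prod.swap k2 : keys ?P" using k k1(1) k2(1) by auto
   show "fst l <= snd k2 & snd l <= fst k1" if "l : keys ?P" for l using that k' k1(2) k2(2) by fastforce
  qed (use False in auto)
  thus ?thesis by (rule lex_le_trans) (use False ab in \<open>auto simp: lex_le_def\<close>)
 qed
qed

end

section \<open>Transforming a plane relation\<close>

lemma lookup_mult_extreme:
 fixes P Q :: "'x::comm_monoid_add \<Rightarrow>\<^sub>0 'k::comm_ring_1"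
 assumes e: "!!a b. a : keys P ==> b : keys Q ==> a + b = k + l ==> a = k & b = l"
 shows "lookup (P * Q) (k + l) = lookup P k * lookup Q l"
proof -
 have "lookup (P * Q) (k + l) = (\<Sum>a\<in>keys P. \<Sum>b\<in>keys Q. lookup (single (a + b) (lookup P a * lookup Q b)) (k + l))"
  by (simp add: mult_as_sum[of P Q] lookup_sum)
 also have "\<dots> = (\<Sum>a\<in>keys P. if a = k then (\<Sum>b\<in>keys Q. if b = l then lookup P k * lookup Q l else 0) else 0)"
 proof (rule sum.cong)
  fix a assume a: "a : keys P"
  have "lookup (single (a + b) (lookup P a * lookup Q b)) (k + l) = (if a = k & b = l then lookup P k * lookup Q l else 0)" if "b : keys Q" for b
   using e[OF a that] by (auto simp: lookup_single when_def)
  thus "(\<Sum>b\<in>keys Q. lookup (single (a + b) (lookup P a * lookup Q b)) (k + l)) =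
   (if a = k then (\<Sum>b\<in>keys Q. if b = l then lookup P k * lookup Q l else 0) else 0)" by simp
 qed simp
 also have "\<dots> = lookup P k * lookup Q l" by (auto simp: sum.delta in_keys_iff)
 finally show ?thesis .
qed

text \<open>Weights (1, 1) give the total degree, (1, 0) and (0, 1) the degree in one variable, and
  (1, E) the slanted side of a trapezoid.\<close>

definition wle :: "nat => nat => nat => 'k::zero poly2 => bool" where
 "wle p q d P \<longleftrightarrow> (\<forall>k\<in>keys P. p * fst k + q * snd k <= d)"

lemma wle_mono: "wle p q d P ==> d <= e ==> wle p q e P"
 unfolding wle_def by fastforce

lemma wle_0 [simp]: "wle p q d 0"
 by (simp add: wle_def)

lemma wle_single: "p * fst k + q * snd k <= d ==> wle p q d (single k c)"
 by (simp add: wle_def)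

lemma wle_add: "wle p q d P ==> wle p q d Q ==> wle p q d (P + Q)"
 using Poly_Mapping.keys_add[of P Q] unfolding wle_def by blast

lemma wle_uminus: "wle p q d P ==> wle p q d (- P :: 'k::comm_ring_1 poly2)"
 by (simp add: wle_def)

lemma wle_diff: "wle p q d P ==> wle p q d Q ==> wle p q d (P - Q :: 'k::comm_ring_1 poly2)"
 using wle_add[OF _ wle_uminus, of p q d P Q] by simp

lemma wle_sum: "(!!x. x : A ==> wle p q d (P x)) ==> wle p q d (sum P A)"
 by (induction A rule: infinite_finite_induct) (auto intro: wle_add)

lemma wle_mult:
 fixes P Q :: "'k::comm_ring_1 poly2"
 assumes "wle p q d P" "wle p q e Q" "d + e <= n"
 shows "wle p q n (P * Q)"
 unfolding wle_def
proof
 fix k assume "k : keys (P * Q)"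
 then obtain a b where k: "k = a + b" "a : keys P" "b : keys Q" using keys_mult[of P Q] by blast
 hence "p * fst a + q * snd a <= d" "p * fst b + q * snd b <= e" using assms by (auto simp: wle_def)
 moreover have "p * fst k + q * snd k = (p * fst a + q * snd a) + (p * fst b + q * snd b)" by (simp add: k algebra_simps)
 ultimately show "p * fst k + q * snd k <= n" using assms(3) by linarith
qed

lemma wle_power:
 fixes P :: "'k::comm_ring_1 poly2"
 assumes "wle p q d P"
 shows "wle p q (n * d) (P ^ n)"
proof (induction n)
 case 0
 show ?case using wle_single[of p "0 :: nat \<times> nat" q 0 "1::'k"] by (simp add: single_one)
next
 case (Suc n)
 thus ?case using wle_mult[OF assms Suc] by simp
qed

lemma wle_1 [simp]: "wle p q d (1 :: 'k::comm_ring_1 poly2)"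
 using wle_single[of p "0 :: nat \<times> nat" q d "1::'k"] by (simp add: single_one)

lemma lookup_top_mult:
 fixes P Q :: "'k::comm_ring_1 poly2"
 assumes "wle 1 1 d P" "wle 1 1 e Q" "(s, t) : {(1, 0), (0, 1)}"
 shows "lookup (P * Q) ((d + e) * s, (d + e) * t) = lookup P (d * s, d * t) * lookup Q (e * s, e * t)"
proof -
 have "lookup (P * Q) ((d * s, d * t) + (e * s, e * t)) = lookup P (d * s, d * t) * lookup Q (e * s, e * t)"
 proof (rule lookup_mult_extreme)
  fix a b assume "a : keys P" "b : keys Q" and eq: "a + b = (d * s, d * t) + (e * s, e * t)"
  hence "fst a + snd a <= d" "fst b + snd b <= e" using assms by (auto simp: wle_def)
  thus "a = (d * s, d * t) & b = (e * s, e * t)" using eq assms(3) by (auto simp: prod_eq_iff)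
 qed
 thus ?thesis by (simp add: algebra_simps)
qed

lemma lookup_top_power:
 fixes P :: "'k::comm_ring_1 poly2"
 assumes "wle 1 1 1 P" "(s, t) : {(1, 0), (0, 1)}"
 shows "lookup (P ^ n) (n * s, n * t) = lookup P (s, t) ^ n"
proof (induction n)
 case 0
 show ?case by (simp add: lookup_one zero_prod_def)
next
 case (Suc n)
 have "wle 1 1 n (P ^ n)" using wle_power[OF assms(1), of n] by simp
 from lookup_top_mult[OF assms(1) this assms(2)] show ?case using Suc by simp
qed

definition lin :: "'k::comm_ring_1 => 'k => 'k => 'k poly2" where
 "lin x y z = single (1, 0) x + single (0, 1) y + single 0 z"

lemma ev_lin: "ev (lin x y z) a b = x * a + y * b + z"
 by (simp add: lin_def ev_add ev_single)

lemma lookup_lin: "lookup (lin x y z) (1, 0) = x" "lookup (lin x y z) (0, 1) = y" "lookup (lin x y z) (Suc 0, 0) = x" "lookup (lin x y z) (0, Suc 0) = y"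
 by (simp_all add: lin_def lookup_add lookup_single zero_prod_def)

lemma wle_lin: "p <= d ==> q <= d ==> wle p q d (lin x y z)"
 unfolding lin_def by (intro wle_add wle_single) auto

lemma wle_lin_snd: "wle 1 0 0 (lin 0 y z)" and wle_lin_fst: "wle 0 1 0 (lin x 0 z)"
 and wle_lin_Suc: "wle (Suc 0) 0 0 (lin 0 y z)" "wle 0 (Suc 0) 0 (lin x 0 z)"
 unfolding lin_def by (auto intro!: wle_add wle_single)

lemma lin_nonzero: "x ~= 0 \<or> y ~= 0 ==> lin x y z ~= 0"
 using lookup_lin[of x y z] by fastforce

text \<open>The homogenization of P in degree n evaluated at (A : B : C), which makes a projective
  change of coordinates polynomial.\<close>

definition substh :: "nat => 'k::comm_ring_1 poly2 => 'k poly2 => 'k poly2 => 'k poly2 => 'k poly2" where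
 "substh n P A B C = (\<Sum>k\<in>keys P. single 0 (lookup P k) * (A ^ fst k * (B ^ snd k * C ^ (n - (fst k + snd k)))))"

lemma ev_substh:
 fixes P :: "'k::field poly2"
 assumes "wle 1 1 n P" "ev C a b ~= 0"
 shows "ev (substh n P A B C) a b = ev C a b ^ n * ev P (ev A a b / ev C a b) (ev B a b / ev C a b)"
proof -
 let ?c = "ev C a b"
 have "ev (substh n P A B C) a b = (\<Sum>k\<in>keys P. lookup P k * (ev A a b ^ fst k * (ev B a b ^ snd k * ?c ^ (n - (fst k + snd k)))))"
  unfolding substh_def ev_sum by (simp add: ev_mult ev_power ev_single)
 also have "\<dots> = (\<Sum>k\<in>keys P. ?c ^ n * (lookup P k * ((ev A a b / ?c) ^ fst k * (ev B a b / ?c) ^ snd k)))"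
 proof (rule sum.cong)
  fix k assume "k : keys P"
  hence "n = (n - (fst k + snd k)) + fst k + snd k" using assms(1) by (force simp: wle_def)
  hence "?c ^ n = ?c ^ (n - (fst k + snd k)) * ?c ^ fst k * ?c ^ snd k" by (metis power_add)
  thus "lookup P k * (ev A a b ^ fst k * (ev B a b ^ snd k * ?c ^ (n - (fst k + snd k)))) =
   ?c ^ n * (lookup P k * ((ev A a b / ?c) ^ fst k * (ev B a b / ?c) ^ snd k))"
   using assms(2) by (simp add: power_divide field_simps)
 qed simp
 finally show ?thesis by (simp add: ev_def pmev_def case_prod_unfold sum_distrib_left)
qed

lemma wle_substh:
 assumes "wle p q \<alpha> A" "wle p q \<beta> B" "wle p q \<gamma> C"
  and "!!i j. (i, j) : keys P ==> i * \<alpha> + j * \<beta> + (n - (i + j)) * \<gamma> <= d"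
 shows "wle p q d (substh n P A B C)"
 unfolding substh_def
proof (rule wle_sum)
 fix k assume k: "k : keys P"
 let ?m = "n - (fst k + snd k)"
 have "wle p q (fst k * \<alpha> + (snd k * \<beta> + ?m * \<gamma>)) (A ^ fst k * (B ^ snd k * C ^ ?m))"
  by (rule wle_mult[OF wle_power[OF assms(1)] wle_mult[OF wle_power[OF assms(2)] wle_power[OF assms(3)] order_refl] order_refl])
 thus "wle p q d (single 0 (lookup P k) * (A ^ fst k * (B ^ snd k * C ^ ?m)))"
  using wle_mult[OF wle_single[of p 0 q 0 "lookup P k"], of _ "A ^ fst k * (B ^ snd k * C ^ ?m)" d] assms(4)[of "fst k" "snd k"] k
  by (simp add: add.assoc)
qed

text \<open>The coefficient of a pure top power is the value of the homogenized P at the image of a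
  point at infinity, normalized by the leading coefficient 1 of C. It vanishes as soon as that image
  is chosen on the curve.\<close>

lemma lookup_substh:
 fixes P :: "'k::comm_ring_1 poly2"
 assumes "wle 1 1 n P" "wle 1 1 1 A" "wle 1 1 1 B" "wle 1 1 1 C" and st: "(s, t) : {(1, 0), (0, 1)}" and C: "lookup C (s, t) = 1"
 shows "lookup (substh n P A B C) (n * s, n * t) = ev P (lookup A (s, t)) (lookup B (s, t))"
proof -
 have "lookup (single 0 (lookup P k) * (A ^ fst k * (B ^ snd k * C ^ (n - (fst k + snd k))))) (n * s, n * t) =
  lookup P k * (lookup A (s, t) ^ fst k * lookup B (s, t) ^ snd k)" if k: "k : keys P" for k
 proof -
  let ?m = "n - (fst k + snd k)"
  have n: "n = 0 + (fst k + (snd k + ?m))" using assms(1) k by (force simp: wle_def)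
  have w: "wle 1 1 0 (single 0 (lookup P k))" "wle 1 1 (fst k) (A ^ fst k)" "wle 1 1 (snd k) (B ^ snd k)" "wle 1 1 ?m (C ^ ?m)"
   using wle_power[OF assms(2), of "fst k"] wle_power[OF assms(3), of "snd k"] wle_power[OF assms(4), of ?m] by (auto intro: wle_single)
  have w1: "wle 1 1 (snd k + ?m) (B ^ snd k * C ^ ?m)" by (rule wle_mult[OF w(3,4) order_refl])
  have w2: "wle 1 1 (fst k + (snd k + ?m)) (A ^ fst k * (B ^ snd k * C ^ ?m))" by (rule wle_mult[OF w(2) w1 order_refl])
  let ?X = "single 0 (lookup P k) * (A ^ fst k * (B ^ snd k * C ^ ?m))"
  have "lookup ?X (n * s, n * t) = lookup ?X ((0 + (fst k + (snd k + ?m))) * s, (0 + (fst k + (snd k + ?m))) * t)"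
   using n by simp
  also have "\<dots> = lookup P k * (lookup A (s, t) ^ fst k * (lookup B (s, t) ^ snd k * lookup C (s, t) ^ ?m))"
   unfolding lookup_top_mult[OF w(1) w2 st] lookup_top_mult[OF w(2) w1 st] lookup_top_mult[OF w(3,4) st]
    lookup_top_power[OF assms(2) st] lookup_top_power[OF assms(3) st] lookup_top_power[OF assms(4) st]
   by (simp add: lookup_single zero_prod_def)
  finally show ?thesis by (simp add: C)
 qed
 thus ?thesis unfolding substh_def lookup_sum by (simp add: ev_def pmev_def case_prod_unfold)
qed

lemma ev_nonzero_both:
 fixes P Q :: "'k::alg_closed_field poly2"
 assumes "P ~= 0" "Q ~= 0"
 obtains a b where "ev P a b ~= 0" "ev Q a b ~= 0"
proof -
 obtain a b where "ev (P * Q) a b ~= 0" using ev_nonzero[OF poly2_mult_nonzero[OF assms]] .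
 thus ?thesis by (intro that) (auto simp: ev_mult)
qed

lemma ev_fst_zero:
 fixes P :: "'k::alg_closed_field poly2"
 assumes "!!b. ev P 0 b = 0"
 shows "lookup P (0, j) = 0"
proof -
 let ?p = "\<Sum>k\<in>keys P. if fst k = 0 then monom (lookup P k) (snd k) else 0"
 have "poly ?p b = ev P 0 b" for b
  unfolding ev_def pmev_def poly_sum by (rule sum.cong) (auto simp: poly_monom zero_power)
 hence "?p = 0" using assms infinite_alg_closed[where 'k = 'k]
  by (metis (mono_tags, lifting) UNIV_eq_I mem_Collect_eq poly_roots_finite)
 hence "coeff ?p j = 0" by simp
 moreover have "coeff ?p j = (\<Sum>k\<in>keys P. if k = (0, j) then lookup P k else 0)"
  unfolding coeff_sum by (rule sum.cong) (auto simp: prod_eq_iff)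
 ultimately show ?thesis by (simp add: sum.delta in_keys_iff split: if_splits)
qed

lemma divide_fst:
 fixes P :: "'k::alg_closed_field poly2"
 assumes "!!b. ev P 0 b = 0"
 obtains Q where "!!a b. ev P a b = a * ev Q a b" "!!k. k : keys Q ==> (Suc (fst k), snd k) : keys P"
proof
 let ?Q = "push (%(i, j). (i - 1, j)) P"
 have pos: "fst k > 0" if "k : keys P" for k
  using ev_fst_zero[OF assms, of "snd k"] that by (cases k) (auto simp: in_keys_iff intro: gr0I)
 show "ev P a b = a * ev ?Q a b" for a b
  unfolding ev_def pmev_push unfolding pmev_def sum_distrib_left
 proof (rule sum.cong)
  fix k assume "k : keys P"
  then obtain i where "fst k = Suc i" using pos gr0_implies_Suc by blast
  thus "lookup P k * (case k of (i, j) => a ^ i * b ^ j) = a * (lookup P k * (case case k of (i, j) => (i - 1, j) of (i, j) => a ^ i * b ^ j))"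
   by (simp add: case_prod_unfold)
 qed simp
 show "(Suc (fst k), snd k) : keys P" if "k : keys ?Q" for k
 proof -
  obtain l where "l : keys P" "k = (fst l - 1, snd l)" using keys_push[of "%(i, j). (i - 1, j)" P] \<open>k : keys ?Q\<close> by (auto simp: case_prod_unfold)
  thus ?thesis using pos[of l] by simp
 qed
qed

text \<open>Inversion of the matrix with columns (x1, y1, z1), (x2, y2, z2), (x3, y3, z3): the
  numerators of a and b and the form l are the rows of its adjugate, and D is its
  determinant.\<close>

lemma projection_formulas:
 fixes x1 :: "'k::field"
 assumes D: "D = x1 * (y2 * z3 - y3 * z2) + y1 * (z2 * x3 - z3 * x2) + z1 * (x2 * y3 - x3 * y2)" "D ~= 0"
  and l: "l = x * (y1 * z2 - y2 * z1) + y * (z1 * x2 - z2 * x1) + (x1 * y2 - x2 * y1)" "l ~= 0"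
  and a: "a = (x * (y2 * z3 - y3 * z2) + y * (z2 * x3 - z3 * x2) + (x2 * y3 - x3 * y2)) / l"
  and b: "b = (x * (y3 * z1 - y1 * z3) + y * (z3 * x1 - z1 * x3) + (x3 * y1 - x1 * y3)) / l"
 shows "z1 * a + z2 * b + z3 ~= 0" "x = (x1 * a + x2 * b + x3) / (z1 * a + z2 * b + z3)" "y = (y1 * a + y2 * b + y3) / (z1 * a + z2 * b + z3)"
proof -
 have al: "a * l = x * (y2 * z3 - y3 * z2) + y * (z2 * x3 - z3 * x2) + (x2 * y3 - x3 * y2)"
  and bl: "b * l = x * (y3 * z1 - y1 * z3) + y * (z3 * x1 - z1 * x3) + (x3 * y1 - x1 * y3)" using a b l by simp_all
 have "(z1 * a + z2 * b + z3) * l = z1 * (a * l) + z2 * (b * l) + z3 * l" by (simp add: algebra_simps)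
 also have "\<dots> = D" unfolding al bl unfolding D(1) l(1) by algebra
 finally have zl: "(z1 * a + z2 * b + z3) * l = D" .
 thus nz: "z1 * a + z2 * b + z3 ~= 0" using D(2) by auto
 have "(x1 * a + x2 * b + x3) * l = x1 * (a * l) + x2 * (b * l) + x3 * l" by (simp add: algebra_simps)
 also have "\<dots> = x * D" unfolding al bl unfolding D(1) l(1) by algebra
 finally have "(x1 * a + x2 * b + x3) * l = (x * (z1 * a + z2 * b + z3)) * l" using zl by (simp add: mult.assoc)
 hence "x1 * a + x2 * b + x3 = x * (z1 * a + z2 * b + z3)" using mult_right_cancel[OF l(2)] by blast
 thus "x = (x1 * a + x2 * b + x3) / (z1 * a + z2 * b + z3)" using nz by simp
 have "(y1 * a + y2 * b + y3) * l = y1 * (a * l) + y2 * (b * l) + y3 * l" by (simp add: algebra_simps)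
 also have "\<dots> = y * D" unfolding al bl unfolding D(1) l(1) by algebra
 finally have "(y1 * a + y2 * b + y3) * l = (y * (z1 * a + z2 * b + z3)) * l" using zl by (simp add: mult.assoc)
 hence "y1 * a + y2 * b + y3 = y * (z1 * a + z2 * b + z3)" using mult_right_cancel[OF l(2)] by blast
 thus "y = (y1 * a + y2 * b + y3) / (z1 * a + z2 * b + z3)" using nz by simp
qed

context curve begin

lemma gens_in: "u : gen F {u, v}" "v : gen F {u, v}"
 by (auto intro: gen_base)

lemma dich_const:
 assumes "h : K"
 shows "eventually (%z. h z = c) F \<or> eventually (%z. h z ~= c) F"
proof -
 have "(%z. h z - c) : K" using assms by (intro gen_intros)
 from K_dich[OF this] show ?thesis by simp
qed

text \<open>By the dichotomy h either equals a given root almost everywhere or avoids it almost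
  everywhere, and it cannot avoid all of the finitely many roots.\<close>

lemma root_const:
 assumes "h : K" "q ~= 0" "eventually (%z. poly q (h z) = 0) F"
 obtains r where "eventually (%z. h z = r) F"
proof (rule ccontr)
 assume "~ thesis"
 hence "eventually (%z. h z ~= r) F" for r using dich_const[OF assms(1), of r] that by blast
 hence "eventually (%z. \<forall>r\<in>{r. poly q r = 0}. h z ~= r) F" using poly_roots_finite[OF assms(2)] by (intro eventually_ball_finite) auto
 hence "eventually (%z. False) F" using assms(3) by eventually_elim auto
 thus False using F_neq_bot by simp
qed

lemma projection:
 assumes g: "gens u v" and D: "D = x1 * (y2 * z3 - y3 * z2) + y1 * (z2 * x3 - z3 * x2) + z1 * (x2 * y3 - x3 * y2)" "D ~= 0"
  and l: "eventually (%z. u z * (y1 * z2 - y2 * z1) + v z * (z1 * x2 - z2 * x1) + (x1 * y2 - x2 * y1) ~= 0) F"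
 obtains a b where "gens a b" "eventually (%z. z1 * a z + z2 * b z + z3 ~= 0 &
   u z = (x1 * a z + x2 * b z + x3) / (z1 * a z + z2 * b z + z3) & v z = (y1 * a z + y2 * b z + y3) / (z1 * a z + z2 * b z + z3)) F"
proof -
 define m a b where "m = (%z. u z * (y1 * z2 - y2 * z1) + v z * (z1 * x2 - z2 * x1) + (x1 * y2 - x2 * y1))"
  and "a = (%z. (u z * (y2 * z3 - y3 * z2) + v z * (z2 * x3 - z3 * x2) + (x2 * y3 - x3 * y2)) / m z)"
  and "b = (%z. (u z * (y3 * z1 - y1 * z3) + v z * (z3 * x1 - z1 * x3) + (x3 * y1 - x1 * y3)) / m z)"
 have ev: "eventually (%z. z1 * a z + z2 * b z + z3 ~= 0 &
   u z = (x1 * a z + x2 * b z + x3) / (z1 * a z + z2 * b z + z3) & v z = (y1 * a z + y2 * b z + y3) / (z1 * a z + z2 * b z + z3)) F"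
  using l
 proof eventually_elim
  case (elim z)
  show ?case using projection_formulas[OF D refl elim refl refl] unfolding a_def b_def m_def by blast
 qed
 have m: "m : gen F {u, v}" unfolding m_def by (intro gen_intros gens_in)
 have "gens a b"
 proof (rule gens_change[OF g])
  show "a : gen F {u, v}" "b : gen F {u, v}" unfolding a_def b_def by (intro gen_intros gens_in m)+
  have 1: "(%z. (x1 * a z + x2 * b z + x3) / (z1 * a z + z2 * b z + z3)) : gen F {a, b}"
   "(%z. (y1 * a z + y2 * b z + y3) / (z1 * a z + z2 * b z + z3)) : gen F {a, b}"
   by (intro gen_divide gen_add gen_mult gen_const gens_in)+
  show "u : gen F {a, b}" by (rule gen_cong[OF 1(1)]) (use ev in \<open>eventually_elim, simp\<close>)
  show "v : gen F {a, b}" by (rule gen_cong[OF 1(2)]) (use ev in \<open>eventually_elim, simp\<close>)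
 qed
 thus ?thesis using ev by (rule that)
qed

lemma two_curve_points:
 assumes g: "gens u v" and P: "eventually P F"
 obtains z w where "z : Z" "w : Z" "P z" "P w" "(u z, v z) ~= (u w, v w)"
proof -
 let ?I = "(%z. (u z, v z)) ` {z : Z. P z}"
 have i: "infinite ?I" by (rule gens_infinite_image[OF g P])
 then obtain p where p: "p : ?I" by (metis ex_in_conv finite.emptyI)
 from i have "infinite (?I - {p})" by simp
 then obtain q where "q : ?I - {p}" by (metis ex_in_conv finite.emptyI)
 thus ?thesis using p that by auto
qed

text \<open>Two points of a plane curve of degree \<open>n\<close> become the points at infinity of
  \<open>\<P>\<^sup>1 \<times> \<P>\<^sup>1\<close>; both degrees drop because the curve passes through them.\<close>

lemma rel_project:
 assumes r: "rel u v {(i, j). i + j <= n}" and n: "n >= 2"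
 obtains u' v' where "rel u' v' {(i, j). i <= n - 1 & j <= n - 1}"
proof -
 obtain P where g: "gens u v" and P: "P ~= 0" "keys P \<subseteq> {(i, j). i + j <= n}" "eventually (%z. ev P (u z) (v z) = 0) F"
  using r by (auto simp: rel_def)
 have w: "wle 1 1 n P" using P(2) by (auto simp: wle_def)
 obtain z w where "ev P (u z) (v z) = 0" "ev P (u w) (v w) = 0" "(u z, v z) ~= (u w, v w)" using two_curve_points[OF g P(3)] by metis
 then obtain x1 y1 x2 y2 where p: "ev P x1 y1 = 0" "ev P x2 y2 = 0" "(x1, y1) ~= (x2, y2)" by metis
 \<comment> \<open>The third base point (x3 : y3 : 0) lies at infinity off the line through the two
   curve points, so the determinant is nonzero.\<close>
 define x3 y3 :: 'k where "x3 = (if x1 = x2 then 1 else 0)" and "y3 = (if x1 = x2 then 0 else 1)"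
 let ?l = "%z. u z * (y1 * 1 - y2 * 1) + v z * (1 * x2 - 1 * x1) + (x1 * y2 - x2 * y1)"
 let ?L = "lin (y1 - y2) (x2 - x1) (x1 * y2 - x2 * y1)"
 have L0: "?L ~= 0" by (rule lin_nonzero) (use p(3) in auto)
 have Lev: "ev ?L x y = x * (y1 * 1 - y2 * 1) + y * (1 * x2 - 1 * x1) + (x1 * y2 - x2 * y1)" for x y by (simp add: ev_lin algebra_simps)
 have "?l : gen F {u, v}" by (intro gen_intros gens_in)
 from K_dich[OF gens_K[OF g this]] show ?thesis
 proof
  \<comment> \<open>The curve is the line through the two points; its linear equation already has
    the required support.\<close>
  assume "eventually (%z. ?l z = 0) F"
  hence "eventually (%z. ev ?L (u z) (v z) = 0) F" by (simp only: Lev)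
  moreover have "wle 1 0 1 ?L" "wle 0 1 1 ?L" by (auto intro: wle_lin)
  hence "keys ?L \<subseteq> {(i, j). i <= n - 1 & j <= n - 1}" using n unfolding wle_def by fastforce
  ultimately have "rel u v {(i, j). i <= n - 1 & j <= n - 1}" using L0 g by (intro relI)
  thus ?thesis by (rule that)
 next
  assume l: "eventually (%z. ?l z ~= 0) F"
  define D where "D = x1 * (y2 * 0 - y3 * 1) + y1 * (1 * x3 - 0 * x2) + 1 * (x2 * y3 - x3 * y2)"
  have "D ~= 0" using p(3) by (auto simp: D_def x3_def y3_def)
  from projection[OF g D_def this l] obtain a b where ab: "gens a b" "eventually (%z. 1 * a z + 1 * b z + 0 ~= 0 &
   u z = (x1 * a z + x2 * b z + x3) / (1 * a z + 1 * b z + 0) & v z = (y1 * a z + y2 * b z + y3) / (1 * a z + 1 * b z + 0)) F" by blast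
  let ?A = "lin x1 x2 x3" and ?B = "lin y1 y2 y3" and ?C = "lin 1 1 0 :: 'k poly2"
  let ?Q = "substh n P ?A ?B ?C"
  have "eventually (%z. ev ?Q (a z) (b z) = 0) F" using ab(2) P(3)
  proof eventually_elim
   case (elim z)
   thus ?case using ev_substh[OF w, of ?C "a z" "b z" ?A ?B] by (simp add: ev_lin)
  qed
  moreover have "?Q ~= 0"
  proof -
   obtain x y where xy: "ev P x y ~= 0" "ev ?L x y ~= 0" using ev_nonzero_both[OF P(1) L0] by blast
   from projection_formulas[OF D_def \<open>D ~= 0\<close> refl xy(2)[unfolded Lev] refl refl] obtain a b where
    "1 * a + 1 * b + 0 ~= 0" "x = (x1 * a + x2 * b + x3) / (1 * a + 1 * b + 0)" "y = (y1 * a + y2 * b + y3) / (1 * a + 1 * b + 0)" by blast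
   hence "ev ?Q a b ~= 0" using ev_substh[OF w, of ?C a b ?A ?B] xy(1) by (simp add: ev_lin)
   thus ?thesis by auto
  qed
  moreover have "keys ?Q \<subseteq> {(i, j). i <= n - 1 & j <= n - 1}"
  proof
   fix k assume k: "k : keys ?Q"
   have l1: "wle 1 1 1 ?A" "wle 1 1 1 ?B" "wle 1 1 1 ?C" by (auto intro: wle_lin)
   have "wle 1 1 n ?Q" by (rule wle_substh[OF l1]) (use w in \<open>fastforce simp: wle_def\<close>)
   hence "fst k + snd k <= n" using k by (auto simp: wle_def)
   moreover have "lookup ?Q (n, 0) = 0" "lookup ?Q (0, n) = 0"
    using lookup_substh[OF w l1, of 1 0] lookup_substh[OF w l1, of 0 1] p(1,2) by (simp_all add: lookup_lin)
   hence "k ~= (n, 0)" "k ~= (0, n)" using k by (auto simp: in_keys_iff)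
   ultimately show "k : {(i, j). i <= n - 1 & j <= n - 1}" using n by (cases k) auto
  qed
  ultimately have "rel a b {(i, j). i <= n - 1 & j <= n - 1}" using ab(1) by (intro relI)
  thus ?thesis by (rule that)
 qed
qed

text \<open>In the blow-up chart u = a + y0, v = a b + z0 at a curve point the equation becomes
  divisible by a. With weight 1 for a and E for b the product a b has the weight E + 1 that v had
  before, and dividing by a lowers the bound by one.\<close>

lemma rel_shear:
 assumes r: "rel u v {(i, j). j <= m & i + Suc E * j <= Suc n}" and n: "n >= 1"
 obtains u' v' where "rel u' v' {(i, j). j <= m & i + E * j <= n}"
proof -
 obtain P where g: "gens u v" and P: "P ~= 0" "keys P \<subseteq> {(i, j). j <= m & i + Suc E * j <= Suc n}" "eventually (%z. ev P (u z) (v z) = 0) F"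
  using r by (auto simp: rel_def)
 obtain z where "ev P (u z) (v z) = 0" using eventually_point[OF P(3)] by metis
 then obtain y0 z0 where p: "ev P y0 z0 = 0" by metis
 have uK: "u : K" using g by (simp add: gens_def)
 from dich_const[OF uK, of y0] show ?thesis
 proof
  assume "eventually (%z. u z = y0) F"
  hence "eventually (%z. ev (lin 1 0 (- y0)) (u z) (v z) = 0) F" by eventually_elim (simp add: ev_lin)
  moreover have "lin 1 0 (- y0) ~= 0" by (rule lin_nonzero) simp
  moreover have "wle 0 1 0 (lin 1 0 (- y0))" "wle 1 0 1 (lin 1 0 (- y0))" by (auto intro: wle_lin_Suc wle_lin)
  hence "keys (lin 1 0 (- y0)) \<subseteq> {(i, j). j <= m & i + E * j <= n}" using n unfolding wle_def by fastforce
  ultimately have "rel u v {(i, j). j <= m & i + E * j <= n}" using g by (intro relI)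
  thus ?thesis by (rule that)
 next
  assume ne: "eventually (%z. u z ~= y0) F"
  let ?a = "%z. u z - y0" and ?b = "%z. (v z - z0) / (u z - y0)"
  have gab: "gens ?a ?b"
  proof (rule gens_change[OF g])
   show "?a : gen F {u, v}" "?b : gen F {u, v}" by (intro gen_intros gens_in)+
   have "(%z. ?a z + y0) : gen F {?a, ?b}" by (intro gen_add gen_const gens_in(1)[of ?a ?b] gens_in(2)[of ?b ?a])
   thus "u : gen F {?a, ?b}" by simp
   have "(%z. ?a z * ?b z + z0) : gen F {?a, ?b}" by (intro gen_add gen_mult gen_const gens_in(1)[of ?a ?b] gens_in(2)[of ?b ?a])
   thus "v : gen F {?a, ?b}" by (rule gen_cong) (use ne in \<open>eventually_elim, simp\<close>)
  qed
  let ?A = "lin 1 0 y0" and ?B = "single (1, 1) 1 + single 0 z0"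
  define N where "N = tdeg P"
  have w: "wle 1 1 N P" using tdeg_ge[of _ _ P] by (auto simp: wle_def N_def)
  define Q where "Q = substh N P ?A ?B 1"
  have Qev: "ev Q a b = ev P (a + y0) (a * b + z0)" for a b
   unfolding Q_def using ev_substh[OF w, of 1 a b ?A ?B] by (simp add: ev_lin ev_add ev_single)
  have "ev Q 0 b = 0" for b using p by (simp add: Qev)
  from divide_fst[OF this] obtain R where R: "!!a b. ev Q a b = a * ev R a b" "!!k. k : keys R ==> (Suc (fst k), snd k) : keys Q" by blast
  have "wle 0 1 m Q" unfolding Q_def
  proof (rule wle_substh[where \<alpha> = 0 and \<beta> = 1 and \<gamma> = 0])
   show "wle 0 1 1 ?B" by (auto intro!: wle_add wle_single)
  qed (use P(2) in \<open>auto intro: wle_lin_Suc\<close>)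
  moreover have "wle 1 E (Suc n) Q" unfolding Q_def
  proof (rule wle_substh[where \<alpha> = 1 and \<beta> = "Suc E" and \<gamma> = 0])
   show "wle 1 E (Suc E) ?B" by (auto intro!: wle_add wle_single)
   show "wle 1 E 1 ?A" unfolding lin_def by (auto intro!: wle_add wle_single)
  qed (use P(2) in \<open>auto simp: mult.commute\<close>)
  ultimately have "keys R \<subseteq> {(i, j). j <= m & i + E * j <= n}" using R(2) unfolding wle_def by fastforce
  moreover have "R ~= 0"
  proof
   assume "R = 0"
   hence Q0: "ev P (a + y0) (a * b + z0) = 0" for a b using R(1)[of a b] by (simp add: Qev)
   obtain x y where xy: "ev P x y ~= 0" "ev (lin 1 0 (- y0)) x y ~= 0" using ev_nonzero_both[OF P(1) lin_nonzero[of 1 0]] by auto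
   hence "x ~= y0" by (simp add: ev_lin)
   thus False using Q0[of "x - y0" "(y - z0) / (x - y0)"] xy(1) by simp
  qed
  moreover have "eventually (%z. ev R (?a z) (?b z) = 0) F" using ne P(3)
  proof eventually_elim
   case (elim z)
   have "?a z * ev R (?a z) (?b z) = 0" unfolding R(1)[symmetric] Qev using elim by simp
   thus ?case using elim by simp
  qed
  ultimately have "rel ?a ?b {(i, j). j <= m & i + E * j <= n}" using gab by (intro relI)
  thus ?thesis by (rule that)
 qed
qed

lemma rel_shear_iterate:
 assumes "rel u v {(i, j). j <= m & i + (E + s) * j <= n + s}" "n >= 1"
 shows "\<exists>u' v'. rel u' v' {(i, j). j <= m & i + E * j <= n}"
 using assms(1)
proof (induction s arbitrary: u v)
 case 0
 thus ?case by auto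
next
 case (Suc s)
 have "rel u v {(i, j). j <= m & i + Suc (E + s) * j <= Suc (n + s)}" using Suc.prems by simp
 then obtain u' v' where "rel u' v' {(i, j). j <= m & i + (E + s) * j <= n + s}" by (rule rel_shear) (use assms(2) in simp)
 thus ?case by (rule Suc.IH)
qed

text \<open>In the coordinates a = 1/(u - x0) and b = 1/(v - y0) the coefficient of a^A b^B is the
  value of P at (x0, y0). At a curve point this is zero, so the corner of the rectangle
  disappears.\<close>

lemma rel_rectangle:
 assumes r: "rel u v {(i, j). i <= A & j <= B}" and AB: "A + B >= 2"
 obtains u' v' where "rel u' v' {(i, j). i + j <= A + B - 1}"
proof -
 note th = that
 obtain P where g: "gens u v" and P: "P ~= 0" "keys P \<subseteq> {(i, j). i <= A & j <= B}" "eventually (%z. ev P (u z) (v z) = 0) F"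
  using r by (auto simp: rel_def)
 obtain z where "ev P (u z) (v z) = 0" using eventually_point[OF P(3)] by metis
 then obtain x0 y0 where p: "ev P x0 y0 = 0" by metis
 have uK: "u : K" and vK: "v : K" using g by (auto simp: gens_def)
 have lin: ?thesis if ez: "eventually (%z. ev (lin x y c) (u z) (v z) = 0) F" and "x ~= 0 \<or> y ~= 0" for x y c
 proof -
  have "wle 1 1 1 (lin x y c)" by (auto intro: wle_lin)
  hence "keys (lin x y c) \<subseteq> {(i, j). i + j <= A + B - 1}" using AB unfolding wle_def by fastforce
  hence "rel u v {(i, j). i + j <= A + B - 1}" using g ez lin_nonzero[OF \<open>x ~= 0 \<or> y ~= 0\<close>, of c] by (intro relI)
  thus ?thesis by (rule th)
 qed
 consider "eventually (%z. u z = x0) F" | "eventually (%z. v z = y0) F" | "eventually (%z. u z ~= x0) F" "eventually (%z. v z ~= y0) F"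
  using dich_const[OF uK] dich_const[OF vK] by blast
 thus ?thesis
 proof cases
  case 1
  hence "eventually (%z. ev (lin 1 0 (- x0)) (u z) (v z) = 0) F" by eventually_elim (simp add: ev_lin)
  thus ?thesis by (rule lin) simp
 next
  case 2
  hence "eventually (%z. ev (lin 0 1 (- y0)) (u z) (v z) = 0) F" by eventually_elim (simp add: ev_lin)
  thus ?thesis by (rule lin) simp
 next
  case 3
  let ?a = "%z. 1 / (u z - x0)" and ?b = "%z. 1 / (v z - y0)"
  have gab: "gens ?a ?b"
  proof (rule gens_change[OF g])
   show "?a : gen F {u, v}" "?b : gen F {u, v}" by (intro gen_intros gens_in)+
   have "(%z. x0 + inverse (?a z)) : gen F {?a, ?b}" "(%z. y0 + inverse (?b z)) : gen F {?a, ?b}"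
    by (intro gen_add gen_inverse gen_const gens_in(1)[of ?a ?b] gens_in(2)[of ?b ?a])+
   thus "u : gen F {?a, ?b}" "v : gen F {?a, ?b}" by simp_all
  qed
  \<comment> \<open>a^A b^B times the term of P at x0 + 1/a and y0 + 1/b, with denominators cleared
    into x0 a + 1 and y0 b + 1.\<close>
  define T where "T k = single (A - fst k, B - snd k) (lookup P k) * ((lin x0 0 1) ^ fst k * (lin 0 y0 1) ^ snd k)" for k
  define Q where "Q = (\<Sum>k\<in>keys P. T k)"
  have k: "fst k <= A" "snd k <= B" if "k : keys P" for k using that P(2) by auto
  have Qev: "ev Q a b = a ^ A * b ^ B * ev P (x0 + 1 / a) (y0 + 1 / b)" if ab: "a ~= 0" "b ~= 0" for a b
  proof -
   have "ev Q a b = (\<Sum>k\<in>keys P. a ^ A * b ^ B * (lookup P k * ((x0 + 1 / a) ^ fst k * (y0 + 1 / b) ^ snd k)))"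
    unfolding Q_def ev_sum
   proof (rule sum.cong)
    fix l assume "l : keys P"
    from k[OF this] have e: "a ^ A = a ^ (A - fst l) * a ^ fst l" "b ^ B = b ^ (B - snd l) * b ^ snd l" by (simp_all flip: power_add)
    have p: "a ^ fst l * (x0 + 1 / a) ^ fst l = (x0 * a + 1) ^ fst l" "b ^ snd l * (y0 + 1 / b) ^ snd l = (y0 * b + 1) ^ snd l"
     using ab by (simp_all flip: power_mult_distrib add: algebra_simps)
    have "ev (T l) a b = lookup P l * (a ^ (A - fst l) * b ^ (B - snd l)) * ((x0 * a + 1) ^ fst l * (y0 * b + 1) ^ snd l)"
     unfolding T_def by (simp add: ev_mult ev_power ev_single ev_lin)
    also have "\<dots> = a ^ A * b ^ B * (lookup P l * ((x0 + 1 / a) ^ fst l * (y0 + 1 / b) ^ snd l))"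
     unfolding p[symmetric] e by (simp only: mult_ac)
    finally show "ev (T l) a b = a ^ A * b ^ B * (lookup P l * ((x0 + 1 / a) ^ fst l * (y0 + 1 / b) ^ snd l))" .
   qed simp
   thus ?thesis by (simp add: ev_def pmev_def case_prod_unfold sum_distrib_left)
  qed
  have wl: "wle 1 0 1 (lin x0 0 1)" "wle 1 0 0 (lin 0 y0 1)" "wle 0 1 0 (lin x0 0 1)" "wle 0 1 1 (lin 0 y0 1)"
   by (auto intro: wle_lin wle_lin_Suc)
  have wT: "wle 1 0 A (T l)" "wle 0 1 B (T l)" "lookup (T l) (A, B) = lookup P l * (x0 ^ fst l * y0 ^ snd l)" if l: "l : keys P" for l
  proof -
   have w: "wle 1 0 (fst l) (lin x0 0 1 ^ fst l)" "wle 1 0 0 (lin 0 y0 1 ^ snd l)" "wle 0 1 0 (lin x0 0 1 ^ fst l)" "wle 0 1 (snd l) (lin 0 y0 1 ^ snd l)"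
    using wle_power[OF wl(1), of "fst l"] wle_power[OF wl(2), of "snd l"] wle_power[OF wl(3), of "fst l"] wle_power[OF wl(4), of "snd l"] by simp_all
   have w': "wle 1 0 (fst l) (lin x0 0 1 ^ fst l * lin 0 y0 1 ^ snd l)" "wle 0 1 (snd l) (lin x0 0 1 ^ fst l * lin 0 y0 1 ^ snd l)"
    by (rule wle_mult[OF w(1,2)], simp) (rule wle_mult[OF w(3,4)], simp)
   have s: "wle 1 0 (A - fst l) (single (A - fst l, B - snd l) (lookup P l))" "wle 0 1 (B - snd l) (single (A - fst l, B - snd l) (lookup P l))"
    by (auto intro: wle_single)
   show "wle 1 0 A (T l)" "wle 0 1 B (T l)" unfolding T_def
    by (rule wle_mult[OF s(1) w'(1)], use k[OF l] in simp) (rule wle_mult[OF s(2) w'(2)], use k[OF l] in simp)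
   have kb: "fst c <= i & snd c <= j" if "wle 1 0 i R" "wle 0 1 j R" "c : keys R" for i j R and c :: "nat \<times> nat"
    using that by (auto simp: wle_def)
   have pw: "lookup (lin x0 0 1 ^ n) (n, 0) = x0 ^ n" "lookup (lin 0 y0 1 ^ n) (0, n) = y0 ^ n" for n
    using lookup_top_power[OF wle_lin[of 1 1 1 x0 0 1], of 1 0 n] lookup_top_power[OF wle_lin[of 1 1 1 0 y0 1], of 0 1 n] by (simp_all add: lookup_lin)
   have "lookup (lin x0 0 1 ^ fst l * lin 0 y0 1 ^ snd l) ((fst l, 0) + (0, snd l)) = lookup (lin x0 0 1 ^ fst l) (fst l, 0) * lookup (lin 0 y0 1 ^ snd l) (0, snd l)"
    by (rule lookup_mult_extreme) (use kb[OF w(1,3)] kb[OF w(2,4)] in \<open>fastforce simp: prod_eq_iff\<close>)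
   hence e1: "lookup (lin x0 0 1 ^ fst l * lin 0 y0 1 ^ snd l) l = x0 ^ fst l * y0 ^ snd l" by (simp add: pw)
   have "lookup (T l) ((A - fst l, B - snd l) + l) = lookup (single (A - fst l, B - snd l) (lookup P l)) (A - fst l, B - snd l) * lookup (lin x0 0 1 ^ fst l * lin 0 y0 1 ^ snd l) l"
    unfolding T_def by (rule lookup_mult_extreme) (use kb[OF w'] in \<open>auto simp: prod_eq_iff split: if_splits\<close>)
   moreover have "(A - fst l, B - snd l) + l = (A, B)" using k[OF l] by (simp add: prod_eq_iff)
   ultimately show "lookup (T l) (A, B) = lookup P l * (x0 ^ fst l * y0 ^ snd l)" by (simp add: e1)
  qed
  have "keys Q \<subseteq> {(i, j). i + j <= A + B - 1}"
  proof
   fix c assume c: "c : keys Q"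
   have "wle 1 0 A Q" "wle 0 1 B Q" unfolding Q_def by (rule wle_sum, erule wT)+
   hence "fst c <= A" "snd c <= B" using c by (auto simp: wle_def)
   moreover have "lookup Q (A, B) = ev P x0 y0" unfolding Q_def lookup_sum by (simp add: wT ev_def pmev_def case_prod_unfold)
   hence "c ~= (A, B)" using c p by (auto simp: in_keys_iff)
   ultimately show "c : {(i, j). i + j <= A + B - 1}" by (cases c) auto
  qed
  moreover have "Q ~= 0"
  proof -
   have "lin 1 0 (- x0) ~= 0" "lin 0 1 (- y0) ~= 0" by (rule lin_nonzero, simp)+
   from ev_nonzero_both[OF P(1) poly2_mult_nonzero[OF this]] obtain x y where "ev P x y ~= 0" "ev (lin 1 0 (- x0) * lin 0 1 (- y0)) x y ~= 0" by blast
   hence "ev P x y ~= 0" "x ~= x0" "y ~= y0" by (auto simp: ev_mult ev_lin)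
   hence "ev Q (1 / (x - x0)) (1 / (y - y0)) ~= 0" using Qev[of "1 / (x - x0)" "1 / (y - y0)"] by simp
   thus ?thesis by auto
  qed
  moreover have "eventually (%z. ev Q (?a z) (?b z) = 0) F" using 3 P(3)
  proof eventually_elim
   case (elim z)
   thus ?case using Qev[of "?a z" "?b z"] by simp
  qed
  ultimately have "rel ?a ?b {(i, j). i + j <= A + B - 1}" using gab by (intro relI)
  thus ?thesis by (rule that)
 qed
qed

end

lemma gen_poly: "u : gen F S ==> (%z. poly p (u z)) : gen F S"
 by (induction p) (auto intro: gen_const gen_add gen_mult)

lemma lookup_push:
 assumes "inj_on \<pi> (keys P)" "k : keys P"
 shows "lookup (push \<pi> P) (\<pi> k) = lookup P k"
proof -
 have "lookup (push \<pi> P) (\<pi> k) = (\<Sum>l\<in>keys P. if l = k then lookup P k else 0)"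
  unfolding push_def lookup_sum by (rule sum.cong) (use assms in \<open>auto simp: lookup_single when_def inj_on_def\<close>)
 thus ?thesis using assms(2) by simp
qed

definition amap :: "int => int => int => int => int => int => real \<times> real => real \<times> real" where
 "amap a b c d e h = (%(x, y). (of_int a * x + of_int b * y + of_int e, of_int c * x + of_int d * y + of_int h))"

lemma unimodular_amap: "unimodular \<phi> \<longleftrightarrow> (\<exists>a b c d e h. \<bar>a * d - b * c\<bar> = 1 & \<phi> = amap a b c d e h)"
 unfolding unimodular_def amap_def by blast

lemma pull_amap: "pull a b c d e h D = amap a b c d e h -` D"
 unfolding pull_def amap_def by auto

lemma amap_lpt: "amap a b c d e h (lpt i j) = lpt (a * i + b * j + e) (c * i + d * j + h)"
 by (simp add: amap_def lpt_def)

lemma convex_amap_vimage: "convex X ==> convex (amap a b c d e h -` X)"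
 using convex_pull[of X] by (simp add: pull_amap)

lemma amap_inverse:
 assumes "\<bar>a * d - b * c\<bar> = 1"
 obtains a' b' c' d' e' h' where "\<bar>a' * d' - b' * c'\<bar> = 1"
  "!!p. amap a b c d e h (amap a' b' c' d' e' h' p) = p" "!!p. amap a' b' c' d' e' h' (amap a b c d e h p) = p"
proof -
 define s where "s = a * d - b * c"
 have ss: "s * s = 1" using assms unfolding s_def[symmetric] by (auto simp: abs_if split: if_splits)
 hence sr: "real_of_int s * real_of_int s = 1" by (metis of_int_1 of_int_mult)
 have s1: "real_of_int s * (real_of_int a * real_of_int d - real_of_int b * real_of_int c) = 1" using sr unfolding s_def by simp
 show ?thesis
 proof (rule that[of "s * d" "s * a" "- s * b" "- s * c" "- s * (d * e - b * h)" "- s * (a * h - c * e)"])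
  have "s * d * (s * a) - - s * b * (- s * c) = s * s * s" by (simp add: s_def algebra_simps)
  thus "\<bar>s * d * (s * a) - - s * b * (- s * c)\<bar> = 1" using ss assms by (simp add: s_def)
  fix p :: "real \<times> real"
  obtain x y where p: "p = (x, y)" by fastforce
  let ?s = "real_of_int s" and ?a = "real_of_int a" and ?b = "real_of_int b" and ?c = "real_of_int c" and ?d = "real_of_int d" and ?e = "real_of_int e" and ?h = "real_of_int h"
  have "?a * (?s * ?d * x + - ?s * ?b * y + - ?s * (?d * ?e - ?b * ?h)) + ?b * (- ?s * ?c * x + ?s * ?a * y + - ?s * (?a * ?h - ?c * ?e)) + ?e = x"
   "?c * (?s * ?d * x + - ?s * ?b * y + - ?s * (?d * ?e - ?b * ?h)) + ?d * (- ?s * ?c * x + ?s * ?a * y + - ?s * (?a * ?h - ?c * ?e)) + ?h = y"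
   using s1 by algebra+
  thus "amap a b c d e h (amap (s * d) (- s * b) (- s * c) (s * a) (- s * (d * e - b * h)) (- s * (a * h - c * e)) p) = p"
   by (simp add: amap_def p)
  have "?s * ?d * (?a * x + ?b * y + ?e) + - ?s * ?b * (?c * x + ?d * y + ?h) + - ?s * (?d * ?e - ?b * ?h) = x"
   "- ?s * ?c * (?a * x + ?b * y + ?e) + ?s * ?a * (?c * x + ?d * y + ?h) + - ?s * (?a * ?h - ?c * ?e) = y"
   using s1 by algebra+
  thus "amap (s * d) (- s * b) (- s * c) (s * a) (- s * (d * e - b * h)) (- s * (a * h - c * e)) (amap a b c d e h p) = p"
   by (simp add: amap_def p)
 qed
qed

section \<open>From the polygon shapes to bounds for the curve\<close>

context curve begin

text \<open>Solving for v expresses it by u. If the coefficient of v vanishes on the curve, the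
  other coefficient vanishes too, u is constant and v alone generates.\<close>

lemma rel_linear:
 assumes "rel u v {(i, j). j <= 1}"
 shows "\<exists>w. gens w (%z. 0)"
proof -
 obtain P where g: "gens u v" and P: "P ~= 0" "keys P \<subseteq> {(i, j). j <= 1}" "eventually (%z. ev P (u z) (v z) = 0) F"
  using assms by (auto simp: rel_def)
 define p0 p1 where "p0 = coeff (to_pp P) 0" and "p1 = coeff (to_pp P) 1"
 have "to_pp P = [:p0, p1:]"
 proof (rule poly_eqI)
  fix n
  have "coeff (to_pp P) (Suc (Suc m)) = 0" for m
   by (rule poly_eqI) (use P(2) in \<open>auto simp: coeff_to_pp simp flip: not_in_keys_iff_lookup_eq_zero\<close>)
  thus "coeff (to_pp P) n = coeff [:p0, p1:] n" by (auto simp: p0_def p1_def coeff_pCons split: nat.splits)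
 qed
 hence evP: "ev P a b = poly p0 a + b * poly p1 a" and ne: "p0 ~= 0 \<or> p1 ~= 0" for a b
  using ev2_to_pp[of P a b] to_pp_eq_0[of P] P(1) by (auto simp: ev2_def)
 have uv: "u : K" "v : K" using g by (auto simp: gens_def)
 from K_dich[OF gen_poly[OF uv(1), of p1]] show ?thesis
 proof
  assume nz: "eventually (%z. poly p1 (u z) ~= 0) F"
  have "gens u (%z. 0)"
  proof (rule gens_change[OF g])
   have "(%z. - (poly p0 (u z)) / poly p1 (u z)) : gen F {u, %z. 0}" by (intro gen_divide gen_uminus gen_poly gens_in)
   thus "v : gen F {u, %z. 0}"
   proof (rule gen_cong)
    show "eventually (%z. - (poly p0 (u z)) / poly p1 (u z) = v z) F" using nz P(3)
    proof eventually_elim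
     case (elim z)
     hence "v z * poly p1 (u z) = - poly p0 (u z)" by (simp add: evP eq_neg_iff_add_eq_0 add.commute)
     thus ?case using elim(1) by (simp add: field_simps)
    qed
   qed
  qed (auto intro: gens_in gen_const)
  thus ?thesis by blast
 next
  assume z: "eventually (%z. poly p1 (u z) = 0) F"
  hence z0: "eventually (%z. poly p0 (u z) = 0) F" using P(3) by eventually_elim (simp add: evP)
  obtain r where r: "eventually (%z. u z = r) F" using root_const[OF uv(1)] ne z z0 by metis
  have "gens v (%z. 0)"
  proof (rule gens_change[OF g])
   show "u : gen F {v, %z. 0}" by (rule gen_cong[OF gen_const[of r]]) (use r in \<open>eventually_elim, simp\<close>)
  qed (auto intro: gens_in gen_const)
  thus ?thesis by blast
 qed
qed

text \<open>The model is the line with equation v = 0, of degree 1 and bidegree (0, 1).\<close>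

lemma rational_bounds:
 assumes "rel u v {(i, j). j <= 1}"
 shows "s2_curve (torus_curve f) <= 1" "lex_le (s11_curve (torus_curve f)) (1, 1)"
proof -
 obtain w where "gens w (%z. 0)" using rel_linear[OF assms] by blast
 hence r: "rel w (%z. 0) {(0, 1)}" 
 proof (rule relI)
  show "lin 0 1 0 ~= (0 :: 'k poly2)" by (rule lin_nonzero) simp
  show "keys (lin 0 1 0 :: 'k poly2) \<subseteq> {(0, 1)}" by (auto simp: lin_def split: if_splits)
 qed (simp add: ev_lin)
 show "s2_curve (torus_curve f) <= 1" by (rule s2_le[OF rel_mono[OF r]]) auto
 have "lex_le (s11_curve (torus_curve f)) (min 0 1, max 0 1)" by (rule s11_le[OF rel_mono[OF r]]) auto
 thus "lex_le (s11_curve (torus_curve f)) (1, 1)" by (auto simp: lex_le_def)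
qed

text \<open>Shifting exponents by (m, m) multiplies the equation by (u v)^m, which has no zeros on
  the curve.\<close>

lemma laurent_rel:
 assumes g: "gens u v" and ev: "eventually (%z. u z ~= 0 & v z ~= 0 & evL h (u z, v z) = 0) F" and h: "h ~= 0"
  and S: "!!i j. (i, j) : keys h ==> 0 <= i + m & 0 <= j + m & (nat (i + m), nat (j + m)) : S"
 shows "rel u v S"
proof (rule relI[OF g])
 let ?\<pi> = "%(i, j). (nat (i + m), nat (j + m))"
 have inj: "inj_on ?\<pi> (keys h)"
 proof (rule inj_onI)
  fix k l assume "k : keys h" "l : keys h" "?\<pi> k = ?\<pi> l"
  thus "k = l" using S[of "fst k" "snd k"] S[of "fst l" "snd l"] by (auto simp: case_prod_unfold prod_eq_iff)
 qed
 obtain k where "k : keys h" using h by (metis ex_in_conv keys_eq_empty)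
 hence "lookup (push ?\<pi> h) (?\<pi> k) ~= 0" using lookup_push[OF inj] by (simp add: in_keys_iff)
 thus "push ?\<pi> h ~= 0" by auto
 show "keys (push ?\<pi> h) \<subseteq> S" using keys_push[of ?\<pi> h] S by fastforce
 show "eventually (%z. ev (push ?\<pi> h) (u z) (v z) = 0) F" using ev
 proof eventually_elim
  case (elim z)
  have "ev (push ?\<pi> h) (u z) (v z) = (\<Sum>k\<in>keys h. (u z powi m * v z powi m) * (lookup h k * (u z powi fst k * v z powi snd k)))"
   unfolding ev_def pmev_push unfolding pmev_def
  proof (rule sum.cong)
   fix k assume "k : keys h"
   hence k: "0 <= fst k + m" "0 <= snd k + m" using S[of "fst k" "snd k"] by auto
   have "u z ^ nat (fst k + m) = u z powi fst k * u z powi m" "v z ^ nat (snd k + m) = v z powi snd k * v z powi m"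
    using elim k by (simp_all flip: power_int_add) (simp_all add: power_int_def)
   thus "lookup h k * (case ?\<pi> k of (i, j) => u z ^ i * v z ^ j) = (u z powi m * v z powi m) * (lookup h k * (u z powi fst k * v z powi snd k))"
    by (simp add: case_prod_unfold mult_ac)
  qed simp
  also have "\<dots> = (u z powi m * v z powi m) * evL h (u z, v z)"
   by (simp add: eval_laurent2_pmev pmev_def case_prod_unfold sum_distrib_left)
  finally show ?case using elim by simp
 qed
qed

text \<open>A statement about every point: u and v map the curve onto the torus zeros of g, and a
  Laurent identity in u and v that holds off a finite set holds everywhere on it. This pointwise
  strength serves to count the points of a plane section.\<close>

definition laurent_model :: "('k \<times> 'k => 'k) => ('k \<times> 'k => 'k) => 'k laurent2 => bool" where
 "laurent_model u v g \<longleftrightarrow> gens u v & g ~= 0 & (\<forall>z\<in>Z. u z ~= 0 & v z ~= 0 & evL g (u z, v z) = 0) &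
  (\<forall>x y. x ~= 0 --> y ~= 0 --> evL g (x, y) = 0 --> (\<exists>z\<in>Z. u z = x & v z = y)) &
  (\<forall>h. eventually (%z. evL h (u z, v z) = 0) F --> (\<forall>z\<in>Z. evL h (u z, v z) = 0))"

lemma laurent_model_eventually: "laurent_model u v g ==> eventually (%z. u z ~= 0 & v z ~= 0 & evL g (u z, v z) = 0) F"
 using eventually_torus by (rule eventually_mono) (simp add: laurent_model_def)

text \<open>Since u^i v^j = x^(a i + b j) y^(c i + d j) for the chosen monomials, reindexing by the
  inverse map \<pi> rewrites f in u and v up to a monomial factor. The last conclusion says that D'
  is spanned by the exponents of g, from which its vertices are recovered as exponents.\<close>

lemma laurent_start:
 assumes D': "newton_polygon f \<sim> D'"
 obtains u v g where "laurent_model u v g" "!!i j. (i, j) : keys g ==> pt D' i j"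
  "!!X. convex X ==> (!!i j. (i, j) : keys g ==> lpt i j : X) ==> D' \<subseteq> X"
proof -
 obtain a b c d e h where u: "\<bar>a * d - b * c\<bar> = 1" and D: "D' = pull a b c d e h (newton_polygon f)" using D' by (auto simp: ueq_def)
 define \<delta> where "\<delta> = a * d - b * c"
 have dd: "\<delta> * \<delta> = 1" using u unfolding \<delta>_def[symmetric] by (auto simp: abs_if split: if_splits)
 define \<pi> where "\<pi> k = (\<delta> * (d * (fst k - e) - b * (snd k - h)), \<delta> * (a * (snd k - h) - c * (fst k - e)))" for k :: "int \<times> int"
 have IJ: "a * fst (\<pi> k) + b * snd (\<pi> k) + e = fst k" "c * fst (\<pi> k) + d * snd (\<pi> k) + h = snd k" for k
 proof -
  have "a * fst (\<pi> k) + b * snd (\<pi> k) = \<delta> * \<delta> * (fst k - e)" "c * fst (\<pi> k) + d * snd (\<pi> k) = \<delta> * \<delta> * (snd k - h)"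
   unfolding \<pi>_def by (simp_all add: \<delta>_def algebra_simps)
  thus "a * fst (\<pi> k) + b * snd (\<pi> k) + e = fst k" "c * fst (\<pi> k) + d * snd (\<pi> k) + h = snd k" using dd by simp_all
 qed
 have inj: "inj_on \<pi> (keys f)" by (rule inj_onI) (metis IJ prod_eq_iff)
 define g where "g = push \<pi> f"
 define u where "u = (%z :: 'k \<times> 'k. fst z powi a * snd z powi c)"
 define v where "v = (%z :: 'k \<times> 'k. fst z powi b * snd z powi d)"
 have uv: "u z powi i * v z powi j = fst z powi (a * i + b * j) * snd z powi (c * i + d * j)" if "fst z ~= 0" "snd z ~= 0" for z i j
  using that unfolding u_def v_def power_int_mult_distrib power_int_mult[symmetric] by (simp add: power_int_add mult_ac)
 have tor: "eventually (%z. fst z ~= 0 & snd z ~= 0) F"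
  using eventually_torus by (rule eventually_mono) (simp add: torus_zeros_def)
 have gg: "gens u v" unfolding gens_def
 proof (intro conjI)
  have b: "fst : K" "snd : K" by (auto intro: gen_base)
  show "u : K" "v : K" unfolding u_def v_def by (intro gen_mult gen_powi b)+
  have 1: "(%z. u z powi (\<delta> * d) * v z powi (- (\<delta> * c))) : gen F {u, v}" "(%z. u z powi (- (\<delta> * b)) * v z powi (\<delta> * a)) : gen F {u, v}"
   by (intro gen_powi gen_mult gens_in)+
  have x: "a * (\<delta> * d) + b * (- (\<delta> * c)) = 1" "c * (\<delta> * d) + d * (- (\<delta> * c)) = 0" "a * (- (\<delta> * b)) + b * (\<delta> * a) = 0" "c * (- (\<delta> * b)) + d * (\<delta> * a) = 1"
   using dd by (simp_all add: \<delta>_def algebra_simps)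
  have y: "u z powi (\<delta> * d) * v z powi (- (\<delta> * c)) = fst z & u z powi (- (\<delta> * b)) * v z powi (\<delta> * a) = snd z"
   if "fst z ~= 0" "snd z ~= 0" for z unfolding uv[OF that] x by simp
  show "fst : gen F {u, v}" by (rule gen_cong[OF 1(1)]) (use tor in \<open>eventually_elim, simp add: y\<close>)
  show "snd : gen F {u, v}" by (rule gen_cong[OF 1(2)]) (use tor in \<open>eventually_elim, simp add: y\<close>)
 qed
 have eg: "evL g (u z, v z) = (fst z powi (- e) * snd z powi (- h)) * evL f z" if z: "fst z ~= 0" "snd z ~= 0" for z
 proof -
  have "evL g (u z, v z) = (\<Sum>k\<in>keys f. lookup f k * (u z powi fst (\<pi> k) * v z powi snd (\<pi> k)))"
   unfolding eval_laurent2_pmev g_def pmev_push by (simp add: pmev_def case_prod_unfold)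
  also have "\<dots> = (\<Sum>k\<in>keys f. (fst z powi (- e) * snd z powi (- h)) * (lookup f k * (fst z powi fst k * snd z powi snd k)))"
  proof (rule sum.cong)
   fix k
   have "a * fst (\<pi> k) + b * snd (\<pi> k) = - e + fst k" "c * fst (\<pi> k) + d * snd (\<pi> k) = - h + snd k" using IJ[of k] by simp_all
   thus "lookup f k * (u z powi fst (\<pi> k) * v z powi snd (\<pi> k)) = (fst z powi (- e) * snd z powi (- h)) * (lookup f k * (fst z powi fst k * snd z powi snd k))"
    using z by (simp only: uv[OF z]) (simp add: power_int_diff power_int_minus field_simps)
  qed simp
  also have "\<dots> = (fst z powi (- e) * snd z powi (- h)) * evL f z"
   using eval_laurent2_pmev[of f "fst z" "snd z"] by (simp add: pmev_def case_prod_unfold sum_distrib_left)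
  finally show ?thesis .
 qed
 have Zt: "fst z ~= 0" "snd z ~= 0" "evL f z = 0" if "z : Z" for z using that by (auto simp: torus_zeros_def)
 have "laurent_model u v g" unfolding laurent_model_def
 proof (intro conjI ballI allI impI)
  show "gens u v" by (rule gg)
  obtain k where "k : keys f" using irr by (metis ex_in_conv not_irreducible_zero keys_eq_empty)
  hence "lookup g (\<pi> k) ~= 0" using lookup_push[OF inj] by (simp add: in_keys_iff g_def)
  thus "g ~= 0" by auto
  show "u z ~= 0" "v z ~= 0" "evL g (u z, v z) = 0" if "z : Z" for z
   using Zt[OF that] by (simp_all add: eg) (simp_all add: u_def v_def power_int_eq_0_iff)
  show "\<exists>z\<in>Z. u z = x & v z = y" if xy: "x ~= 0" "y ~= 0" "evL g (x, y) = 0" for x y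
  proof -
   define z where "z = (x powi (\<delta> * d) * y powi (- (\<delta> * c)), x powi (- (\<delta> * b)) * y powi (\<delta> * a))"
   have z0: "fst z ~= 0" "snd z ~= 0" using xy by (simp_all add: z_def power_int_eq_0_iff)
   have comb: "fst z powi i * snd z powi j = x powi (\<delta> * d * i + - (\<delta> * b) * j) * y powi (- (\<delta> * c) * i + \<delta> * a * j)" for i j
    using xy unfolding z_def power_int_mult_distrib fst_conv snd_conv power_int_mult[symmetric] by (simp add: power_int_diff power_int_add power_int_minus field_simps)
   have e: "\<delta> * d * a + - (\<delta> * b) * c = 1" "- (\<delta> * c) * a + \<delta> * a * c = 0" "\<delta> * d * b + - (\<delta> * b) * d = 0" "- (\<delta> * c) * b + \<delta> * a * d = 1"
    using dd by (simp_all add: \<delta>_def algebra_simps)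
   have "u z = x" "v z = y" unfolding u_def v_def comb e by simp_all
   moreover from this have "evL f z = 0" using eg[OF z0] xy(3) z0 by (simp add: power_int_eq_0_iff)
   ultimately show ?thesis using z0 by (intro bexI[of _ z]) (auto simp: torus_zeros_def)
  qed
  show "evL q (u z, v z) = 0" if q: "eventually (%z. evL q (u z, v z) = 0) F" and z: "z : Z" for q z
  proof -
   let ?q = "push (%(i, j). (a * i + b * j, c * i + d * j)) q"
   have e: "evL ?q z = evL q (u z, v z)" if "fst z ~= 0" "snd z ~= 0" for z
   proof -
    have "evL ?q (fst z, snd z) = evL q (u z, v z)"
     unfolding eval_laurent2_pmev pmev_push by (simp add: case_prod_unfold uv[OF that])
    thus ?thesis by simp
   qed
   have "eventually (%z. evL ?q z = 0) F" using q tor by eventually_elim (simp add: e)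
   from laurent_zero_everywhere[OF this z] show ?thesis using e Zt[OF z] by simp
  qed
 qed
 moreover have kg: "\<exists>k\<in>keys f. (i, j) = \<pi> k" if "(i, j) : keys g" for i j using keys_push[of \<pi> f] that by (auto simp: g_def)
 have kf: "k : keys f ==> lpt (fst k) (snd k) : newton_polygon f" for k
  unfolding lpt_def newton_polygon_def by (rule hull_inc) (auto simp: image_iff case_prod_unfold)
 have "pt D' i j" if ij: "(i, j) : keys g" for i j
 proof -
  obtain k where k: "k : keys f" "(i, j) = \<pi> k" using kg[OF ij] by blast
  hence "i = fst (\<pi> k)" "j = snd (\<pi> k)" by (metis fst_conv snd_conv)+
  thus ?thesis unfolding D pt_pull using kf[OF k(1)] by (simp only: IJ pt_def)
 qed
 moreover have "D' \<subseteq> X" if X: "convex X" and kX: "!!i j. (i, j) : keys g ==> lpt i j : X" for X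
 proof
  fix p assume p: "p : D'"
  obtain a' b' c' d' e' h' where v: "!!p. amap a' b' c' d' e' h' (amap a b c d e h p) = p" using amap_inverse[OF u, of e h] by metis
  have "newton_polygon f \<subseteq> amap a' b' c' d' e' h' -` X" unfolding newton_polygon_def
  proof (rule hull_minimal)
   show "convex (amap a' b' c' d' e' h' -` X)" by (rule convex_amap_vimage[OF X])
   show "(%(i, j). (real_of_int i, real_of_int j)) ` keys f \<subseteq> amap a' b' c' d' e' h' -` X"
   proof
    fix r assume "r : (%(i, j). (real_of_int i, real_of_int j)) ` keys f"
    then obtain k where k: "k : keys f" "r = lpt (fst k) (snd k)" by (auto simp: lpt_def)
    have "lookup g (\<pi> k) ~= 0" using lookup_push[OF inj k(1)] k(1) by (simp add: in_keys_iff g_def)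
    hence "lpt (fst (\<pi> k)) (snd (\<pi> k)) : X" by (intro kX) (simp add: in_keys_iff)
    moreover have "amap a b c d e h (lpt (fst (\<pi> k)) (snd (\<pi> k))) = r" unfolding amap_lpt IJ k(2) ..
    ultimately show "r : amap a' b' c' d' e' h' -` X" using v by (metis vimageI2)
   qed
  qed
  moreover have "amap a b c d e h p : newton_polygon f" using p unfolding D pull_amap by simp
  ultimately have "amap a' b' c' d' e' h' (amap a b c d e h p) : X" by blast
  thus "p : X" by (simp only: v)
 qed
 ultimately show ?thesis by (rule that)
qed

lemma rel_start:
 assumes D': "newton_polygon f \<sim> D'" and S: "!!i j. pt D' i j ==> 0 <= i & 0 <= j & (nat i, nat j) : S"
 shows "\<exists>u v. rel u v S"
proof -
 obtain u v g where m: "laurent_model u v g" and k: "!!i j. (i, j) : keys g ==> pt D' i j" using laurent_start[OF D'] by metis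
 have "gens u v" "g ~= 0" using m by (auto simp: laurent_model_def)
 hence "rel u v S" using laurent_rel[OF _ laurent_model_eventually[OF m], of 0 S] S[OF k] by simp
 thus ?thesis by blast
qed

lemma s2_tri_model:
 assumes "tri_model n (newton_polygon f)" "n >= 0"
 shows "int (s2_curve (torus_curve f)) <= n + 3"
proof -
 obtain N where N: "n = int N" using assms(2) nonneg_int_cases by blast
 have "\<exists>u v. rel u v {(i, j). i + j <= N + 3}" using assms(1) unfolding tri_model_def
 proof (elim disjE exE conjE)
  fix D' and E :: int
  assume D: "newton_polygon f \<sim> D'" "E >= 1" "\<forall>i j. pt D' i j --> 0 <= i & 0 <= j & i + E * j <= n + 2 + E"
  obtain s where s: "E = int (1 + s)" using zle_iff_zadd[of 1 E] D(2) by auto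
  \<comment> \<open>The bound on j is implied and only fits the shape of
    \<open>rel_shear_iterate\<close>; with E = 1 + s there remain s substitutions.\<close>
  have "\<exists>u v. rel u v {(i, j). j <= N + 3 + s & i + (1 + s) * j <= (N + 3) + s}"
  proof (rule rel_start[OF D(1)])
   fix i j assume "pt D' i j"
   hence p: "0 <= i" "0 <= j" "i + E * j <= n + 2 + E" using D(3) by auto
   have "1 * j <= E * j" using p(2) D(2) by (intro mult_right_mono)
   hence j: "j <= n + 2 + E" using p by linarith
   have "int (nat i + (1 + s) * nat j) = i + E * j" using p(1,2) s by (simp add: algebra_simps)
   hence "nat i + (1 + s) * nat j <= N + 3 + s" using p(3) N s by linarith
   moreover have "nat j <= N + 3 + s" using j N s by linarith
   ultimately show "0 <= i & 0 <= j & (nat i, nat j) : {(i, j). j <= N + 3 + s & i + (1 + s) * j <= (N + 3) + s}" using p by simp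
  qed
  then obtain u v where "rel u v {(i, j). j <= N + 3 + s & i + (1 + s) * j <= (N + 3) + s}" by blast
  then obtain u v where "rel u v {(i, j). j <= N + 3 + s & i + 1 * j <= N + 3}" using rel_shear_iterate by fastforce
  hence "rel u v {(i, j). i + j <= N + 3}" by (rule rel_mono) auto
  thus ?thesis by blast
 next
  fix D' and A B :: int
  assume D: "newton_polygon f \<sim> D'" "0 <= A" "0 <= B" "A + B = n + 4" "\<forall>i j. pt D' i j --> 0 <= i & i <= A & 0 <= j & j <= B"
  have "\<exists>u v. rel u v {(i, j). i <= nat A & j <= nat B}"
   by (rule rel_start[OF D(1)]) (use D(5) nat_mono in auto)
  then obtain u v where r: "rel u v {(i, j). i <= nat A & j <= nat B}" by blast
  have AB: "nat A + nat B = N + 4" using D(2-4) N by linarith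
  then obtain u v where "rel u v {(i, j). i + j <= nat A + nat B - 1}" using rel_rectangle[OF r] by auto
  moreover have "nat A + nat B - 1 = N + 3" using AB by simp
  ultimately have "rel u v {(i, j). i + j <= N + 3}" by metis
  thus ?thesis by blast
 qed
 then obtain u v where "rel u v {(i, j). i + j <= N + 3}" by blast
 from s2_le[OF this] show ?thesis using N by simp
qed

lemma s11_box_model:
 assumes "box_model w b (newton_polygon f)" "0 <= w" "w <= b"
 shows "lex_le (map_prod int int (s11_curve (torus_curve f))) (w + 2, b + 2)"
proof -
 obtain W B where N: "w = int W" "b = int B" using assms(2,3) by (metis nonneg_int_cases order_trans)
 have "lex_le (s11_curve (torus_curve f)) (W + 2, B + 2)" using assms(1) unfolding box_model_def
 proof (elim disjE exE conjE)
  fix D' and E :: int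
  assume D: "newton_polygon f \<sim> D'" "E >= 0" "\<forall>i j. pt D' i j --> 0 <= i & 0 <= j & j <= w + 2 & i + E * j <= b + 2 + E"
  obtain s where s: "E = int s" using D(2) nonneg_int_cases by blast
  have "\<exists>u v. rel u v {(i, j). j <= W + 2 & i + (0 + s) * j <= (B + 2) + s}"
  proof (rule rel_start[OF D(1)])
   fix i j assume "pt D' i j"
   hence p: "0 <= i" "0 <= j" "j <= w + 2" "i + E * j <= b + 2 + E" using D(3) by auto
   have "int (nat i + s * nat j) = i + E * j" using p s by simp
   hence "nat i + s * nat j <= B + 2 + s" using p(4) N s by linarith
   moreover have "nat j <= W + 2" using p N by linarith
   ultimately show "0 <= i & 0 <= j & (nat i, nat j) : {(i, j). j <= W + 2 & i + (0 + s) * j <= (B + 2) + s}" using p by simp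
  qed
  then obtain u v where "rel u v {(i, j). j <= W + 2 & i + (0 + s) * j <= (B + 2) + s}" by blast
  then obtain u v where "rel u v {(i, j). j <= W + 2 & i + 0 * j <= B + 2}" using rel_shear_iterate by fastforce
  hence "rel u v {(i, j). i <= B + 2 & j <= W + 2}" by (rule rel_mono) auto
  from s11_le[OF this] show ?thesis by (rule lex_le_trans) (use assms(3) N in \<open>auto simp: lex_le_def\<close>)
 next
  fix D'
  assume D: "newton_polygon f \<sim> D'" "\<forall>i j. pt D' i j --> 0 <= i & 0 <= j & i + j <= w + 3"
  have "\<exists>u v. rel u v {(i, j). i + j <= W + 3}"
  proof (rule rel_start[OF D(1)])
   fix i j assume "pt D' i j"
   hence "0 <= i" "0 <= j" "i + j <= w + 3" using D(2) by auto
   thus "0 <= i & 0 <= j & (nat i, nat j) : {(i, j). i + j <= W + 3}" using N by simp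
  qed
  then obtain u v where r: "rel u v {(i, j). i + j <= W + 3}" by blast
  \<comment> \<open>Degree W + 3 projects from two curve points to bidegree (W + 2, W + 2), which is
    enough because w <= b.\<close>
  obtain u v where "rel u v {(i, j). i <= W + 3 - 1 & j <= W + 3 - 1}" by (rule rel_project[OF r]) simp
  from s11_le[OF this] show ?thesis by (rule lex_le_trans) (use assms(3) N in \<open>auto simp: lex_le_def\<close>)
 qed
 thus ?thesis using N by (auto simp: lex_le_def)
qed

text \<open>The values -2 and -1 for the empty polygon make 1 and (1, 1) the required bounds. They
  hold because the curve is rational: a strip of width one gives a relation linear in one variable,
  and a conic becomes such a relation by projection from two of its points.\<close>

lemma no_interior_bounds:
 assumes D: "body (newton_polygon f)" and n: "!!i j. ~ ip (newton_polygon f) i j"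
 shows "s2_curve (torus_curve f) <= 1" "lex_le (s11_curve (torus_curve f)) (1, 1)"
proof -
 obtain D' where D': "newton_polygon f \<sim> D'" "(\<forall>i j. pt D' i j --> 0 <= j & j <= 1) \<or> (\<forall>i j. pt D' i j --> 0 <= i & 0 <= j & i + j <= 2)"
  using no_interior_points[OF D n] by blast
 have "\<exists>u v. rel u v {(i, j). j <= 1}" using D'(2)
 proof
  assume s: "\<forall>i j. pt D' i j --> 0 <= j & j <= 1"
  obtain M where M: "!!i j. pt D' i j ==> \<bar>i\<bar> <= M & \<bar>j\<bar> <= M" using body_bounded[OF ueq_body[OF D'(1) D]] by metis
  have "newton_polygon f \<sim> pull 1 0 0 1 (- M) 0 D'" by (rule ueq_trans[OF D'(1)]) (rule ueqI, simp)
  thus ?thesis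
  proof (rule rel_start)
   fix i j assume "pt (pull 1 0 0 1 (- M) 0 D') i j"
   hence p: "pt D' (i - M) j" by simp
   have "0 <= j" "j <= 1" "\<bar>i - M\<bar> <= M" using s M p by blast+
   thus "0 <= i & 0 <= j & (nat i, nat j) : {(i, j). j <= 1}" by auto
  qed
 next
  assume t: "\<forall>i j. pt D' i j --> 0 <= i & 0 <= j & i + j <= 2"
  have "\<exists>u v. rel u v {(i, j). i + j <= 2}"
  proof (rule rel_start[OF D'(1)])
   fix i j assume "pt D' i j"
   hence "0 <= i" "0 <= j" "i + j <= 2" using t by auto
   thus "0 <= i & 0 <= j & (nat i, nat j) : {(i, j). i + j <= 2}" by simp
  qed
  then obtain u v where r: "rel u v {(i, j). i + j <= 2}" by blast
  obtain u v where "rel u v {(i, j). i <= 2 - 1 & j <= 2 - 1}" by (rule rel_project[OF r order_refl])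
  hence "rel u v {(i, j). j <= 1}" by (rule rel_mono) auto
  thus ?thesis by blast
 qed
 thus "s2_curve (torus_curve f) <= 1" "lex_le (s11_curve (torus_curve f)) (1, 1)" using rational_bounds by blast+
qed

end

section \<open>Lattice sizes of the interior polygon\<close>

lemma lattice_set_iff: "p : \<int> \<times> \<int> \<longleftrightarrow> (\<exists>i j. p = lpt i j)"
 by (auto simp: lpt_def Ints_def)

text \<open>A convex set contains the hull as soon as it contains the lattice points, and an image
  under a unimodular map corresponds to the pullback along its inverse.\<close>

lemma fits_iff:
 assumes X: "convex X"
 shows "(\<exists>\<phi>. unimodular \<phi> & \<phi> ` interior_polygon D \<subseteq> X) \<longleftrightarrow> (\<exists>D'. D \<sim> D' & (\<forall>i j. ip D' i j --> lpt i j : X))"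
  (is "?L \<longleftrightarrow> ?R")
proof
 assume ?L
 then obtain a b c d e h where u: "\<bar>a * d - b * c\<bar> = 1" and s: "amap a b c d e h ` interior_polygon D \<subseteq> X"
  unfolding unimodular_amap by blast
 obtain a' b' c' d' e' h' where v: "\<bar>a' * d' - b' * c'\<bar> = 1" "!!p. amap a b c d e h (amap a' b' c' d' e' h' p) = p"
  using amap_inverse[OF u, of e h] by metis
 show ?R
 proof (intro exI[of _ "pull a' b' c' d' e' h' D"] conjI allI impI)
  show "D \<sim> pull a' b' c' d' e' h' D" by (rule ueqI[OF v(1)])
  fix i j assume "ip (pull a' b' c' d' e' h' D) i j"
  hence "ip D (a' * i + b' * j + e') (c' * i + d' * j + h')" by (simp only: ip_pull[OF v(1)])
  hence "amap a' b' c' d' e' h' (lpt i j) : interior_polygon D" unfolding interior_polygon_def amap_lpt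
   by (intro hull_inc) (auto simp: ip_def lattice_set_iff)
  hence "amap a b c d e h (amap a' b' c' d' e' h' (lpt i j)) : X" using s by blast
  thus "lpt i j : X" by (simp only: v(2))
 qed
next
 assume ?R
 then obtain a b c d e h where u: "\<bar>a * d - b * c\<bar> = 1" and s: "!!i j. ip (pull a b c d e h D) i j ==> lpt i j : X"
  unfolding ueq_def by blast
 obtain a' b' c' d' e' h' where v: "\<bar>a' * d' - b' * c'\<bar> = 1" "!!p. amap a b c d e h (amap a' b' c' d' e' h' p) = p"
  using amap_inverse[OF u, of e h] by metis
 have "interior_polygon D \<subseteq> amap a' b' c' d' e' h' -` X" unfolding interior_polygon_def
 proof (rule hull_minimal)
  show "convex (amap a' b' c' d' e' h' -` X)" by (rule convex_amap_vimage[OF X])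
  show "interior D \<inter> \<int> \<times> \<int> \<subseteq> amap a' b' c' d' e' h' -` X"
  proof
  fix p assume p: "p : interior D \<inter> \<int> \<times> \<int>"
  then obtain m n where mn: "p = lpt m n" by (auto simp: lattice_set_iff)
  obtain i j where ij: "amap a' b' c' d' e' h' p = lpt i j" unfolding mn amap_lpt by blast
  have "lpt (a * i + b * j + e) (c * i + d * j + h) = p" using v(2)[of p] unfolding ij amap_lpt .
  hence "ip D (a * i + b * j + e) (c * i + d * j + h)" using p by (simp add: ip_def)
  hence "ip (pull a b c d e h D) i j" by (simp only: ip_pull[OF u])
  thus "p : amap a' b' c' d' e' h' -` X" using s ij by simp
  qed
 qed
 thus ?L using v(1) unfolding unimodular_amap by blast
qed

lemma dilate_std_triangle: "dilate n std_triangle = {(x, y). 0 <= x & 0 <= y & x + y <= real n}"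
proof -
 have std: "std_triangle = {(x, y). 0 <= x & 0 <= y & x + y <= 1}"
 proof (intro equalityI subsetI)
  fix p assume "p : std_triangle"
  thus "p : {(x, y). 0 <= x & 0 <= y & x + y <= 1}" unfolding std_triangle_def convex_hull_3 by auto
 next
  fix p :: "real \<times> real" assume "p : {(x, y). 0 <= x & 0 <= y & x + y <= 1}"
  then obtain x y where p: "p = (x, y)" "0 <= x" "0 <= y" "x + y <= 1" by auto
  show "p : std_triangle" unfolding std_triangle_def convex_hull_3
   by (rule CollectI, rule exI[of _ "1 - x - y"], rule exI[of _ x], rule exI[of _ y]) (use p in auto)
 qed
 show ?thesis
 proof (intro equalityI subsetI)
  fix p assume "p : dilate n std_triangle"
  then obtain x y where p: "p = (real n * x, real n * y)" "0 <= x" "0 <= y" "x + y <= 1" unfolding dilate_def std by force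
  have "real n * (x + y) <= real n * 1" using p(4) by (intro mult_left_mono) auto
  thus "p : {(x, y). 0 <= x & 0 <= y & x + y <= real n}" using p by (auto simp: algebra_simps)
 next
  fix p :: "real \<times> real" assume "p : {(x, y). 0 <= x & 0 <= y & x + y <= real n}"
  then obtain x y where p: "p = (x, y)" "0 <= x" "0 <= y" "x + y <= real n" by auto
  show "p : dilate n std_triangle" unfolding dilate_def std
  proof (rule image_eqI[of _ _ "(x / real n, y / real n)"])
   show "p = real n *\<^sub>R (x / real n, y / real n)" using p by (cases "n = 0") auto
   show "(x / real n, y / real n) : {(x, y). 0 <= x & 0 <= y & x + y <= 1}"
    using p by (cases "n = 0") (auto simp: field_simps)
  qed
 qed
qed

lemma dilate_unit_square: "dilate n unit_square = {0..real n} \<times> {0..real n}"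
proof (intro equalityI subsetI)
 fix p assume "p : dilate n unit_square"
 then obtain x y where p: "p = (real n * x, real n * y)" "0 <= x" "0 <= y" "x <= 1" "y <= 1" unfolding dilate_def unit_square_def by force
 have "real n * x <= real n * 1" "real n * y <= real n * 1" using p by (intro mult_left_mono; simp)+
 thus "p : {0..real n} \<times> {0..real n}" using p by auto
next
 fix p :: "real \<times> real" assume "p : {0..real n} \<times> {0..real n}"
 then obtain x y where p: "p = (x, y)" "0 <= x" "0 <= y" "x <= real n" "y <= real n" by auto
 show "p : dilate n unit_square" unfolding dilate_def unit_square_def
 proof (rule image_eqI[of _ _ "(x / real n, y / real n)"])
  show "p = real n *\<^sub>R (x / real n, y / real n)" using p by (cases "n = 0") auto
  show "(x / real n, y / real n) : {0..1} \<times> {0..1}" using p by (cases "n = 0") (auto simp: field_simps)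
 qed
qed

lemma tri_bound_iff: "(\<exists>\<phi>. unimodular \<phi> & \<phi> ` interior_polygon D \<subseteq> dilate n std_triangle) \<longleftrightarrow> tri_bound D (int n)"
proof -
 have "convex (dilate n std_triangle)" unfolding dilate_def std_triangle_def by (intro convex_scaling convex_convex_hull)
 moreover have "lpt i j : dilate n std_triangle \<longleftrightarrow> 0 <= i & 0 <= j & i + j <= int n" for i j
  unfolding dilate_std_triangle lpt_def by simp linarith
 ultimately show ?thesis by (simp add: fits_iff tri_bound_def)
qed

lemma box_bound_iff: "(\<exists>\<phi>. unimodular \<phi> & \<phi> ` interior_polygon D \<subseteq> dilate n unit_square) \<longleftrightarrow> box_bound D (int n) (int n)"
proof -
 have "convex (dilate n unit_square)" unfolding dilate_unit_square by (intro convex_Times) auto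
 moreover have "lpt i j : dilate n unit_square \<longleftrightarrow> 0 <= i & i <= int n & 0 <= j & j <= int n" for i j
  unfolding dilate_unit_square lpt_def by auto
 ultimately show ?thesis by (simp add: fits_iff box_bound_def)
qed

lemma strip_bound_iff: "(\<exists>\<phi>. unimodular \<phi> & \<phi> ` interior_polygon D \<subseteq> {0..real n} \<times> UNIV) \<longleftrightarrow> strip_bound D (int n)"
proof -
 have "convex ({0..real n} \<times> (UNIV :: real set))" by (intro convex_Times) auto
 moreover have "lpt i j : {0..real n} \<times> UNIV \<longleftrightarrow> 0 <= i & i <= int n" for i j
  unfolding lpt_def by auto
 ultimately show ?thesis by (simp add: fits_iff strip_bound_def)
qed

lemma interior_polygon_empty: "interior_polygon D = {} \<longleftrightarrow> (\<forall>i j. ~ ip D i j)"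
proof -
 have "interior D \<inter> \<int> \<times> \<int> = {} \<longleftrightarrow> (\<forall>i j. lpt i j \<notin> interior D)" using lattice_set_iff by (metis IntI Int_iff all_not_in_conv)
 thus ?thesis by (simp add: interior_polygon_def ip_def)
qed

lemma body_box_bound:
 assumes "body D"
 shows "\<exists>n. box_bound D (int n) (int n)"
proof -
 obtain M where M: "!!i j. pt D i j ==> \<bar>i\<bar> <= M & \<bar>j\<bar> <= M" using body_bounded[OF assms] by metis
 have "D \<sim> pull 1 0 0 1 (- M) (- M) D" by (rule ueqI) simp
 moreover have "0 <= i & i <= int (nat (2 * M)) & 0 <= j & j <= int (nat (2 * M))" if "ip (pull 1 0 0 1 (- M) (- M) D) i j" for i j
 proof -
  have "ip D (i - M) (j - M)" using that by (simp add: ip_pull)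
  from M[OF ip_pt[OF this]] show ?thesis by auto
 qed
 ultimately show ?thesis unfolding box_bound_def by (intro exI[of _ "nat (2 * M)"] conjI) auto
qed

lemma body_newton_polygon:
 assumes "aff_dim (newton_polygon f) = 2"
 shows "body (newton_polygon f)"
proof -
 let ?N = "newton_polygon f"
 have c: "convex ?N" by (simp add: newton_polygon_def)
 have ne: "?N ~= {}" using assms by auto
 then obtain k where "k : keys f" by (metis ex_in_conv image_empty newton_polygon_def convex_hull_empty)
 hence "lpt (fst k) (snd k) : ?N" unfolding lpt_def newton_polygon_def by (intro hull_inc) (auto simp: image_iff case_prod_unfold)
 hence k: "pt ?N (fst k) (snd k)" by (simp add: pt_def)
 have "interior ?N = rel_interior ?N" using interior_rel_interior_gen[of ?N] assms by simp
 hence i: "interior ?N ~= {}" using rel_interior_eq_empty[OF c] ne by simp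
 have "bounded ?N" unfolding newton_polygon_def by (intro compact_imp_bounded finite_imp_compact_convex_hull) simp
 then obtain B where B: "!!p. p : ?N ==> norm p <= B" by (auto simp: bounded_iff)
 have "{(i, j). pt ?N i j} \<subseteq> {-\<lceil>B\<rceil>..\<lceil>B\<rceil>} \<times> {-\<lceil>B\<rceil>..\<lceil>B\<rceil>}"
 proof
  fix q assume "q : {(i, j). pt ?N i j}"
  then obtain i j where q: "q = (i, j)" "norm (lpt i j) <= B" using B[of "lpt _ _"] by (auto simp: pt_def)
  have "\<bar>real_of_int i\<bar> <= B" "\<bar>real_of_int j\<bar> <= B"
   using norm_fst_le[of "real_of_int i" "real_of_int j"] norm_snd_le[of "real_of_int j" "real_of_int i"] q(2) by (auto simp: lpt_def)
  hence "\<bar>i\<bar> <= \<lceil>B\<rceil>" "\<bar>j\<bar> <= \<lceil>B\<rceil>" by linarith+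
  thus "q : {-\<lceil>B\<rceil>..\<lceil>B\<rceil>} \<times> {-\<lceil>B\<rceil>..\<lceil>B\<rceil>}" using q by auto
 qed
 hence "finite {(i, j). pt ?N i j}" by (rule finite_subset) simp
 thus ?thesis unfolding body_def using c i k by blast
qed

context curve begin

theorem general_bounds:
 assumes "aff_dim (newton_polygon f) = 2"
 shows "int (s2_curve (torus_curve f)) <= ls_triangle (interior_polygon (newton_polygon f)) + 3"
  "lex_le (map_prod int int (s11_curve (torus_curve f))) (s11_polygon (interior_polygon (newton_polygon f)) + (2, 2))"
proof -
 let ?N = "newton_polygon f"
 have B: "body ?N" by (rule body_newton_polygon[OF assms])
 have "int (s2_curve (torus_curve f)) <= ls_triangle (interior_polygon ?N) + 3 &
  lex_le (map_prod int int (s11_curve (torus_curve f))) (s11_polygon (interior_polygon ?N) + (2, 2))"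
 proof (cases "interior_polygon ?N = {}")
  case True
  hence "~ ip ?N i j" for i j by (simp add: interior_polygon_empty)
  from no_interior_bounds[OF B this] show ?thesis using True
   by (auto simp: ls_triangle_def s11_polygon_def lw_def ls_square_def lex_le_def)
 next
  case False
  then obtain i0 j0 where ip: "ip ?N i0 j0" by (auto simp: interior_polygon_empty)
  obtain n0 where n0: "box_bound ?N (int n0) (int n0)" using body_box_bound[OF B] by blast
  hence s0: "strip_bound ?N (int n0)" unfolding box_bound_def strip_bound_def by blast
  have t0: "tri_bound ?N (int (2 * n0))" using n0 unfolding box_bound_def tri_bound_def by fastforce
  define t where "t = (LEAST d. tri_bound ?N (int d))"
  define w where "w = (LEAST d. strip_bound ?N (int d))"
  define b where "b = (LEAST d. box_bound ?N (int d) (int d))"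
  have t: "tri_bound ?N (int t)" unfolding t_def by (rule LeastI[of _ "2 * n0"]) (rule t0)
  have w: "strip_bound ?N (int w)" unfolding w_def by (rule LeastI[of _ n0]) (rule s0)
  have b: "box_bound ?N (int b) (int b)" unfolding b_def by (rule LeastI[of _ n0]) (rule n0)
  have tmin: "int t <= n" if "tri_bound ?N n" for n
  proof -
   have "n = int (nat n)" using that by (simp add: tri_bound_def)
   hence "t <= nat n" unfolding t_def using that by (intro Least_le) simp
   thus ?thesis using \<open>n = int (nat n)\<close> by linarith
  qed
  have wmin: "int w <= n" if "strip_bound ?N n" for n
  proof -
   have "n = int (nat n)" using that by (simp add: strip_bound_def)
   hence "w <= nat n" unfolding w_def using that by (intro Least_le) simp
   thus ?thesis using \<open>n = int (nat n)\<close> by linarith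
  qed
  have "tri_model (int t) ?N" by (rule tri_model_exists[OF B ip t tmin])
  hence "int (s2_curve (torus_curve f)) <= int t + 3" by (rule s2_tri_model) simp
  moreover have "ls_triangle (interior_polygon ?N) = int t" using False by (simp add: ls_triangle_def tri_bound_iff t_def)
  moreover have "box_model (int w) (int b) ?N" by (rule box_model_exists[OF B ip w wmin b])
  hence "lex_le (map_prod int int (s11_curve (torus_curve f))) (int w + 2, int b + 2)"
  proof (rule s11_box_model)
   show "int w <= int b" by (rule wmin) (use b in \<open>auto simp: box_bound_def strip_bound_def\<close>)
  qed simp
  moreover have "lw (interior_polygon ?N) = int w" "ls_square (interior_polygon ?N) = int b"
   using False by (simp_all add: lw_def ls_square_def strip_bound_iff box_bound_iff w_def b_def)
  ultimately show ?thesis by (simp add: s11_polygon_def)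
 qed
 thus "int (s2_curve (torus_curve f)) <= ls_triangle (interior_polygon ?N) + 3"
  "lex_le (map_prod int int (s11_curve (torus_curve f))) (s11_polygon (interior_polygon ?N) + (2, 2))" by auto
qed

end

section \<open>Projecting a curve on a cubic surface from one of its points\<close>

text \<open>Newton's recursion for the power sums of two quantities with sum s and product q; the
  initial 2 counts their zeroth powers.\<close>

fun psum :: "'k::comm_ring_1 poly2 => 'k poly2 => nat => 'k poly2" where
 "psum s q 0 = 2"
| "psum s q (Suc 0) = s"
| "psum s q (Suc (Suc n)) = s * psum s q (Suc n) - q * psum s q n"

lemma ev_2 [simp]: "ev 2 a b = 2"
 using ev_add[of 1 1 a b] by simp

lemma wle_2 [simp]: "wle p q d (2 :: 'k::comm_ring_1 poly2)"
 using wle_add[OF wle_1 wle_1, of p q d] by simp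

lemma ev_psum: "ev s a b = r1 + r2 ==> ev q a b = r1 * r2 ==> ev (psum s q n) a b = r1 ^ n + r2 ^ n"
 by (induction s q n rule: psum.induct) (simp_all add: ev_add ev_diff ev_mult ev_single algebra_simps)

lemma wle_psum: "wle 1 1 2 s ==> wle 1 1 4 q ==> wle 1 1 (2 * n) (psum s q n)"
proof (induction s q n rule: psum.induct)
 case (1 s q)
 show ?case by simp
next
 case (3 s q n)
 show ?case unfolding psum.simps
  by (rule wle_diff; rule wle_mult[OF "3.prems"(1) "3.IH"(1)[OF "3.prems"]] wle_mult[OF "3.prems"(2) "3.IH"(2)[OF "3.prems"]]; simp)
qed simp

lemma sum_square_split:
 fixes A :: "nat => nat => 'a::comm_ring_1"
 shows "(\<Sum>i<n. \<Sum>j<n. A i j) = (\<Sum>i<n. A i i) + (\<Sum>j<n. \<Sum>i<j. A i j + A j i)"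
 by (induction n) (simp_all add: sum.distrib algebra_simps)

lemma coeff_mult_top:
 fixes p q :: "'a::comm_ring_1 poly"
 assumes "pdeg p <= m" "pdeg q <= n"
 shows "coeff (p * q) (m + n) = coeff p m * coeff q n"
proof -
 have "coeff (p * q) (m + n) = (\<Sum>i\<le>m + n. if i = m then coeff p m * coeff q n else 0)"
  unfolding coeff_mult
 proof (rule sum.cong)
  fix i assume "i : {..m + n}"
  show "coeff p i * coeff q (m + n - i) = (if i = m then coeff p m * coeff q n else 0)"
  proof (cases i m rule: linorder_cases)
   case less
   hence "coeff q (m + n - i) = 0" using assms by (intro coeff_eq_0) linarith
   thus ?thesis using less by simp
  next
   case greater
   hence "coeff p i = 0" using assms by (intro coeff_eq_0) linarith
   thus ?thesis using greater by simp
  qed simp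
 qed simp
 thus ?thesis by simp
qed

lemma coeff_linear_power:
 fixes x :: "'a::comm_ring_1"
 shows "pdeg ([:1, x:] ^ n) <= n & coeff ([:1, x:] ^ n) n = x ^ n"
proof (induction n)
 case (Suc n)
 have d: "pdeg [:1, x:] <= 1" by simp
 have "pdeg ([:1, x:] * [:1, x:] ^ n) <= 1 + n" using degree_mult_le[of "[:1, x:]" "[:1, x:] ^ n"] Suc d by linarith
 moreover have "coeff ([:1, x:] * [:1, x:] ^ n) (1 + n) = x * x ^ n" using coeff_mult_top[OF d, of "[:1, x:] ^ n" n] Suc by simp
 ultimately show ?case by simp
qed simp

text \<open>In X = 1 + p t and W = 1 + q t each p or q comes with a factor t, so the coefficient of
  t^i has degree at most i in p and q.\<close>

definition graded :: "'k::comm_ring_1 poly2 poly => bool" where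
 "graded p \<longleftrightarrow> (\<forall>i. wle 1 1 i (coeff p i))"

lemma graded_mult: "graded p ==> graded q ==> graded (p * q)"
 unfolding graded_def coeff_mult by (intro allI wle_sum) (rule wle_mult, auto)

lemma graded_1: "graded 1"
 unfolding graded_def by (auto simp: coeff_1 simp flip: One_nat_def)

lemma graded_power: "graded p ==> graded (p ^ n)"
 by (induction n) (auto intro: graded_mult graded_1)

lemma graded_sum: "(!!k. k : A ==> graded (p k)) ==> graded (sum p A)"
 unfolding graded_def coeff_sum by (intro allI wle_sum) auto

lemma graded_linear: "wle 1 1 0 c ==> wle 1 1 1 x ==> graded [:c, x:]"
 unfolding graded_def by (auto simp: coeff_pCons split: nat.splits intro: wle_mono)

text \<open>The homogeneous parts at \<open>(1, 1, 1)\<close> of a polynomial \<open>\<Sum> c X\<^sup>\<alpha> Y\<^sup>\<beta> Z\<^sup>\<gamma>\<close>, dehomogenized in the direction of \<open>Y\<close>.\<close>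

lemma taylor:
 fixes c :: "'i => 'k::comm_ring_1" and \<alpha> \<beta> \<gamma> :: "'i => nat"
 assumes fin: "finite I" and deg: "!!k. k : I ==> \<alpha> k + \<beta> k + \<gamma> k <= d" and one: "(\<Sum>k\<in>I. c k) = 0"
 obtains T :: "nat => 'k poly2" where "!!i. wle 1 1 (Suc i) (T i)"
  "!!p q t. (\<Sum>k\<in>I. c k * ((1 + p * t) ^ \<alpha> k * (1 + t) ^ \<beta> k * (1 + q * t) ^ \<gamma> k)) = t * (\<Sum>i<d. ev (T i) p q * t ^ i)"
  "!!p. d > 0 ==> ev (T (d - 1)) p 0 = (\<Sum>k\<in>{k\<in>I. \<alpha> k + \<beta> k = d}. c k * p ^ \<alpha> k)"
proof -
 let ?A = "single (1, 0) 1 :: 'k poly2" and ?C = "single (0, 1) 1 :: 'k poly2"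
 define M where "M k = [:single 0 (c k):] * ([:1, ?A:] ^ \<alpha> k * ([:1, 1:] ^ \<beta> k * [:1, ?C:] ^ \<gamma> k))" for k
 define P where "P = (\<Sum>k\<in>I. M k)"
 have gl: "graded [:1, ?A:]" "graded [:1, 1:]" "graded [:1, ?C:]"
  by (auto intro!: graded_linear wle_single)
 have "graded [:single 0 (c k), 0:]" for k by (intro graded_linear wle_single) auto
 hence gM: "graded (M k)" for k unfolding M_def by (intro graded_mult graded_power gl) simp
 hence gP: "graded P" unfolding P_def by (intro graded_sum)
 have top: "pdeg (M k) <= \<alpha> k + (\<beta> k + \<gamma> k) & coeff (M k) (\<alpha> k + (\<beta> k + \<gamma> k)) = single 0 (c k) * (?A ^ \<alpha> k * ?C ^ \<gamma> k)" for k
 proof -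
  have A: "pdeg ([:1, ?A:] ^ \<alpha> k) <= \<alpha> k" "coeff ([:1, ?A:] ^ \<alpha> k) (\<alpha> k) = ?A ^ \<alpha> k"
   and B: "pdeg ([:1, 1:] ^ \<beta> k :: 'k poly2 poly) <= \<beta> k" "coeff ([:1, 1:] ^ \<beta> k :: 'k poly2 poly) (\<beta> k) = 1 ^ \<beta> k"
   and C: "pdeg ([:1, ?C:] ^ \<gamma> k) <= \<gamma> k" "coeff ([:1, ?C:] ^ \<gamma> k) (\<gamma> k) = ?C ^ \<gamma> k"
   using coeff_linear_power by blast+
  have BC: "pdeg ([:1, 1:] ^ \<beta> k * [:1, ?C:] ^ \<gamma> k) <= \<beta> k + \<gamma> k"
   using degree_mult_le[of "[:1, 1:] ^ \<beta> k" "[:1, ?C:] ^ \<gamma> k"] B(1) C(1) by linarith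
  have ABC: "pdeg ([:1, ?A:] ^ \<alpha> k * ([:1, 1:] ^ \<beta> k * [:1, ?C:] ^ \<gamma> k)) <= \<alpha> k + (\<beta> k + \<gamma> k)"
   using degree_mult_le[of "[:1, ?A:] ^ \<alpha> k" "[:1, 1:] ^ \<beta> k * [:1, ?C:] ^ \<gamma> k"] BC A(1) by linarith
  have c0: "pdeg [:single 0 (c k) :: 'k poly2:] <= 0" by simp
  have "pdeg (M k) <= 0 + (\<alpha> k + (\<beta> k + \<gamma> k))"
   unfolding M_def using degree_mult_le[of "[:single 0 (c k):]" "[:1, ?A:] ^ \<alpha> k * ([:1, 1:] ^ \<beta> k * [:1, ?C:] ^ \<gamma> k)"] ABC c0 by linarith
  moreover have "coeff (M k) (0 + (\<alpha> k + (\<beta> k + \<gamma> k))) = single 0 (c k) * (?A ^ \<alpha> k * (1 ^ \<beta> k * ?C ^ \<gamma> k))"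
   unfolding M_def coeff_mult_top[OF c0 ABC] coeff_mult_top[OF A(1) BC] coeff_mult_top[OF B(1) C(1)] A B C by simp
  ultimately show ?thesis by simp
 qed
 have degP: "pdeg P <= d" unfolding P_def using top deg by (intro degree_sum_le) (auto simp: fin add.assoc intro: order_trans)
 have val: "ev (poly P (single 0 t)) p q = (\<Sum>k\<in>I. c k * ((1 + p * t) ^ \<alpha> k * (1 + t) ^ \<beta> k * (1 + q * t) ^ \<gamma> k))" for p q t
  unfolding P_def M_def poly_sum ev_sum by (simp add: ev_mult ev_add ev_power ev_single mult.assoc mult.commute[of t])
 have expand: "ev (poly P (single 0 t)) p q = (\<Sum>i<Suc d. ev (coeff P i) p q * t ^ i)" for p q t
 proof -
  have "poly P (single 0 t) = (\<Sum>i\<le>pdeg P. coeff P i * single 0 t ^ i)" by (rule poly_altdef)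
  also have "\<dots> = (\<Sum>i<Suc d. coeff P i * single 0 t ^ i)"
   by (rule sum.mono_neutral_left) (use degP in \<open>auto simp: coeff_eq_0 not_le\<close>)
  finally show ?thesis by (simp only: ev_sum ev_mult ev_power ev_single) simp
 qed
 have P0: "ev (coeff P 0) p q = 0" for p q
 proof -
  have "ev (poly P (single 0 0)) p q = 0" unfolding val using one by simp
  thus ?thesis by (simp add: poly_0_coeff_0)
 qed
 show ?thesis
 proof (rule that[of "%i. coeff P (Suc i)"])
  show "wle 1 1 (Suc i) (coeff P (Suc i))" for i using gP by (auto simp: graded_def simp flip: One_nat_def)
  show "(\<Sum>k\<in>I. c k * ((1 + p * t) ^ \<alpha> k * (1 + t) ^ \<beta> k * (1 + q * t) ^ \<gamma> k)) = t * (\<Sum>i<d. ev (coeff P (Suc i)) p q * t ^ i)" for p q t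
   unfolding val[symmetric] expand sum.lessThan_Suc_shift by (simp add: P0 sum_distrib_left mult_ac)
  show "ev (coeff P (Suc (d - 1))) p 0 = (\<Sum>k\<in>{k\<in>I. \<alpha> k + \<beta> k = d}. c k * p ^ \<alpha> k)" if "d > 0" for p
  proof -
   have "ev (coeff P d) p 0 = (\<Sum>k\<in>I. ev (coeff (M k) d) p 0)" by (simp add: P_def coeff_sum ev_sum)
   also have "\<dots> = (\<Sum>k\<in>I. if \<alpha> k + \<beta> k = d then c k * p ^ \<alpha> k else 0)"
   proof (rule sum.cong)
    fix k assume k: "k : I"
    show "ev (coeff (M k) d) p 0 = (if \<alpha> k + \<beta> k = d then c k * p ^ \<alpha> k else 0)"
    proof (cases "\<alpha> k + (\<beta> k + \<gamma> k) = d")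
     case True
     hence "coeff (M k) d = single 0 (c k) * (?A ^ \<alpha> k * ?C ^ \<gamma> k)" using top[of k] by simp
     thus ?thesis using True by (auto simp: ev_mult ev_power ev_single zero_power)
    next
     case False
     hence "\<alpha> k + (\<beta> k + \<gamma> k) < d" using deg[OF k] by simp
     hence "coeff (M k) d = 0" using top[of k] by (intro coeff_eq_0) linarith
     thus ?thesis using \<open>\<alpha> k + (\<beta> k + \<gamma> k) < d\<close> by auto
    qed
   qed simp
   also have "\<dots> = (\<Sum>k\<in>{k\<in>I. \<alpha> k + \<beta> k = d}. c k * p ^ \<alpha> k)" by (simp add: sum.If_cases fin Int_def)
   finally show ?thesis using that by simp
  qed
 qed
qed

text \<open>The norm of \<open>\<Sum> T\<^sub>i t\<^sup>i\<close> over the two roots \<open>t\<close> of \<open>p q t\<^sup>2 + \<sigma>\<^sub>2 t + \<sigma>\<^sub>1\<close>, cleared of denominators.\<close>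

definition norm_rel :: "nat => (nat => 'k::comm_ring_1 poly2) => 'k poly2" where
 "norm_rel d T = (let e = single (1, 1) 1; \<sigma>\<^sub>1 = lin 1 1 1; \<sigma>\<^sub>2 = lin 1 1 0 + e; S = psum (- \<sigma>\<^sub>2) (\<sigma>\<^sub>1 * e) in
  (\<Sum>i<d. (T i * T i) * (\<sigma>\<^sub>1 ^ i * e ^ (d - 1 - i))) +
  (\<Sum>j<d. \<Sum>i<j. (T i * T j) * (\<sigma>\<^sub>1 ^ i * (S (j - i) * e ^ (d - 1 - j)))))"

text \<open>The term with indices i <= j has degree at most (i + 1) + (j + 1) + i + 2 (j - i) + 2 (d
  - 1 - j) = 2 d + j, and j <= d - 1.\<close>

lemma wle_norm_rel:
 assumes T: "!!i. wle 1 1 (Suc i) (T i)"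
 shows "wle 1 1 (3 * d - 1) (norm_rel d T)"
proof -
 let ?e = "single (1, 1) 1 :: 'a poly2" and ?s = "lin 1 1 1 :: 'a poly2" and ?u = "lin 1 1 0 + single (1, 1) 1 :: 'a poly2"
 have e: "wle 1 1 2 ?e" by (rule wle_single) simp
 have s: "wle 1 1 1 ?s" by (rule wle_lin) simp_all
 have u: "wle 1 1 2 (- ?u)" by (intro wle_uminus wle_add e wle_lin) simp_all
 have se: "wle 1 1 4 (?s * ?e)" by (rule wle_mult[OF s e]) simp
 have sp: "wle 1 1 i (?s ^ i)" for i using wle_power[OF s, of i] by simp
 have ep: "wle 1 1 (2 * i) (?e ^ i)" for i using wle_power[OF e, of i] by (simp add: mult.commute)
 have S: "wle 1 1 (2 * i) (psum (- ?u) (?s * ?e) i)" for i by (rule wle_psum[OF u se])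
 have 1: "wle 1 1 (3 * d - 1) ((T i * T i) * (?s ^ i * ?e ^ (d - 1 - i)))" if "i < d" for i
  by (rule wle_mult[OF wle_mult[OF T T order_refl] wle_mult[OF sp ep order_refl]]) (use that in simp)
 have 2: "wle 1 1 (3 * d - 1) ((T i * T j) * (?s ^ i * (psum (- ?u) (?s * ?e) (j - i) * ?e ^ (d - 1 - j))))" if "i < j" "j < d" for i j
  by (rule wle_mult[OF wle_mult[OF T T order_refl] wle_mult[OF sp wle_mult[OF S ep order_refl] order_refl]]) (use that in simp)
 show ?thesis unfolding norm_rel_def Let_def by (intro wle_add wle_sum) (use 1 2 in auto)
qed

text \<open>r1 and r2 are p q times the two roots, a scaling that makes their sum and product
  polynomial in p and q. In the expanded product the pairs (i, j) and (j, i) combine to a power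
  sum.\<close>

lemma norm_rel_eq:
 fixes T :: "nat => 'k::field poly2"
 assumes d: "d > 0" and r: "r1 + r2 = - (p + q + p * q)" "r1 * r2 = (p + q + 1) * (p * q)"
 shows "(p * q) ^ (d - 1) * ev (norm_rel d T) p q =
  (\<Sum>i<d. ev (T i) p q * ((p * q) ^ (d - 1 - i) * r1 ^ i)) * (\<Sum>j<d. ev (T j) p q * ((p * q) ^ (d - 1 - j) * r2 ^ j))"
proof -
 define e s g where "e = p * q" and "s = p + q + 1" and "g i = ev (T i) p q" for i
 let ?S = "psum (- (lin 1 1 0 + single (1, 1) 1)) (lin 1 1 1 * single (1, 1) 1) :: nat => 'k poly2"
 have S: "ev (?S n) p q = r1 ^ n + r2 ^ n" for n
  by (rule ev_psum) (use r in \<open>simp_all add: ev_uminus ev_add ev_diff ev_mult ev_lin ev_single algebra_simps\<close>)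
 have rr: "r1 * r2 = s * e" using r by (simp add: s_def e_def)
 have G: "ev (norm_rel d T) p q = (\<Sum>i<d. (g i * g i) * (s ^ i * e ^ (d - 1 - i))) + (\<Sum>j<d. \<Sum>i<j. (g i * g j) * (s ^ i * ((r1 ^ (j - i) + r2 ^ (j - i)) * e ^ (d - 1 - j))))"
  unfolding norm_rel_def Let_def ev_add ev_sum ev_mult ev_power S by (simp add: ev_lin ev_single g_def s_def e_def)
 let ?A = "%i j. (g i * (e ^ (d - 1 - i) * r1 ^ i)) * (g j * (e ^ (d - 1 - j) * r2 ^ j))"
 have ee: "e ^ (d - 1) = e ^ (d - 1 - i) * e ^ i" if "i < d" for i using that by (simp flip: power_add)
 have "(\<Sum>i<d. g i * (e ^ (d - 1 - i) * r1 ^ i)) * (\<Sum>j<d. g j * (e ^ (d - 1 - j) * r2 ^ j)) = (\<Sum>i<d. \<Sum>j<d. ?A i j)" by (rule sum_product)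
 also have "\<dots> = (\<Sum>i<d. ?A i i) + (\<Sum>j<d. \<Sum>i<j. ?A i j + ?A j i)" by (rule sum_square_split)
 also have "(\<Sum>i<d. ?A i i) = (\<Sum>i<d. e ^ (d - 1) * ((g i * g i) * (s ^ i * e ^ (d - 1 - i))))"
 proof (rule sum.cong)
  fix i assume "i : {..<d}"
  have "?A i i = (g i * g i) * (e ^ (d - 1 - i) * e ^ (d - 1 - i)) * (r1 * r2) ^ i" by (simp add: power_mult_distrib mult_ac)
  also have "\<dots> = e ^ (d - 1) * ((g i * g i) * (s ^ i * e ^ (d - 1 - i)))"
   unfolding rr using ee[of i] \<open>i : {..<d}\<close> by (simp add: power_mult_distrib mult_ac)
  finally show "?A i i = e ^ (d - 1) * ((g i * g i) * (s ^ i * e ^ (d - 1 - i)))" .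
 qed simp
 also have "(\<Sum>j<d. \<Sum>i<j. ?A i j + ?A j i) = (\<Sum>j<d. \<Sum>i<j. e ^ (d - 1) * ((g i * g j) * (s ^ i * ((r1 ^ (j - i) + r2 ^ (j - i)) * e ^ (d - 1 - j)))))"
 proof (intro sum.cong refl)
  fix i j assume "j : {..<d}" "i : {..<j}"
  hence ij: "i < d" "i < j" "j < d" by auto
  have "r1 ^ j = r1 ^ i * r1 ^ (j - i)" "r2 ^ j = r2 ^ i * r2 ^ (j - i)" using ij by (simp_all flip: power_add)
  hence "?A i j + ?A j i = (g i * g j) * (e ^ (d - 1 - i) * e ^ (d - 1 - j)) * ((r1 * r2) ^ i * (r1 ^ (j - i) + r2 ^ (j - i)))"
   by (simp add: power_mult_distrib algebra_simps)
  also have "\<dots> = e ^ (d - 1) * ((g i * g j) * (s ^ i * ((r1 ^ (j - i) + r2 ^ (j - i)) * e ^ (d - 1 - j))))"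
   unfolding rr power_mult_distrib ee[OF ij(1)] by (simp only: mult_ac)
  finally show "?A i j + ?A j i = e ^ (d - 1) * ((g i * g j) * (s ^ i * ((r1 ^ (j - i) + r2 ^ (j - i)) * e ^ (d - 1 - j))))" .
 qed
 finally show ?thesis unfolding G by (simp add: g_def e_def sum_distrib_left distrib_left)
qed

text \<open>At q = 0 one root escapes to infinity, where only the leading coefficient survives, and
  the other becomes -(p + 1)/p. The explicit value serves to show that \<open>norm_rel\<close> is
  not the zero polynomial.\<close>

lemma norm_rel_degenerate:
 fixes T :: "nat => 'k::field poly2"
 assumes d: "d > 0" and p: "p ~= 0"
 shows "ev (norm_rel d T) p 0 = ev (T (d - 1)) p 0 * ((- p) ^ (d - 1) * (\<Sum>i<d. ev (T i) p 0 * (- ((p + 1) / p)) ^ i))"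
proof -
 define s g where "s = p + 1" and "g i = ev (T i) p 0" for i
 let ?S = "psum (- (lin 1 1 0 + single (1, 1) 1)) (lin 1 1 1 * single (1, 1) 1) :: nat => 'k poly2"
 have S: "ev (?S n) p 0 = (- p) ^ n + 0 ^ n" for n
  by (rule ev_psum) (simp_all add: ev_uminus ev_add ev_diff ev_mult ev_lin ev_single)
 obtain m where m: "d = Suc m" using d gr0_implies_Suc by blast
 have G: "ev (norm_rel d T) p 0 = (\<Sum>i<d. (g i * g i) * (s ^ i * 0 ^ (d - 1 - i))) + (\<Sum>j<d. \<Sum>i<j. (g i * g j) * (s ^ i * (((- p) ^ (j - i) + 0 ^ (j - i)) * 0 ^ (d - 1 - j))))"
  unfolding norm_rel_def Let_def ev_add ev_sum ev_mult ev_power S by (simp add: ev_lin ev_single g_def s_def)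
 have "(\<Sum>i<d. (g i * g i) * (s ^ i * 0 ^ (d - 1 - i))) = g m * g m * s ^ m"
  unfolding m by (simp add: sum.neutral zero_power)
 moreover have "(\<Sum>j<d. \<Sum>i<j. (g i * g j) * (s ^ i * (((- p) ^ (j - i) + 0 ^ (j - i)) * 0 ^ (d - 1 - j)))) = (\<Sum>i<m. g i * g m * (s ^ i * (- p) ^ (m - i)))"
  unfolding m by (simp add: sum.neutral zero_power)
 ultimately have "ev (norm_rel d T) p 0 = g m * (\<Sum>i<Suc m. g i * (s ^ i * (- p) ^ (m - i)))"
  unfolding G by (simp add: sum_distrib_left algebra_simps)
 also have "(\<Sum>i<Suc m. g i * (s ^ i * (- p) ^ (m - i))) = (\<Sum>i<Suc m. (- p) ^ m * (g i * (- (s / p)) ^ i))"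
 proof (rule sum.cong)
  fix i assume "i : {..<Suc m}"
  hence "(- p) ^ m = (- p) ^ (m - i) * (- p) ^ i" by (simp flip: power_add)
  moreover have "(- p) ^ i * (- (s / p)) ^ i = s ^ i" using p by (simp flip: power_mult_distrib)
  ultimately show "g i * (s ^ i * (- p) ^ (m - i)) = (- p) ^ m * (g i * (- (s / p)) ^ i)" by (simp add: mult_ac)
 qed simp
 finally show ?thesis by (simp only: m g_def s_def sum_distrib_left diff_Suc_1)
qed

context curve begin

text \<open>The curve lies on X Y W = 1 and passes through (1, 1, 1); p and q are the coordinates of
  the projection from there, and \<kappa> t is the parameter of the third point of the surface on
  the line with parameter t. Either the projection is birational, or the third point satisfies the
  equation of the curve too.\<close>

lemma project_from_point:
 fixes c :: "'i => 'k" and \<alpha> \<beta> \<gamma> :: "'i => nat" and W :: "'k \<times> 'k => 'k"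
 assumes g: "gens X Y" and d: "d >= 2" and fin: "finite I" and deg: "!!k. k : I ==> \<alpha> k + \<beta> k + \<gamma> k <= d" and one: "(\<Sum>k\<in>I. c k) = 0"
  and ev: "eventually (%z. X z * Y z * W z = 1 & X z ~= 1 & Y z ~= 1 & W z ~= 1 &
   (\<Sum>k\<in>I. c k * (X z ^ \<alpha> k * Y z ^ \<beta> k * W z ^ \<gamma> k)) = 0) F"
  and nz: "a ~= 0" "(\<Sum>k\<in>{k\<in>I. \<alpha> k + \<beta> k = d}. c k * a ^ \<alpha> k) ~= 0" "(\<Sum>k\<in>I. c k * ((- a) ^ \<alpha> k * (- (1 / a)) ^ \<beta> k)) ~= 0"
 defines "\<kappa> \<equiv> %z. (X z + Y z + W z - 3) / ((X z - 1) * (Y z - 1) * (W z - 1))"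
 shows "(\<exists>u v. rel u v {(i, j). i + j <= 3 * d - 1}) \<or>
  eventually (%z. (\<Sum>k\<in>I. c k * ((1 + (X z - 1) * \<kappa> z) ^ \<alpha> k * (1 + (Y z - 1) * \<kappa> z) ^ \<beta> k * (1 + (W z - 1) * \<kappa> z) ^ \<gamma> k)) = 0) F"
proof -
 obtain T :: "nat => 'k poly2" where T: "!!i. wle 1 1 (Suc i) (T i)"
  "!!p q t. (\<Sum>k\<in>I. c k * ((1 + p * t) ^ \<alpha> k * (1 + t) ^ \<beta> k * (1 + q * t) ^ \<gamma> k)) = t * (\<Sum>i<d. ev (T i) p q * t ^ i)"
  "!!p. d > 0 ==> ev (T (d - 1)) p 0 = (\<Sum>k\<in>{k\<in>I. \<alpha> k + \<beta> k = d}. c k * p ^ \<alpha> k)"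
  using taylor[of I \<alpha> \<beta> \<gamma> d c, OF fin deg one] by blast
 define t p q where "t = (%z. Y z - 1)" and "p = (%z. (X z - 1) / (Y z - 1))" and "q = (%z. (W z - 1) / (Y z - 1))"
 define t2 where "t2 = (%z. - ((p z + q z + p z * q z) / (p z * q z)) - t z)"
 have good: "eventually (%z. t z ~= 0 & p z ~= 0 & q z ~= 0 & X z = 1 + p z * t z & Y z = 1 + t z & W z = 1 + q z * t z &
  t z ^ 2 = - ((p z + q z + p z * q z) / (p z * q z)) * t z - (p z + q z + 1) / (p z * q z) &
  t2 z ^ 2 = - ((p z + q z + p z * q z) / (p z * q z)) * t2 z - (p z + q z + 1) / (p z * q z) &
  t z * t2 z = (p z + q z + 1) / (p z * q z) & t2 z = \<kappa> z * t z & (\<Sum>i<d. ev (T i) (p z) (q z) * t z ^ i) = 0) F"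
  using ev
 proof eventually_elim
  case (elim z)
  let ?p = "p z" and ?q = "q z" and ?t = "t z"
  have t: "?t ~= 0" and pq: "?p ~= 0" "?q ~= 0" and XYW: "X z = 1 + ?p * ?t" "Y z = 1 + ?t" "W z = 1 + ?q * ?t"
   using elim by (simp_all add: t_def p_def q_def)
  \<comment> \<open>Along the line of direction (p, 1, q) the surface equation has the root 0 and
    two more, t and t2, of a quadratic over k(p, q). Their product gives t2 / t = \<kappa>.\<close>
  have "(1 + ?p * ?t) * (1 + ?t) * (1 + ?q * ?t) = 1" using elim XYW by simp
  hence "?t * (?p * ?q * ?t ^ 2 + (?p + ?q + ?p * ?q) * ?t + (?p + ?q + 1)) = 0" by (simp add: algebra_simps power2_eq_square)
  hence quad: "?p * ?q * ?t ^ 2 + (?p + ?q + ?p * ?q) * ?t + (?p + ?q + 1) = 0" using t by simp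
  define m n where "m = (?p + ?q + ?p * ?q) / (?p * ?q)" and "n = (?p + ?q + 1) / (?p * ?q)"
  have "?p * ?q * m = ?p + ?q + ?p * ?q" "?p * ?q * n = ?p + ?q + 1" using pq by (simp_all add: m_def n_def)
  hence "(?p * ?q) * (?t ^ 2 + m * ?t + n) = 0" using quad by algebra
  hence q1: "?t ^ 2 + m * ?t + n = 0" using pq by simp
  have t2: "t2 z = - m - ?t" by (simp add: t2_def m_def)
  have q2: "t2 z ^ 2 + m * t2 z + n = 0" using q1 unfolding t2 by algebra
  have tt: "?t * t2 z = n" using q1 unfolding t2 by algebra
  have "\<kappa> z = (?p + ?q + 1) * ?t / (?p * ?t * ?t * (?q * ?t))" using XYW by (simp add: \<kappa>_def algebra_simps)
  also have "\<dots> = n / (?t * ?t)" using t pq by (simp add: n_def field_simps)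
  also have "\<dots> = t2 z / ?t" using t tt by (simp add: field_simps)
  finally have k: "t2 z = \<kappa> z * ?t" using t by simp
  have "?t * (\<Sum>i<d. ev (T i) ?p ?q * ?t ^ i) = 0" unfolding T(2)[symmetric] using elim XYW by simp
  hence s: "(\<Sum>i<d. ev (T i) ?p ?q * ?t ^ i) = 0" using t by simp
  have "?t ^ 2 = - m * ?t - n" "t2 z ^ 2 = - m * t2 z - n" using q1 q2 by (simp_all add: eq_neg_iff_add_eq_0 algebra_simps)
  thus ?case using t pq XYW tt k s by (simp add: m_def n_def)
 qed
 let ?L = "gen F {p, q}"
 have WXY: "W : gen F {X, Y}"
 proof (rule gen_cong)
  show "(%z. 1 / (X z * Y z)) : gen F {X, Y}" by (intro gen_intros gens_in)
  show "eventually (%z. 1 / (X z * Y z) = W z) F" using ev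
  proof eventually_elim
   case (elim z)
   hence "X z * Y z ~= 0" by auto
   thus ?case using elim by (simp add: field_simps)
  qed
 qed
 have pXY: "p : gen F {X, Y}" and qXY: "q : gen F {X, Y}" unfolding p_def q_def by (intro gen_intros gens_in WXY)+
 define m n where "m = (%z. (p z + q z + p z * q z) / (p z * q z))" and "n = (%z. (p z + q z + 1) / (p z * q z))"
 have mn: "m : ?L" "n : ?L" unfolding m_def n_def by (intro gen_intros gens_in)+
 have pow: "\<exists>U\<in>?L. \<exists>V\<in>?L. eventually (%z. t z ^ i = U z + V z * t z & t2 z ^ i = U z + V z * t2 z) F" for i
 proof (induction i)
  case 0
  show ?case by (rule bexI[of _ "%z. 1"], rule bexI[of _ "%z. 0"]) (auto intro: gen_const)
 next
  case (Suc i)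
  then obtain U V where UV: "U : ?L" "V : ?L" "eventually (%z. t z ^ i = U z + V z * t z & t2 z ^ i = U z + V z * t2 z) F" by blast
  show ?case
  proof (rule bexI[of _ "%z. - (V z * n z)"], rule bexI[of _ "%z. U z - V z * m z"])
   show "eventually (%z. t z ^ Suc i = - (V z * n z) + (U z - V z * m z) * t z & t2 z ^ Suc i = - (V z * n z) + (U z - V z * m z) * t2 z) F"
    using UV(3) good
   proof eventually_elim
    case (elim z)
    hence "t z ^ 2 = - m z * t z - n z" "t2 z ^ 2 = - m z * t2 z - n z" unfolding m_def n_def by blast+
    hence "t z * (U z + V z * t z) = - (V z * n z) + (U z - V z * m z) * t z" "t2 z * (U z + V z * t2 z) = - (V z * n z) + (U z - V z * m z) * t2 z"
     by algebra+
    thus ?case using elim(1) by simp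
   qed
  qed (use UV mn in \<open>auto intro!: gen_uminus gen_mult gen_diff\<close>)
 qed
 have "\<exists>A\<in>?L. \<exists>B\<in>?L. eventually (%z. (\<Sum>i<l. ev (T i) (p z) (q z) * t z ^ i) = A z + B z * t z & (\<Sum>i<l. ev (T i) (p z) (q z) * t2 z ^ i) = A z + B z * t2 z) F" for l
 proof (induction l)
  case 0
  show ?case by (rule bexI[of _ "%z. 0"], rule bexI[of _ "%z. 0"]) (auto intro: gen_const)
 next
  case (Suc l)
  then obtain A B where AB: "A : ?L" "B : ?L" "eventually (%z. (\<Sum>i<l. ev (T i) (p z) (q z) * t z ^ i) = A z + B z * t z & (\<Sum>i<l. ev (T i) (p z) (q z) * t2 z ^ i) = A z + B z * t2 z) F" by blast
  obtain U V where UV: "U : ?L" "V : ?L" "eventually (%z. t z ^ l = U z + V z * t z & t2 z ^ l = U z + V z * t2 z) F" using pow[of l] by blast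
  show ?case
  proof (rule bexI[of _ "%z. A z + ev (T l) (p z) (q z) * U z"], rule bexI[of _ "%z. B z + ev (T l) (p z) (q z) * V z"])
   show "eventually (%z. (\<Sum>i<Suc l. ev (T i) (p z) (q z) * t z ^ i) = A z + ev (T l) (p z) (q z) * U z + (B z + ev (T l) (p z) (q z) * V z) * t z &
    (\<Sum>i<Suc l. ev (T i) (p z) (q z) * t2 z ^ i) = A z + ev (T l) (p z) (q z) * U z + (B z + ev (T l) (p z) (q z) * V z) * t2 z) F"
    using AB(3) UV(3) by eventually_elim (simp add: algebra_simps)
  qed (use UV AB in \<open>auto intro!: gen_add gen_mult gen_ev gens_in\<close>)
 qed
 then obtain A B where AB: "A : ?L" "B : ?L" "eventually (%z. (\<Sum>i<d. ev (T i) (p z) (q z) * t z ^ i) = A z + B z * t z & (\<Sum>i<d. ev (T i) (p z) (q z) * t2 z ^ i) = A z + B z * t2 z) F" by blast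
 have "B : gen F {X, Y}" using gen_trans[OF AB(2)] pXY qXY by blast
 \<comment> \<open>Modulo the quadratic the equation is A + B t with A and B in k(p, q). If B is
   nonzero, then t and with it X and Y lie in k(p, q); if B is zero, so is A, and the equation holds
   at t2 as well.\<close>
 from K_dich[OF gens_K[OF g this]] show ?thesis
 proof
  assume "eventually (%z. B z = 0) F"
  hence "eventually (%z. (\<Sum>k\<in>I. c k * ((1 + (X z - 1) * \<kappa> z) ^ \<alpha> k * (1 + (Y z - 1) * \<kappa> z) ^ \<beta> k * (1 + (W z - 1) * \<kappa> z) ^ \<gamma> k)) = 0) F"
   using AB(3) good
  proof eventually_elim
   case (elim z)
   hence "(\<Sum>i<d. ev (T i) (p z) (q z) * t2 z ^ i) = 0" by simp
   hence "(\<Sum>k\<in>I. c k * ((1 + p z * t2 z) ^ \<alpha> k * (1 + t2 z) ^ \<beta> k * (1 + q z * t2 z) ^ \<gamma> k)) = 0" unfolding T(2) by simp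
   moreover have E: "p z * t2 z = (X z - 1) * \<kappa> z" "q z * t2 z = (W z - 1) * \<kappa> z" "t2 z = (Y z - 1) * \<kappa> z" using elim by simp_all
   ultimately show ?case unfolding E(1,2) unfolding E(3) by simp
  qed
  thus ?thesis ..
 next
  assume B0: "eventually (%z. B z ~= 0) F"
  have tL: "t : ?L"
  proof (rule gen_cong)
   show "(%z. - A z / B z) : ?L" by (intro gen_divide gen_uminus AB)
   show "eventually (%z. - A z / B z = t z) F" using B0 AB(3) good
   proof eventually_elim
    case (elim z)
    hence "A z + B z * t z = 0" by simp
    hence "B z * t z = - A z" by (simp add: eq_neg_iff_add_eq_0 add.commute)
    thus ?case using elim(1) by (simp add: field_simps)
   qed
  qed
  have gpq: "gens p q"
  proof (rule gens_change[OF g pXY qXY])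
   have 1: "(%z. 1 + p z * t z) : ?L" "(%z. 1 + t z) : ?L" by (intro gen_add gen_const gen_mult gens_in tL)+
   show "X : ?L" by (rule gen_cong[OF 1(1)]) (use good in \<open>eventually_elim, simp\<close>)
   show "Y : ?L" by (rule gen_cong[OF 1(2)]) (use good in \<open>eventually_elim, simp\<close>)
  qed
  let ?G = "norm_rel d T"
  have "rel p q {(i, j). i + j <= 3 * d - 1}"
  proof (rule relI[OF gpq])
   show "keys ?G \<subseteq> {(i, j). i + j <= 3 * d - 1}" using wle_norm_rel[of T d] T(1) by (auto simp: wle_def)
   \<comment> \<open>The parameter of the other finite intersection of the surface with the line of
     direction (a, 1, 0), namely of the point (-a, -1/a, 1).\<close>
   let ?s = "- ((a + 1) / a)"
   have "1 + a * ?s = - a" "1 + ?s = - (1 / a)" using nz(1) by (simp_all add: field_simps)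
   hence "?s * (\<Sum>i<d. ev (T i) a 0 * ?s ^ i) = (\<Sum>k\<in>I. c k * ((- a) ^ \<alpha> k * (- (1 / a)) ^ \<beta> k))"
    using T(2)[of a ?s 0] by simp
   hence "(\<Sum>i<d. ev (T i) a 0 * ?s ^ i) ~= 0" using nz(3) by auto
   hence "ev ?G a 0 ~= 0" using norm_rel_degenerate[of d a T] d nz(1,2) T(3)[of a] by simp
   thus "?G ~= 0" by auto
   show "eventually (%z. ev ?G (p z) (q z) = 0) F" using good
   proof eventually_elim
    case (elim z)
    let ?e = "p z * q z"
    have e: "?e ~= 0" using elim by simp
    have r: "?e * t z + ?e * t2 z = - (p z + q z + ?e)" "?e * t z * (?e * t2 z) = (p z + q z + 1) * ?e"
    proof -
     show "?e * t z + ?e * t2 z = - (p z + q z + ?e)" using e by (simp add: t2_def field_simps)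
     have "?e * t z * (?e * t2 z) = ?e * ?e * (t z * t2 z)" by (simp add: mult_ac)
     also have "t z * t2 z = (p z + q z + 1) / ?e" using elim by blast
     finally show "?e * t z * (?e * t2 z) = (p z + q z + 1) * ?e" using e by simp
    qed
    have "(\<Sum>i<d. ev (T i) (p z) (q z) * (?e ^ (d - 1 - i) * (?e * t z) ^ i)) = ?e ^ (d - 1) * (\<Sum>i<d. ev (T i) (p z) (q z) * t z ^ i)"
     unfolding sum_distrib_left
    proof (rule sum.cong)
     fix i assume "i : {..<d}"
     hence "?e ^ (d - 1) = ?e ^ (d - 1 - i) * ?e ^ i" by (simp flip: power_add)
     thus "ev (T i) (p z) (q z) * (?e ^ (d - 1 - i) * (?e * t z) ^ i) = ?e ^ (d - 1) * (ev (T i) (p z) (q z) * t z ^ i)"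
      by (simp only: power_mult_distrib mult_ac)
    qed simp
    also have "\<dots> = 0" using elim by simp
    finally have "?e ^ (d - 1) * ev ?G (p z) (q z) = 0" using norm_rel_eq[OF _ r, of d T] d by simp
    thus ?case using e by simp
   qed
  qed
  thus ?thesis by blast
 qed
qed

end

section \<open>Curves whose polygon is a multiple of \<open>upsilon\<close>\<close>

text \<open>The least power of Z = 1/(X Y) that makes the exponents of X and Y nonnegative. On the
  surface X Y Z = 1 the d-th multiple of \<open>upsilon\<close> thereby turns into total degree at
  most d.\<close>

definition gam :: "int \<times> int => nat" where
 "gam k = nat (max 0 (max (- fst k) (- snd k)))"

definition alp :: "int \<times> int => nat" where
 "alp k = nat (fst k + int (gam k))"

definition bet :: "int \<times> int => nat" where
 "bet k = nat (snd k + int (gam k))"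

lemma int_exponents: "int (alp k) = fst k + int (gam k)" "int (bet k) = snd k + int (gam k)"
 unfolding alp_def bet_def gam_def by simp_all

lemma monomial_exponents:
 fixes x :: "'k::field"
 assumes "x * y * w = 1"
 shows "x ^ alp k * y ^ bet k * w ^ gam k = x powi fst k * y powi snd k"
proof -
 have nz: "x ~= 0" "y ~= 0" using assms by auto
 have "x ^ alp k = x powi fst k * x ^ gam k" "y ^ bet k = y powi snd k * y ^ gam k"
  using nz by (simp_all flip: power_int_of_nat add: int_exponents power_int_add)
 hence "x ^ alp k * y ^ bet k * w ^ gam k = (x powi fst k * y powi snd k) * (x * y * w) ^ gam k" by (simp add: power_mult_distrib mult_ac)
 thus ?thesis using assms by simp
qed

definition in_ups :: "nat => int => int => bool" where
 "in_ups d i j \<longleftrightarrow> i + j <= int d & i - 2 * j <= int d & j - 2 * i <= int d"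

lemma exponents_le: "in_ups d (fst k) (snd k) ==> alp k + bet k + gam k <= d"
 using int_exponents[of k] unfolding in_ups_def gam_def by linarith

lemma dilate_upsilon: "dilate d upsilon \<subseteq> {(x, y). x + y <= real d & x - 2 * y <= real d & y - 2 * x <= real d}"
  "(real d, 0) : dilate d upsilon" "(0, real d) : dilate d upsilon" "(- real d, - real d) : dilate d upsilon"
proof -
 show "dilate d upsilon \<subseteq> {(x, y). x + y <= real d & x - 2 * y <= real d & y - 2 * x <= real d}"
 proof
  fix r assume "r : dilate d upsilon"
  then obtain a b c where "0 <= a" "0 <= b" "0 <= c" "a + b + c = 1" "r = (real d * (b - a), real d * (c - a))"
   unfolding dilate_def upsilon_def convex_hull_3 by force
  moreover have "real d * (1 - 3 * a) <= real d * 1" "real d * (1 - 3 * b) <= real d * 1" "real d * (1 - 3 * c) <= real d * 1"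
   using calculation by (intro mult_left_mono; simp)+
  moreover have "c = 1 - a - b" using calculation by simp
  ultimately show "r : {(x, y). x + y <= real d & x - 2 * y <= real d & y - 2 * x <= real d}" by (simp add: algebra_simps)
 qed
 have "(1, 0) : upsilon" "(0, 1) : upsilon" "(-1, -1) : upsilon" unfolding upsilon_def by (auto intro: hull_inc)
 hence "real d *\<^sub>R (1, 0) : dilate d upsilon" "real d *\<^sub>R (0, 1) : dilate d upsilon" "real d *\<^sub>R (-1, -1) : dilate d upsilon"
  unfolding dilate_def by (blast intro: imageI)+
 thus "(real d, 0) : dilate d upsilon" "(0, real d) : dilate d upsilon" "(- real d, - real d) : dilate d upsilon" by simp_all
qed

lemma convex_half_plane: "convex {(x, y). a * x + b * y <= (c :: real)}"
proof -
 have "{(x, y). a * x + b * y <= c} = {p. inner (a, b) p <= c}" by auto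
 thus ?thesis by (simp add: convex_halfspace_le)
qed

lemma keys_lookup_sum:
 fixes h :: "'x => 'k::comm_ring_1" and A :: "'x set"
 assumes "finite A"
 shows "lookup (\<Sum>k\<in>A. single k (h k)) l = (if l : A then h l else 0)"
proof -
 have "lookup (\<Sum>k\<in>A. single k (h k)) l = (\<Sum>k\<in>A. if k = l then h l else 0)"
  unfolding lookup_sum by (rule sum.cong) (auto simp: lookup_single when_def)
 thus ?thesis using assms by simp
qed

lemma card_simple_roots:
 fixes p :: "'k::alg_closed_field poly"
 assumes "p ~= 0" and s: "!!x. poly p x = 0 ==> poly (pderiv p) x ~= 0"
 shows "card {x. poly p x = 0} = pdeg p"
 using assms
proof (induction "pdeg p" arbitrary: p)
 case 0
 then obtain c where "p = [:c:]" by (metis degree_eq_zeroE)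
 thus ?case using 0 by simp
next
 case (Suc n)
 obtain a where a: "poly p a = 0" using alg_closed_imp_poly_has_root[of p] Suc.hyps(2) by (metis zero_less_Suc)
 then obtain q where q: "p = [:- a, 1:] * q" using poly_eq_0_iff_dvd by (metis dvdE)
 have q0: "q ~= 0" using q Suc.prems(1) by auto
 have dp: "pderiv p = q + [:- a, 1:] * pderiv q" unfolding q pderiv_mult by (simp add: pderiv_pCons)
 have aq: "poly q a ~= 0" using Suc.prems(2)[OF a] unfolding dp by simp
 have "pdeg p = Suc (pdeg q)" unfolding q using q0 by (subst degree_mult_eq) auto
 hence "card {x. poly q x = 0} = pdeg q"
 proof (intro Suc.hyps(1) q0)
  fix x assume x: "poly q x = 0"
  hence "poly (pderiv p) x ~= 0" by (intro Suc.prems(2)) (simp add: q)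
  thus "poly (pderiv q) x ~= 0" using x unfolding dp by auto
 qed (use Suc.hyps(2) in simp)
 moreover have "{x. poly p x = 0} = insert a {x. poly q x = 0}" unfolding q by auto
 ultimately show ?case using aq poly_roots_finite[OF q0] \<open>pdeg p = Suc (pdeg q)\<close> by simp
qed

text \<open>Closure under ring operations recognizes an expression in the coordinates as a Laurent
  polynomial, to which extension from almost all curve points applies.\<close>

definition lfun :: "('k::field \<times> 'k => 'k) set" where
 "lfun = {h. \<exists>g. \<forall>z. fst z ~= 0 --> snd z ~= 0 --> evL g z = h z}"

lemma lfun_single: "(%z. c * (fst z powi i * snd z powi j)) : lfun"
 unfolding lfun_def by (auto intro: exI[of _ "single (i, j) c"] simp: evL_single)

lemma lfun_const: "(%z. c) : lfun"
 using lfun_single[of c 0 0] by simp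

lemma lfun_add:
 assumes "g : lfun" "h : lfun"
 shows "(%z. g z + h z) : lfun"
proof -
 obtain P Q where "!!z. fst z ~= 0 ==> snd z ~= 0 ==> evL P z = g z" "!!z. fst z ~= 0 ==> snd z ~= 0 ==> evL Q z = h z"
  using assms unfolding lfun_def by blast
 thus ?thesis unfolding lfun_def by (intro CollectI exI[of _ "P + Q"]) (simp add: evL_add)
qed

lemma lfun_mult:
 assumes "g : lfun" "h : lfun"
 shows "(%z. g z * h z) : lfun"
proof -
 obtain P Q where "!!z. fst z ~= 0 ==> snd z ~= 0 ==> evL P z = g z" "!!z. fst z ~= 0 ==> snd z ~= 0 ==> evL Q z = h z"
  using assms unfolding lfun_def by blast
 thus ?thesis unfolding lfun_def by (intro CollectI exI[of _ "P * Q"]) (simp add: evL_mult)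
qed

lemma lfun_diff: "g : lfun ==> h : lfun ==> (%z. g z - h z) : lfun"
 using lfun_add[OF _ lfun_mult[OF lfun_const[of "- 1"]], of g h] by simp

lemma lfun_power: "g : lfun ==> (%z. g z ^ n) : lfun"
 by (induction n) (auto intro: lfun_const lfun_mult)

lemma lfun_sum: "(!!a. a : A ==> g a : lfun) ==> (%z. \<Sum>a\<in>A. g a z) : lfun"
 by (induction A rule: infinite_finite_induct) (auto intro: lfun_const lfun_add)

context curve begin

definition ups_model :: "nat => ('k \<times> 'k => 'k) => ('k \<times> 'k => 'k) => 'k laurent2 => bool" where
 "ups_model d u v g \<longleftrightarrow> laurent_model u v g & (\<forall>(i, j)\<in>keys g. in_ups d i j) &
  (int d, 0) : keys g & (0, int d) : keys g & (- int d, - int d) : keys g"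

lemma ups_start:
 assumes "polygon_equiv (newton_polygon f) (dilate d upsilon)"
 obtains u v g where "ups_model d u v g"
proof -
 obtain a b c e m n where u: "\<bar>a * e - b * c\<bar> = 1" and D: "dilate d upsilon = amap a b c e m n ` newton_polygon f"
  using assms unfolding polygon_equiv_def unimodular_amap by metis
 obtain a' b' c' d' e' h' where v: "\<bar>a' * d' - b' * c'\<bar> = 1" "!!p. amap a b c e m n (amap a' b' c' d' e' h' p) = p"
  "!!p. amap a' b' c' d' e' h' (amap a b c e m n p) = p" using amap_inverse[OF u, of m n] by metis
 have "dilate d upsilon = pull a' b' c' d' e' h' (newton_polygon f)" unfolding D pull_amap using v(2,3) by (auto simp: image_iff) metis
 hence "newton_polygon f \<sim> dilate d upsilon" using ueqI[OF v(1)] by metis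
 from laurent_start[OF this] obtain u v g where g: "laurent_model u v g" "!!i j. (i, j) : keys g ==> pt (dilate d upsilon) i j"
  "!!X. convex X ==> (!!i j. (i, j) : keys g ==> lpt i j : X) ==> dilate d upsilon \<subseteq> X" by metis
 have in_ups: "in_ups d i j" if "(i, j) : keys g" for i j
 proof -
  have "real_of_int i + real_of_int j <= real d & real_of_int i - 2 * real_of_int j <= real d & real_of_int j - 2 * real_of_int i <= real d"
   using g(2)[OF that] dilate_upsilon(1)[of d] by (auto simp: pt_def lpt_def)
  hence "real_of_int (i + j) <= real_of_int (int d) & real_of_int (i - 2 * j) <= real_of_int (int d) & real_of_int (j - 2 * i) <= real_of_int (int d)" by simp
  thus ?thesis unfolding in_ups_def of_int_le_iff .
 qed
 \<comment> \<open>If a vertex were missing from the support, all exponents and hence their hull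
   would lie in a half plane that excludes it.\<close>
 have vertex: "(i, j) : keys g" if vx: "(real_of_int i, real_of_int j) : dilate d upsilon" and w: "w = \<alpha> * i + \<beta> * j"
  and un: "!!i' j'. in_ups d i' j' ==> (i', j') ~= (i, j) ==> \<alpha> * i' + \<beta> * j' <= w - 1" for i j w \<alpha> \<beta> :: int
 proof (rule ccontr)
  assume n: "(i, j) \<notin> keys g"
  have "dilate d upsilon \<subseteq> {(x, y). real_of_int \<alpha> * x + real_of_int \<beta> * y <= real_of_int (w - 1)}"
  proof (rule g(3)[OF convex_half_plane])
   fix i' j' assume k: "(i', j') : keys g"
   hence "\<alpha> * i' + \<beta> * j' <= w - 1" using un[OF in_ups[OF k]] n by metis
   hence "real_of_int (\<alpha> * i' + \<beta> * j') <= real_of_int (w - 1)" by (simp only: of_int_le_iff)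
   thus "lpt i' j' : {(x, y). real_of_int \<alpha> * x + real_of_int \<beta> * y <= real_of_int (w - 1)}" by (simp add: lpt_def)
  qed
  hence "real_of_int (\<alpha> * i + \<beta> * j) <= real_of_int (w - 1)" using vx by auto
  thus False using w unfolding of_int_le_iff by simp
 qed
 have "(int d, 0) : keys g" by (rule vertex[where \<alpha> = 2 and \<beta> = "- 1" and w = "2 * int d"]) (use dilate_upsilon in \<open>auto simp: in_ups_def\<close>)
 moreover have "(0, int d) : keys g" by (rule vertex[where \<alpha> = "- 1" and \<beta> = 2 and w = "2 * int d"]) (use dilate_upsilon in \<open>auto simp: in_ups_def\<close>)
 moreover have "(- int d, - int d) : keys g" by (rule vertex[where \<alpha> = "- 1" and \<beta> = "- 1" and w = "2 * int d"]) (use dilate_upsilon in \<open>auto simp: in_ups_def\<close>)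
 ultimately have "ups_model d u v g" using g(1) in_ups by (auto simp: ups_model_def)
 thus ?thesis by (rule that)
qed

text \<open>The cyclic symmetry of X Y Z = 1. It replaces the exponents i, j by j - i, -i, so their
  difference becomes j; this decides which exponent has to be nonzero in the field.\<close>

lemma ups_rotate:
 assumes m: "ups_model d u v g"
 defines "g' \<equiv> push (%(i, j). (j - i, - i)) g"
 shows "ups_model d v (%z. 1 / (u z * v z)) g'" "!!i j. (i, j) : keys g ==> (j - i, - i) : keys g'"
proof -
 let ?R = "%(i, j). (j - i, - i) :: int \<times> int" and ?w = "%z. 1 / (u z * v z)"
 have lm: "laurent_model u v g" using m by (simp add: ups_model_def)
 have inj: "inj_on ?R (keys g)" by (auto simp: inj_on_def)
 show k: "(j - i, - i) : keys g'" if "(i, j) : keys g" for i j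
  using lookup_push[OF inj that] that by (simp add: in_keys_iff g'_def)
 have k': "\<exists>i j. (i, j) : keys g & l = (j - i, - i)" if "l : keys g'" for l
  using keys_push[of ?R g] that by (fastforce simp: g'_def)
 have rot: "evL (push ?R q) (y, 1 / (x * y)) = evL q (x, y)" if "x ~= 0" "y ~= 0" for x y and q :: "'k laurent2"
  unfolding eval_laurent2_pmev pmev_push unfolding pmev_def case_prod_unfold
  using that by (intro sum.cong refl) (simp add: power_int_diff power_int_divide_distrib power_int_minus power_int_mult_distrib field_simps)
 have Z: "u z ~= 0" "v z ~= 0" "evL g (u z, v z) = 0" if "z : Z" for z using lm that by (auto simp: laurent_model_def)
 have g: "gens u v" using lm by (simp add: laurent_model_def)
 have ev: "eventually (%z. u z ~= 0 & v z ~= 0) F" using laurent_model_eventually[OF lm] by eventually_elim simp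
 have "laurent_model v ?w g'" unfolding laurent_model_def
 proof (intro conjI ballI allI impI)
  show "gens v ?w"
  proof (rule gens_change[OF g])
   show "v : gen F {u, v}" "?w : gen F {u, v}" by (intro gen_divide gen_const gen_mult gens_in)+
   show "v : gen F {v, ?w}" by (rule gens_in)
   have 1: "(%z. 1 / (v z * ?w z)) : gen F {v, ?w}" by (intro gen_divide gen_const gen_mult gens_in(1)[of v ?w] gens_in(2)[of ?w v])
   show "u : gen F {v, ?w}" by (rule gen_cong[OF 1]) (use ev in \<open>eventually_elim, simp\<close>)
  qed
  show "g' ~= 0" using k m unfolding ups_model_def by fastforce
  show "v z ~= 0" "?w z ~= 0" "evL g' (v z, ?w z) = 0" if "z : Z" for z using Z[OF that] rot[of "u z" "v z" g] by (simp_all add: g'_def)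
  show "\<exists>z\<in>Z. v z = x & ?w z = y" if xy: "x ~= 0" "y ~= 0" "evL g' (x, y) = 0" for x y
  proof -
   have "evL g (1 / (x * y), x) = 0" using rot[of "1 / (x * y)" x g] xy by (simp add: g'_def)
   then obtain z where "z : Z" "u z = 1 / (x * y)" "v z = x" using lm xy unfolding laurent_model_def by (metis divide_eq_0_iff mult_eq_0_iff zero_neq_one)
   thus ?thesis using xy by (intro bexI[of _ z]) auto
  qed
  show "evL h (v z, ?w z) = 0" if h: "eventually (%z. evL h (v z, ?w z) = 0) F" and z: "z : Z" for h z
  proof -
   let ?h = "push (%(i, j). (- j, i - j)) h"
   have "push ?R ?h = h" by (rule push_push_inverse) auto
   hence e: "evL ?h (x, y) = evL h (y, 1 / (x * y))" if "x ~= 0" "y ~= 0" for x y using rot[OF that, of ?h] by simp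
   have "eventually (%z. evL ?h (u z, v z) = 0) F" using h ev by eventually_elim (simp add: e)
   hence "evL ?h (u z, v z) = 0" using lm z by (auto simp: laurent_model_def)
   thus ?thesis using e Z[OF z] by simp
  qed
 qed
 moreover have "in_ups d i j" if ij: "(i, j) : keys g'" for i j
 proof -
  obtain i' j' where "(i', j') : keys g" "i = j' - i'" "j = - i'" using k'[OF ij] by auto
  moreover from this have "in_ups d i' j'" using m by (auto simp: ups_model_def)
  ultimately show ?thesis by (auto simp: in_ups_def)
 qed
 moreover have "(int d, 0) : keys g'" "(0, int d) : keys g'" "(- int d, - int d) : keys g'"
  using k[of 0 "int d"] k[of "- int d" "- int d"] k[of "int d" 0] m by (auto simp: ups_model_def)
 ultimately show "ups_model d v ?w g'" by (auto simp: ups_model_def)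
qed

end

lemma pderiv_sum: "pderiv (sum p A) = (\<Sum>x\<in>A. pderiv (p x))"
 by (induction A rule: infinite_finite_induct) (simp_all add: pderiv_add)

context curve begin

lemma ups_constant:
 assumes g: "gens u v" and h: "eventually (%z. ev P (u z) (v z) = 0) F" and P: "P ~= 0" "wle 1 1 2 P" and d: "d >= 2"
 shows "\<exists>u v. rel u v {(i, j). i + j <= 3 * d - 1}"
proof -
 have "rel u v {(i, j). i + j <= 3 * d - 1}" by (rule relI[OF g P(1) _ h]) (use P(2) d in \<open>force simp: wle_def\<close>)
 thus ?thesis by blast
qed

text \<open>If all exponents are divisible by the characteristic, then the equation is a \<open>p\<close>-th power.\<close>

lemma ups_frobenius:
 assumes m: "ups_model d u v g" and d: "d >= 2" and p: "!!i j. (i, j) : keys g ==> of_int i = (0 :: 'k) & of_int j = (0 :: 'k)"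
 shows "\<exists>u v. rel u v {(i, j). i + j <= 3 * d - 1}"
proof -
 let ?p = "CHAR('k)"
 have "of_int (int d) = (0 :: 'k)" using p[of "int d" 0] m by (auto simp: ups_model_def)
 hence "?p dvd d" by (simp add: of_nat_eq_0_iff_char_dvd)
 hence p0: "?p > 0" using d by (auto intro: gr0I)
 hence pr: "prime ?p" by (rule prime_CHAR_semidom)
 hence p2: "?p >= 2" by (rule prime_ge_2_nat)
 have dv: "int ?p dvd i & int ?p dvd j" if "(i, j) : keys g" for i j using p[OF that] by (simp add: of_int_eq_0_iff_char_dvd)
 have "\<exists>r. r ^ ?p = a" for a :: 'k
 proof -
  have "pdeg (monom 1 ?p + [:- a:]) = ?p" using p0 by (subst degree_add_eq_left) (simp_all add: degree_monom_eq)
  then obtain r where "poly (monom 1 ?p + [:- a:]) r = 0" using alg_closed_imp_poly_has_root[of "monom 1 ?p + [:- a:]"] p0 by auto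
  thus ?thesis by (auto simp: poly_monom)
 qed
 then obtain r where r: "!!a :: 'k. r a ^ ?p = a" by metis
 let ?\<pi> = "%(i, j). (i div int ?p, j div int ?p)"
 define h where "h = (\<Sum>k\<in>keys g. single (?\<pi> k) (r (lookup g k)))"
 have hk: "\<exists>i j. (i, j) : keys g & l = (i div int ?p, j div int ?p)" if lk: "l : keys h" for l
 proof -
  have "keys h \<subseteq> (\<Union>k\<in>keys g. keys (single (?\<pi> k) (r (lookup g k))))" unfolding h_def by (rule Poly_Mapping.keys_sum)
  then obtain k where "k : keys g" "l = ?\<pi> k" using lk by (auto split: if_splits)
  thus ?thesis by (cases k) auto
 qed
 have pw: "evL h (x, y) ^ ?p = evL g (x, y)" for x y
 proof -
  have "evL h (x, y) ^ ?p = (\<Sum>k\<in>keys g. r (lookup g k) * (x powi (fst k div int ?p) * y powi (snd k div int ?p))) ^ ?p"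
   unfolding h_def evL_sum by (simp add: evL_single case_prod_unfold)
  also have "\<dots> = (\<Sum>k\<in>keys g. (r (lookup g k) * (x powi (fst k div int ?p) * y powi (snd k div int ?p))) ^ ?p)"
   by (rule freshmans_dream_sum[OF pr refl])
  also have "\<dots> = (\<Sum>k\<in>keys g. lookup g k * (x powi fst k * y powi snd k))"
  proof (rule sum.cong)
   fix k assume "k : keys g"
   hence "int ?p dvd fst k" "int ?p dvd snd k" using dv[of "fst k" "snd k"] by auto
   hence "x powi fst k = (x powi (fst k div int ?p)) ^ ?p" "y powi snd k = (y powi (snd k div int ?p)) ^ ?p"
    by (simp_all flip: power_int_of_nat power_int_mult)
   thus "(r (lookup g k) * (x powi (fst k div int ?p) * y powi (snd k div int ?p))) ^ ?p = lookup g k * (x powi fst k * y powi snd k)"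
    by (simp add: power_mult_distrib r)
  qed simp
  also have "\<dots> = evL g (x, y)" by (simp add: eval_laurent2_pmev pmev_def case_prod_unfold)
  finally show ?thesis .
 qed
 have "inj_on ?\<pi> (keys g)"
 proof (rule inj_onI)
  fix k l assume k: "k : keys g" and l: "l : keys g" and e: "?\<pi> k = ?\<pi> l"
  have "int ?p dvd fst k" "int ?p dvd snd k" "int ?p dvd fst l" "int ?p dvd snd l" using dv[of "fst k" "snd k"] dv[of "fst l" "snd l"] k l by auto
  thus "k = l" using e by (metis (no_types, lifting) case_prod_unfold dvd_div_mult_self fst_conv prod_eq_iff snd_conv)
 qed
 hence "lookup h (?\<pi> (int d, 0)) = (\<Sum>k\<in>keys g. if k = (int d, 0) then r (lookup g (int d, 0)) else 0)"
  unfolding h_def lookup_sum using m by (intro sum.cong) (auto simp: lookup_single when_def inj_on_def ups_model_def)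
 also have "\<dots> = r (lookup g (int d, 0))" using m by (auto simp: ups_model_def)
 also have "\<dots> ~= 0"
 proof
  assume "r (lookup g (int d, 0)) = 0"
  hence "lookup g (int d, 0) = 0" using r[of "lookup g (int d, 0)"] p0 by (simp add: zero_power)
  thus False using m by (simp add: ups_model_def in_keys_iff)
 qed
 finally have "h ~= 0" by auto
 have lm: "laurent_model u v g" using m by (simp add: ups_model_def)
 hence g: "gens u v" by (simp add: laurent_model_def)
 have "rel u v {(i, j). i + j <= 3 * d - 1}"
 proof (rule laurent_rel[OF g _ \<open>h ~= 0\<close>])
  show "eventually (%z. u z ~= 0 & v z ~= 0 & evL h (u z, v z) = 0) F"
   using laurent_model_eventually[OF lm]
  proof eventually_elim
   case (elim z)
   hence "evL h (u z, v z) ^ ?p = 0" by (simp add: pw)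
   thus ?case using elim by simp
  qed
  fix i j assume "(i, j) : keys h"
  from hk[OF this] obtain i' j' where k: "(i', j') : keys g" "i = i' div int ?p" "j = j' div int ?p" by auto
  have ups: "in_ups d i' j'" using k m by (auto simp: ups_model_def)
  have ij: "i' = int ?p * i" "j' = int ?p * j" using dv[OF k(1)] k by simp_all
  have "int ?p * (i + j) <= int d" "int ?p * (i - 2 * j) <= int d" "int ?p * (j - 2 * i) <= int d" using ups unfolding ij in_ups_def by (simp_all add: algebra_simps)
  \<comment> \<open>As the characteristic is at least 2, the root has its exponents in the polygon
    of half the size; after the shift by d the degree is at most d/2 + 2 d <= 3 d - 1.\<close>
  moreover have le: "2 * x <= int d" if "int ?p * x <= int d" for x
  proof (cases "x >= 0")
   case True
   hence "2 * x <= int ?p * x" using p2 by (intro mult_right_mono) auto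
   thus ?thesis using that by linarith
  qed simp
  ultimately have "2 * (i + j) <= int d" "2 * (i - 2 * j) <= int d" "2 * (j - 2 * i) <= int d" by blast+
  thus "0 <= i + int d & 0 <= j + int d & (nat (i + int d), nat (j + int d)) : {(i, j). i + j <= 3 * d - 1}" using d by auto
 qed
 thus ?thesis by blast
qed

text \<open>The levels of x y are the plane sections Z = const. The hypothesis makes the derivation
  along them nonzero on g: either its value on g is itself a relation of small degree, or a suitable
  level meets the curve in 2 d distinct points, which the count requires. If x, y or x y is constant
  on the curve, there is a relation of degree at most two.\<close>

lemma ups_separable:
 assumes m: "ups_model d u v g" and d: "d >= 2" and k0: "(i0, j0) : keys g" "of_int (i0 - j0) ~= (0 :: 'k)"
 shows "\<exists>u v. rel u v {(i, j). i + j <= 3 * d - 1}"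
proof -
 have lm: "laurent_model u v g" using m by (simp add: ups_model_def)
 hence g: "gens u v" and Zp: "!!z. z : Z ==> u z ~= 0 & v z ~= 0 & evL g (u z, v z) = 0"
  and sur: "!!x y. x ~= 0 ==> y ~= 0 ==> evL g (x, y) = 0 ==> \<exists>z\<in>Z. u z = x & v z = y"
  and everywhere: "!!h z. eventually (%z. evL h (u z, v z) = 0) F ==> z : Z ==> evL h (u z, v z) = 0"
  by (auto simp: laurent_model_def)
 have ups: "in_ups d (fst k) (snd k)" if "k : keys g" for k using m that by (auto simp: ups_model_def)
 have uvK: "u : K" "v : K" using g by (auto simp: gens_def)
 have ev0: "eventually (%z. u z ~= 0 & v z ~= 0 & evL g (u z, v z) = 0) F" by (rule laurent_model_eventually[OF lm])
 text \<open>The derivation \<open>x \<partial>\<^sub>x - y \<partial>\<^sub>y\<close>, which annihilates \<open>xy\<close>.\<close>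
 define Dg where "Dg = (\<Sum>k\<in>keys g. single k (of_int (fst k - snd k) * lookup g k))"
 have lD: "lookup Dg k = (if k : keys g then of_int (fst k - snd k) * lookup g k else 0)" for k
  unfolding Dg_def by (rule keys_lookup_sum) simp
 have eD: "evL Dg (x, y) = (\<Sum>k\<in>keys g. of_int (fst k - snd k) * lookup g k * (x powi fst k * y powi snd k))" for x y
  unfolding Dg_def evL_sum by (simp add: evL_single)
 have uvL: "(%z. u z * v z) : K" using uvK by (intro gen_mult)
 have DK: "(%z. evL Dg (u z, v z)) : K"
  unfolding eD by (intro gen_sum gen_mult gen_const gen_powi uvK)
 consider (D) "eventually (%z. evL Dg (u z, v z) = 0) F" | (c) r where "eventually (%z. u z * v z = r) F"
  | (x) r where "eventually (%z. u z = r) F" | (y) r where "eventually (%z. v z = r) F"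
  | (gen) "eventually (%z. evL Dg (u z, v z) ~= 0) F" "!!r. eventually (%z. u z * v z ~= r) F" "!!r. eventually (%z. u z ~= r) F" "!!r. eventually (%z. v z ~= r) F"
  using K_dich[OF DK] dich_const[OF uvL] dich_const[OF uvK(1)] dich_const[OF uvK(2)] by blast
 thus ?thesis
 proof cases
  case D
  \<comment> \<open>\<open>Dg\<close> has no diagonal exponents, in particular not the vertex (-d,
    -d). A shift by d - 1 suffices, and the degree is at most d + 2 (d - 1).\<close>
  have "lookup Dg (i0, j0) ~= 0" using k0 by (simp add: lD in_keys_iff)
  hence D0: "Dg ~= 0" by auto
  have "rel u v {(i, j). i + j <= 3 * d - 1}"
  proof (rule laurent_rel[OF g _ D0, of "int d - 1"])
   show "eventually (%z. u z ~= 0 & v z ~= 0 & evL Dg (u z, v z) = 0) F" using D ev0 by eventually_elim simp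
   fix i j assume "(i, j) : keys Dg"
   hence "lookup Dg (i, j) ~= 0" by (simp add: in_keys_iff)
   hence k: "(i, j) : keys g" "i ~= j" by (auto simp: lD split: if_splits)
   hence "i + j <= int d" "i - 2 * j <= int d" "j - 2 * i <= int d" using ups[OF k(1)] by (auto simp: in_ups_def)
   thus "0 <= i + (int d - 1) & 0 <= j + (int d - 1) & (nat (i + (int d - 1)), nat (j + (int d - 1))) : {(i, j). i + j <= 3 * d - 1}"
    using k(2) d by auto
  qed
  thus ?thesis by blast
 next
  case (c r)
  let ?P = "single (1, 1) 1 + single 0 (- r) :: 'k poly2"
  have "lookup ?P (1, 1) ~= 0" by (simp add: lookup_add lookup_single zero_prod_def)
  hence "?P ~= 0" by auto
  moreover have "eventually (%z. ev ?P (u z) (v z) = 0) F" using c by eventually_elim (simp add: ev_add ev_single)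
  moreover have "wle 1 1 2 ?P" by (auto intro!: wle_add wle_single)
  ultimately show ?thesis using ups_constant[OF g _ _ _ d] by blast
 next
  case (x r)
  hence "eventually (%z. ev (lin 1 0 (- r)) (u z) (v z) = 0) F" by eventually_elim (simp add: ev_lin)
  thus ?thesis by (rule ups_constant[OF g _ lin_nonzero wle_lin d]) auto
 next
  case (y r)
  hence "eventually (%z. ev (lin 0 1 (- r)) (u z) (v z) = 0) F" by eventually_elim (simp add: ev_lin)
  thus ?thesis by (rule ups_constant[OF g _ lin_nonzero wle_lin d]) auto
 next
  case gen
  define E where "E = {z : Z. evL Dg (u z, v z) = 0}"
  \<comment> \<open>The point z0 is chosen so that its level of x y contains no curve point at which
    \<open>Dg\<close> vanishes; this makes the roots of \<open>L\<close> simple.\<close>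
  have "finite E" using gen(1) by (simp add: eventually_cofin E_def)
  hence "eventually (%z. \<forall>r\<in>(%z. u z * v z) ` E. u z * v z ~= r) F" using gen(2) by (intro eventually_ball_finite) auto
  then obtain z0 where z0: "z0 : Z" "\<forall>r\<in>(%z. u z * v z) ` E. u z0 * v z0 ~= r" using eventually_point by blast
  define x0 y0 where "x0 = u z0" and "y0 = v z0"
  have xy0: "x0 ~= 0" "y0 ~= 0" "evL g (x0, y0) = 0" using Zp[OF z0(1)] by (auto simp: x0_def y0_def)
  define q where "q = x0 * y0"
  have q0: "q ~= 0" using xy0 by (simp add: q_def)
  \<comment> \<open>The restriction of g to the level x y = q, multiplied by x^d. The vertices (d,
    0) and (0, d) supply the extreme coefficients, so the degree is 2 d and 0 is no root.\<close>
  define L where "L = (\<Sum>k\<in>keys g. monom (lookup g k * q powi snd k) (nat (fst k - snd k + int d)))"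
  have rng: "0 <= fst k - snd k + int d" "fst k - snd k <= int d" if "k : keys g" for k using ups[OF that] by (auto simp: in_ups_def)
  have Lx: "poly L x = x ^ d * evL g (x, q / x)" if "x ~= 0" for x
  proof -
   have "poly L x = (\<Sum>k\<in>keys g. x ^ d * (lookup g k * (x powi fst k * (q / x) powi snd k)))"
    unfolding L_def poly_sum poly_monom
   proof (rule sum.cong)
    fix k assume k: "k : keys g"
    have "x ^ nat (fst k - snd k + int d) = x powi (fst k - snd k + int d)" using rng[OF k] by (simp add: power_int_def)
    also have "\<dots> = x powi fst k * x powi (- snd k) * x ^ d" using that by (simp add: power_int_add power_int_diff power_int_minus field_simps)
    finally show "lookup g k * q powi snd k * x ^ nat (fst k - snd k + int d) = x ^ d * (lookup g k * (x powi fst k * (q / x) powi snd k))"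
     by (simp add: power_int_divide_distrib power_int_minus field_simps)
   qed simp
   thus ?thesis by (simp add: eval_laurent2_pmev pmev_def case_prod_unfold sum_distrib_left)
  qed
  have coeffL: "coeff L n = (\<Sum>k\<in>keys g. if nat (fst k - snd k + int d) = n then lookup g k * q powi snd k else 0)" for n
   unfolding L_def coeff_sum by (simp add: coeff_monom)
  have vx: "(int d, 0) : keys g" "(0, int d) : keys g" using m by (auto simp: ups_model_def)
  have "coeff L (2 * d) = (\<Sum>k\<in>keys g. if k = (int d, 0) then lookup g (int d, 0) else 0)"
   unfolding coeffL
  proof (rule sum.cong)
   fix k assume k: "k : keys g"
   have "nat (fst k - snd k + int d) = 2 * d \<longleftrightarrow> k = (int d, 0)" using ups[OF k] by (auto simp: in_ups_def prod_eq_iff)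
   thus "(if nat (fst k - snd k + int d) = 2 * d then lookup g k * q powi snd k else 0) = (if k = (int d, 0) then lookup g (int d, 0) else 0)" by auto
  qed simp
  hence c2d: "coeff L (2 * d) ~= 0" using vx by (simp add: in_keys_iff)
  have "coeff L 0 = (\<Sum>k\<in>keys g. if k = (0, int d) then lookup g (0, int d) * q powi int d else 0)"
   unfolding coeffL
  proof (rule sum.cong)
   fix k assume k: "k : keys g"
   have "nat (fst k - snd k + int d) = 0 \<longleftrightarrow> k = (0, int d)" using ups[OF k] by (auto simp: in_ups_def prod_eq_iff)
   thus "(if nat (fst k - snd k + int d) = 0 then lookup g k * q powi snd k else 0) = (if k = (0, int d) then lookup g (0, int d) * q powi int d else 0)" by auto
  qed simp
  hence c0: "coeff L 0 ~= 0" using vx q0 by (simp add: in_keys_iff)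
  have degL: "pdeg L = 2 * d"
  proof (rule antisym)
   show "pdeg L <= 2 * d" unfolding L_def
   proof (rule degree_sum_le)
    fix k assume k: "k : keys g"
    have "nat (fst k - snd k + int d) <= 2 * d" using rng[OF k] by linarith
    thus "pdeg (monom (lookup g k * q powi snd k) (nat (fst k - snd k + int d))) <= 2 * d"
     by (rule order_trans[OF degree_monom_le])
   qed simp
   show "2 * d <= pdeg L" using c2d by (rule le_degree)
  qed
  have L0: "L ~= 0" using c0 by auto
  have root: "x ~= 0" if "poly L x = 0" for x using that c0 by (metis poly_0_coeff_0)
  have pt: "\<exists>z\<in>Z. u z = x & v z = q / x" if "poly L x = 0" for x
   using sur[of x "q / x"] Lx[of x] root[OF that] that q0 by simp
  have card: "card {x. poly L x = 0} = 2 * d" unfolding degL[symmetric]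
  proof (rule card_simple_roots[OF L0])
   fix x assume r: "poly L x = 0"
   have x: "x ~= 0" by (rule root[OF r])
   obtain z where z: "z : Z" "u z = x" "v z = q / x" using pt[OF r] by blast
   have "z \<notin> E" using z0(2) z x by (auto simp: q_def x0_def y0_def)
   hence nz: "evL Dg (x, q / x) ~= 0" using z by (simp add: E_def)
   \<comment> \<open>The operator x d/dx on the level is the derivation that defines
     \<open>Dg\<close>; the factor x^d only contributes d L(x), which is zero at a root.\<close>
   have "x * poly (pderiv L) x = (\<Sum>k\<in>keys g. of_nat (nat (fst k - snd k + int d)) * (lookup g k * q powi snd k * x ^ nat (fst k - snd k + int d)))"
    unfolding L_def pderiv_sum poly_sum pderiv_monom poly_monom sum_distrib_left
   proof (rule sum.cong)
    fix k :: "int \<times> int"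
    let ?n = "nat (fst k - snd k + int d)"
    show "x * (of_nat ?n * (lookup g k * q powi snd k) * x ^ (?n - 1)) = of_nat ?n * (lookup g k * q powi snd k * x ^ ?n)"
     by (cases ?n) (simp_all add: mult_ac)
   qed simp
   also have "\<dots> = (\<Sum>k\<in>keys g. x ^ d * (of_int (fst k - snd k) * lookup g k * (x powi fst k * (q / x) powi snd k)) + of_nat d * (lookup g k * q powi snd k * x ^ nat (fst k - snd k + int d)))"
   proof (rule sum.cong)
    fix k assume k: "k : keys g"
    have n: "of_nat (nat (fst k - snd k + int d)) = (of_int (fst k - snd k) + of_nat d :: 'k)" using rng[OF k] by (metis of_int_add of_int_of_nat_eq of_nat_nat)
    have "x ^ nat (fst k - snd k + int d) = x powi (fst k - snd k + int d)" using rng[OF k] by (simp add: power_int_def)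
    also have "\<dots> = x powi fst k * x powi (- snd k) * x ^ d" using x by (simp add: power_int_add power_int_diff power_int_minus field_simps)
    finally have e: "q powi snd k * x ^ nat (fst k - snd k + int d) = x ^ d * (x powi fst k * (q / x) powi snd k)"
     by (simp add: power_int_divide_distrib power_int_minus field_simps)
    thus "of_nat (nat (fst k - snd k + int d)) * (lookup g k * q powi snd k * x ^ nat (fst k - snd k + int d)) =
     x ^ d * (of_int (fst k - snd k) * lookup g k * (x powi fst k * (q / x) powi snd k)) + of_nat d * (lookup g k * q powi snd k * x ^ nat (fst k - snd k + int d))"
     unfolding n mult.assoc e by (simp add: algebra_simps)
   qed simp
   also have "\<dots> = x ^ d * evL Dg (x, q / x) + of_nat d * poly L x"
    unfolding eD L_def poly_sum poly_monom by (simp add: sum.distrib sum_distrib_left)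
   finally show "poly (pderiv L) x ~= 0" using nz x r by auto
  qed
  define c where "c k = lookup g k * (x0 powi fst k * y0 powi snd k)" for k
  have c0: "(\<Sum>k\<in>keys g. c k) = 0" using xy0(3) by (simp add: c_def eval_laurent2_pmev pmev_def case_prod_unfold)
  \<comment> \<open>The equation at the points at infinity of the surface with Z = 0: only the terms
    of degree d in X and Y survive. The vertex (d, 0) makes it nonzero.\<close>
  define e where "e = (\<Sum>k\<in>{k : keys g. alp k + bet k = d}. monom (c k) (alp k))"
  have "coeff e d = (\<Sum>k\<in>{k : keys g. alp k + bet k = d}. if k = (int d, 0) then c (int d, 0) else 0)"
   unfolding e_def coeff_sum coeff_monom
  proof (rule sum.cong)
   fix k assume k: "k : {k : keys g. alp k + bet k = d}"
   have "alp k = d \<longleftrightarrow> k = (int d, 0)"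
   proof
    assume a: "alp k = d"
    hence "bet k = 0" "gam k = 0" using k exponents_le[OF ups, of k] by auto
    thus "k = (int d, 0)" using int_exponents[of k] a by (simp add: prod_eq_iff)
   qed (simp add: alp_def gam_def)
   thus "(if alp k = d then c k else 0) = (if k = (int d, 0) then c (int d, 0) else 0)" by auto
  qed simp
  also have "\<dots> = c (int d, 0)" using vx by (simp add: alp_def bet_def gam_def)
  finally have ed: "coeff e d ~= 0" using vx xy0 by (simp add: c_def in_keys_iff)
  hence e0: "e ~= 0" by auto
  have poly_e: "poly e a = (\<Sum>k\<in>{k : keys g. alp k + bet k = d}. c k * a ^ alp k)" for a
   unfolding e_def poly_sum poly_monom ..
  have dege: "pdeg e <= d" unfolding e_def by (rule degree_sum_le) (auto intro: order_trans[OF degree_monom_le])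
  \<comment> \<open>These exclusions, together with e(a) being nonzero, are the conditions of
    \<open>project_from_point\<close>: the equation at (-a, -1/a, 1) is L at -a x0 up to a nonzero
    factor.\<close>
  let ?bad = "insert 0 ((%x. - (x / x0)) ` {x. poly L x = 0})"
  obtain a where a: "poly e a ~= 0" "a \<notin> ?bad" using poly_nonroot[OF e0, of ?bad] poly_roots_finite[OF L0] by auto
  have a0: "a ~= 0" and La: "poly L (- (a * x0)) ~= 0" using a(2) xy0(1) by (auto simp: image_iff)
  define X Y W where "X = (%z. u z / x0)" and "Y = (%z. v z / y0)" and "W = (%z. q / (u z * v z))"
  have gXY: "gens X Y"
  proof (rule gens_change[OF g])
   show "X : gen F {u, v}" "Y : gen F {u, v}" unfolding X_def Y_def by (intro gen_divide gen_const gens_in)+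
   have "(%z. x0 * X z) : gen F {X, Y}" "(%z. y0 * Y z) : gen F {X, Y}" by (intro gen_mult gen_const gens_in)+
   thus "u : gen F {X, Y}" "v : gen F {X, Y}" using xy0 by (simp_all add: X_def Y_def)
  qed
  have mono: "c k * ((x / x0) ^ alp k * (y / y0) ^ bet k * (q / (x * y)) ^ gam k) = lookup g k * (x powi fst k * y powi snd k)"
   if "x ~= 0" "y ~= 0" for x y k
  proof -
   have "(x / x0) * (y / y0) * (q / (x * y)) = 1" using that xy0 by (simp add: q_def)
   from monomial_exponents[OF this, of k] show ?thesis using xy0 by (simp add: c_def power_int_divide_distrib power_int_eq_0_iff)
  qed
  have evg: "(\<Sum>k\<in>keys g. c k * ((x / x0) ^ alp k * (y / y0) ^ bet k * (q / (x * y)) ^ gam k)) = evL g (x, y)" if "x ~= 0" "y ~= 0" for x y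
   unfolding eval_laurent2_pmev pmev_def case_prod_unfold by (simp only: mono[OF that])
  let ?k = "%z. (X z + Y z + W z - 3) / ((X z - 1) * (Y z - 1) * (W z - 1))"
  have good: "eventually (%z. X z * Y z * W z = 1 & X z ~= 1 & Y z ~= 1 & W z ~= 1 &
   (\<Sum>k\<in>keys g. c k * (X z ^ alp k * Y z ^ bet k * W z ^ gam k)) = 0) F"
   using ev0 gen(2)[of q] gen(3)[of x0] gen(4)[of y0]
  proof eventually_elim
   case (elim z)
   thus ?case using evg[of "u z" "v z"] xy0 q0 by (auto simp: X_def Y_def W_def q_def)
  qed
  have "(\<Sum>k\<in>keys g. c k * ((- a) ^ alp k * (- (1 / a)) ^ bet k)) ~= 0"
  proof -
   let ?x = "- (a * x0)" and ?y = "- (y0 / a)"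
   have xy: "?x ~= 0" "?y ~= 0" using a0 xy0 by auto
   have "?x / x0 = - a" "?y / y0 = - (1 / a)" "q / (?x * ?y) = 1" "q / ?x = ?y" using a0 xy0 by (simp_all add: q_def field_simps)
   hence "(\<Sum>k\<in>keys g. c k * ((- a) ^ alp k * (- (1 / a)) ^ bet k)) = evL g (?x, q / ?x)" using evg[OF xy] by simp
   thus ?thesis using La Lx[OF xy(1)] by auto
  qed
  from project_from_point[OF gXY d _ _ c0 good a0 _ this] have "?thesis \<or>
   eventually (%z. (\<Sum>k\<in>keys g. c k * ((1 + (X z - 1) * ?k z) ^ alp k * (1 + (Y z - 1) * ?k z) ^ bet k * (1 + (W z - 1) * ?k z) ^ gam k)) = 0) F"
   using exponents_le[OF ups] a(1) unfolding poly_e by simp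
  thus ?thesis
  proof
   assume R: "eventually (%z. (\<Sum>k\<in>keys g. c k * ((1 + (X z - 1) * ?k z) ^ alp k * (1 + (Y z - 1) * ?k z) ^ bet k * (1 + (W z - 1) * ?k z) ^ gam k)) = 0) F"
   \<comment> \<open>The terms of the equation at the third point, multiplied by the d-th power of
     the denominator of \<kappa>. Their sum is a Laurent polynomial, so it vanishes at every curve
     point, also on W = 1 where \<kappa> has no meaning.\<close>
   define N where "N x y w k = c k * ((x - 1) * (y - 1) * (w - 1) + (x - 1) * (x + y + w - 3)) ^ alp k * ((x - 1) * (y - 1) * (w - 1) + (y - 1) * (x + y + w - 3)) ^ bet k *
    ((x - 1) * (y - 1) * (w - 1) + (w - 1) * (x + y + w - 3)) ^ gam k * ((x - 1) * (y - 1) * (w - 1)) ^ (d - (alp k + bet k + gam k))" for x y w k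
   define H where "H = (%z :: 'k \<times> 'k. \<Sum>k\<in>keys g. N (fst z / x0) (snd z / y0) (q / (fst z * snd z)) k)"
   have "H : lfun"
   proof -
    have x: "(%z :: 'k \<times> 'k. fst z / x0) : lfun" using lfun_single[of "1 / x0" 1 0] by simp
    have y: "(%z :: 'k \<times> 'k. snd z / y0) : lfun" using lfun_single[of "1 / y0" 0 1] by simp
    have w: "(%z :: 'k \<times> 'k. q / (fst z * snd z)) : lfun" using lfun_single[of q "-1" "-1"] by (simp add: power_int_minus field_simps)
    show ?thesis unfolding H_def N_def by (intro lfun_sum lfun_mult lfun_power lfun_add lfun_diff lfun_const x y w)
   qed
   then obtain h where h: "!!z. fst z ~= 0 ==> snd z ~= 0 ==> evL h z = H z" unfolding lfun_def by blast
   have "eventually (%z. evL h (u z, v z) = 0) F" using R good ev0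
   proof eventually_elim
    case (elim z)
    let ?x = "X z" and ?y = "Y z" and ?w = "W z"
    let ?P = "(?x - 1) * (?y - 1) * (?w - 1)"
    have P: "?P ~= 0" using elim by simp
    have N: "N ?x ?y ?w k = ?P ^ d * (c k * ((1 + (?x - 1) * ?k z) ^ alp k * (1 + (?y - 1) * ?k z) ^ bet k * (1 + (?w - 1) * ?k z) ^ gam k))" if k: "k : keys g" for k
    proof -
     define s where "s = ?x + ?y + ?w - 3"
     have kk: "?k z = s / ?P" by (simp add: s_def)
     have f: "?P + t * s = ?P * (1 + t * (s / ?P))" for t using P by (simp add: field_simps)
     have "d = alp k + bet k + gam k + (d - (alp k + bet k + gam k))" using exponents_le[OF ups[OF k]] by simp
     hence "?P ^ d = ?P ^ alp k * ?P ^ bet k * ?P ^ gam k * ?P ^ (d - (alp k + bet k + gam k))" by (metis power_add)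
     thus ?thesis unfolding N_def s_def[symmetric] kk f power_mult_distrib by (simp only: mult_ac)
    qed
    have "H (u z, v z) = (\<Sum>k\<in>keys g. N ?x ?y ?w k)" by (simp add: H_def X_def Y_def W_def)
    also have "\<dots> = ?P ^ d * (\<Sum>k\<in>keys g. c k * ((1 + (?x - 1) * ?k z) ^ alp k * (1 + (?y - 1) * ?k z) ^ bet k * (1 + (?w - 1) * ?k z) ^ gam k))"
     unfolding sum_distrib_left by (rule sum.cong[OF refl N])
    also have "\<dots> = 0" using elim(1) by simp
    finally show ?case using h[of "(u z, v z)"] elim by simp
   qed
   hence H0: "H (u z, v z) = 0" if "z : Z" for z using everywhere[OF _ that] h[of "(u z, v z)"] Zp[OF that] by simp
   text \<open>On the level \<open>W = 1\<close> the third point lies at infinity, so it is one of the \<open>d\<close> roots of the edge polynomial.\<close>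
   have "poly e (- (x / x0)) = 0" if r: "poly L x = 0" and xn: "x ~= x0" for x
   proof -
    obtain z where z: "z : Z" "u z = x" "v z = q / x" using pt[OF r] by blast
    have x: "x ~= 0" by (rule root[OF r])
    define \<xi> where "\<xi> = x / x0"
    have xi: "\<xi> ~= 0" "\<xi> ~= 1" using x xn xy0 by (auto simp: \<xi>_def)
    have args: "u z / x0 = \<xi>" "v z / y0 = 1 / \<xi>" "q / (u z * v z) = 1" using z x xy0 by (simp_all add: \<xi>_def q_def)
    define s where "s = \<xi> + 1 / \<xi> + 1 - 3"
    have s: "s = (\<xi> - 1) * (\<xi> - 1) / \<xi>" using xi by (simp add: s_def field_simps)
    have "N \<xi> (1 / \<xi>) 1 k = (if alp k + bet k = d then ((\<xi> - 1) * s) ^ d * ((- 1 / \<xi>) ^ d * (c k * (- \<xi>) ^ alp k)) else 0)" if k: "k : keys g" for k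
    proof (cases "alp k + bet k = d")
     case True
     hence gz: "gam k = 0" using exponents_le[OF ups[OF k]] by simp
     have y: "1 / \<xi> - 1 = (\<xi> - 1) * (- 1 / \<xi>)" using xi by (simp add: field_simps)
     have one: "(- 1 / \<xi>) ^ alp k * (- \<xi>) ^ alp k = 1" using xi by (simp flip: power_mult_distrib)
     have "N \<xi> (1 / \<xi>) 1 k = c k * ((\<xi> - 1) * s) ^ alp k * ((1 / \<xi> - 1) * s) ^ bet k" unfolding N_def s_def[symmetric] using True gz by simp
     also have "\<dots> = c k * (((\<xi> - 1) * s) ^ alp k * ((\<xi> - 1) * s) ^ bet k) * (- 1 / \<xi>) ^ bet k" unfolding y by (simp only: power_mult_distrib mult_ac)
     also have "\<dots> = c k * ((\<xi> - 1) * s) ^ d * (- 1 / \<xi>) ^ bet k * ((- 1 / \<xi>) ^ alp k * (- \<xi>) ^ alp k)" unfolding one by (simp add: True flip: power_add)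
     also have "\<dots> = ((\<xi> - 1) * s) ^ d * (((- 1 / \<xi>) ^ alp k * (- 1 / \<xi>) ^ bet k) * (c k * (- \<xi>) ^ alp k))" by (simp only: mult_ac)
     finally show ?thesis by (simp add: True flip: power_add)
    next
     case False
     have "N \<xi> (1 / \<xi>) 1 k = 0"
     proof (cases "gam k = 0")
      case True
      hence "d - (alp k + bet k + gam k) > 0" using False exponents_le[OF ups[OF k]] by simp
      thus ?thesis by (simp add: N_def)
     qed (simp add: N_def)
     thus ?thesis using False by simp
    qed
    hence "(\<Sum>k\<in>keys g. if alp k + bet k = d then ((\<xi> - 1) * s) ^ d * ((- 1 / \<xi>) ^ d * (c k * (- \<xi>) ^ alp k)) else 0) = 0"
     using H0[OF z(1)] by (simp add: H_def args)
    hence "((\<xi> - 1) * s) ^ d * ((- 1 / \<xi>) ^ d * poly e (- \<xi>)) = 0" unfolding poly_e by (simp add: sum.If_cases Int_def sum_distrib_left)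
    moreover have "(\<xi> - 1) * s ~= 0" unfolding s using xi by simp
    ultimately show ?thesis using xi by (simp add: \<xi>_def)
   qed
   hence "(%x. - (x / x0)) ` ({x. poly L x = 0} - {x0}) \<subseteq> {t. poly e t = 0}" by auto
   moreover have "inj_on (%x. - (x / x0)) ({x. poly L x = 0} - {x0})" using xy0 by (auto simp: inj_on_def)
   ultimately have "card ({x. poly L x = 0} - {x0}) <= card {t. poly e t = 0}" using poly_roots_finite[OF e0] by (metis card_image card_mono)
   also have "\<dots> <= d" using card_poly_roots_bound[OF e0] dege by linarith
   finally have "2 * d - 1 <= d" using card poly_roots_finite[OF L0] by (simp add: card_Diff_singleton_if split: if_splits)
   thus ?thesis using d by simp
  qed
 qed
qed

theorem upsilon_s2:
 assumes "polygon_equiv (newton_polygon f) (dilate d upsilon)" "d >= 2"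
 shows "int (s2_curve (torus_curve f)) <= 3 * int d - 1"
proof -
 obtain u v g where m: "ups_model d u v g" using ups_start[OF assms(1)] by blast
 have "\<exists>u v. rel u v {(i, j). i + j <= 3 * d - 1}"
 proof (cases "\<forall>(i, j)\<in>keys g. of_int i = (0 :: 'k) & of_int j = (0 :: 'k)")
  case True
  thus ?thesis using ups_frobenius[OF m assms(2)] by blast
 next
  case False
  then obtain i j where k: "(i, j) : keys g" "of_int i ~= (0 :: 'k) \<or> of_int j ~= (0 :: 'k)" by auto
  show ?thesis
  proof (cases "of_int (i - j) = (0 :: 'k)")
   case False
   thus ?thesis by (rule ups_separable[OF m assms(2) k(1)])
  next
   \<comment> \<open>Now i = j holds in the field with one of them nonzero, so j is nonzero, and j
     is the exponent difference after rotation.\<close>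
   case True
   hence "of_int ((j - i) - (- i)) ~= (0 :: 'k)" using k(2) by auto
   from ups_separable[OF ups_rotate(1)[OF m] assms(2) ups_rotate(2)[OF m k(1)] this] show ?thesis .
  qed
 qed
 then obtain u v where "rel u v {(i, j). i + j <= 3 * d - 1}" by blast
 from s2_le[OF this] show ?thesis using assms(2) by linarith
qed

end

section \<open>Curves of genus four\<close>

text \<open>(s, t) selects the pure power x^d or y^d, so c is the value of the degree-d form at the
  corresponding point at infinity; c = 0 means that the degree in that variable drops.\<close>

definition lead :: "nat => nat => nat => 'k::comm_ring_1 poly2 => 'k => bool" where
 "lead s t d P c \<longleftrightarrow> (s, t) : {(1, 0), (0, 1)} & wle 1 1 d P & lookup P (d * s, d * t) = c"

lemma lead_mult: "lead s t d P a ==> lead s t e Q b ==> n = d + e ==> lead s t n (P * Q) (a * b)"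
 unfolding lead_def using lookup_top_mult[of d P e Q s t] wle_mult[of 1 1 d P e Q "d + e"] by auto

lemma lead_add: "lead s t d P a ==> lead s t d Q b ==> lead s t d (P + Q) (a + b)"
 unfolding lead_def by (auto intro: wle_add simp: lookup_add)

lemma lead_diff: "lead s t d P a ==> lead s t d Q b ==> lead s t d (P - Q) (a - b)"
 unfolding lead_def by (auto intro: wle_diff simp: lookup_minus)

lemma lead_const: "(s, t) : {(1, 0), (0, 1)} ==> lead s t 0 (single 0 c) c"
 unfolding lead_def by (auto intro: wle_single simp: lookup_single zero_prod_def)

lemma lead_lin: "lead 1 0 1 (lin x y z) x" "lead 0 1 1 (lin x y z) y"
 unfolding lead_def by (auto intro: wle_lin simp: lookup_lin)

lemma lead_smult: "lead s t d P a ==> lead s t d (single 0 c * P) (c * a)"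
 by (rule lead_mult[OF lead_const]) (auto simp: lead_def)

lemma lead_prod: "lead s t 1 P a ==> lead s t 1 Q b ==> lead s t 2 (P * Q) (a * b)"
 by (rule lead_mult) auto

lemma lead_linear:
 assumes "lead s t 1 X x" "lead s t 1 Y y" "lead s t 1 W w"
 shows "lead s t 1 (single 0 a * X + single 0 b * Y + single 0 c * W) (a * x + b * y + c * w)"
 by (intro lead_add lead_smult assms)

lemma lead_quadratic:
 assumes "lead s t 1 X x" "lead s t 1 Y y" "lead s t 1 W w"
 shows "lead s t 2 (single 0 A * (X * X) + single 0 E * (Y * X) + single 0 C * (Y * Y) + single 0 H * (X * W) + single 0 J * (Y * W) + single 0 M * (W * W))
  (A * (x * x) + E * (y * x) + C * (y * y) + H * (x * w) + J * (y * w) + M * (w * w))"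
 by (intro lead_add lead_smult[OF lead_prod] assms)

lemma lead_fst_less:
 assumes "lead 1 0 d P 0"
 shows "wle 1 0 (d - 1) P"
 unfolding wle_def
proof
 fix k assume k: "k : keys P"
 hence "fst k + snd k <= d" "k ~= (d, 0)" using assms by (auto simp: lead_def wle_def in_keys_iff)
 thus "1 * fst k + 0 * snd k <= d - 1" by (cases k) auto
qed

lemma lead_snd_less:
 assumes "lead 0 1 d P 0"
 shows "wle 0 1 (d - 1) P"
 unfolding wle_def
proof
 fix k assume k: "k : keys P"
 hence "fst k + snd k <= d" "k ~= (0, d)" using assms by (auto simp: lead_def wle_def in_keys_iff)
 thus "0 * fst k + 1 * snd k <= d - 1" by (cases k) auto
qed

lemma quadratic_root:
 fixes a :: "'k::alg_closed_field"
 assumes "a ~= 0"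
 obtains x where "a * x ^ 2 + b * x + c = 0"
proof -
 have "pdeg [:c, b, a:] > 0" using assms by simp
 then obtain x where "poly [:c, b, a:] x = 0" using alg_closed_imp_poly_has_root by blast
 hence "a * x ^ 2 + b * x + c = 0" by (simp add: power2_eq_square algebra_simps)
 thus ?thesis by (rule that)
qed

text \<open>On the points a + m b of the line the conic is a quadratic polynomial in m with leading
  coefficient Q(b): it has a root, unless Q(b) = 0, in which case b itself is a solution.\<close>

lemma line_meets_conic:
 fixes l1 :: "'k::alg_closed_field"
 assumes l: "l1 ~= 0 \<or> l2 ~= 0 \<or> l3 ~= 0"
 obtains s z w where "s ~= 0 \<or> z ~= 0 \<or> w ~= 0" "l1 * s + l2 * z + l3 * w = 0"
  "A * s ^ 2 + E * (z * s) + C * z ^ 2 + H * (s * w) + J * (z * w) + M * w ^ 2 = 0"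
proof -
 define Q where "Q s z w = A * s ^ 2 + E * (z * s) + C * z ^ 2 + H * (s * w) + J * (z * w) + M * w ^ 2" for s z w
 obtain a1 a2 a3 b1 b2 b3 where v: "l1 * a1 + l2 * a2 + l3 * a3 = 0" "l1 * b1 + l2 * b2 + l3 * b3 = 0" "b1 ~= 0 \<or> b2 ~= 0 \<or> b3 ~= 0"
  "!!m. a1 + m * b1 ~= 0 \<or> a2 + m * b2 ~= 0 \<or> a3 + m * b3 ~= 0"
 proof -
  consider "l3 ~= 0" | "l3 = 0" "l1 ~= 0" | "l3 = 0" "l1 = 0" "l2 ~= 0" using l by blast
  thus ?thesis
  proof cases
   case 1
   thus ?thesis using that[of l3 0 "- l1" 0 l3 "- l2"] by (simp add: algebra_simps)
  next
   case 2
   thus ?thesis using that[of 0 0 1 "- l2" l1 0] by (simp add: algebra_simps)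
  next
   case 3
   thus ?thesis using that[of 1 0 0 0 0 1] by simp
  qed
 qed
 show ?thesis
 proof (cases "Q b1 b2 b3 = 0")
  case True
  thus ?thesis using that[of b1 b2 b3] v(2,3) unfolding Q_def by blast
 next
  case False
  obtain m where m: "Q b1 b2 b3 * m ^ 2 + (Q (a1 + b1) (a2 + b2) (a3 + b3) - Q a1 a2 a3 - Q b1 b2 b3) * m + Q a1 a2 a3 = 0"
   using quadratic_root[OF False] by blast
  have "Q (a1 + m * b1) (a2 + m * b2) (a3 + m * b3) = Q b1 b2 b3 * m ^ 2 + (Q (a1 + b1) (a2 + b2) (a3 + b3) - Q a1 a2 a3 - Q b1 b2 b3) * m + Q a1 a2 a3"
   unfolding Q_def by algebra
  hence q: "Q (a1 + m * b1) (a2 + m * b2) (a3 + m * b3) = 0" using m by simp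
  have "l1 * (a1 + m * b1) + l2 * (a2 + m * b2) + l3 * (a3 + m * b3) = 0" using v(1,2) by algebra
  thus ?thesis using that[of "a1 + m * b1" "a2 + m * b2" "a3 + m * b3"] v(4)[of m] q unfolding Q_def by blast
 qed
qed

lemma lin_nonzero3: "x ~= 0 \<or> y ~= 0 \<or> z ~= 0 ==> lin x y z ~= 0"
 using lin_nonzero[of x y z] ev_lin[of x y z 0 0] by fastforce

context curve begin

lemma bidegree_bound:
 assumes "rel u v {(i, j). i <= a & j <= b}" "min a b < 3 \<or> (min a b = 3 & max a b <= 4)"
 shows "lex_le (s11_curve (torus_curve f)) (3, 4)"
 using s11_le[OF assms(1)] by (rule lex_le_trans) (use assms(2) in \<open>auto simp: lex_le_def\<close>)

text \<open>Projection of the curve from the point \<open>(c : 1 : 0 : 0)\<close> at infinity gives a plane quintic with a double point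
  at each common zero of \<open>l\<close> and \<open>q\<close>; projecting this from the double point and another point gives bidegree \<open>(3, 4)\<close>.\<close>

lemma quadric_section_bound:
 assumes g: "gens x y" and c: "A * c ^ 2 + G * c + B = 0" "c ~= 0" "C ~= 0"
  and eq: "eventually (%z. x z * y z * w z = 1 & A * x z ^ 2 + B * y z ^ 2 + C * w z ^ 2 + D * (y z * w z) + E * (w z * x z) + G * (x z * y z) +
   H * x z + I * y z + J * w z + M = 0) F"
  and l: "2 * A * c + G ~= 0 \<or> D + E * c ~= 0 \<or> H * c + I ~= 0"
 shows "lex_le (s11_curve (torus_curve f)) (3, 4)"
proof -
 define l1 l2 l3 where "l1 = 2 * A * c + G" and "l2 = D + E * c" and "l3 = H * c + I"
 \<comment> \<open>As c is a root, the y^2 term cancels after substituting x = s + c y and the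
   quadric reads y el + q = 0. Eliminating y from this and (s + c y) y w = 1 gives the quintic form
   \<open>gm\<close>, where z stands for the function w and w for the homogenizing
   coordinate.\<close>
 define s where "s = (%z. x z - c * y z)"
 define el where "el s z w = l1 * s + l2 * z + l3 * w" for s z w
 define q where "q s z w = A * s ^ 2 + E * (z * s) + C * z ^ 2 + H * (s * w) + J * (z * w) + M * w ^ 2" for s z w
 define gm where "gm s z w = z * q s z w * (c * q s z w - s * el s z w) - el s z w * el s z w * (w * w * w)" for s z w
 have e1: "eventually (%z. x z ~= 0 & y z ~= 0 & w z = 1 / (x z * y z) & (s z + c * y z) * y z * w z = 1 & y z * el (s z) (w z) 1 + q (s z) (w z) 1 = 0) F"
  using eq
 proof eventually_elim
  case (elim z)
  hence nz: "x z ~= 0" "y z ~= 0" by auto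
  have "w z = 1 / (x z * y z)" using elim nz by (simp add: field_simps)
  moreover have "(s z + c * y z) * y z * w z = 1" using elim by (simp add: s_def)
  moreover have "y z * el (s z) (w z) 1 + q (s z) (w z) 1 = 0"
  proof -
   have "y z * el (s z) (w z) 1 + q (s z) (w z) 1 = (A * x z ^ 2 + B * y z ^ 2 + C * w z ^ 2 + D * (y z * w z) + E * (w z * x z) + G * (x z * y z) +
    H * x z + I * y z + J * w z + M) - (A * c ^ 2 + G * c + B) * y z ^ 2"
    unfolding s_def el_def q_def l1_def l2_def l3_def by (simp add: power2_eq_square algebra_simps)
   thus ?thesis using elim c(1) by simp
  qed
  ultimately show ?case using nz by blast
 qed
 have wg: "w : gen F {x, y}"
 proof (rule gen_cong)
  show "(%z. 1 / (x z * y z)) : gen F {x, y}" by (intro gen_intros gens_in)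
  show "eventually (%z. 1 / (x z * y z) = w z) F" using e1 by eventually_elim simp
 qed
 have sg: "s : gen F {x, y}" unfolding s_def by (intro gen_intros gens_in)
 have yg: "y : gen F {x, y}" by (rule gens_in)
 have xs: "x : gen F {s', y}" if "s : gen F {s', y}" for s'
 proof -
  have "(%z. s z + c * y z) : gen F {s', y}" using that by (intro gen_add gen_mult gen_const gens_in)
  thus ?thesis by (simp add: s_def)
 qed
 have elg: "(%z. el (s z) (w z) 1) : gen F {x, y}" unfolding el_def by (intro gen_add gen_mult gen_const sg wg)
 from K_dich[OF gens_K[OF g elg]] show ?thesis
 proof
  assume el0: "eventually (%z. el (s z) (w z) 1 = 0) F"
  show ?thesis
  proof (cases "l1 = 0")
   case False
   have gwy: "gens w y"
   proof (rule gens_change[OF g wg yg])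
    show "y : gen F {w, y}" by (rule gens_in)
    show "x : gen F {w, y}"
    proof (rule xs, rule gen_cong)
     show "(%z. - (l2 * w z + l3) / l1) : gen F {w, y}" by (intro gen_divide gen_uminus gen_add gen_mult gen_const gens_in)
     show "eventually (%z. - (l2 * w z + l3) / l1 = s z) F" using el0
     proof eventually_elim
      case (elim z)
      hence "l1 * s z = - (l2 * w z + l3)" unfolding el_def by algebra
      hence "- (l2 * w z + l3) / l1 = l1 * s z / l1" by simp
      thus ?case using False by simp
     qed
    qed
   qed
   \<comment> \<open>The surface equation times l1, with l1 s replaced by -(l2 w + l3).\<close>
   let ?P = "single (1, 2) (c * l1) + single (2, 1) (- l2) + single (1, 1) (- l3) + single 0 (- l1) :: 'k poly2"
   have "rel w y {(i, j). i <= 2 & j <= 2}"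
   proof (rule relI[OF gwy])
    have "lookup ?P 0 = - l1" by (simp add: lookup_add lookup_single zero_prod_def)
    thus "?P ~= 0" using False by (metis lookup_zero neg_equal_0_iff_equal)
    have "wle 1 0 2 ?P" "wle 0 1 2 ?P" by (intro wle_add wle_single; simp)+
    thus "keys ?P \<subseteq> {(i, j). i <= 2 & j <= 2}" by (fastforce simp: wle_def)
    show "eventually (%z. ev ?P (w z) (y z) = 0) F" using el0 e1
    proof eventually_elim
     case (elim z)
     have "ev ?P (w z) (y z) = c * l1 * (w z * y z ^ 2) - l2 * (w z ^ 2 * y z) - l3 * (w z * y z) - l1" by (simp add: ev_add ev_single)
     also have "\<dots> = l1 * ((s z + c * y z) * y z * w z - 1) - w z * y z * el (s z) (w z) 1" unfolding el_def by algebra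
     also have "\<dots> = 0"
     proof -
      have "(s z + c * y z) * y z * w z = 1" "el (s z) (w z) 1 = 0" using elim by blast+
      thus ?thesis by (simp only:) simp
     qed
     finally show ?case .
    qed
   qed
   thus ?thesis by (rule bidegree_bound) simp
  next
   case True
   have l2: "l2 ~= 0"
   proof
    assume "l2 = 0"
    hence "l3 ~= 0" "eventually (%z. l3 = 0) F" using el0 True l by (auto simp: el_def l1_def l2_def l3_def)
    thus False using F_neq_bot by simp
   qed
   define r where "r = - l3 / l2"
   have wr: "eventually (%z. w z = r) F" using el0
   proof eventually_elim
    case (elim z)
    hence "l2 * w z + l3 = 0" using True by (simp add: el_def)
    hence "- l3 / l2 = l2 * w z / l2" by (simp add: add_eq_0_iff2)
    thus ?case using l2 by (simp add: r_def)
   qed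
   have gsy: "gens s y"
   proof (rule gens_change[OF g sg yg])
    show "x : gen F {s, y}" by (rule xs) (rule gens_in)
    show "y : gen F {s, y}" by (rule gens_in)
   qed
   let ?P = "single (1, 1) r + single (0, 2) (r * c) + single 0 (- 1) :: 'k poly2"
   have "rel s y {(i, j). i <= 1 & j <= 2}"
   proof (rule relI[OF gsy])
    have "lookup ?P 0 = - 1" by (simp add: lookup_add lookup_single zero_prod_def)
    thus "?P ~= 0" by (metis lookup_zero neg_equal_0_iff_equal one_neq_zero)
    have "wle 1 0 1 ?P" "wle 0 1 2 ?P" by (intro wle_add wle_single; simp)+
    thus "keys ?P \<subseteq> {(i, j). i <= 1 & j <= 2}" by (fastforce simp: wle_def)
    show "eventually (%z. ev ?P (s z) (y z) = 0) F" using wr e1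
    proof eventually_elim
     case (elim z)
     have "ev ?P (s z) (y z) = r * (s z * y z) + r * c * y z ^ 2 - 1" by (simp add: ev_add ev_single)
     also have "\<dots> = (s z + c * y z) * y z * r - 1" by algebra
     also have "\<dots> = 0"
     proof -
      have "(s z + c * y z) * y z * w z = 1" "w z = r" using elim by blast+
      thus ?thesis by (simp only:) simp
     qed
     finally show ?case .
    qed
   qed
   thus ?thesis by (rule bidegree_bound) simp
  qed
 next
  assume el0: "eventually (%z. el (s z) (w z) 1 ~= 0) F"
  have gsw: "gens s w"
  proof (rule gens_change[OF g sg wg])
   have y1: "(%z. - q (s z) (w z) 1 / el (s z) (w z) 1) : gen F {s, w}"
    unfolding q_def el_def by (intro gen_divide gen_uminus gen_add gen_mult gen_power gen_const gens_in)
   show y: "y : gen F {s, w}"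
   proof (rule gen_cong[OF y1])
    show "eventually (%z. - q (s z) (w z) 1 / el (s z) (w z) 1 = y z) F" using el0 e1
    proof eventually_elim
     case (elim z)
     hence e: "y z * el (s z) (w z) 1 + q (s z) (w z) 1 = 0" and nz: "el (s z) (w z) 1 ~= 0" by blast+
     from e have "- q (s z) (w z) 1 = y z * el (s z) (w z) 1" by (simp add: add_eq_0_iff2)
     hence "- q (s z) (w z) 1 / el (s z) (w z) 1 = y z * el (s z) (w z) 1 / el (s z) (w z) 1" by (rule arg_cong)
     also have "\<dots> = y z" using nz by (rule nonzero_mult_div_cancel_right)
     finally show ?case .
    qed
   qed
   have "(%z. s z + c * y z) : gen F {s, w}" using y by (intro gen_add gen_mult gen_const gens_in)
   thus "x : gen F {s, w}" by (simp add: s_def)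
  qed
  have gm0: "eventually (%z. gm (s z) (w z) 1 = 0) F" using e1
  proof eventually_elim
   case (elim z)
   hence e: "y z * el (s z) (w z) 1 + q (s z) (w z) 1 = 0" "(s z + c * y z) * y z * w z = 1" by blast+
   have q: "q (s z) (w z) 1 = - (y z * el (s z) (w z) 1)" using e(1) by (simp add: eq_neg_iff_add_eq_0 add.commute)
   have "gm (s z) (w z) 1 = el (s z) (w z) 1 * el (s z) (w z) 1 * ((s z + c * y z) * y z * w z - 1)" unfolding gm_def q by algebra
   thus ?case unfolding e(2) by simp
  qed
  have hom: "gm (t * a) (t * b) (t * e) = t ^ 5 * gm a b e" for t a b e
  proof -
   have q: "q (t * a) (t * b) (t * e) = t * (t * q a b e)" unfolding q_def by algebra
   have el: "el (t * a) (t * b) (t * e) = t * el a b e" unfolding el_def by algebra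
   show ?thesis unfolding gm_def q el by algebra
  qed
  define Gm where "Gm X Y W = Y * (single 0 A * (X * X) + single 0 E * (Y * X) + single 0 C * (Y * Y) + single 0 H * (X * W) + single 0 J * (Y * W) + single 0 M * (W * W)) *
    (single 0 c * (single 0 A * (X * X) + single 0 E * (Y * X) + single 0 C * (Y * Y) + single 0 H * (X * W) + single 0 J * (Y * W) + single 0 M * (W * W)) -
    X * (single 0 l1 * X + single 0 l2 * Y + single 0 l3 * W)) -
    (single 0 l1 * X + single 0 l2 * Y + single 0 l3 * W) * (single 0 l1 * X + single 0 l2 * Y + single 0 l3 * W) * (W * W * W)" for X Y W :: "'k poly2"
  have evGm: "ev (Gm X Y W) a b = gm (ev X a b) (ev Y a b) (ev W a b)" for X Y W a b
   unfolding Gm_def gm_def q_def el_def by (simp add: ev_add ev_diff ev_mult ev_single power2_eq_square)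
  let ?G0 = "Gm (lin 1 0 0) (lin 0 1 0) 1"
  have evG0: "ev ?G0 a b = gm a b 1" for a b by (simp add: evGm ev_lin)
  have G0: "?G0 ~= 0"
  proof
   assume "?G0 = 0"
   hence z: "gm 0 b 1 = 0" for b using evG0[of 0 b] by simp
   \<comment> \<open>On s = 0 the quintic is c b q^2 - el^2; its first part has odd degree five with
     leading coefficient c C^2 and cannot be cancelled.\<close>
   let ?p = "[:0, c:] * [:M, J, C:] * [:M, J, C:] - [:l3, l2:] * [:l3, l2:]"
   have "poly ?p b = gm 0 b 1" for b by (simp add: gm_def q_def el_def power2_eq_square algebra_simps)
   hence "{b. poly ?p b = 0} = UNIV" using z by auto
   hence "?p = 0" using poly_roots_finite[of ?p] infinite_alg_closed[where 'k = 'k] by metis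
   thus False using c by simp
  qed
  have ll: "l1 ~= 0 \<or> l2 ~= 0 \<or> l3 ~= 0" using l by (simp add: l1_def l2_def l3_def)
  obtain s1 z1 w1 where p1: "s1 ~= 0 \<or> z1 ~= 0 \<or> w1 ~= 0" "el s1 z1 w1 = 0" "q s1 z1 w1 = 0"
   unfolding el_def q_def by (rule line_meets_conic[OF ll])
  \<comment> \<open>A second point of the quintic, different from the double point: of two distinct
    affine points of the curve at least one qualifies.\<close>
  obtain s2 z2 where p2: "gm s2 z2 1 = 0" "z1 * 1 - z2 * w1 ~= 0 \<or> w1 * s2 - 1 * s1 ~= 0 \<or> s1 * z2 - s2 * z1 ~= 0"
  proof -
   obtain za zb where zz: "gm (s za) (w za) 1 = 0" "gm (s zb) (w zb) 1 = 0" "(s za, w za) ~= (s zb, w zb)" using two_curve_points[OF gsw gm0] by metis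
   have K: "z1 * 1 - b * w1 ~= 0 \<or> w1 * a - 1 * s1 ~= 0 \<or> s1 * b - a * z1 ~= 0" if "~ (w1 ~= 0 & a = s1 / w1 & b = z1 / w1)" for a b
   proof (cases "w1 = 0")
    case True
    thus ?thesis using p1(1) by auto
   next
    case False
    have "a = s1 / w1" if "w1 * a - 1 * s1 = 0" using that False by (simp add: nonzero_eq_divide_eq mult.commute)
    moreover have "b = z1 / w1" if "z1 * 1 - b * w1 = 0" using that False by (simp add: nonzero_eq_divide_eq)
    ultimately show ?thesis using that False by blast
   qed
   show ?thesis
   proof (cases "w1 ~= 0 & s za = s1 / w1 & w za = z1 / w1")
    case True
    hence "~ (w1 ~= 0 & s zb = s1 / w1 & w zb = z1 / w1)" using zz(3) by auto
    thus ?thesis by (rule that[OF zz(2) K])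
   next
    case False
    thus ?thesis by (rule that[OF zz(1) K])
   qed
  qed
  define k1 k2 k3 where "k1 = z1 * 1 - z2 * w1" and "k2 = w1 * s2 - 1 * s1" and "k3 = s1 * z2 - s2 * z1"
  have k: "k1 ~= 0 \<or> k2 ~= 0 \<or> k3 ~= 0" using p2(2) by (simp add: k1_def k2_def k3_def)
  obtain s3 z3 w3 where p3: "s3 * k1 + z3 * k2 + w3 * k3 ~= 0"
  proof -
   consider "k1 ~= 0" | "k2 ~= 0" | "k3 ~= 0" using k by blast
   thus ?thesis by cases (use that[of 1 0 0] that[of 0 1 0] that[of 0 0 1] in auto)
  qed
  define D' where "D' = s1 * (z2 * w3 - z3 * 1) + z1 * (1 * s3 - w3 * s2) + w1 * (s2 * z3 - s3 * z2)"
  have "D' = s3 * k1 + z3 * k2 + w3 * k3" unfolding D'_def k1_def k2_def k3_def by algebra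
  hence D0: "D' ~= 0" using p3 by simp
  let ?l = "%z. s z * (z1 * 1 - z2 * w1) + w z * (w1 * s2 - 1 * s1) + (s1 * z2 - s2 * z1)"
  let ?L = "lin k1 k2 k3"
  have L0: "?L ~= 0" by (rule lin_nonzero3[OF k])
  have Lev: "ev ?L a b = a * (z1 * 1 - z2 * w1) + b * (w1 * s2 - 1 * s1) + (s1 * z2 - s2 * z1)" for a b by (simp add: ev_lin k1_def k2_def k3_def mult.commute)
  have "?l : gen F {s, w}" by (intro gen_intros gens_in)
  from K_dich[OF gens_K[OF gsw this]] show ?thesis
  proof
   assume "eventually (%z. ?l z = 0) F"
   hence "eventually (%z. ev ?L (s z) (w z) = 0) F" by (simp only: Lev)
   moreover have "wle 1 0 1 ?L" "wle 0 1 1 ?L" by (auto intro: wle_lin)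
   hence "keys ?L \<subseteq> {(i, j). i <= 1 & j <= 1}" by (fastforce simp: wle_def)
   ultimately have "rel s w {(i, j). i <= 1 & j <= 1}" using L0 gsw by (intro relI)
   thus ?thesis by (rule bidegree_bound) simp
  next
   assume "eventually (%z. ?l z ~= 0) F"
   from projection[OF gsw D'_def D0 this] obtain a b where ab: "gens a b" "eventually (%z. w1 * a z + 1 * b z + w3 ~= 0 &
    s z = (s1 * a z + s2 * b z + s3) / (w1 * a z + 1 * b z + w3) & w z = (z1 * a z + z2 * b z + z3) / (w1 * a z + 1 * b z + w3)) F" by blast
   let ?X = "lin s1 s2 s3" and ?Y = "lin z1 z2 z3" and ?W = "lin w1 1 w3"
   let ?Q = "Gm ?X ?Y ?W"
   let ?q = "single 0 A * (?X * ?X) + single 0 E * (?Y * ?X) + single 0 C * (?Y * ?Y) + single 0 H * (?X * ?W) + single 0 J * (?Y * ?W) + single 0 M * (?W * ?W)"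
   let ?e = "single 0 l1 * ?X + single 0 l2 * ?Y + single 0 l3 * ?W"
   have val: "ev ?Q a b = (w1 * a + 1 * b + w3) ^ 5 * gm ((s1 * a + s2 * b + s3) / (w1 * a + 1 * b + w3)) ((z1 * a + z2 * b + z3) / (w1 * a + 1 * b + w3)) 1"
    if "w1 * a + 1 * b + w3 ~= 0" for a b
    using that unfolding hom[symmetric] evGm ev_lin by simp
   have "rel a b {(i, j). i <= 3 & j <= 4}"
   proof (rule relI[OF ab(1)])
    obtain xa ya where xy: "ev ?G0 xa ya ~= 0" "ev ?L xa ya ~= 0" using ev_nonzero_both[OF G0 L0] by blast
    from projection_formulas[OF D'_def D0 refl xy(2)[unfolded Lev] refl refl] obtain a0 b0 where
     "w1 * a0 + 1 * b0 + w3 ~= 0" "xa = (s1 * a0 + s2 * b0 + s3) / (w1 * a0 + 1 * b0 + w3)" "ya = (z1 * a0 + z2 * b0 + z3) / (w1 * a0 + 1 * b0 + w3)" by blast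
    hence "ev ?Q a0 b0 ~= 0" using val[of a0 b0] xy(1) evG0[of xa ya] by simp
    thus "?Q ~= 0" by auto
    show "eventually (%z. ev ?Q (a z) (b z) = 0) F" using ab(2) gm0 by eventually_elim (simp add: val)
    have q2: "lead 1 0 2 ?q (A * (s1 * s1) + E * (z1 * s1) + C * (z1 * z1) + H * (s1 * w1) + J * (z1 * w1) + M * (w1 * w1))"
     by (rule lead_quadratic[OF lead_lin(1) lead_lin(1) lead_lin(1)])
    have e1: "lead 1 0 1 ?e (l1 * s1 + l2 * z1 + l3 * w1)"
     by (rule lead_linear[OF lead_lin(1) lead_lin(1) lead_lin(1)])
    \<comment> \<open>Both q and el vanish at the double point and lose one degree in the first
      variable. Each product in the quintic contains two such factors, so its degree drops from 5 to
      3; the second point lowers the other degree only to 4.\<close>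
    have "lead 1 0 2 ?q 0" using q2 unfolding p1(3)[unfolded q_def power2_eq_square] .
    from lead_fst_less[OF this] have q1: "wle 1 0 1 ?q" by (rule wle_mono) simp
    have "lead 1 0 1 ?e 0" using e1 unfolding p1(2)[unfolded el_def] .
    from lead_fst_less[OF this] have e0: "wle 1 0 0 ?e" by (rule wle_mono) simp
    have lw: "wle 1 0 1 ?X" "wle 1 0 1 ?Y" "wle 1 0 1 ?W" by (auto intro: wle_lin)
    have "wle 1 0 3 ?Q" unfolding Gm_def
    proof (rule wle_diff)
     have "wle 1 0 1 (single 0 c * ?q - ?X * ?e)"
     proof (rule wle_diff)
      show "wle 1 0 1 (single 0 c * ?q)" by (rule wle_mult[OF wle_single[where d = 0] q1]) simp_all
      show "wle 1 0 1 (?X * ?e)" by (rule wle_mult[OF lw(1) e0]) simp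
     qed
     thus "wle 1 0 3 (?Y * ?q * (single 0 c * ?q - ?X * ?e))" by (rule wle_mult[OF wle_mult[OF lw(2) q1 order_refl]]) simp
     show "wle 1 0 3 (?e * ?e * (?W * ?W * ?W))"
      by (rule wle_mult[OF wle_mult[OF e0 e0 order_refl] wle_mult[OF wle_mult[OF lw(3) lw(3) order_refl] lw(3) order_refl]]) simp
    qed
    moreover have "lead 0 1 5 ?Q 0"
    proof -
     have Lx: "lead 0 1 1 ?X s2" "lead 0 1 1 ?Y z2" "lead 0 1 1 ?W 1" by (rule lead_lin)+
     have q: "lead 0 1 2 ?q (q s2 z2 1)" unfolding q_def power2_eq_square
      by (rule lead_quadratic[OF Lx])
     have e: "lead 0 1 1 ?e (el s2 z2 1)" unfolding el_def
      by (rule lead_linear[OF Lx])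
     have "lead 0 1 2 (single 0 c * ?q - ?X * ?e) (c * q s2 z2 1 - s2 * el s2 z2 1)"
      by (rule lead_diff[OF lead_smult[OF q] lead_prod[OF Lx(1) e]])
     hence 1: "lead 0 1 5 (?Y * ?q * (single 0 c * ?q - ?X * ?e)) (z2 * q s2 z2 1 * (c * q s2 z2 1 - s2 * el s2 z2 1))"
      by (rule lead_mult[OF lead_mult[OF Lx(2) q refl]]) simp
     have 2: "lead 0 1 5 (?e * ?e * (?W * ?W * ?W)) (el s2 z2 1 * el s2 z2 1 * (1 * 1 * 1))"
      by (rule lead_mult[OF lead_mult[OF e e refl] lead_mult[OF lead_mult[OF Lx(3) Lx(3) refl] Lx(3) refl]]) simp
     have "lead 0 1 5 ?Q (gm s2 z2 1)" unfolding Gm_def gm_def by (rule lead_diff[OF 1 2])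
     thus ?thesis unfolding p2(1) .
    qed
    hence "wle 0 1 (5 - 1) ?Q" by (rule lead_snd_less)
    hence "wle 0 1 4 ?Q" by (rule wle_mono) simp
    ultimately show "keys ?Q \<subseteq> {(i, j). i <= 3 & j <= 4}" by (fastforce simp: wle_def)
   qed
   thus ?thesis by (rule bidegree_bound) simp
  qed
 qed
qed

text \<open>These points correspond to the ten monomials of degree at most two in X, Y and Z = 1/(X
  Y).\<close>

lemma in_ups_2: "in_ups 2 i j ==> (i, j) : {(2, 0), (0, 2), (-2, -2), (-1, 0), (0, -1), (1, 1), (1, 0), (0, 1), (-1, -1), (0, 0)}"
proof -
 assume u: "in_ups 2 i j"
 hence "- 2 <= i" "i <= 2" by (auto simp: in_ups_def)
 then consider "i = -2" | "i = -1" | "i = 0" | "i = 1" | "i = 2" by linarith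
 thus ?thesis
 proof cases
  case 1
  hence "j = -2" using u by (simp add: in_ups_def)
  thus ?thesis using 1 by simp
 next
  case 2
  hence "j = -1 \<or> j = 0" using u by (simp add: in_ups_def) linarith
  thus ?thesis using 2 by auto
 next
  case 3
  hence "j = -1 \<or> j = 0 \<or> j = 1 \<or> j = 2" using u by (simp add: in_ups_def) linarith
  thus ?thesis using 3 by auto
 next
  case 4
  hence "j = 0 \<or> j = 1" using u by (simp add: in_ups_def) linarith
  thus ?thesis using 4 by auto
 next
  case 5
  hence "j = 0" using u by (simp add: in_ups_def)
  thus ?thesis using 5 by simp
 qed
qed

text \<open>\<open>quadric_section_bound\<close> applies unless its centre (c : 1 : 0 : 0) is a
  singular point of the quadric. If the rotated centre is singular too, the quadric is a polynomial
  in a single linear form, that form is constant on the curve, and the curve is a plane section of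
  the cubic surface.\<close>

theorem upsilon_s11:
 assumes "polygon_equiv (newton_polygon f) (dilate 2 upsilon)"
 shows "lex_le (s11_curve (torus_curve f)) (3, 4)"
proof -
 obtain u v g where m: "ups_model 2 u v g" using ups_start[OF assms] by blast
 have lm: "laurent_model u v g" using m by (simp add: ups_model_def)
 hence gn: "gens u v" by (simp add: laurent_model_def)
 define A B C D E G H I J M where co: "A = lookup g (2, 0)" "B = lookup g (0, 2)" "C = lookup g (-2, -2)" "D = lookup g (-1, 0)" "E = lookup g (0, -1)"
  "G = lookup g (1, 1)" "H = lookup g (1, 0)" "I = lookup g (0, 1)" "J = lookup g (-1, -1)" "M = lookup g (0, 0)"
 have ABC: "A ~= 0" "B ~= 0" "C ~= 0" using m by (auto simp: ups_model_def co in_keys_iff)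
 define w where "w = (%z. 1 / (u z * v z))"
 have eq: "eventually (%z. u z * v z * w z = 1 & A * u z ^ 2 + B * v z ^ 2 + C * w z ^ 2 + D * (v z * w z) + E * (w z * u z) + G * (u z * v z) +
   H * u z + I * v z + J * w z + M = 0) F"
  using laurent_model_eventually[OF lm]
 proof eventually_elim
  case (elim z)
  let ?S = "{(2, 0), (0, 2), (-2, -2), (-1, 0), (0, -1), (1, 1), (1, 0), (0, 1), (-1, -1), (0, 0)} :: (int \<times> int) set"
  have "keys g \<subseteq> ?S" using m in_ups_2 unfolding ups_model_def by blast
  hence "evL g (u z, v z) = (\<Sum>k\<in>?S. lookup g k * (case k of (i, j) => u z powi i * v z powi j))"
   unfolding eval_laurent2_pmev by (intro pmev_superset) auto
  also have "\<dots> = A * u z ^ 2 + B * v z ^ 2 + C * w z ^ 2 + D * (v z * w z) + E * (w z * u z) + G * (u z * v z) + H * u z + I * v z + J * w z + M"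
   using elim by (simp add: co w_def power_int_minus field_simps power2_eq_square)
  finally show ?case using elim by (simp add: w_def)
 qed
 obtain c where c: "A * c ^ 2 + G * c + B = 0" using quadratic_root[OF ABC(1)] by blast
 obtain c' where c': "B * c' ^ 2 + D * c' + C = 0" using quadratic_root[OF ABC(2)] by blast
 have c0: "c ~= 0" "c' ~= 0" using c c' ABC by auto
 show ?thesis
 proof (cases "2 * A * c + G ~= 0 \<or> D + E * c ~= 0 \<or> H * c + I ~= 0")
  case True
  show ?thesis by (rule quadric_section_bound[OF gn c c0(1) ABC(3) eq True])
 next
  case l: False
  show ?thesis
  proof (cases "2 * B * c' + D ~= 0 \<or> E + G * c' ~= 0 \<or> I * c' + J ~= 0")
   case True
   have gr: "gens v w" using ups_rotate(1)[OF m] by (simp add: ups_model_def laurent_model_def w_def)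
   have "eventually (%z. v z * w z * u z = 1 & B * v z ^ 2 + C * w z ^ 2 + A * u z ^ 2 + E * (w z * u z) + G * (u z * v z) + D * (v z * w z) +
    I * v z + J * w z + H * u z + M = 0) F" using eq by eventually_elim (simp add: algebra_simps)
   from quadric_section_bound[OF gr c' c0(2) ABC(1) this True] show ?thesis .
  next
   case False
   \<comment> \<open>Under the vanishing conditions all coefficients are expressed by A, H, M, c and
     c', and the quadric becomes A L^2 + H L + M for this form L.\<close>
   let ?L = "%z. u z - c * v z + c * c' * w z"
   have uv: "u : K" "v : K" using gn by (auto simp: gens_def)
   have wK: "w : K" unfolding w_def by (intro gen_divide gen_const gen_mult uv)
   have "?L : K" by (intro gen_add gen_diff gen_mult gen_const uv wK)
   moreover have "[:M, H, A:] ~= 0" using ABC by simp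
   moreover have "eventually (%z. poly [:M, H, A:] (?L z) = 0) F" using eq
   proof eventually_elim
    case (elim z)
    have "poly [:M, H, A:] (?L z) = A * ?L z ^ 2 + H * ?L z + M" by (simp add: power2_eq_square algebra_simps)
    also have "\<dots> = A * u z ^ 2 + B * v z ^ 2 + C * w z ^ 2 + D * (v z * w z) + E * (w z * u z) + G * (u z * v z) + H * u z + I * v z + J * w z + M"
    proof -
     have G: "G = - (2 * A * c)" and I: "I = - (H * c)" using l by (simp_all add: eq_neg_iff_add_eq_0 add.commute)
     have E: "E = 2 * A * c * c'" and J: "J = H * c * c'" using False G I by (simp_all add: algebra_simps add_eq_0_iff)
     have D: "D = - (2 * A * c * c' * c)" using l E by (simp add: eq_neg_iff_add_eq_0)
     have B: "B = A * c ^ 2" using c G by (simp add: power2_eq_square algebra_simps)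
     have C: "C = A * c ^ 2 * c' ^ 2" using c' B D by (simp add: power2_eq_square algebra_simps)
     show ?thesis unfolding G I E J D B C by algebra
    qed
    finally show ?case using elim by simp
   qed
   ultimately obtain r where r: "eventually (%z. ?L z = r) F" by (rule root_const)
   \<comment> \<open>The plane equation L = r multiplied by u v, with u v w replaced by 1.\<close>
   let ?P = "single (2, 1) 1 + single (1, 2) (- c) + single 0 (c * c') + single (1, 1) (- r) :: 'k poly2"
   have "rel u v {(i, j). i <= 2 & j <= 2}"
   proof (rule relI[OF gn])
    have "lookup ?P 0 = c * c'" by (simp add: lookup_add lookup_single zero_prod_def)
    thus "?P ~= 0" using c0 by (metis lookup_zero mult_eq_0_iff)
    have "wle 1 0 2 ?P" "wle 0 1 2 ?P" by (intro wle_add wle_single; simp)+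
    thus "keys ?P \<subseteq> {(i, j). i <= 2 & j <= 2}" by (fastforce simp: wle_def)
    show "eventually (%z. ev ?P (u z) (v z) = 0) F" using r eq
    proof eventually_elim
     case (elim z)
     have "ev ?P (u z) (v z) = u z ^ 2 * v z - c * (u z * v z ^ 2) + c * c' - r * (u z * v z)" by (simp add: ev_add ev_single)
     also have "\<dots> = u z * v z * (?L z - r) + c * c' * (1 - u z * v z * w z)" by algebra
     also have "\<dots> = 0" using elim by simp
     finally show ?case .
    qed
   qed
   thus ?thesis by (rule bidegree_bound) simp
  qed
 qed
qed

end

theorem theorem2:
  fixes f :: "'k::alg_closed_field laurent2"
  assumes "irreducible f"
    and "aff_dim (newton_polygon f) = 2"
  shows "int (s2_curve (torus_curve f)) \<le> ls_triangle (interior_polygon (newton_polygon f)) + 3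
    \<and> lex_le (map_prod int int (s11_curve (torus_curve f)))
              (s11_polygon (interior_polygon (newton_polygon f)) + (2, 2))
    \<and> (\<forall>d::nat. d \<ge> 2 \<and> polygon_equiv (newton_polygon f) (dilate d upsilon) \<longrightarrow>
         int (s2_curve (torus_curve f)) \<le> 3 * int d - 1 \<and>
         (d = 2 \<longrightarrow> lex_le (s11_curve (torus_curve f)) (3, 4)))"
proof -
  interpret curve f by unfold_locales (rule assms(1))
  show ?thesis using general_bounds[OF assms(2)] upsilon_s2 upsilon_s11 by blast
qed

end
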